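(* For every real $q\geq 1$ and every integer $d\geq 3$, one has $\hat{p}_c(q,d)=\tilde{p}_c(q,d)$; that is, for the FK (random-cluster) model on $\mathbb{Z}^d$ with cluster weight $q$, the slab percolation threshold $\hat p_c$ equals the critical point $\tilde p_c$ for positivity of the free surface tension.
   Context: Let $d\ge 3$, let $E$ be the set of nearest-neighbour edges of $\mathbb{Z}^d$, and for a finite $\Lambda\subset\mathbb{Z}^d$ let $E(\Lambda)\subset E$ be the set of edges intersecting $\Lambda$ (i.e. with at least one endpoint in $\Lambda$). For $q\ge 1$, $p\in[0,1]$ and a boundary condition $\xi\in\{0,1\}^{E\setminus E(\Lambda)}$, the FK measure $\phi^{\xi}_{\Lambda,p,q}$ on $\{0,1\}^{E(\Lambda)}$ is $$\phi^{\xi}_{\Lambda,p,q}(\omega)=\frac{1}{Z^{\xi}_{\Lambda,p,q}}\,p^{o(\omega)}(1-p)^{c(\omega)}q^{k^{\xi}_{\Lambda}(\omega)},$$ where $o(\omega)$ and $c(\omega)$ are the numbers of open ($=1$) and closed ($=0$) edges of $\omega$, $k^\xi_\Lambda(\omega)$ is the number of clusters (connected components of the graph of open edges, isolated vertices included) intersecting $\Lambda$ in the concatenation $\omega\cup\xi\in\{0,1\}^E$, and $Z^{\xi}_{\Lambda,p,q}$ is the normalizing constant. The measure with free boundary condition $\xi\equiv 0$ is denoted $\phi^0_{\Lambda,p,q}$. For vertices or sets of vertices $A,B$, $A\leftrightarrow B$ denotes the event that there is a path of open edges from $A$ to $B$, and $A\not\leftrightarrow B$ its complement. The slab box is $\mathcal{S}(L,N)=\{-L,\ldots,L\}^{d-2}\times\{-N,\ldots,N\}^2$,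 and the slab percolation threshold is $$\hat p_c(q,d)=\inf\Big\{p\in[0,1]:\ \exists L\ge 0\text{ such that }\inf_{N}\ \inf_{x\in\mathcal{S}(L,N)}\phi^0_{\mathcal{S}(L,N),p,q}(0\leftrightarrow x)>0\Big\}.$$ Let $\Lambda_N=\{-N,\ldots,N\}^d$ and $\mathcal{R}(L,M)=\{-L,\ldots,L\}^{d-1}\times\{-M,\ldots,M\}$, with top and bottom sides $\partial^{top}\mathcal{R}(L,M)=\{-L,\ldots,L\}^{d-1}\times\{M\}$ and $\partial^{bot}\mathcal{R}(L,M)=\{-L,\ldots,L\}^{d-1}\times\{-M\}$ (non-integer sizes are rounded down). The (free) surface tension is $$\tilde\tau_p(q,d)=\sup_{C\ge 1}\ \sup_{\delta>0}\ \limsup_{L\to\infty}\frac{1}{L^{d-1}}\log\Big(\phi^0_{\Lambda_{CL},p,q}\big[\partial^{bot}\mathcal{R}(L,\delta L)\not\leftrightarrow\partial^{top}\mathcal{R}(L,\delta L)\big]^{-1}\Big)$$ (with $\log(1/0)=+\infty$), and $$\tilde p_c(q,d)=\inf\{p\in[0,1]:\ \tilde\tau_p(q,d)>0\}.$$ *)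

theory Defs
  imports "HOL-Analysis.Analysis"
begin

text \<open>The dimension \<open>d\<close> is a natural number. A point of $Z^d$ is a function
  \<open>nat \<Rightarrow> int\<close> that vanishes at all indices \<open>\<ge> d\<close>; its coordinates are \<open>x 0, \<dots>, x (d - 1)\<close>.\<close>

type_synonym vertex = "nat \<Rightarrow> int"
type_synonym edge = "vertex set"

definition lattice_points :: "nat \<Rightarrow> vertex set" where
  "lattice_points d = {x. \<forall>i\<ge>d. x i = 0}"

definition origin :: vertex where
  "origin = (\<lambda>_. 0)"

definition lattice_edges :: "nat \<Rightarrow> edge set" where
  "lattice_edges d = {{x, y} | x y.
     x \<in> lattice_points d \<and> y \<in> lattice_points d \<and> (\<Sum>i<d. \<bar>x i - y i\<bar>) = 1}"

definition edges_meeting :: "nat \<Rightarrow> vertex set \<Rightarrow> edge set" where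
  "edges_meeting d \<Lambda> = {e \<in> lattice_edges d. e \<inter> \<Lambda> \<noteq> {}}"

text \<open>A configuration in $\{0,1\}^F$ is represented by the set of its open edges, a subset of \<open>F\<close>.
  The concatenation of configurations on disjoint edge sets is then their union.\<close>

definition open_path_rel :: "nat \<Rightarrow> edge set \<Rightarrow> (vertex \<times> vertex) set" where
  "open_path_rel d \<eta> = {(x, y). x \<in> lattice_points d \<and> y \<in> lattice_points d \<and>
     (x, y) \<in> {(u, v). {u, v} \<in> \<eta>}\<^sup>*}"

definition clusters :: "nat \<Rightarrow> edge set \<Rightarrow> vertex set set" where
  "clusters d \<eta> = lattice_points d // open_path_rel d \<eta>"

definition connected_to :: "nat \<Rightarrow> edge set \<Rightarrow> vertex set \<Rightarrow> vertex set \<Rightarrow> bool" where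
  "connected_to d \<eta> A B \<longleftrightarrow> (\<exists>a\<in>A. \<exists>b\<in>B. (a, b) \<in> open_path_rel d \<eta>)"

definition cluster_count :: "nat \<Rightarrow> vertex set \<Rightarrow> edge set \<Rightarrow> edge set \<Rightarrow> nat" where
  "cluster_count d \<Lambda> \<xi> \<omega> = card {K \<in> clusters d (\<omega> \<union> \<xi>). K \<inter> \<Lambda> \<noteq> {}}"

definition fk_weight :: "nat \<Rightarrow> vertex set \<Rightarrow> real \<Rightarrow> real \<Rightarrow> edge set \<Rightarrow> edge set \<Rightarrow> real" where
  "fk_weight d \<Lambda> p q \<xi> \<omega> =
     p ^ card \<omega> * (1 - p) ^ card (edges_meeting d \<Lambda> - \<omega>) * q ^ cluster_count d \<Lambda> \<xi> \<omega>"

definition fk_partition :: "nat \<Rightarrow> vertex set \<Rightarrow> real \<Rightarrow> real \<Rightarrow> edge set \<Rightarrow> real" where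
  "fk_partition d \<Lambda> p q \<xi> = (\<Sum>\<omega>\<in>Pow (edges_meeting d \<Lambda>). fk_weight d \<Lambda> p q \<xi> \<omega>)"

definition fk_measure :: "nat \<Rightarrow> vertex set \<Rightarrow> real \<Rightarrow> real \<Rightarrow> edge set \<Rightarrow> edge set measure" where
  "fk_measure d \<Lambda> p q \<xi> = point_measure (Pow (edges_meeting d \<Lambda>))
     (\<lambda>\<omega>. ennreal (fk_weight d \<Lambda> p q \<xi> \<omega> / fk_partition d \<Lambda> p q \<xi>))"

abbreviation fk_free :: "nat \<Rightarrow> vertex set \<Rightarrow> real \<Rightarrow> real \<Rightarrow> edge set measure" where
  "fk_free d \<Lambda> p q \<equiv> fk_measure d \<Lambda> p q {}"

text \<open>Under the free boundary condition \<open>\<omega> \<union> \<xi>\<close> is \<open>\<omega>\<close> itself, so the connection events are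
  evaluated in \<open>\<omega>\<close>.\<close>

definition free_connect_prob ::
  "nat \<Rightarrow> vertex set \<Rightarrow> real \<Rightarrow> real \<Rightarrow> vertex set \<Rightarrow> vertex set \<Rightarrow> real" where
  "free_connect_prob d \<Lambda> p q A B = measure (fk_free d \<Lambda> p q)
     {\<omega> \<in> space (fk_free d \<Lambda> p q). connected_to d \<omega> A B}"

definition free_disconnect_prob ::
  "nat \<Rightarrow> vertex set \<Rightarrow> real \<Rightarrow> real \<Rightarrow> vertex set \<Rightarrow> vertex set \<Rightarrow> real" where
  "free_disconnect_prob d \<Lambda> p q A B = measure (fk_free d \<Lambda> p q)
     {\<omega> \<in> space (fk_free d \<Lambda> p q). \<not> connected_to d \<omega> A B}"

definition slab_box :: "nat \<Rightarrow> nat \<Rightarrow> nat \<Rightarrow> vertex set" where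
  "slab_box d L N = {x \<in> lattice_points d.
     (\<forall>i<d - 2. x i \<in> {- int L..int L}) \<and> (\<forall>i\<in>{d - 2..<d}. x i \<in> {- int N..int N})}"

definition p_hat :: "real \<Rightarrow> nat \<Rightarrow> real" where
  "p_hat q d = Inf {p \<in> {0..1}. \<exists>L::nat.
     (INF N::nat. INF x\<in>slab_box d L N. free_connect_prob d (slab_box d L N) p q {origin} {x}) > 0}"

text \<open>The scale \<open>L\<close> in the limit superior runs through the natural numbers, while
  \<open>C\<close> and \<open>\<delta>\<close> are real. Hence the side lengths \<open>C * L\<close> and \<open>\<delta> * L\<close> are rounded down.\<close>

definition cube :: "nat \<Rightarrow> int \<Rightarrow> vertex set" where
  "cube d N = {x \<in> lattice_points d. \<forall>i<d. x i \<in> {- N..N}}"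

definition top_side :: "nat \<Rightarrow> int \<Rightarrow> int \<Rightarrow> vertex set" where
  "top_side d L M = {x \<in> lattice_points d. (\<forall>i<d - 1. x i \<in> {- L..L}) \<and> x (d - 1) = M}"

definition bottom_side :: "nat \<Rightarrow> int \<Rightarrow> int \<Rightarrow> vertex set" where
  "bottom_side d L M = {x \<in> lattice_points d. (\<forall>i<d - 1. x i \<in> {- L..L}) \<and> x (d - 1) = - M}"

text \<open>$\log(1/a)$ with the convention $\log(1/0) = +\infty$\<close>

definition log_recip :: "real \<Rightarrow> ereal" where
  "log_recip a = (if a = 0 then \<infinity> else ereal (ln (1 / a)))"

definition surface_tension :: "real \<Rightarrow> real \<Rightarrow> nat \<Rightarrow> ereal" where
  "surface_tension p q d = (SUP C\<in>{1::real..}. SUP \<delta>\<in>{0::real<..}. limsup (\<lambda>L::nat.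
     log_recip (free_disconnect_prob d (cube d \<lfloor>C * real L\<rfloor>) p q
         (bottom_side d (int L) \<lfloor>\<delta> * real L\<rfloor>) (top_side d (int L) \<lfloor>\<delta> * real L\<rfloor>))
       / ereal (real L ^ (d - 1))))"

definition p_tilde :: "real \<Rightarrow> nat \<Rightarrow> real" where
  "p_tilde q d = Inf {p \<in> {0..1}. surface_tension p q d > 0}"

end

theory Submission
  imports Defs
    "HOL-Real_Asymp.Real_Asymp"
begin

text \<open>
  Put \<open>r = p / (1 - p)\<close>. The random-cluster weight satisfies the FKG lattice condition by the
  four functions theorem, and the measure with odds \<open>r' > r\<close> dominates the union of the measure with
  odds \<open>r\<close> and an independent Bernoulli percolation of small density (a sprinkling). Since a
  threshold is only an infimum, every implication may pass from \<open>r\<close> to a larger \<open>r'\<close>.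

  Both positivity conditions are equivalent, up to such a shift, to a finite-size criterion (the link
  property): two translates of a connected shape are linked inside a larger box with probability close
  to \<open>1\<close>, at a scale at which many disjoint translates of the shape fit, so that the sprinkling opens
  one of them entirely. Given the criterion, open seeds form a renormalized process in the plane, and
  a Peierls argument yields connections in a slab. Order \<open>L^(d - 2)\<close> disjoint slices, each missing a
  vertical crossing with probability at most \<open>exp (- c L)\<close>, show that the surface tension is positive.

  Conversely, slab percolation gives the criterion for a stack of slabs by FKG. If the surface tension
  is positive, FKG and translation invariance show that a flat tile of side \<open>K\<close> fails to reach a
  macroscopic distance with probability at most \<open>exp (- c K^(d - 1))\<close>. For \<open>K\<close> of order
  \<open>(ln n)^(2/3)\<close>, which is enough since \<open>d \<ge> 3\<close>, all tiles in a box of size \<open>n\<close> reach its boundary.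
  Following Benjamini and Tassion, a sprinkling then merges all clusters from the boundary to the
  centre: crossing a layer at least halves the number of distinct clusters that survive.
\<close>

section \<open>Weighted averages over the subsets of a finite set\<close>

text \<open>Random-cluster measures lack independence, so the main estimates concern disconnection,
  a decreasing event: disconnection inside each of several disjoint boxes has at most the product of
  the free probabilities, whatever surrounds the boxes. The sprinkling is kept as a second,
  genuinely independent configuration. It alone selects the open seeds, so the random-cluster
  estimates are applied to fixed sets.

  The exponent 2/3 balances two demands. A union bound over about n^d tiles needs K^(d - 1) to be
  much larger than ln n, which for d = 3 means an exponent above 1/2. Opening a path between two
  nearby clusters has probability s^(O(K)); the annuli of width O(K) in a box of size n, divided
  among O(ln n) layers, make up for this when K = o(ln n), which means an exponent below 1. In
  dimension two no exponent meets both demands.\<close>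

text \<open>With \<open>t = c0 * d1\<close>, the mixed terms \<open>u\<close> and \<open>v\<close>
  are both at most \<open>t\<close>, and their product is at most \<open>t * (c1 * d0)\<close>.
  Expanding \<open>(t - u) * (t - v) >= 0\<close> then gives
  \<open>u + v <= t + c1 * d0\<close>.\<close>

lemma four_functions_point:
  fixes a0 a1 b0 b1 c0 c1 d0 d1 :: real
  assumes nn: "0 \<le> a0" "0 \<le> a1" "0 \<le> b0" "0 \<le> b1" "0 \<le> c0" "0 \<le> c1" "0 \<le> d0" "0 \<le> d1"
    and "a0 * b0 \<le> c0 * d0" "a0 * b1 \<le> c0 * d1" "a1 * b0 \<le> c0 * d1" "a1 * b1 \<le> c1 * d1"
  shows "(a0 + a1) * (b0 + b1) \<le> (c0 + c1) * (d0 + d1)"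
proof -
  define t u v where "t = c0 * d1" and "u = a0 * b1" and "v = a1 * b0"
  have uv: "0 \<le> u" "0 \<le> v" "u \<le> t" "v \<le> t" "0 \<le> c1 * d0"
    using assms by (auto simp: t_def u_def v_def)
  have "u * v = (a0 * b0) * (a1 * b1)" by (simp add: u_def v_def)
  also have "\<dots> \<le> (c0 * d0) * (c1 * d1)" by (rule mult_mono) (use assms in auto)
  finally have prod: "u * v \<le> t * (c1 * d0)" by (simp add: t_def mult_ac)
  have "u + v \<le> t + c1 * d0"
  proof (cases "t = 0")
    case False
    then have "t > 0" using uv by linarith
    have "0 \<le> (t - u) * (t - v)" using uv by simp
    then have "t * (u + v) \<le> t * t + u * v" by (simp add: algebra_simps)
    also have "\<dots> \<le> t * (t + c1 * d0)" using prod by (simp add: algebra_simps)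
    finally show ?thesis using \<open>t > 0\<close> by simp
  qed (use uv in linarith)
  then show ?thesis using assms by (simp add: algebra_simps t_def u_def v_def)
qed

lemma sum_Pow_insert:
  assumes "finite E" "e \<notin> E"
  shows "(\<Sum>A\<in>Pow (insert e E). f A) = (\<Sum>A\<in>Pow E. f A + f (insert e A))"
proof -
  have inj: "inj_on (insert e) (Pow E)"
    using assms by (auto simp: inj_on_def insert_ident)
  have "(\<Sum>A\<in>Pow (insert e E). f A) = sum f (Pow E) + sum f (insert e ` Pow E)"
    unfolding Pow_insert using assms by (intro sum.union_disjoint) auto
  then show ?thesis by (simp add: sum.reindex[OF inj] sum.distrib)
qed

lemma sum_Pow_Un:
  assumes "finite E" "finite F" "E \<inter> F = {}"
  shows "(\<Sum>A\<in>Pow (E \<union> F). f A) = (\<Sum>B\<in>Pow F. \<Sum>A\<in>Pow E. f (A \<union> B))"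
proof -
  have "(\<Sum>B\<in>Pow F. \<Sum>A\<in>Pow E. f (A \<union> B)) = (\<Sum>(B, A)\<in>Pow F \<times> Pow E. f (A \<union> B))"
    by (simp add: sum.cartesian_product)
  also have "\<dots> = (\<Sum>A\<in>Pow (E \<union> F). f A)"
    by (rule sum.reindex_bij_witness[where i = "\<lambda>A. (A \<inter> F, A \<inter> E)" and j = "\<lambda>(B, A). A \<union> B"])
      (use assms in auto)
  finally show ?thesis by simp
qed

text \<open>The Ahlswede-Daykin theorem. Summing out one element replaces each function
  \<open>f\<close> by \<open>?up f\<close>, and the one-point inequality shows that the hypothesis
  survives on the smaller set.\<close>

theorem four_functions:
  fixes \<alpha> \<beta> \<gamma> \<delta> :: "'e set \<Rightarrow> real"
  assumes "finite E"
    and "\<And>A. A \<subseteq> E \<Longrightarrow> 0 \<le> \<alpha> A" "\<And>A. A \<subseteq> E \<Longrightarrow> 0 \<le> \<beta> A"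
    and "\<And>A. A \<subseteq> E \<Longrightarrow> 0 \<le> \<gamma> A" "\<And>A. A \<subseteq> E \<Longrightarrow> 0 \<le> \<delta> A"
    and "\<And>A B. A \<subseteq> E \<Longrightarrow> B \<subseteq> E \<Longrightarrow> \<alpha> A * \<beta> B \<le> \<gamma> (A \<inter> B) * \<delta> (A \<union> B)"
  shows "sum \<alpha> (Pow E) * sum \<beta> (Pow E) \<le> sum \<gamma> (Pow E) * sum \<delta> (Pow E)"
  using assms
proof (induction E arbitrary: \<alpha> \<beta> \<gamma> \<delta> rule: finite_induct)
  case empty
  then show ?case using empty(5)[of "{}" "{}"] by simp
next
  case (insert e E)
  let ?up = "\<lambda>f A. f A + (f (insert e A) :: real)"
  have *: "sum f (Pow (insert e E)) = sum (?up f) (Pow E)" for f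
    using sum_Pow_insert[OF insert.hyps] by simp
  have "sum (?up \<alpha>) (Pow E) * sum (?up \<beta>) (Pow E) \<le> sum (?up \<gamma>) (Pow E) * sum (?up \<delta>) (Pow E)"
  proof (rule insert.IH)
    fix A B assume AB: "A \<subseteq> E" "B \<subseteq> E"
    then have e: "e \<notin> A" "e \<notin> B" using insert.hyps by auto
    have sub: "A \<subseteq> insert e E" "B \<subseteq> insert e E" "insert e A \<subseteq> insert e E" "insert e B \<subseteq> insert e E"
      "A \<inter> B \<subseteq> insert e E" "A \<union> B \<subseteq> insert e E" "insert e (A \<inter> B) \<subseteq> insert e E"
      "insert e (A \<union> B) \<subseteq> insert e E"
      using AB by auto
    show "?up \<alpha> A * ?up \<beta> B \<le> ?up \<gamma> (A \<inter> B) * ?up \<delta> (A \<union> B)"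
      using insert.prems(5)[OF sub(1,2)] insert.prems(5)[OF sub(1,4)]
        insert.prems(5)[OF sub(3,2)] insert.prems(5)[OF sub(3,4)] e
      by (intro four_functions_point insert.prems(1-4) sub) (simp_all add: Int_insert_left Int_insert_right)
  qed (intro add_nonneg_nonneg insert.prems(1-4); auto)+
  then show ?case by (simp only: *)
qed

section \<open>Averages and the inequalities of Holley and FKG\<close>

text \<open>The expectation under the law on \<open>Pow E\<close> proportional to \<open>w\<close>.
  Keeping the same \<open>w\<close> and shrinking \<open>E\<close> to \<open>F\<close> gives the law
  on \<open>F\<close> with everything outside \<open>F\<close> closed, that is, the free boundary
  condition.\<close>

definition wavg :: "'e set \<Rightarrow> ('e set \<Rightarrow> real) \<Rightarrow> ('e set \<Rightarrow> real) \<Rightarrow> real" where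
  "wavg E w f = (\<Sum>A\<in>Pow E. w A * f A) / (\<Sum>A\<in>Pow E. w A)"

definition log_supermodular :: "'e set \<Rightarrow> ('e set \<Rightarrow> real) \<Rightarrow> bool" where
  "log_supermodular E w \<longleftrightarrow> finite E \<and> (\<forall>A\<subseteq>E. 0 < w A) \<and>
     (\<forall>A\<subseteq>E. \<forall>B\<subseteq>E. w A * w B \<le> w (A \<inter> B) * w (A \<union> B))"

lemma log_supermodularD:
  assumes "log_supermodular E w"
  shows "finite E" "A \<subseteq> E \<Longrightarrow> 0 < w A" "A \<subseteq> E \<Longrightarrow> 0 \<le> w A"
    "A \<subseteq> E \<Longrightarrow> B \<subseteq> E \<Longrightarrow> w A * w B \<le> w (A \<inter> B) * w (A \<union> B)"
  using assms by (auto simp: log_supermodular_def less_imp_le)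

lemma log_supermodular_subset: "log_supermodular E w \<Longrightarrow> F \<subseteq> E \<Longrightarrow> log_supermodular F w"
  unfolding log_supermodular_def by (meson finite_subset order_trans)

lemma log_supermodular_sum_pos:
  assumes "log_supermodular E w" shows "0 < sum w (Pow E)"
  using assms by (intro sum_pos) (auto simp: log_supermodular_def)

lemma wavg_mono:
  assumes "log_supermodular E w" "\<And>A. A \<subseteq> E \<Longrightarrow> f A \<le> g A"
  shows "wavg E w f \<le> wavg E w g"
  unfolding wavg_def using assms log_supermodular_sum_pos[OF assms(1)]
  by (intro divide_right_mono sum_mono mult_left_mono) (auto dest: log_supermodularD)

lemma wavg_cong: "(\<And>A. A \<subseteq> E \<Longrightarrow> f A = g A) \<Longrightarrow> wavg E w f = wavg E w g"
  unfolding wavg_def by (auto intro!: arg_cong2[where f = "(/)"] sum.cong)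

lemma wavg_cong_weight: "(\<And>A. A \<subseteq> E \<Longrightarrow> w A = v A) \<Longrightarrow> wavg E w f = wavg E v f"
  unfolding wavg_def by (auto intro!: arg_cong2[where f = "(/)"] sum.cong)

lemma wavg_const: "log_supermodular E w \<Longrightarrow> wavg E w (\<lambda>_. c) = c"
  unfolding wavg_def sum_distrib_right[symmetric] using log_supermodular_sum_pos[of E w] by simp

lemma wavg_nonneg:
  "log_supermodular E w \<Longrightarrow> (\<And>A. A \<subseteq> E \<Longrightarrow> 0 \<le> f A) \<Longrightarrow> 0 \<le> wavg E w f"
  using wavg_mono[of E w "\<lambda>_. 0" f] wavg_const[of E w 0] by simp

lemma wavg_le: "log_supermodular E w \<Longrightarrow> (\<And>A. A \<subseteq> E \<Longrightarrow> f A \<le> c) \<Longrightarrow> wavg E w f \<le> c"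
  using wavg_mono[of E w f "\<lambda>_. c"] wavg_const[of E w c] by simp

lemma wavg_cmult: "wavg E w (\<lambda>A. c * f A) = c * wavg E w f"
  unfolding wavg_def by (simp add: sum_distrib_left mult_ac)

lemma wavg_add: "wavg E w (\<lambda>A. f A + g A) = wavg E w f + wavg E w g"
  unfolding wavg_def by (simp add: sum.distrib algebra_simps add_divide_distrib)

lemma wavg_diff: "wavg E w (\<lambda>A. f A - g A) = wavg E w f - wavg E w g"
  unfolding wavg_def by (simp add: sum_subtractf algebra_simps diff_divide_distrib)

lemma wavg_sum: "wavg E w (\<lambda>A. \<Sum>i\<in>I. f i A) = (\<Sum>i\<in>I. wavg E w (f i))"
  unfolding wavg_def sum_divide_distrib[symmetric] sum_distrib_left by (subst sum.swap) simp

lemma wavg_swap: "wavg E w (\<lambda>A. wavg F v (\<lambda>B. f A B)) = wavg F v (\<lambda>B. wavg E w (\<lambda>A. f A B))"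
  unfolding wavg_def
  by (simp add: sum_distrib_left sum_divide_distrib mult_ac) (subst sum.swap, simp add: mult_ac)

lemma wavg_compl:
  "log_supermodular E w \<Longrightarrow> wavg E w (\<lambda>A. of_bool (\<not> P A)) = 1 - wavg E w (\<lambda>A. of_bool (P A))"
  using wavg_diff[of E w "\<lambda>_. 1" "\<lambda>A. of_bool (P A)"] wavg_const[of E w 1]
  by (simp add: of_bool_not_iff)

text \<open>Holley's inequality as one instance of the four functions theorem: the decreasing factor
  travels with the intersection, so that on the right it is paired with \<open>w\<close> instead of
  \<open>v\<close>.\<close>

lemma holley_antimono:
  assumes "finite E" "\<And>A. A \<subseteq> E \<Longrightarrow> 0 < w A" "\<And>A. A \<subseteq> E \<Longrightarrow> 0 < v A"
    and "\<And>A B. A \<subseteq> E \<Longrightarrow> B \<subseteq> E \<Longrightarrow> w A * v B \<le> w (A \<inter> B) * v (A \<union> B)"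
    and "antimono_on (Pow E) g" "\<And>A. A \<subseteq> E \<Longrightarrow> 0 \<le> g A"
  shows "wavg E v g \<le> wavg E w g"
proof -
  have *: "sum w (Pow E) * (\<Sum>A\<in>Pow E. v A * g A) \<le> (\<Sum>A\<in>Pow E. w A * g A) * sum v (Pow E)"
  proof (rule four_functions)
    fix A B assume AB: "A \<subseteq> E" "B \<subseteq> E"
    have "g B \<le> g (A \<inter> B)" using assms(5) AB by (intro monotone_onD[OF assms(5)]) auto
    moreover have "A \<inter> B \<subseteq> E" "A \<union> B \<subseteq> E" using AB by auto
    ultimately have "w A * v B * g B \<le> (w (A \<inter> B) * v (A \<union> B)) * g (A \<inter> B)"
      using assms(2,3,6) AB
      by (intro mult_mono[OF assms(4)[OF AB]]) (simp_all add: less_imp_le le_infI1)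
    then show "w A * (v B * g B) \<le> w (A \<inter> B) * g (A \<inter> B) * v (A \<union> B)" by (simp add: mult_ac)
  qed (use assms(1,2,3,6) in \<open>auto simp: less_imp_le\<close>)
  moreover have "0 < sum w (Pow E)" "0 < sum v (Pow E)"
    using assms(1-3) by (auto intro!: sum_pos)
  ultimately show ?thesis by (simp add: wavg_def field_simps)
qed

lemma holley_mono:
  assumes "finite E" "\<And>A. A \<subseteq> E \<Longrightarrow> 0 < w A" "\<And>A. A \<subseteq> E \<Longrightarrow> 0 < v A"
    and "\<And>A B. A \<subseteq> E \<Longrightarrow> B \<subseteq> E \<Longrightarrow> w A * v B \<le> w (A \<inter> B) * v (A \<union> B)"
    and "mono_on (Pow E) g" "\<And>A. A \<subseteq> E \<Longrightarrow> 0 \<le> g A"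
  shows "wavg E w g \<le> wavg E v g"
proof -
  have *: "(\<Sum>A\<in>Pow E. w A * g A) * sum v (Pow E) \<le> sum w (Pow E) * (\<Sum>A\<in>Pow E. v A * g A)"
  proof (rule four_functions)
    fix A B assume AB: "A \<subseteq> E" "B \<subseteq> E"
    have "g A \<le> g (A \<union> B)" using assms(5) AB by (intro monotone_onD[OF assms(5)]) auto
    moreover have "A \<inter> B \<subseteq> E" "A \<union> B \<subseteq> E" using AB by auto
    ultimately have "w A * v B * g A \<le> (w (A \<inter> B) * v (A \<union> B)) * g (A \<union> B)"
      using assms(2,3,6) AB
      by (intro mult_mono[OF assms(4)[OF AB]]) (simp_all add: less_imp_le le_infI1)
    then show "w A * g A * v B \<le> w (A \<inter> B) * (v (A \<union> B) * g (A \<union> B))" by (simp add: mult_ac)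
  qed (use assms(1,2,3,6) in \<open>auto simp: less_imp_le\<close>)
  moreover have "0 < sum w (Pow E)" "0 < sum v (Pow E)"
    using assms(1-3) by (auto intro!: sum_pos)
  ultimately show ?thesis by (simp add: wavg_def field_simps)
qed

text \<open>Both increasing factors are moved to the union, so one factor on the right carries their
  product. For decreasing functions the intersection takes this part.\<close>

lemma fkg_mono:
  assumes w: "log_supermodular E w"
    and f: "mono_on (Pow E) f" "\<And>A. A \<subseteq> E \<Longrightarrow> 0 \<le> f A"
    and g: "mono_on (Pow E) g" "\<And>A. A \<subseteq> E \<Longrightarrow> 0 \<le> g A"
  shows "wavg E w f * wavg E w g \<le> wavg E w (\<lambda>A. f A * g A)"
proof -
  have "(\<Sum>A\<in>Pow E. w A * f A) * (\<Sum>A\<in>Pow E. w A * g A) \<le> sum w (Pow E) * (\<Sum>A\<in>Pow E. w A * (f A * g A))"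
  proof (rule four_functions)
    fix A B assume AB: "A \<subseteq> E" "B \<subseteq> E"
    have "f A \<le> f (A \<union> B)" "g B \<le> g (A \<union> B)"
      using AB by (auto intro!: monotone_onD[OF f(1)] monotone_onD[OF g(1)])
    moreover have "A \<inter> B \<subseteq> E" "A \<union> B \<subseteq> E" using AB by auto
    ultimately have "(w A * w B) * (f A * g B) \<le> (w (A \<inter> B) * w (A \<union> B)) * (f (A \<union> B) * g (A \<union> B))"
      using f(2) g(2) AB log_supermodularD(3)[OF w]
      by (intro mult_mono[OF log_supermodularD(4)[OF w AB]] mult_mono mult_nonneg_nonneg) auto
    then show "w A * f A * (w B * g B) \<le> w (A \<inter> B) * (w (A \<union> B) * (f (A \<union> B) * g (A \<union> B)))"
      by (simp add: mult_ac)
  qed (use f g log_supermodularD[OF w] in \<open>auto intro!: mult_nonneg_nonneg\<close>)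
  then show ?thesis using log_supermodular_sum_pos[OF w] by (simp add: wavg_def field_simps)
qed

lemma fkg_antimono:
  assumes w: "log_supermodular E w"
    and f: "antimono_on (Pow E) f" "\<And>A. A \<subseteq> E \<Longrightarrow> 0 \<le> f A"
    and g: "antimono_on (Pow E) g" "\<And>A. A \<subseteq> E \<Longrightarrow> 0 \<le> g A"
  shows "wavg E w f * wavg E w g \<le> wavg E w (\<lambda>A. f A * g A)"
proof -
  have "(\<Sum>A\<in>Pow E. w A * f A) * (\<Sum>A\<in>Pow E. w A * g A) \<le> (\<Sum>A\<in>Pow E. w A * (f A * g A)) * sum w (Pow E)"
  proof (rule four_functions)
    fix A B assume AB: "A \<subseteq> E" "B \<subseteq> E"
    have "f A \<le> f (A \<inter> B)" "g B \<le> g (A \<inter> B)"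
      using AB by (auto intro!: monotone_onD[OF f(1)] monotone_onD[OF g(1)])
    moreover have "A \<inter> B \<subseteq> E" "A \<union> B \<subseteq> E" using AB by auto
    ultimately have "(w A * w B) * (f A * g B) \<le> (w (A \<inter> B) * w (A \<union> B)) * (f (A \<inter> B) * g (A \<inter> B))"
      using f(2) g(2) AB log_supermodularD(3)[OF w]
      by (intro mult_mono[OF log_supermodularD(4)[OF w AB]] mult_mono mult_nonneg_nonneg) auto
    then show "w A * f A * (w B * g B) \<le> w (A \<inter> B) * (f (A \<inter> B) * g (A \<inter> B)) * w (A \<union> B)"
      by (simp add: mult_ac)
  qed (use f g log_supermodularD[OF w] in \<open>auto intro!: mult_nonneg_nonneg\<close>)
  then show ?thesis using log_supermodular_sum_pos[OF w] by (simp add: wavg_def field_simps)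
qed

lemma fkg_antimono_prod:
  assumes w: "log_supermodular E w" and "finite I"
    and "\<And>i. i \<in> I \<Longrightarrow> antimono_on (Pow E) (f i)" "\<And>i A. i \<in> I \<Longrightarrow> A \<subseteq> E \<Longrightarrow> 0 \<le> f i A"
  shows "(\<Prod>i\<in>I. wavg E w (f i)) \<le> wavg E w (\<lambda>A. \<Prod>i\<in>I. f i A)"
  using assms(2-)
proof (induction I rule: finite_induct)
  case empty
  then show ?case by (simp add: wavg_const[OF w])
next
  case (insert j I)
  have "(\<Prod>i\<in>insert j I. wavg E w (f i)) = wavg E w (f j) * (\<Prod>i\<in>I. wavg E w (f i))"
    using insert.hyps by simp
  also have "\<dots> \<le> wavg E w (f j) * wavg E w (\<lambda>A. \<Prod>i\<in>I. f i A)"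
    using insert by (intro mult_left_mono insert.IH wavg_nonneg[OF w]) auto
  also have "\<dots> \<le> wavg E w (\<lambda>A. f j A * (\<Prod>i\<in>I. f i A))"
  proof (rule fkg_antimono[OF w])
    show "antimono_on (Pow E) (\<lambda>A. \<Prod>i\<in>I. f i A)"
      by (intro monotone_onI prod_mono) (auto intro!: insert.prems monotone_onD[OF insert.prems(1)])
  qed (use insert.prems in \<open>auto intro!: prod_nonneg\<close>)
  finally show ?case using insert.hyps by simp
qed

text \<open>Given the configuration outside \<open>F\<close>, the configuration inside \<open>F\<close> stochastically dominates
  the one with nothing outside. This is how free boundary conditions are compared.\<close>

lemma wavg_section_le:
  assumes w: "log_supermodular E w" and F: "F \<subseteq> E"
    and anti: "\<And>Z. Z \<subseteq> E - F \<Longrightarrow> antimono_on (Pow F) (\<lambda>A. G (A \<union> Z))"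
    and nonneg: "\<And>A. A \<subseteq> E \<Longrightarrow> 0 \<le> G A"
    and bound: "\<And>Z. Z \<subseteq> E - F \<Longrightarrow> wavg F w (\<lambda>A. G (A \<union> Z)) \<le> b * h Z"
  shows "wavg E w G \<le> b * wavg E w (\<lambda>A. h (A - F))"
proof -
  have fin: "finite F" "finite (E - F)" and un: "F \<union> (E - F) = E" "F \<inter> (E - F) = {}"
    using F log_supermodularD(1)[OF w] finite_subset by auto
  have split: "sum f (Pow E) = (\<Sum>Z\<in>Pow (E - F). \<Sum>A\<in>Pow F. f (A \<union> Z))" for f :: "'a set \<Rightarrow> real"
    using sum_Pow_Un[OF fin un(2), of f] un by simp
  have inside: "(\<Sum>A\<in>Pow F. w (A \<union> Z) * G (A \<union> Z)) \<le> b * (\<Sum>A\<in>Pow F. w (A \<union> Z) * h Z)"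
    if Z: "Z \<subseteq> E - F" for Z
  proof -
    have pos: "0 < (\<Sum>A\<in>Pow F. w (A \<union> Z))"
      using F Z fin by (intro sum_pos log_supermodularD(2)[OF w]) auto
    have AZ: "A \<union> Z \<subseteq> E" if "A \<subseteq> F" for A using that F Z by auto
    have "wavg F (\<lambda>A. w (A \<union> Z)) (\<lambda>A. G (A \<union> Z)) \<le> wavg F w (\<lambda>A. G (A \<union> Z))"
    proof (rule holley_antimono)
      fix A B assume AB: "A \<subseteq> F" "B \<subseteq> F"
      have "A \<inter> (B \<union> Z) = A \<inter> B" "A \<union> (B \<union> Z) = A \<union> B \<union> Z" using AB Z by auto
      moreover have "A \<subseteq> E" "B \<union> Z \<subseteq> E" using AB F Z by auto
      ultimately show "w A * w (B \<union> Z) \<le> w (A \<inter> B) * w (A \<union> B \<union> Z)"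
        using log_supermodularD(4)[OF w, of A "B \<union> Z"] by simp
    qed (use F fin anti[OF Z] nonneg[OF AZ] log_supermodularD(2)[OF w AZ] log_supermodularD(2)[OF w] in auto)
    also have "\<dots> \<le> b * h Z" by (rule bound[OF Z])
    finally show ?thesis using pos
      by (simp add: wavg_def pos_divide_le_eq mult_ac flip: sum_distrib_left sum_distrib_right)
  qed
  have "(\<Sum>A\<in>Pow E. w A * G A) \<le> (\<Sum>Z\<in>Pow (E - F). b * (\<Sum>A\<in>Pow F. w (A \<union> Z) * h Z))"
    unfolding split by (intro sum_mono inside) auto
  also have "\<dots> = b * (\<Sum>Z\<in>Pow (E - F). \<Sum>A\<in>Pow F. w (A \<union> Z) * h ((A \<union> Z) - F))"
    unfolding sum_distrib_left
  proof (intro sum.cong refl)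
    fix Z A assume "Z \<in> Pow (E - F)" "A \<in> Pow F"
    then have "(A \<union> Z) - F = Z" by auto
    then show "b * (w (A \<union> Z) * h Z) = b * (w (A \<union> Z) * h (A \<union> Z - F))" by simp
  qed
  also have "\<dots> = b * (\<Sum>A\<in>Pow E. w A * h (A - F))" unfolding split ..
  finally show ?thesis
    using log_supermodular_sum_pos[OF w] by (simp add: wavg_def field_simps)
qed

text \<open>Whatever is open outside \<open>F\<close>, the law inside dominates the free one, so the
  bound \<open>wavg F w g\<close> is the same for every \<open>Z\<close>.\<close>

lemma wavg_restrict_antimono:
  assumes w: "log_supermodular E w" and F: "F \<subseteq> E"
    and "antimono_on (Pow F) g" "\<And>A. A \<subseteq> F \<Longrightarrow> 0 \<le> g A"
  shows "wavg E w (\<lambda>A. g (A \<inter> F)) \<le> wavg F w g"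
proof -
  have eq: "(A \<union> Z) \<inter> F = A" if "Z \<subseteq> E - F" "A \<subseteq> F" for A Z using that by auto
  have "wavg E w (\<lambda>A. g (A \<inter> F)) \<le> wavg F w g * wavg E w (\<lambda>_. 1)"
  proof (rule wavg_section_le[OF w F, where h = "\<lambda>_. 1"])
    fix Z assume Z: "Z \<subseteq> E - F"
    show "antimono_on (Pow F) (\<lambda>A. g ((A \<union> Z) \<inter> F))"
      using eq[OF Z] monotone_onD[OF assms(3)] by (intro monotone_onI) auto
    show "wavg F w (\<lambda>A. g ((A \<union> Z) \<inter> F)) \<le> wavg F w g * 1"
      using eq[OF Z] by (simp cong: wavg_cong)
  qed (use assms in auto)
  then show ?thesis using wavg_const[OF w, of 1] by simp
qed

text \<open>This replaces independence for decreasing events. Given the configuration outside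
  \<open>F j\<close>, the factor of \<open>F j\<close> averages to at most its free value, hence to
  at most \<open>b j\<close>; the remaining factors do not see \<open>F j\<close>, and the induction
  continues with them.\<close>

lemma wavg_prod_le:
  assumes w: "log_supermodular E w" and "finite I"
    and "\<And>i. i \<in> I \<Longrightarrow> F i \<subseteq> E" "disjoint_family_on F I"
    and "\<And>i. i \<in> I \<Longrightarrow> antimono_on (Pow (F i)) (g i)" "\<And>i A. i \<in> I \<Longrightarrow> A \<subseteq> F i \<Longrightarrow> 0 \<le> g i A"
    and "\<And>i. i \<in> I \<Longrightarrow> wavg (F i) w (g i) \<le> b i"
  shows "wavg E w (\<lambda>A. \<Prod>i\<in>I. g i (A \<inter> F i)) \<le> (\<Prod>i\<in>I. b i)"
  using assms(2-)
proof (induction I rule: finite_induct)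
  case empty
  then show ?case by (simp add: wavg_const[OF w])
next
  case (insert j I)
  have disj: "F i \<inter> F j = {}" if "i \<in> I" for i
    using insert.prems(2) insert.hyps that by (auto simp: disjoint_family_on_def)
  have b0: "0 \<le> b i" if "i \<in> insert j I" for i
  proof -
    have "0 \<le> wavg (F i) w (g i)"
      using insert.prems(1,4) that by (intro wavg_nonneg log_supermodular_subset[OF w]) auto
    then show ?thesis using insert.prems(5)[OF that] by linarith
  qed
  have "wavg E w (\<lambda>A. \<Prod>i\<in>insert j I. g i (A \<inter> F i))
      \<le> b j * wavg E w (\<lambda>A. \<Prod>i\<in>I. g i ((A - F j) \<inter> F i))"
  proof (rule wavg_section_le[OF w, where F = "F j" and h = "\<lambda>Z. \<Prod>i\<in>I. g i (Z \<inter> F i)"])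
    fix Z assume Z: "Z \<subseteq> E - F j"
    have eq: "(\<Prod>i\<in>insert j I. g i ((A \<union> Z) \<inter> F i)) = g j A * (\<Prod>i\<in>I. g i (Z \<inter> F i))"
      if A: "A \<subseteq> F j" for A
    proof -
      have "(A \<union> Z) \<inter> F j = A" using A Z by auto
      moreover have "(A \<union> Z) \<inter> F i = Z \<inter> F i" if "i \<in> I" for i using A disj[OF that] by auto
      ultimately show ?thesis using insert.hyps by simp
    qed
    have nn: "0 \<le> (\<Prod>i\<in>I. g i (Z \<inter> F i))" using insert.prems by (intro prod_nonneg) auto
    show "antimono_on (Pow (F j)) (\<lambda>A. \<Prod>i\<in>insert j I. g i ((A \<union> Z) \<inter> F i))"
      using eq nn insert.prems(3)[of j]
      by (intro monotone_onI) (auto intro!: mult_right_mono dest: monotone_onD)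
    have "wavg (F j) w (\<lambda>A. \<Prod>i\<in>insert j I. g i ((A \<union> Z) \<inter> F i))
        = wavg (F j) w (\<lambda>A. (\<Prod>i\<in>I. g i (Z \<inter> F i)) * g j A)"
      by (rule wavg_cong) (simp only: eq mult.commute)
    also have "\<dots> = (\<Prod>i\<in>I. g i (Z \<inter> F i)) * wavg (F j) w (g j)" by (rule wavg_cmult)
    also have "\<dots> \<le> b j * (\<Prod>i\<in>I. g i (Z \<inter> F i))"
      using mult_left_mono[OF insert.prems(5)[of j] nn] by (simp add: mult.commute)
    finally show "wavg (F j) w (\<lambda>A. \<Prod>i\<in>insert j I. g i ((A \<union> Z) \<inter> F i))
        \<le> b j * (\<Prod>i\<in>I. g i (Z \<inter> F i))" .
  qed (use insert.prems in \<open>auto intro!: prod_nonneg\<close>)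
  also have "wavg E w (\<lambda>A. \<Prod>i\<in>I. g i ((A - F j) \<inter> F i)) = wavg E w (\<lambda>A. \<Prod>i\<in>I. g i (A \<inter> F i))"
  proof -
    have "(A - F j) \<inter> F i = A \<inter> F i" if "i \<in> I" for i A using disj[OF that] by auto
    then show ?thesis by simp
  qed
  also have "b j * \<dots> \<le> b j * (\<Prod>i\<in>I. b i)"
    using insert.prems insert.hyps b0
    by (intro mult_left_mono insert.IH) (auto simp: disjoint_family_on_def)
  finally show ?case using insert.hyps by simp
qed

subsection \<open>Sprinkling\<close>

text \<open>Opening \<open>e\<close> with probability \<open>s\<close> turns \<open>w\<close> into
  \<open>w'\<close>. This multiplies the conditional odds of \<open>e\<close> by at most
  \<open>(1 + s / odds) / (1 - s)\<close>, which is at most \<open>t\<close>, so Holley's criterion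
  compares \<open>w'\<close> with \<open>w\<close> tilted by \<open>t\<close> at
  \<open>e\<close>.\<close>

lemma wavg_sprinkle_edge:
  assumes w: "log_supermodular E w" and e: "e \<in> E" and s: "0 \<le> s" "s < 1"
    and "0 < odds" "\<And>A. A \<subseteq> E \<Longrightarrow> e \<notin> A \<Longrightarrow> odds * w A \<le> w (insert e A)"
    and t: "1 \<le> t" "1 + s / odds \<le> (1 - s) * t"
    and f: "mono_on (Pow E) f" "\<And>A. A \<subseteq> E \<Longrightarrow> 0 \<le> f A"
  shows "wavg E w (\<lambda>A. (1 - s) * f A + s * f (insert e A)) \<le> wavg E (\<lambda>A. w A * (if e \<in> A then t else 1)) f"
proof -
  define E' where "E' = E - {e}"
  \<comment> \<open>An open \<open>e\<close> was either open before or closed and then sprinkled,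
    whence the two terms.\<close>
  define w' where "w' A = (if e \<in> A then w A + s * w (A - {e}) else (1 - s) * w A)" for A
  have E: "E = insert e E'" "e \<notin> E'" and fin: "finite E'"
    using e log_supermodularD(1)[OF w] by (auto simp: E'_def)
  have wpos: "0 < w A" "0 \<le> w A" if "A \<subseteq> E" for A using log_supermodularD[OF w] that by auto
  have split: "sum g (Pow E) = (\<Sum>A\<in>Pow E'. g A + g (insert e A))" for g :: "'a set \<Rightarrow> real"
    unfolding E(1) by (rule sum_Pow_insert[OF fin E(2)])
  have "(\<Sum>A\<in>Pow E. w A * ((1 - s) * f A + s * f (insert e A))) = (\<Sum>A\<in>Pow E. w' A * f A)"
    unfolding split using E(2) by (intro sum.cong refl) (auto simp: w'_def algebra_simps insert_absorb)
  moreover have "sum w (Pow E) = sum w' (Pow E)"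
    unfolding split using E(2) by (intro sum.cong refl) (auto simp: w'_def algebra_simps insert_absorb)
  ultimately have "wavg E w (\<lambda>A. (1 - s) * f A + s * f (insert e A)) = wavg E w' f"
    by (simp add: wavg_def)
  also have "\<dots> \<le> wavg E (\<lambda>A. w A * (if e \<in> A then t else 1)) f"
  proof (rule holley_mono)
    fix A assume A: "A \<subseteq> E"
    show "0 < w' A" using A wpos[of A] wpos[of "A - {e}"] s
      by (auto simp: w'_def intro!: add_pos_nonneg mult_nonneg_nonneg)
    show "0 < w A * (if e \<in> A then t else 1)" using wpos[OF A] t by auto
    fix B assume B: "B \<subseteq> E"
    have AB: "w A * w B \<le> w (A \<inter> B) * w (A \<union> B)" by (rule log_supermodularD(4)[OF w A B])
    have nn: "0 \<le> w (A \<inter> B) * w (A \<union> B)" using A B by (intro mult_nonneg_nonneg wpos) auto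
    consider "e \<in> A" "e \<in> B" | "e \<notin> A" | "e \<in> A" "e \<notin> B" by blast
    then show "w' A * (w B * (if e \<in> B then t else 1))
        \<le> w' (A \<inter> B) * (w (A \<union> B) * (if e \<in> A \<union> B then t else 1))"
    proof cases
      case 1
      have "(A - {e}) \<inter> B = A \<inter> B - {e}" "(A - {e}) \<union> B = A \<union> B" using 1 by auto
      then have "w (A - {e}) * w B \<le> w (A \<inter> B - {e}) * w (A \<union> B)"
        using log_supermodularD(4)[OF w, of "A - {e}" B] A B by auto
      then have "t * (w A * w B + s * (w (A - {e}) * w B))
          \<le> t * (w (A \<inter> B) * w (A \<union> B) + s * (w (A \<inter> B - {e}) * w (A \<union> B)))"
        using AB s t by (intro mult_left_mono add_mono) auto
      then show ?thesis using 1 by (simp add: w'_def algebra_simps)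
    next
      case 2
      have "(1 - s) * (w A * w B) * (if e \<in> B then t else 1)
          \<le> (1 - s) * (w (A \<inter> B) * w (A \<union> B)) * (if e \<in> B then t else 1)"
        using AB s t by (intro mult_right_mono mult_left_mono) auto
      then show ?thesis using 2 by (simp add: w'_def algebra_simps)
    next
      case 3
      have "odds * w (A - {e}) \<le> w A"
        using assms(6)[of "A - {e}"] A 3 by (auto simp: insert_absorb)
      then have "w (A - {e}) \<le> w A / odds" using assms(5) by (simp add: field_simps)
      then have "w A + s * w (A - {e}) \<le> w A + s * (w A / odds)"
        using s by (intro add_left_mono mult_left_mono) auto
      also have "\<dots> = w A * (1 + s / odds)" by (simp add: algebra_simps)
      also have "\<dots> \<le> w A * ((1 - s) * t)" using t wpos[OF A] by (intro mult_left_mono) auto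
      finally have "(w A + s * w (A - {e})) * w B \<le> (w A * ((1 - s) * t)) * w B"
        using wpos[OF B] by (intro mult_right_mono) auto
      also have "\<dots> = (1 - s) * t * (w A * w B)" by simp
      also have "\<dots> \<le> (1 - s) * t * (w (A \<inter> B) * w (A \<union> B))"
        using AB s t by (intro mult_left_mono) auto
      finally show ?thesis using 3 by (simp add: w'_def algebra_simps)
    qed
  qed (use f log_supermodularD(1)[OF w] in auto)
  finally show ?thesis .
qed

text \<open>Averaging with this weight is expectation under a product of Bernoulli(\<open>s\<close>) variables.\<close>

definition bernoulli_weight :: "real \<Rightarrow> 'e set \<Rightarrow> real" where
  "bernoulli_weight s A = (s / (1 - s)) ^ card A"

lemma log_supermodular_bernoulli:
  assumes "finite E" "0 < s" "s < 1"
  shows "log_supermodular E (bernoulli_weight s)"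
proof -
  have "bernoulli_weight s A * bernoulli_weight s B
      = bernoulli_weight s (A \<inter> B) * bernoulli_weight s (A \<union> B)" if "A \<subseteq> E" "B \<subseteq> E" for A B
  proof -
    have "card A + card B = card (A \<inter> B) + card (A \<union> B)"
      using card_Un_Int[of A B] that finite_subset[OF _ assms(1)] by auto
    then show ?thesis unfolding bernoulli_weight_def by (metis power_add)
  qed
  then show ?thesis using assms by (auto simp: log_supermodular_def bernoulli_weight_def)
qed

lemma wavg_bernoulli_insert:
  assumes "finite F" "e \<notin> F" "0 < s" "s < 1"
  shows "wavg (insert e F) (bernoulli_weight s) g
    = wavg F (bernoulli_weight s) (\<lambda>B. (1 - s) * g B + s * g (insert e B))"
proof -
  have bw: "bernoulli_weight s (insert e B) = s / (1 - s) * bernoulli_weight s B" if "B \<in> Pow F" for B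
    using assms that finite_subset[of B F] by (auto simp: bernoulli_weight_def card_insert_if)
  have tot: "sum (bernoulli_weight s) (Pow (insert e F)) = sum (bernoulli_weight s) (Pow F) / (1 - s)"
    unfolding sum_Pow_insert[OF assms(1,2)] sum_divide_distrib
    using assms by (intro sum.cong refl) (simp add: bw field_simps)
  have "(\<Sum>A\<in>Pow (insert e F). bernoulli_weight s A * g A)
     = (\<Sum>B\<in>Pow F. bernoulli_weight s B * ((1 - s) * g B + s * g (insert e B))) / (1 - s)"
    unfolding sum_Pow_insert[OF assms(1,2)] sum_divide_distrib
    using assms by (intro sum.cong refl) (simp add: bw field_simps)
  then show ?thesis using assms unfolding wavg_def tot by simp
qed

lemma wavg_bernoulli_all:
  assumes "finite G" "0 < s" "s < 1"
  shows "wavg G (bernoulli_weight s) (\<lambda>A. of_bool (G \<subseteq> A)) = s ^ card G"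
  using assms(1)
proof (induction G rule: finite_induct)
  case empty
  then show ?case by (simp add: wavg_def bernoulli_weight_def)
next
  case (insert e F)
  have "wavg (insert e F) (bernoulli_weight s) (\<lambda>A. of_bool (insert e F \<subseteq> A))
      = wavg F (bernoulli_weight s) (\<lambda>B. s * of_bool (F \<subseteq> B))"
    unfolding wavg_bernoulli_insert[OF insert.hyps assms(2,3)]
    by (rule wavg_cong) (use insert.hyps in auto)
  then show ?case using insert by (simp add: wavg_cmult)
qed

text \<open>Edges are sprinkled one at a time. The tilt \<open>t ^ card (A \<inter> F)\<close> is
  modular in \<open>A\<close>, so supermodularity and the lower bound on the odds persist for the
  next edge.\<close>

lemma wavg_sprinkle:
  assumes w: "log_supermodular E w" and "F \<subseteq> E" and s: "0 < s" "s < 1"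
    and "0 < odds" "\<And>e A. e \<in> E \<Longrightarrow> A \<subseteq> E \<Longrightarrow> e \<notin> A \<Longrightarrow> odds * w A \<le> w (insert e A)"
    and t: "1 \<le> t" "1 + s / odds \<le> (1 - s) * t"
    and "mono_on (Pow E) f" "\<And>A. A \<subseteq> E \<Longrightarrow> 0 \<le> f A"
  shows "wavg E w (\<lambda>A. wavg F (bernoulli_weight s) (\<lambda>B. f (A \<union> B)))
    \<le> wavg E (\<lambda>A. w A * t ^ card (A \<inter> F)) f"
proof -
  have "finite F" using assms(2) log_supermodularD(1)[OF w] finite_subset by auto
  then show ?thesis using assms(2) assms(9-)
  proof (induction F arbitrary: f rule: finite_induct)
    case empty
    then show ?case by (simp add: wavg_def bernoulli_weight_def)
  next
    case (insert e F)
    let ?f = "\<lambda>A. (1 - s) * f A + s * f (insert e A)"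
    let ?w = "\<lambda>A. w A * t ^ card (A \<inter> F)"
    have finE: "finite E" by (rule log_supermodularD(1)[OF w])
    have fins: "finite A" if "A \<subseteq> E" for A using that finE finite_subset by auto
    have e: "e \<in> E" "F \<subseteq> E" using insert.prems by auto
    have cards: "card (A \<inter> F) + card (B \<inter> F) = card (A \<inter> B \<inter> F) + card ((A \<union> B) \<inter> F)" for A B
    proof -
      have "A \<inter> B \<inter> F = (A \<inter> F) \<inter> (B \<inter> F)" "(A \<union> B) \<inter> F = (A \<inter> F) \<union> (B \<inter> F)" by auto
      then show ?thesis using card_Un_Int[of "A \<inter> F" "B \<inter> F"] insert.hyps by simp
    qed
    have lsm: "log_supermodular E ?w"
      unfolding log_supermodular_def
    proof (intro conjI allI impI finE)
      fix A assume A: "A \<subseteq> E"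
      show "0 < w A * t ^ card (A \<inter> F)" using log_supermodularD(2)[OF w A] t by simp
      fix B assume B: "B \<subseteq> E"
      have "(w A * w B) * t ^ (card (A \<inter> F) + card (B \<inter> F))
          \<le> (w (A \<inter> B) * w (A \<union> B)) * t ^ (card (A \<inter> F) + card (B \<inter> F))"
        using t by (intro mult_right_mono log_supermodularD(4)[OF w A B]) auto
      then show "w A * t ^ card (A \<inter> F) * (w B * t ^ card (B \<inter> F))
          \<le> w (A \<inter> B) * t ^ card (A \<inter> B \<inter> F) * (w (A \<union> B) * t ^ card ((A \<union> B) \<inter> F))"
        by (subst (asm) (2) cards) (simp add: power_add mult_ac)
    qed
    have fmono: "mono_on (Pow E) ?f"
    proof (intro monotone_onI add_mono mult_left_mono)
      fix A B assume "A \<in> Pow E" "B \<in> Pow E" "A \<le> B"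
      then show "f A \<le> f B" "f (insert e A) \<le> f (insert e B)"
        using e by (auto intro!: monotone_onD[OF insert.prems(2)])
    qed (use s in auto)
    have "wavg E w (\<lambda>A. wavg (insert e F) (bernoulli_weight s) (\<lambda>B. f (A \<union> B)))
        = wavg E w (\<lambda>A. wavg F (bernoulli_weight s) (\<lambda>B. ?f (A \<union> B)))"
      unfolding wavg_bernoulli_insert[OF insert.hyps s] by simp
    also have "\<dots> \<le> wavg E ?w ?f"
      using e s insert.prems by (intro insert.IH fmono) auto
    also have "\<dots> \<le> wavg E (\<lambda>A. ?w A * (if e \<in> A then t else 1)) f"
    proof (rule wavg_sprinkle_edge[OF lsm e(1) _ _ assms(5)])
      fix A assume A: "A \<subseteq> E" "e \<notin> A"
      have "insert e A \<inter> F = A \<inter> F" using insert.hyps by auto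
      then show "odds * (w A * t ^ card (A \<inter> F)) \<le> w (insert e A) * t ^ card (insert e A \<inter> F)"
        using mult_right_mono[OF assms(6)[OF e(1) A], of "t ^ card (A \<inter> F)"] t by (simp add: mult_ac)
    qed (use s t insert.prems in auto)
    also have "\<dots> = wavg E (\<lambda>A. w A * t ^ card (A \<inter> insert e F)) f"
    proof -
      have "(\<lambda>A. ?w A * (if e \<in> A then t else 1)) = (\<lambda>A. w A * t ^ card (A \<inter> insert e F))"
        using insert.hyps by (intro ext) (auto simp: Int_insert_right)
      then show ?thesis by (simp only:)
    qed
    finally show ?case .
  qed
qed

section \<open>Clusters and the random-cluster weight\<close>

definition linked :: "'v set set \<Rightarrow> 'v \<Rightarrow> 'v \<Rightarrow> bool" where
  "linked \<omega> x y \<longleftrightarrow> (x, y) \<in> {(u, v). {u, v} \<in> \<omega>}\<^sup>*"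

lemma linked_refl [simp, intro]: "linked \<omega> x x"
  by (simp add: linked_def)

lemma linked_trans [trans]: "linked \<omega> x y \<Longrightarrow> linked \<omega> y z \<Longrightarrow> linked \<omega> x z"
  by (simp add: linked_def)

lemma linked_sym: "linked \<omega> x y \<Longrightarrow> linked \<omega> y x"
proof -
  have "sym ({(u, v). {u, v} \<in> \<omega>}\<^sup>*)" by (intro sym_rtrancl symI) (auto simp: insert_commute)
  then show "linked \<omega> x y \<Longrightarrow> linked \<omega> y x" by (auto simp: linked_def dest: symD)
qed

lemma linked_commute: "linked \<omega> x y \<longleftrightarrow> linked \<omega> y x"
  using linked_sym by metis

lemma linked_mono: "linked \<omega> x y \<Longrightarrow> \<omega> \<subseteq> \<omega>' \<Longrightarrow> linked \<omega>' x y"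
  unfolding linked_def by (rule rtrancl_mono[THEN subsetD, rotated]) auto

lemma linked_edge: "{x, y} \<in> \<omega> \<Longrightarrow> linked \<omega> x y"
  by (auto simp: linked_def)

lemma linked_induct [consumes 1, case_names refl step]:
  assumes "linked \<omega> x y" "P x" "\<And>y z. linked \<omega> x y \<Longrightarrow> {y, z} \<in> \<omega> \<Longrightarrow> P y \<Longrightarrow> P z"
  shows "P y"
  using assms(1)[unfolded linked_def] assms(2,3)
  by (induction rule: rtrancl_induct) (auto simp: linked_def)

lemma linked_Union: "linked \<omega> x y \<Longrightarrow> x = y \<or> (x \<in> \<Union>\<omega> \<and> y \<in> \<Union>\<omega>)"
proof -
  have "linked \<omega> x y \<Longrightarrow> x = y \<or> y \<in> \<Union>\<omega>" for x y
    by (induction rule: linked_induct) auto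
  then show "linked \<omega> x y \<Longrightarrow> x = y \<or> (x \<in> \<Union>\<omega> \<and> y \<in> \<Union>\<omega>)" using linked_sym by metis
qed

lemma linked_switch:
  assumes "linked \<omega> x y" "P x" "\<not> P y"
  shows "\<exists>u v. {u, v} \<in> \<omega> \<and> P u \<and> \<not> P v"
  using assms by (induction rule: linked_induct) auto

lemma linked_insert:
  "linked (insert {u, v} \<omega>) x y \<longleftrightarrow>
    linked \<omega> x y \<or> (linked \<omega> x u \<and> linked \<omega> v y) \<or> (linked \<omega> x v \<and> linked \<omega> u y)"
proof
  show "linked (insert {u, v} \<omega>) x y \<Longrightarrow>
    linked \<omega> x y \<or> (linked \<omega> x u \<and> linked \<omega> v y) \<or> (linked \<omega> x v \<and> linked \<omega> u y)"
  proof (induction rule: linked_induct)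
    case (step y z)
    show ?case
    proof (cases "{y, z} \<in> \<omega>")
      case True
      then show ?thesis using step.IH linked_edge linked_trans by metis
    next
      case False
      then have "y = u \<and> z = v \<or> y = v \<and> z = u" using step.hyps by (auto simp: doubleton_eq_iff)
      then show ?thesis using step.IH linked_refl by metis
    qed
  qed simp
  have "linked (insert {u, v} \<omega>) u v" by (rule linked_edge) simp
  then show "linked \<omega> x y \<or> (linked \<omega> x u \<and> linked \<omega> v y) \<or> (linked \<omega> x v \<and> linked \<omega> u y) \<Longrightarrow>
      linked (insert {u, v} \<omega>) x y"
    using linked_mono[of \<omega> _ _ "insert {u, v} \<omega>"] linked_trans linked_sym
    by (metis subset_insertI)
qed

section \<open>The cluster-counting weight and its monotonicity\<close>

definition cluster :: "'v set set \<Rightarrow> 'v \<Rightarrow> 'v set" where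
  "cluster \<omega> x = {y. linked \<omega> x y}"

lemma cluster_eq_iff: "cluster \<omega> x = cluster \<omega> y \<longleftrightarrow> linked \<omega> x y"
proof
  assume "cluster \<omega> x = cluster \<omega> y"
  then have "y \<in> cluster \<omega> x" by (simp add: cluster_def)
  then show "linked \<omega> x y" by (simp add: cluster_def)
next
  assume *: "linked \<omega> x y"
  show "cluster \<omega> x = cluster \<omega> y"
    unfolding cluster_def using linked_trans[OF *] linked_trans[OF linked_sym[OF *]] by blast
qed

lemma card_cluster_insert:
  assumes "finite V" "u \<in> V" "v \<in> V"
  shows "card (cluster \<omega> ` V) = card (cluster (insert {u, v} \<omega>) ` V) + of_bool (\<not> linked \<omega> u v)"
proof (cases "linked \<omega> u v")
  case True
  then have "linked (insert {u, v} \<omega>) x y = linked \<omega> x y" for x y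
    unfolding linked_insert using linked_trans linked_sym by metis
  then show ?thesis using True by (simp add: cluster_def)
next
  case False
  let ?c = "cluster \<omega>"
  have new: "cluster (insert {u, v} \<omega>) x = (if ?c x = ?c u \<or> ?c x = ?c v then ?c u \<union> ?c v else ?c x)" for x
  proof -
    have "cluster (insert {u, v} \<omega>) x
        = ?c x \<union> (if linked \<omega> x u then ?c v else {}) \<union> (if linked \<omega> x v then ?c u else {})"
      by (auto simp: cluster_def linked_insert)
    moreover have "\<not> (linked \<omega> x u \<and> linked \<omega> x v)" using False linked_trans linked_sym by metis
    ultimately show ?thesis by (auto simp: cluster_eq_iff[of \<omega>] dest: cluster_eq_iff[THEN iffD2])
  qed
  have img: "cluster (insert {u, v} \<omega>) ` V = insert (?c u \<union> ?c v) (?c ` V - {?c u, ?c v})"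
    unfolding new using assms by auto
  have "?c u \<union> ?c v \<noteq> ?c x" if "?c x \<noteq> ?c u" for x
  proof
    assume "?c u \<union> ?c v = ?c x"
    then have "u \<in> ?c x" by (auto simp: cluster_def)
    then show False using that by (simp add: cluster_eq_iff) (simp add: cluster_def)
  qed
  then have notin: "?c u \<union> ?c v \<notin> ?c ` V - {?c u, ?c v}" by auto
  have "?c u \<noteq> ?c v" using False by (simp add: cluster_eq_iff)
  then have "card {?c u, ?c v} = 2" by simp
  moreover have "card {?c u, ?c v} \<le> card (?c ` V)" using assms by (intro card_mono) auto
  moreover have "card (?c ` V - {?c u, ?c v}) = card (?c ` V) - card {?c u, ?c v}"
    using assms by (intro card_Diff_subset) auto
  ultimately have "card (?c ` V - {?c u, ?c v}) = card (?c ` V) - 2" "card (?c ` V) \<ge> 2" by auto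
  then show ?thesis using False notin assms unfolding img by simp
qed

text \<open>A vertex without open edges is a cluster of its own and contributes a factor
  \<open>q\<close>. Dividing by one \<open>q\<close> per vertex leaves a weight that depends on the
  open edges alone, so that one function serves all boxes at once.\<close>

definition cluster_weight :: "real \<Rightarrow> 'v set set \<Rightarrow> real" where
  "cluster_weight q \<omega> = q ^ card (cluster \<omega> ` \<Union>\<omega>) / q ^ card (\<Union>\<omega>)"

lemma cluster_weight_eq:
  assumes "finite V" "\<Union>\<omega> \<subseteq> V" "0 < q"
  shows "q ^ card (cluster \<omega> ` V) = q ^ card V * cluster_weight q \<omega>"
proof -
  let ?U = "\<Union>\<omega>"
  have single: "cluster \<omega> x = {x}" if "x \<notin> ?U" for x
    using that linked_Union[of \<omega> x] by (auto simp: cluster_def)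
  have "cluster \<omega> ` V = cluster \<omega> ` ?U \<union> cluster \<omega> ` (V - ?U)" using assms by auto
  moreover have "cluster \<omega> ` ?U \<inter> cluster \<omega> ` (V - ?U) = {}"
  proof -
    have False if "x \<in> ?U" "y \<in> V - ?U" "cluster \<omega> x = cluster \<omega> y" for x y
      using that linked_Union[of \<omega> x y] unfolding cluster_eq_iff by auto
    then show ?thesis by blast
  qed
  moreover have "finite ?U" by (rule finite_subset[OF assms(2,1)])
  ultimately have "card (cluster \<omega> ` V) = card (cluster \<omega> ` ?U) + card (cluster \<omega> ` (V - ?U))"
    using assms by (simp add: card_Un_disjoint)
  also have "card (cluster \<omega> ` (V - ?U)) = card (V - ?U)"
    by (rule card_image) (auto simp: inj_on_def single)
  also have "\<dots> = card V - card ?U" using \<open>finite ?U\<close> assms by (simp add: card_Diff_subset)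
  finally have "card (cluster \<omega> ` V) + card ?U = card (cluster \<omega> ` ?U) + card V"
    using card_mono[OF assms(1,2)] by simp
  then have "q ^ card (cluster \<omega> ` V) * q ^ card ?U = q ^ card (cluster \<omega> ` ?U) * q ^ card V"
    by (metis power_add)
  then show ?thesis using assms by (simp add: cluster_weight_def field_simps)
qed

definition rc_weight :: "real \<Rightarrow> real \<Rightarrow> 'v set set \<Rightarrow> real" where
  "rc_weight r q \<omega> = r ^ card \<omega> * cluster_weight q \<omega>"

lemma rc_weight_pos: "0 < r \<Longrightarrow> 0 < q \<Longrightarrow> 0 < rc_weight r q \<omega>"
  by (simp add: rc_weight_def cluster_weight_def)

lemma rc_weight_insert:
  assumes "finite \<omega>" "finite (\<Union>\<omega>)" "{u, v} \<notin> \<omega>" "0 < q"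
  shows "rc_weight r q (insert {u, v} \<omega>) = rc_weight r q \<omega> * (r * (if linked \<omega> u v then 1 else 1 / q))"
proof -
  define V where "V = \<Union>(insert {u, v} \<omega>)"
  have V: "finite V" "\<Union>\<omega> \<subseteq> V" "\<Union>(insert {u, v} \<omega>) \<subseteq> V" "u \<in> V" "v \<in> V"
    using assms by (auto simp: V_def)
  have "q ^ card (cluster \<omega> ` V) = q ^ card (cluster (insert {u, v} \<omega>) ` V) * q ^ of_bool (\<not> linked \<omega> u v)"
    using card_cluster_insert[OF V(1,4,5), of \<omega>] by (simp add: power_add)
  then have "cluster_weight q \<omega> = cluster_weight q (insert {u, v} \<omega>) * q ^ of_bool (\<not> linked \<omega> u v)"
    using assms cluster_weight_eq[OF V(1,2)] cluster_weight_eq[OF V(1,3)] by simp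
  then show ?thesis using assms by (simp add: rc_weight_def field_simps)
qed

text \<open>A local criterion: the relative gain from adding one edge should grow with the
  configuration. Adding the edges of \<open>A - B\<close> one by one to \<open>A \<inter> B\<close>
  and to \<open>B\<close> multiplies these comparisons.\<close>

lemma log_supermodularI:
  assumes "finite E" and pos: "\<And>A. A \<subseteq> E \<Longrightarrow> 0 < w A"
    and ratio: "\<And>A B e. A \<subseteq> B \<Longrightarrow> B \<subseteq> E \<Longrightarrow> e \<in> E - B \<Longrightarrow> w (insert e A) * w B \<le> w A * w (insert e B)"
  shows "log_supermodular E w"
proof -
  have *: "w (C \<union> D) * w B \<le> w C * w (B \<union> D)"
    if "finite D" "D \<subseteq> E - B" "C \<subseteq> B" "B \<subseteq> E" for B C D
    using that
  proof (induction D rule: finite_induct)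
    case (insert e D)
    have sub: "C \<union> D \<subseteq> B \<union> D" "B \<union> D \<subseteq> E" "e \<in> E - (B \<union> D)" "C \<subseteq> E" "C \<union> D \<subseteq> E" "insert e (B \<union> D) \<subseteq> E"
      using insert by auto
    have p: "0 < w (C \<union> D)" "0 < w (B \<union> D)" "0 < w B" "0 < w C" "0 < w (insert e (B \<union> D))"
      using sub insert.prems by (auto intro!: pos)
    have "(w (insert e (C \<union> D)) * w (B \<union> D)) * (w (C \<union> D) * w B)
        \<le> (w (C \<union> D) * w (insert e (B \<union> D))) * (w C * w (B \<union> D))"
      using p insert.prems
      by (intro mult_mono[OF ratio[OF sub(1-3)] insert.IH]) (auto simp: less_imp_le)
    then have "(w (C \<union> D) * w (B \<union> D)) * (w (insert e (C \<union> D)) * w B)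
        \<le> (w (C \<union> D) * w (B \<union> D)) * (w C * w (insert e (B \<union> D)))"
      by (simp only: mult_ac)
    then have "w (insert e (C \<union> D)) * w B \<le> w C * w (insert e (B \<union> D))"
      using p by (subst (asm) mult_le_cancel_left_pos) auto
    then show ?case by simp
  qed simp
  have "w A * w B \<le> w (A \<inter> B) * w (A \<union> B)" if "A \<subseteq> E" "B \<subseteq> E" for A B
  proof -
    have "(A \<inter> B) \<union> (A - B) = A" "B \<union> (A - B) = A \<union> B" by auto
    then show ?thesis using *[of "A - B" B "A \<inter> B"] that finite_subset[OF _ assms(1)] by auto
  qed
  then show ?thesis using assms by (simp add: log_supermodular_def)
qed

definition pair_set :: "'v set set \<Rightarrow> bool" where
  "pair_set E \<longleftrightarrow> finite E \<and> (\<forall>e\<in>E. \<exists>u v. e = {u, v})"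

lemma pair_set_subset: "pair_set E \<Longrightarrow> F \<subseteq> E \<Longrightarrow> pair_set F"
  unfolding pair_set_def using finite_subset by blast

lemma pair_set_finite: "pair_set E \<Longrightarrow> finite E"
  by (simp add: pair_set_def)

lemma pair_set_finite_Union: "pair_set E \<Longrightarrow> finite (\<Union>E)"
  by (fastforce simp: pair_set_def)

lemma rc_weight_insert':
  assumes "pair_set E" "A \<subseteq> E" "{u, v} \<notin> A" "0 < q"
  shows "rc_weight r q (insert {u, v} A) = rc_weight r q A * (r * (if linked A u v then 1 else 1 / q))"
  using pair_set_subset[OF assms(1,2)] assms(3,4)
  by (intro rc_weight_insert pair_set_finite_Union pair_set_finite)

text \<open>Adding an edge multiplies the weight by \<open>r\<close> if its endpoints are already
  linked and by \<open>r / q\<close> otherwise. For \<open>q >= 1\<close> this gain is increasing,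
  because being linked is.\<close>

lemma log_supermodular_rc:
  assumes "pair_set E" "0 < r" "1 \<le> q"
  shows "log_supermodular E (rc_weight r q)"
proof (rule log_supermodularI)
  show "finite E" by (rule pair_set_finite[OF assms(1)])
  show "0 < rc_weight r q A" for A using assms by (intro rc_weight_pos) auto
  fix A B e assume A: "A \<subseteq> B" and B: "B \<subseteq> E" and e: "e \<in> E - B"
  obtain u v where uv: "e = {u, v}" using assms(1) e by (auto simp: pair_set_def)
  have "linked A u v \<Longrightarrow> linked B u v" using A by (rule linked_mono[rotated])
  then have le: "(if linked A u v then 1 else 1 / q) \<le> (if linked B u v then 1 else 1 / q)"
    using assms by auto
  have pos: "0 < rc_weight r q A" "0 < rc_weight r q B" using assms by (auto intro!: rc_weight_pos)
  have "rc_weight r q (insert e A) = rc_weight r q A * (r * (if linked A u v then 1 else 1 / q))"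
    "rc_weight r q (insert e B) = rc_weight r q B * (r * (if linked B u v then 1 else 1 / q))"
    unfolding uv using A B e assms(3) uv
    by (intro rc_weight_insert'[OF assms(1)]; auto)+
  then show "rc_weight r q (insert e A) * rc_weight r q B \<le> rc_weight r q A * rc_weight r q (insert e B)"
    using le pos assms by (auto simp: mult_ac intro!: mult_left_mono)
qed

lemma rc_weight_odds:
  assumes "pair_set E" "0 < r" "1 \<le> q" "e \<in> E" "A \<subseteq> E" "e \<notin> A"
  shows "r / q * rc_weight r q A \<le> rc_weight r q (insert e A)"
proof -
  obtain u v where uv: "e = {u, v}" using assms by (auto simp: pair_set_def)
  have "r / q * rc_weight r q A \<le> r * rc_weight r q A"
    using assms rc_weight_pos[of r q A] by (intro mult_right_mono) (auto simp: field_simps)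
  then show ?thesis
    using assms rc_weight_insert'[OF assms(1,5), of u v q r] unfolding uv by (auto simp: mult_ac)
qed

text \<open>The last inequality is the hypothesis of \<open>wavg_sprinkle\<close> for the odds bound
  \<open>r / q\<close> and the tilt \<open>t = r' / r\<close>.\<close>

definition sprinkle_ok :: "real \<Rightarrow> real \<Rightarrow> real \<Rightarrow> real \<Rightarrow> bool" where
  "sprinkle_ok q r r' s \<longleftrightarrow> 0 < s \<and> s < 1 \<and> 0 < r \<and> r < r' \<and> 1 + s * q / r \<le> (1 - s) * (r' / r)"

lemma sprinkle_ok_ex:
  assumes "0 < r" "r < r'" "1 \<le> q"
  obtains s where "sprinkle_ok q r r' s"
proof -
  \<comment> \<open>The requirement amounts to \<open>s * (q + r') <= r' - r\<close>.\<close>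
  define s where "s = (r' - r) / (q + r' + r)"
  have s: "0 < s" "s < 1" using assms by (auto simp: s_def)
  have "s * (q + r' + r) = r' - r" using assms by (simp add: s_def)
  moreover have "0 \<le> s * r" using s assms by simp
  ultimately have "r + s * q \<le> (1 - s) * r'" by (simp add: algebra_simps)
  then have "(r + s * q) / r \<le> (1 - s) * r' / r" using assms by (intro divide_right_mono) auto
  then show thesis using assms s by (intro that[of s]) (simp add: sprinkle_ok_def add_divide_distrib)
qed

theorem rc_sprinkle:
  assumes "pair_set E" "1 \<le> q" "sprinkle_ok q r r' s"
    and f: "mono_on (Pow E) f" "\<And>A. A \<subseteq> E \<Longrightarrow> 0 \<le> f A"
  shows "wavg E (rc_weight r q) (\<lambda>A. wavg E (bernoulli_weight s) (\<lambda>B. f (A \<union> B)))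
    \<le> wavg E (rc_weight r' q) f"
proof -
  have s: "0 < s" "s < 1" "0 < r" "r < r'" "1 + s / (r / q) \<le> (1 - s) * (r' / r)"
    using assms by (auto simp: sprinkle_ok_def)
  have "wavg E (rc_weight r q) (\<lambda>A. wavg E (bernoulli_weight s) (\<lambda>B. f (A \<union> B)))
      \<le> wavg E (\<lambda>A. rc_weight r q A * (r' / r) ^ card (A \<inter> E)) f"
    using s assms rc_weight_odds[OF assms(1) s(3) assms(2)]
    by (intro wavg_sprinkle[where odds = "r / q"] log_supermodular_rc) auto
  also have "\<dots> = wavg E (rc_weight r' q) f"
  proof -
    have "rc_weight r q A * (r' / r) ^ card (A \<inter> E) = rc_weight r' q A" if "A \<in> Pow E" for A
      using that s by (simp add: Int_absorb2 rc_weight_def power_divide)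
    then show ?thesis by (intro wavg_cong_weight) auto
  qed
  finally show ?thesis .
qed

text \<open>Finite energy: from \<open>E\<close> to \<open>insert e E\<close> the weight of the
  fully open configuration gains a factor of at least \<open>r / q\<close>, while the total weight
  grows by a factor of at most \<open>1 + r\<close>.\<close>

lemma rc_all_open:
  assumes "pair_set E" "0 < r" "1 \<le> q"
  shows "(r / (q * (1 + r))) ^ card E \<le> wavg E (rc_weight r q) (\<lambda>A. of_bool (E \<subseteq> A))"
  using pair_set_finite[OF assms(1)] assms(1)
proof (induction E rule: finite_induct)
  case empty
  then show ?case using rc_weight_pos[of r q "{} :: 'a set set"] assms by (simp add: wavg_def)
next
  case (insert e E)
  let ?w = "rc_weight r q"
  obtain u v where e: "e = {u, v}" using insert.prems by (auto simp: pair_set_def)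
  have pE: "pair_set E" using insert.prems by (rule pair_set_subset) auto
  have pos: "0 < ?w A" for A :: "'a set set" using assms by (intro rc_weight_pos) auto
  have up: "?w (insert e A) \<le> r * ?w A" if "A \<subseteq> E" for A
  proof -
    have "r * (if linked A u v then 1 else 1 / q) \<le> r" using assms by (auto simp: field_simps)
    then have "?w A * (r * (if linked A u v then 1 else 1 / q)) \<le> ?w A * r"
      using pos[of A] by (intro mult_left_mono) (auto simp: less_imp_le)
    moreover have "{u, v} \<notin> A" using that insert.hyps e by auto
    ultimately show ?thesis
      unfolding e using rc_weight_insert'[OF pE that, of u v q r] assms by (simp add: mult_ac)
  qed
  have "sum ?w (Pow (insert e E)) \<le> (\<Sum>A\<in>Pow E. ?w A + r * ?w A)"
    unfolding sum_Pow_insert[OF insert.hyps] using up by (intro sum_mono add_left_mono) auto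
  also have "\<dots> = (1 + r) * sum ?w (Pow E)"
    by (simp add: sum_distrib_left algebra_simps sum.distrib)
  finally have tot: "sum ?w (Pow (insert e E)) \<le> (1 + r) * sum ?w (Pow E)" .
  have top: "(\<Sum>A\<in>Pow F. ?w A * of_bool (F \<subseteq> A)) = ?w F" if "finite F" for F :: "'a set set"
  proof -
    have "(\<Sum>A\<in>Pow F. ?w A * of_bool (F \<subseteq> A)) = (\<Sum>A\<in>Pow F. if A = F then ?w A else 0)"
      by (intro sum.cong refl) auto
    then show ?thesis using that by simp
  qed
  have "(r / (q * (1 + r))) ^ card (insert e E) = r / (q * (1 + r)) * (r / (q * (1 + r))) ^ card E"
    using insert.hyps by simp
  also have "\<dots> \<le> r / (q * (1 + r)) * (?w E / sum ?w (Pow E))"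
    using insert.IH[OF pE] assms top[OF insert.hyps(1)] by (intro mult_left_mono) (auto simp: wavg_def)
  also have "\<dots> = (r / q * ?w E) / ((1 + r) * sum ?w (Pow E))" by simp
  also have "\<dots> \<le> ?w (insert e E) / sum ?w (Pow (insert e E))"
    using rc_weight_odds[OF insert.prems assms(2,3), of e E] insert.hyps tot pos
    by (intro frac_le sum_pos) (auto simp: less_imp_le)
  finally show ?case using top[of "insert e E"] insert.hyps by (simp add: wavg_def)
qed

lemma linked_image:
  assumes "inj f"
  shows "linked ((`) f ` \<omega>) (f x) z \<longleftrightarrow> (\<exists>y. z = f y \<and> linked \<omega> x y)"
proof
  show "linked ((`) f ` \<omega>) (f x) z \<Longrightarrow> \<exists>y. z = f y \<and> linked \<omega> x y"
  proof (induction rule: linked_induct)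
    case (step z z')
    obtain y where y: "z = f y" "linked \<omega> x y" using step.IH by blast
    obtain e where e: "{z, z'} = f ` e" "e \<in> \<omega>" using step.hyps by blast
    have "z' \<in> f ` e" using e(1) by blast
    then obtain y' where y': "z' = f y'" by blast
    have "f ` {y, y'} = f ` e" using e y y' by simp
    then have "{y, y'} = e" by (rule inj_image_eq_iff[OF assms, THEN iffD1])
    then have "linked \<omega> y y'" using e(2) by (intro linked_edge) simp
    then show ?case using y' linked_trans[OF y(2)] by auto
  qed auto
  have "linked \<omega> x y \<Longrightarrow> linked ((`) f ` \<omega>) (f x) (f y)" for y
  proof (induction rule: linked_induct)
    case (step y z)
    have "{f y, f z} \<in> (`) f ` \<omega>" using imageI[OF step.hyps(2), of "(`) f"] by simp
    then show ?case using linked_trans[OF step.IH linked_edge] by blast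
  qed simp
  then show "\<exists>y. z = f y \<and> linked \<omega> x y \<Longrightarrow> linked ((`) f ` \<omega>) (f x) z" by auto
qed

lemma linked_image_iff: "inj f \<Longrightarrow> linked ((`) f ` \<omega>) (f x) (f y) \<longleftrightarrow> linked \<omega> x y"
  by (auto simp: linked_image inj_eq)

lemma rc_weight_image:
  assumes "inj f" shows "rc_weight r q ((`) f ` \<omega>) = rc_weight r q \<omega>"
proof -
  have "cluster ((`) f ` \<omega>) (f x) = f ` cluster \<omega> x" for x
    using assms by (auto simp: cluster_def linked_image)
  then have "cluster ((`) f ` \<omega>) ` f ` V = (`) f ` cluster \<omega> ` V" for V
    by (simp add: image_image)
  moreover have "card ((`) f ` X) = card X" for X :: "'a set set"
    by (intro card_image inj_onI) (simp add: inj_image_eq_iff[OF assms])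
  moreover have "\<Union>((`) f ` \<omega>) = f ` \<Union>\<omega>" by auto
  moreover have "card (f ` X) = card X" for X using assms by (intro card_image inj_on_subset[OF assms]) simp
  ultimately show ?thesis by (simp add: rc_weight_def cluster_weight_def)
qed

lemma wavg_rc_image:
  assumes "inj f"
  shows "wavg ((`) f ` E) (rc_weight r q) g = wavg E (rc_weight r q) (\<lambda>\<omega>. g ((`) f ` \<omega>))"
proof -
  have inj: "inj_on ((`) ((`) f)) (Pow E)"
    by (intro inj_onI) (simp add: inj_image_eq_iff inj_def inj_image_eq_iff[OF assms])
  have pow: "Pow ((`) f ` E) = (`) ((`) f) ` Pow E" by (simp add: image_Pow_surj)
  show ?thesis unfolding wavg_def pow by (simp add: sum.reindex[OF inj] rc_weight_image[OF assms])
qed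

section \<open>Boxes of the lattice\<close>

text \<open>Corners that vanish from index \<open>d\<close> on pin the remaining coordinates to
  zero. Slabs, slices, cubes, tiles and faces of cubes are all boxes of this form, so connectedness
  is proved once for all of them.\<close>

definition ibox :: "vertex \<Rightarrow> vertex \<Rightarrow> vertex set" where
  "ibox lo hi = {x. \<forall>i. lo i \<le> x i \<and> x i \<le> hi i}"

definition neighbours :: "vertex \<Rightarrow> vertex \<Rightarrow> bool" where
  "neighbours x y \<longleftrightarrow> (\<exists>i. \<bar>x i - y i\<bar> = 1 \<and> (\<forall>j. j \<noteq> i \<longrightarrow> x j = y j))"

definition inner :: "vertex set \<Rightarrow> edge set" where
  "inner V = {{x, y} | x y. x \<in> V \<and> y \<in> V \<and> neighbours x y}"

definition shift :: "vertex \<Rightarrow> vertex \<Rightarrow> vertex" where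
  "shift z x = (\<lambda>i. z i + x i)"

lemma neighbours_sym: "neighbours x y \<Longrightarrow> neighbours y x"
  by (auto simp: neighbours_def abs_minus_commute)

lemma inner_mono: "V \<subseteq> V' \<Longrightarrow> inner V \<subseteq> inner V'"
  by (auto simp: inner_def)

lemma inner_edge_iff: "{x, y} \<in> inner V \<longleftrightarrow> x \<in> V \<and> y \<in> V \<and> neighbours x y"
  by (auto simp: inner_def doubleton_eq_iff dest: neighbours_sym)

lemma inner_disjoint: "V \<inter> V' = {} \<Longrightarrow> inner V \<inter> inner V' = {}"
  by (auto simp: inner_def doubleton_eq_iff)

lemma pair_set_inner: "finite V \<Longrightarrow> pair_set (inner V)"
proof -
  assume "finite V"
  then have "finite ((\<lambda>(x, y). {x, y}) ` (V \<times> V))" by simp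
  then have "finite (inner V)" by (rule rev_finite_subset) (auto simp: inner_def)
  then show ?thesis by (auto simp: pair_set_def inner_def)
qed

lemma finite_inner: "finite V \<Longrightarrow> finite (inner V)"
  using pair_set_inner pair_set_finite by blast

lemma linked_inner_mem: "linked \<omega> x y \<Longrightarrow> \<omega> \<subseteq> inner V \<Longrightarrow> x \<in> V \<Longrightarrow> y \<in> V"
  by (induction rule: linked_induct) (auto simp: inner_edge_iff)

lemma lattice_points_iff: "x \<in> lattice_points d \<longleftrightarrow> (\<forall>i\<ge>d. x i = 0)"
  by (simp add: lattice_points_def)

lemma ibox_subset_lattice:
  assumes "lo \<in> lattice_points d" "hi \<in> lattice_points d"
  shows "ibox lo hi \<subseteq> lattice_points d"
proof
  fix x assume "x \<in> ibox lo hi"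
  then have "lo i \<le> x i" "x i \<le> hi i" for i by (auto simp: ibox_def)
  then show "x \<in> lattice_points d" using assms unfolding lattice_points_iff by (metis antisym)
qed

lemma finite_ibox:
  assumes "lo \<in> lattice_points d" "hi \<in> lattice_points d"
  shows "finite (ibox lo hi)"
proof (rule finite_subset)
  show "finite {x :: vertex. \<forall>i. (i \<in> {..<d} \<longrightarrow> x i \<in> (\<Union>i<d. {lo i..hi i})) \<and> (i \<notin> {..<d} \<longrightarrow> x i = 0)}"
    by (intro finite_set_of_finite_funs) auto
  show "ibox lo hi \<subseteq> {x. \<forall>i. (i \<in> {..<d} \<longrightarrow> x i \<in> (\<Union>i<d. {lo i..hi i})) \<and> (i \<notin> {..<d} \<longrightarrow> x i = 0)}"
    using ibox_subset_lattice[OF assms] by (auto simp: ibox_def lattice_points_iff)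
qed

text \<open>Induction on the l1 distance: one differing coordinate is moved a unit step towards
  \<open>y\<close>, which stays in the box. The bound on the number of edges later bounds the cost
  of opening the path.\<close>

lemma ibox_path:
  assumes "x \<in> ibox lo hi" "y \<in> ibox lo hi" "\<And>i. i \<ge> d \<Longrightarrow> x i = y i"
  shows "\<exists>\<pi>. \<pi> \<subseteq> inner (ibox lo hi) \<and> finite \<pi> \<and> card \<pi> \<le> (\<Sum>i<d. nat \<bar>x i - y i\<bar>) \<and> linked \<pi> x y"
  using assms
proof (induction "\<Sum>i<d. nat \<bar>x i - y i\<bar>" arbitrary: x)
  case 0
  then have "x i = y i" for i by (cases "i < d") auto
  then have "x = y" by auto
  then show ?case by (intro exI[of _ "{}"]) auto
next
  case (Suc n)
  obtain i where i: "i < d" "x i \<noteq> y i"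
  proof (rule ccontr)
    assume "\<not> thesis"
    then have "\<And>i. i < d \<Longrightarrow> x i = y i" using that by blast
    then show False using Suc.hyps(2) by simp
  qed
  define x' where "x' = x(i := x i + sgn (y i - x i))"
  have box: "x' \<in> ibox lo hi"
    unfolding ibox_def
  proof safe
    fix j
    have "lo j \<le> x j" "x j \<le> hi j" "lo j \<le> y j" "y j \<le> hi j" using Suc.prems by (auto simp: ibox_def)
    then show "lo j \<le> x' j" "x' j \<le> hi j" using i by (auto simp: x'_def sgn_if)
  qed
  have "(\<Sum>i<d. nat \<bar>x i - y i\<bar>) = nat \<bar>x i - y i\<bar> + (\<Sum>i\<in>{..<d} - {i}. nat \<bar>x i - y i\<bar>)"
    using i by (intro sum.remove) auto
  moreover have "(\<Sum>i<d. nat \<bar>x' i - y i\<bar>) = nat \<bar>x' i - y i\<bar> + (\<Sum>i\<in>{..<d} - {i}. nat \<bar>x' i - y i\<bar>)"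
    using i by (intro sum.remove) auto
  moreover have "(\<Sum>i\<in>{..<d} - {i}. nat \<bar>x' i - y i\<bar>) = (\<Sum>i\<in>{..<d} - {i}. nat \<bar>x i - y i\<bar>)"
    by (intro sum.cong) (auto simp: x'_def)
  moreover have "nat \<bar>x i - y i\<bar> = Suc (nat \<bar>x' i - y i\<bar>)" using i by (auto simp: x'_def sgn_if)
  ultimately have n: "n = (\<Sum>i<d. nat \<bar>x' i - y i\<bar>)" using Suc.hyps(2) by simp
  obtain \<pi> where \<pi>: "\<pi> \<subseteq> inner (ibox lo hi)" "finite \<pi>" "card \<pi> \<le> n" "linked \<pi> x' y"
    using Suc.hyps(1)[OF n box Suc.prems(2)] Suc.prems(3) i n by (auto simp: x'_def)
  have nb: "neighbours x x'" using i by (auto simp: neighbours_def x'_def sgn_if intro!: exI[of _ i])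
  have "linked (insert {x, x'} \<pi>) x x'" by (rule linked_edge) simp
  also have "linked (insert {x, x'} \<pi>) x' y" by (rule linked_mono[OF \<pi>(4)]) auto
  finally have "linked (insert {x, x'} \<pi>) x y" .
  moreover have "card (insert {x, x'} \<pi>) \<le> Suc n" using \<pi> by (simp add: card_insert_if)
  moreover have "insert {x, x'} \<pi> \<subseteq> inner (ibox lo hi)"
    using \<pi> nb box Suc.prems(1) by (auto simp: inner_edge_iff)
  ultimately show ?case using \<pi>(2) Suc.hyps(2) by (intro exI[of _ "insert {x, x'} \<pi>"]) auto
qed

lemma linked_ibox:
  assumes "x \<in> ibox lo hi" "y \<in> ibox lo hi" "x \<in> lattice_points d" "y \<in> lattice_points d"
  shows "linked (inner (ibox lo hi)) x y"
  using ibox_path[OF assms(1,2), of d] assms(3,4) linked_mono by (fastforce simp: lattice_points_iff)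

lemma inj_shift: "inj (shift z)"
  by (auto simp: inj_def shift_def fun_eq_iff)

lemma shift_neg: "shift z (shift (\<lambda>i. - z i) x) = x" "shift (\<lambda>i. - z i) (shift z x) = x"
  by (simp_all add: shift_def)

lemma shift_image_iff: "x \<in> shift z ` V \<longleftrightarrow> shift (\<lambda>i. - z i) x \<in> V"
  by (metis image_iff shift_neg)

lemma shift_ibox: "shift z ` ibox lo hi = ibox (shift z lo) (shift z hi)"
  by (auto simp: set_eq_iff shift_image_iff) (simp_all add: ibox_def shift_def algebra_simps)

lemma neighbours_shift: "neighbours (shift z x) (shift z y) \<longleftrightarrow> neighbours x y"
  by (simp add: neighbours_def shift_def)

lemma inner_shift: "inner (shift z ` V) = (`) (shift z) ` inner V"
proof (intro set_eqI iffI)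
  fix e assume "e \<in> inner (shift z ` V)"
  then obtain x y where "e = {shift z x, shift z y}" "x \<in> V" "y \<in> V" "neighbours (shift z x) (shift z y)"
    unfolding inner_def by blast
  then show "e \<in> (`) (shift z) ` inner V"
    by (intro image_eqI[of _ _ "{x, y}"]) (simp_all add: inner_edge_iff neighbours_shift)
next
  fix e assume "e \<in> (`) (shift z) ` inner V"
  then obtain x y where "e = shift z ` {x, y}" "x \<in> V" "y \<in> V" "neighbours x y"
    unfolding inner_def by blast
  then have "e = {shift z x, shift z y}" "{shift z x, shift z y} \<in> inner (shift z ` V)"
    unfolding inner_edge_iff by (simp_all add: neighbours_shift)
  then show "e \<in> inner (shift z ` V)" by simp
qed

section \<open>Disconnection probabilities in a finite set of vertices\<close>

definition meets :: "edge set \<Rightarrow> vertex set \<Rightarrow> vertex set \<Rightarrow> bool" where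
  "meets \<omega> A B \<longleftrightarrow> (\<exists>a\<in>A. \<exists>b\<in>B. linked \<omega> a b)"

lemma meets_mono: "meets \<omega> A B \<Longrightarrow> \<omega> \<subseteq> \<omega>' \<Longrightarrow> A \<subseteq> A' \<Longrightarrow> B \<subseteq> B' \<Longrightarrow> meets \<omega>' A' B'"
  unfolding meets_def using linked_mono[of \<omega> _ _ \<omega>'] by (meson subsetD)

lemma meets_shift: "meets ((`) (shift z) ` \<omega>) (shift z ` A) (shift z ` B) \<longleftrightarrow> meets \<omega> A B"
  by (simp add: meets_def linked_image_iff[OF inj_shift])

text \<open>Disconnection is the basic quantity because the product bounds hold for decreasing
  events. Only edges with both endpoints in \<open>V\<close> occur; for boxes,
  \<open>free_disconnect_prob_eq\<close> recovers the probability under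
  \<open>fk_free\<close>.\<close>

definition rc_disc :: "real \<Rightarrow> real \<Rightarrow> vertex set \<Rightarrow> vertex set \<Rightarrow> vertex set \<Rightarrow> real" where
  "rc_disc r q V A B = wavg (inner V) (rc_weight r q) (\<lambda>\<omega>. of_bool (\<not> meets \<omega> A B))"

lemma antimono_not_meets: "antimono_on X (\<lambda>\<omega>. of_bool (\<not> meets \<omega> A B) :: real)"
  by (intro monotone_onI) (auto dest: meets_mono)

lemma log_supermodular_inner:
  "finite V \<Longrightarrow> 0 < r \<Longrightarrow> 1 \<le> q \<Longrightarrow> log_supermodular (inner V) (rc_weight r q)"
  by (intro log_supermodular_rc pair_set_inner)

lemma rc_disc_mono:
  assumes "finite V'" "V \<subseteq> V'" "A \<subseteq> A'" "B \<subseteq> B'" "0 < r" "1 \<le> q"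
  shows "rc_disc r q V' A' B' \<le> rc_disc r q V A B"
proof -
  note lsm = log_supermodular_inner[OF assms(1,5,6)]
  have "rc_disc r q V' A' B' \<le> wavg (inner V') (rc_weight r q) (\<lambda>\<omega>. of_bool (\<not> meets (\<omega> \<inter> inner V) A B))"
    unfolding rc_disc_def by (rule wavg_mono[OF lsm]) (auto dest: meets_mono[OF _ Int_lower1 assms(3,4)])
  also have "\<dots> \<le> rc_disc r q V A B"
    unfolding rc_disc_def
    by (rule wavg_restrict_antimono[OF lsm inner_mono[OF assms(2)] antimono_not_meets]) simp
  finally show ?thesis .
qed

lemma rc_disc_shift: "rc_disc r q (shift z ` V) (shift z ` A) (shift z ` B) = rc_disc r q V A B"
  unfolding rc_disc_def inner_shift wavg_rc_image[OF inj_shift] meets_shift ..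

lemma rc_disc_nonneg: "finite V \<Longrightarrow> 0 < r \<Longrightarrow> 1 \<le> q \<Longrightarrow> 0 \<le> rc_disc r q V A B"
  unfolding rc_disc_def by (intro wavg_nonneg log_supermodular_inner) auto

lemma rc_conn_eq:
  "finite V \<Longrightarrow> 0 < r \<Longrightarrow> 1 \<le> q \<Longrightarrow>
    wavg (inner V) (rc_weight r q) (\<lambda>\<omega>. of_bool (meets \<omega> A B)) = 1 - rc_disc r q V A B"
  unfolding rc_disc_def by (subst wavg_compl[OF log_supermodular_inner]) auto

section \<open>The free measures of the statement\<close>

lemma lattice_edges_iff:
  "e \<in> lattice_edges d \<longleftrightarrow>
    (\<exists>x y. e = {x, y} \<and> x \<in> lattice_points d \<and> y \<in> lattice_points d \<and> neighbours x y)"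
proof -
  have "(\<Sum>i<d. \<bar>x i - y i\<bar>) = 1 \<longleftrightarrow> neighbours x y"
    if xy: "x \<in> lattice_points d" "y \<in> lattice_points d" for x y :: vertex
  proof -
    have "(\<Sum>i<d. \<bar>x i - y i\<bar>) = int (\<Sum>i<d. nat \<bar>x i - y i\<bar>)" by simp
    then have "(\<Sum>i<d. \<bar>x i - y i\<bar>) = 1 \<longleftrightarrow> (\<Sum>i<d. nat \<bar>x i - y i\<bar>) = 1" by linarith
    also have "\<dots> \<longleftrightarrow> (\<exists>i\<in>{..<d}. nat \<bar>x i - y i\<bar> = 1 \<and> (\<forall>j\<in>{..<d}. i \<noteq> j \<longrightarrow> nat \<bar>x j - y j\<bar> = 0))"
      by (rule sum_eq_1_iff) simp
    also have "\<dots> \<longleftrightarrow> neighbours x y"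
    proof
      assume "\<exists>i\<in>{..<d}. nat \<bar>x i - y i\<bar> = 1 \<and> (\<forall>j\<in>{..<d}. i \<noteq> j \<longrightarrow> nat \<bar>x j - y j\<bar> = 0)"
      then obtain i where i: "i < d" "\<bar>x i - y i\<bar> = 1" "\<And>j. j < d \<Longrightarrow> i \<noteq> j \<Longrightarrow> x j = y j" by auto
      moreover have "x j = y j" if "j \<ge> d" for j using xy that by (simp add: lattice_points_iff)
      ultimately show "neighbours x y" unfolding neighbours_def by (metis leI)
    next
      assume "neighbours x y"
      then obtain i where i: "\<bar>x i - y i\<bar> = 1" "\<And>j. j \<noteq> i \<Longrightarrow> x j = y j" by (auto simp: neighbours_def)
      moreover have "i < d"
      proof (rule ccontr)
        assume "\<not> i < d"
        then show False using i(1) xy by (simp add: lattice_points_iff)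
      qed
      ultimately show "\<exists>i\<in>{..<d}. nat \<bar>x i - y i\<bar> = 1 \<and> (\<forall>j\<in>{..<d}. i \<noteq> j \<longrightarrow> nat \<bar>x j - y j\<bar> = 0)"
        by (intro bexI[of _ i]) auto
    qed
    finally show ?thesis .
  qed
  then show ?thesis unfolding lattice_edges_def by blast
qed

lemma measure_point_measure_real:
  assumes "finite A" "X \<subseteq> A" "\<And>x. x \<in> A \<Longrightarrow> 0 \<le> f x"
  shows "measure (point_measure A (\<lambda>x. ennreal (f x))) X = (\<Sum>x\<in>X. f x)"
proof -
  have "emeasure (point_measure A (\<lambda>x. ennreal (f x))) X = (\<Sum>x\<in>X. ennreal (f x))"
    using assms by (intro emeasure_point_measure_finite) auto
  also have "\<dots> = ennreal (\<Sum>x\<in>X. f x)" using assms by (intro sum_ennreal) auto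
  finally show ?thesis using assms by (subst measure_def) (auto intro!: enn2real_ennreal sum_nonneg)
qed

lemma finite_edges_meeting:
  assumes "finite \<Lambda>" "\<Lambda> \<subseteq> lattice_points d"
  shows "finite (edges_meeting d \<Lambda>)"
proof -
  let ?N = "(\<lambda>(x :: vertex, i, s :: int). {x, x(i := x i + s)}) ` (\<Lambda> \<times> {..<d} \<times> {- 1, 1})"
  have "edges_meeting d \<Lambda> \<subseteq> ?N"
  proof
    fix e assume "e \<in> edges_meeting d \<Lambda>"
    then obtain x y where e: "e = {x, y}" "x \<in> \<Lambda>" "neighbours x y" "x \<in> lattice_points d" "y \<in> lattice_points d"
      unfolding edges_meeting_def lattice_edges_iff by (auto dest: neighbours_sym)
    then obtain i where i: "\<bar>x i - y i\<bar> = 1" "\<And>j. j \<noteq> i \<Longrightarrow> x j = y j" by (auto simp: neighbours_def)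
    have "i < d"
    proof (rule ccontr)
      assume "\<not> i < d"
      then show False using i(1) e(4,5) by (simp add: lattice_points_iff)
    qed
    moreover have "y = x(i := x i + (y i - x i))" using i(2) by (auto simp: fun_eq_iff)
    moreover have "y i - x i \<in> {- 1, 1}" using i(1) by auto
    ultimately show "e \<in> ?N" using e by (intro image_eqI[of _ _ "(x, i, y i - x i)"]) auto
  qed
  moreover have "finite ?N" using assms by auto
  ultimately show ?thesis by (rule finite_subset)
qed

lemma free_prob_eq:
  assumes "finite \<Lambda>" "\<Lambda> \<subseteq> lattice_points d" "0 \<le> p" "p \<le> 1" "1 \<le> q"
  shows "measure (fk_free d \<Lambda> p q) {\<omega> \<in> space (fk_free d \<Lambda> p q). Q \<omega>}
    = (\<Sum>\<omega>\<in>Pow (edges_meeting d \<Lambda>). fk_weight d \<Lambda> p q {} \<omega> * of_bool (Q \<omega>)) / fk_partition d \<Lambda> p q {}"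
proof -
  let ?E = "edges_meeting d \<Lambda>"
  have fin: "finite (Pow ?E)" using finite_edges_meeting assms by simp
  have nn: "0 \<le> fk_weight d \<Lambda> p q {} \<omega>" for \<omega> using assms by (simp add: fk_weight_def)
  have "measure (fk_free d \<Lambda> p q) {\<omega> \<in> space (fk_free d \<Lambda> p q). Q \<omega>}
      = (\<Sum>\<omega>\<in>{\<omega> \<in> Pow ?E. Q \<omega>}. fk_weight d \<Lambda> p q {} \<omega> / fk_partition d \<Lambda> p q {})"
    unfolding fk_measure_def space_point_measure
    by (rule measure_point_measure_real[OF fin])
      (auto simp: fk_partition_def intro!: divide_nonneg_nonneg sum_nonneg nn)
  also have "\<dots> = (\<Sum>\<omega>\<in>Pow ?E. fk_weight d \<Lambda> p q {} \<omega> * of_bool (Q \<omega>) / fk_partition d \<Lambda> p q {})"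
    using fin by (intro sum.mono_neutral_cong_left) auto
  finally show ?thesis by (simp add: sum_divide_distrib)
qed

lemma lattice_edges_closed:
  "linked \<omega> x y \<Longrightarrow> \<omega> \<subseteq> lattice_edges d \<Longrightarrow> x \<in> lattice_points d \<Longrightarrow> y \<in> lattice_points d"
proof (induction rule: linked_induct)
  case (step y z)
  then have "{y, z} \<in> lattice_edges d" by auto
  then show ?case by (auto simp: lattice_edges_iff doubleton_eq_iff)
qed auto

lemma open_path_rel_iff:
  "(x, y) \<in> open_path_rel d \<omega> \<longleftrightarrow> x \<in> lattice_points d \<and> y \<in> lattice_points d \<and> linked \<omega> x y"
  by (auto simp: open_path_rel_def linked_def)

lemma connected_to_iff:
  "A \<subseteq> lattice_points d \<Longrightarrow> B \<subseteq> lattice_points d \<Longrightarrow> connected_to d \<omega> A B \<longleftrightarrow> meets \<omega> A B"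
  by (auto simp: connected_to_def meets_def open_path_rel_iff)

lemma card_image_eq_kernel:
  assumes "\<And>x y. x \<in> V \<Longrightarrow> y \<in> V \<Longrightarrow> f x = f y \<longleftrightarrow> g x = g y"
  shows "card (f ` V) = card (g ` V)"
proof (rule bij_betw_same_card)
  show "bij_betw (\<lambda>z. g (inv_into V f z)) (f ` V) (g ` V)"
    unfolding bij_betw_def
  proof
    have inv: "g (inv_into V f (f x)) = g x" if "x \<in> V" for x
    proof -
      have "inv_into V f (f x) \<in> V" "f (inv_into V f (f x)) = f x" using that
        by (auto intro: inv_into_into f_inv_into_f)
      then show ?thesis using assms that by blast
    qed
    show "inj_on (\<lambda>z. g (inv_into V f z)) (f ` V)"
      using inv assms by (auto intro!: inj_onI)
    show "(\<lambda>z. g (inv_into V f z)) ` f ` V = g ` V" using inv by (auto simp: image_image)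
  qed
qed

context
  fixes d :: nat and lo hi :: vertex and \<Lambda> :: "vertex set"
  assumes lohi: "lo \<in> lattice_points d" "hi \<in> lattice_points d" and \<Lambda>: "\<Lambda> = ibox lo hi"
begin

lemma finite_box: "finite \<Lambda>" and box_lattice: "\<Lambda> \<subseteq> lattice_points d"
  using lohi finite_ibox ibox_subset_lattice by (auto simp: \<Lambda>)

lemma inner_subset_meeting: "inner \<Lambda> \<subseteq> edges_meeting d \<Lambda>"
  using box_lattice by (fastforce simp: edges_meeting_def lattice_edges_iff inner_def)

text \<open>An endpoint outside the box hangs off a single vertex of the box, to which clamping the
  coordinates sends it.\<close>

lemma linked_inner_iff:
  assumes "\<omega> \<subseteq> edges_meeting d \<Lambda>" "x \<in> \<Lambda>" "y \<in> \<Lambda>"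
  shows "linked \<omega> x y \<longleftrightarrow> linked (\<omega> \<inter> inner \<Lambda>) x y"
proof
  define clamp where "clamp x = (\<lambda>i. max (lo i) (min (hi i) (x i :: int)))" for x :: vertex
  have lh: "lo i \<le> hi i" for i using assms(2) unfolding \<Lambda> ibox_def by (auto intro: order_trans)
  have clamp_id: "clamp y = y" if "y \<in> \<Lambda>" for y
  proof
    fix i
    have "lo i \<le> y i" "y i \<le> hi i" using that by (auto simp: \<Lambda> ibox_def)
    then show "clamp y i = y i" by (simp add: clamp_def)
  qed
  have clamp_out: "clamp z = y" if yz: "y \<in> \<Lambda>" "z \<notin> \<Lambda>" "neighbours y z" for y z
  proof -
    obtain i where i: "\<bar>y i - z i\<bar> = 1" "\<And>j. j \<noteq> i \<Longrightarrow> y j = z j" using yz by (auto simp: neighbours_def)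
    have y: "lo j \<le> y j" "y j \<le> hi j" for j using that by (auto simp: \<Lambda> ibox_def)
    obtain k where k: "z k < lo k \<or> hi k < z k" using yz by (auto simp: \<Lambda> ibox_def not_le)
    then have "k = i" using i(2)[of k] y[of k] by (cases "k = i") auto
    show ?thesis
    proof
      fix j show "clamp z j = y j"
        using i k y[of j] lh[of j] \<open>k = i\<close> by (cases "j = i") (auto simp: clamp_def)
    qed
  qed
  have "linked \<omega> x y \<Longrightarrow> linked (\<omega> \<inter> inner \<Lambda>) x (clamp y)" for y
  proof (induction rule: linked_induct)
    case refl
    then show ?case using clamp_id assms by simp
  next
    case (step y z)
    then have e: "{y, z} \<in> edges_meeting d \<Lambda>" using assms by auto
    then have nb: "neighbours y z"
      by (auto simp: edges_meeting_def lattice_edges_iff doubleton_eq_iff dest: neighbours_sym)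
    consider "y \<in> \<Lambda>" "z \<in> \<Lambda>" | "y \<in> \<Lambda>" "z \<notin> \<Lambda>" | "y \<notin> \<Lambda>" "z \<in> \<Lambda>"
      using e by (auto simp: edges_meeting_def)
    then show ?case
    proof cases
      case 1
      then have "linked (\<omega> \<inter> inner \<Lambda>) y z"
        using nb step.hyps by (intro linked_edge) (auto simp: inner_edge_iff)
      then show ?thesis using linked_trans[OF step.IH] 1 by (simp add: clamp_id)
    next
      case 2
      then show ?thesis using step.IH clamp_out[OF 2 nb] clamp_id by simp
    next
      case 3
      then show ?thesis using step.IH clamp_out[OF 3(2,1) neighbours_sym[OF nb]] clamp_id by simp
    qed
  qed
  then show "linked \<omega> x y \<Longrightarrow> linked (\<omega> \<inter> inner \<Lambda>) x y" using clamp_id assms by metis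
qed (rule linked_mono, auto)

lemma cluster_count_eq:
  assumes "\<omega> \<subseteq> edges_meeting d \<Lambda>"
  shows "cluster_count d \<Lambda> {} \<omega> = card (cluster (\<omega> \<inter> inner \<Lambda>) ` \<Lambda>)"
proof -
  let ?C = "\<lambda>x. open_path_rel d \<omega> `` {x}"
  have edges: "\<omega> \<subseteq> lattice_edges d" using assms by (auto simp: edges_meeting_def)
  have C: "?C x = cluster \<omega> x" if "x \<in> lattice_points d" for x
    using that lattice_edges_closed[OF _ edges that] by (auto simp: open_path_rel_iff cluster_def)
  have "{K \<in> clusters d \<omega>. K \<inter> \<Lambda> \<noteq> {}} = cluster \<omega> ` \<Lambda>"
  proof (intro set_eqI iffI)
    fix K assume "K \<in> {K \<in> clusters d \<omega>. K \<inter> \<Lambda> \<noteq> {}}"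
    then obtain x y where x: "x \<in> lattice_points d" "K = cluster \<omega> x" and y: "y \<in> \<Lambda>" "y \<in> K"
      using C by (auto simp: clusters_def quotient_def)
    then have "K = cluster \<omega> y" by (simp add: cluster_eq_iff) (simp add: cluster_def)
    then show "K \<in> cluster \<omega> ` \<Lambda>" using y by simp
  next
    fix K assume "K \<in> cluster \<omega> ` \<Lambda>"
    then obtain y where y: "y \<in> \<Lambda>" "K = cluster \<omega> y" by auto
    then have "K = ?C y" "y \<in> K" using C box_lattice by (auto simp: cluster_def)
    then show "K \<in> {K \<in> clusters d \<omega>. K \<inter> \<Lambda> \<noteq> {}}"
      using y box_lattice by (auto simp: clusters_def quotient_def)
  qed
  then show ?thesis
    unfolding cluster_count_def using linked_inner_iff[OF assms]
    by (simp add: card_image_eq_kernel[of \<Lambda> "cluster \<omega>" "cluster (\<omega> \<inter> inner \<Lambda>)"] cluster_eq_iff)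
qed

text \<open>Edges leaving the box hang off it and never merge two of its clusters. They carry only a
  factor \<open>r\<close> each when open, and their total contribution cancels between numerator and
  denominator.\<close>

lemma free_prob_wavg:
  assumes p: "0 < p" "p < 1" and q: "1 \<le> q" and Q: "\<And>\<omega>. \<omega> \<subseteq> edges_meeting d \<Lambda> \<Longrightarrow> Q \<omega> \<longleftrightarrow> Q (\<omega> \<inter> inner \<Lambda>)"
  shows "measure (fk_free d \<Lambda> p q) {\<omega> \<in> space (fk_free d \<Lambda> p q). Q \<omega>}
    = wavg (inner \<Lambda>) (rc_weight (p / (1 - p)) q) (\<lambda>\<omega>. of_bool (Q \<omega>))"
proof -
  define E I P where "E = edges_meeting d \<Lambda>" and "I = inner \<Lambda>" and "P = E - I"
  define r where "r = p / (1 - p)"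
  \<comment> \<open>The factor left over after \<open>p ^ o * (1 - p) ^ c\<close> is written in
    terms of the odds and the factor \<open>q\<close> per vertex, which
    \<open>cluster_weight\<close> divides out, is restored.\<close>
  define c where "c = (1 - p) ^ card E * q ^ card \<Lambda>"
  have finE: "finite E" using finite_edges_meeting[OF finite_box box_lattice] by (simp add: E_def)
  have IP: "I \<union> P = E" "I \<inter> P = {}" "finite I" "finite P"
    using inner_subset_meeting finE finite_subset by (auto simp: E_def I_def P_def)
  have c: "0 < c" using p q by (simp add: c_def)
  have weight: "fk_weight d \<Lambda> p q {} (A \<union> B) = c * (r ^ card B * rc_weight r q A)"
    if AB: "A \<in> Pow I" "B \<in> Pow P" for A B
  proof -
    have fin: "finite A" "finite B" and sub: "A \<union> B \<subseteq> E" "A \<inter> B = {}" "(A \<union> B) \<inter> I = A"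
      using AB IP finite_subset by auto
    have card: "card (A \<union> B) = card A + card B" using fin sub by (simp add: card_Un_disjoint)
    have "card (E - (A \<union> B)) + card (A \<union> B) = card E"
      using sub finE by (metis card_Diff_subset card_mono finite_subset le_add_diff_inverse2)
    then have "(1 - p) ^ card (E - (A \<union> B)) * (1 - p) ^ card (A \<union> B) = (1 - p) ^ card E"
      by (metis power_add)
    then have "p ^ card (A \<union> B) * (1 - p) ^ card (E - (A \<union> B)) = (1 - p) ^ card E * r ^ card (A \<union> B)"
      using p by (simp add: r_def power_divide field_simps)
    moreover have "q ^ cluster_count d \<Lambda> {} (A \<union> B) = q ^ card \<Lambda> * cluster_weight q A"
    proof -
      have "\<Union>A \<subseteq> \<Lambda>" using AB by (fastforce simp: I_def inner_def)
      then show ?thesis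
        using cluster_count_eq[of "A \<union> B"] sub q cluster_weight_eq[OF finite_box, of A q]
        by (simp add: E_def I_def)
    qed
    ultimately show ?thesis
      by (simp add: fk_weight_def E_def[symmetric] c_def rc_weight_def card power_add)
  qed
  have tot: "(\<Sum>\<omega>\<in>Pow E. fk_weight d \<Lambda> p q {} \<omega> * f (\<omega> \<inter> I))
      = c * (\<Sum>B\<in>Pow P. r ^ card B) * (\<Sum>A\<in>Pow I. rc_weight r q A * f A)" for f :: "edge set \<Rightarrow> real"
  proof -
    have "(\<Sum>\<omega>\<in>Pow E. fk_weight d \<Lambda> p q {} \<omega> * f (\<omega> \<inter> I))
        = (\<Sum>B\<in>Pow P. \<Sum>A\<in>Pow I. fk_weight d \<Lambda> p q {} (A \<union> B) * f ((A \<union> B) \<inter> I))"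
      using sum_Pow_Un[OF IP(3,4,2), of "\<lambda>\<omega>. fk_weight d \<Lambda> p q {} \<omega> * f (\<omega> \<inter> I)"] IP(1) by simp
    also have "\<dots> = (\<Sum>B\<in>Pow P. \<Sum>A\<in>Pow I. (c * r ^ card B) * (rc_weight r q A * f A))"
    proof (intro sum.cong refl)
      fix A B assume AB: "B \<in> Pow P" "A \<in> Pow I"
      then have "(A \<union> B) \<inter> I = A" using IP by auto
      then show "fk_weight d \<Lambda> p q {} (A \<union> B) * f ((A \<union> B) \<inter> I) = c * r ^ card B * (rc_weight r q A * f A)"
        using weight[OF AB(2,1)] by simp
    qed
    also have "\<dots> = (\<Sum>B\<in>Pow P. c * r ^ card B) * (\<Sum>A\<in>Pow I. rc_weight r q A * f A)"
      by (rule sum_product[symmetric])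
    also have "(\<Sum>B\<in>Pow P. c * r ^ card B) = c * (\<Sum>B\<in>Pow P. r ^ card B)"
      by (rule sum_distrib_left[symmetric])
    finally show ?thesis .
  qed
  have pos: "0 < (\<Sum>B\<in>Pow P. r ^ card B)" using p IP by (intro sum_pos) (auto simp: r_def)
  have "measure (fk_free d \<Lambda> p q) {\<omega> \<in> space (fk_free d \<Lambda> p q). Q \<omega>}
      = (\<Sum>\<omega>\<in>Pow E. fk_weight d \<Lambda> p q {} \<omega> * of_bool (Q (\<omega> \<inter> I))) / (\<Sum>\<omega>\<in>Pow E. fk_weight d \<Lambda> p q {} \<omega>)"
    using free_prob_eq[OF finite_box box_lattice, of p q Q] p q Q
    by (simp add: fk_partition_def E_def[symmetric] I_def[symmetric] cong: sum.cong) (simp add: E_def I_def)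
  also have "\<dots> = wavg I (rc_weight r q) (\<lambda>\<omega>. of_bool (Q \<omega>))"
    using tot[of "\<lambda>\<omega>. of_bool (Q \<omega>)"] tot[of "\<lambda>_. 1"] c pos by (simp add: wavg_def)
  finally show ?thesis by (simp add: I_def r_def)
qed

lemma meets_inner_iff:
  assumes "\<omega> \<subseteq> edges_meeting d \<Lambda>" "A \<subseteq> \<Lambda>" "B \<subseteq> \<Lambda>"
  shows "meets \<omega> A B \<longleftrightarrow> meets (\<omega> \<inter> inner \<Lambda>) A B"
  unfolding meets_def using assms(2,3) by (intro bex_cong refl linked_inner_iff[OF assms(1)]) auto

lemma free_disconnect_prob_eq:
  assumes "0 < p" "p < 1" "1 \<le> q" "A \<subseteq> \<Lambda>" "B \<subseteq> \<Lambda>"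
  shows "free_disconnect_prob d \<Lambda> p q A B = rc_disc (p / (1 - p)) q \<Lambda> A B"
proof -
  have lat: "A \<subseteq> lattice_points d" "B \<subseteq> lattice_points d" using assms box_lattice by auto
  show ?thesis
    unfolding free_disconnect_prob_def rc_disc_def connected_to_iff[OF lat]
    by (rule free_prob_wavg[OF assms(1-3), where Q = "\<lambda>\<omega>. \<not> meets \<omega> A B"])
      (simp add: meets_inner_iff[OF _ assms(4,5), symmetric])
qed

lemma free_connect_prob_eq:
  assumes "0 < p" "p < 1" "1 \<le> q" "A \<subseteq> \<Lambda>" "B \<subseteq> \<Lambda>"
  shows "free_connect_prob d \<Lambda> p q A B = 1 - rc_disc (p / (1 - p)) q \<Lambda> A B"
proof -
  have lat: "A \<subseteq> lattice_points d" "B \<subseteq> lattice_points d" using assms box_lattice by auto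
  have "free_connect_prob d \<Lambda> p q A B
      = wavg (inner \<Lambda>) (rc_weight (p / (1 - p)) q) (\<lambda>\<omega>. of_bool (meets \<omega> A B))"
    unfolding free_connect_prob_def connected_to_iff[OF lat]
    by (rule free_prob_wavg[OF assms(1-3), where Q = "\<lambda>\<omega>. meets \<omega> A B"])
      (simp add: meets_inner_iff[OF _ assms(4,5), symmetric])
  then show ?thesis using rc_conn_eq[OF finite_box] assms by simp
qed

end

section \<open>A Peierls argument in the plane\<close>

type_synonym site = "int \<times> int"

text \<open>The sup norm: distance 1 is star-adjacency, the adjacency dual to nearest-neighbour
  steps in the plane.\<close>

definition site_dist :: "site \<Rightarrow> site \<Rightarrow> int" where
  "site_dist u v = max \<bar>fst u - fst v\<bar> \<bar>snd u - snd v\<bar>"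

definition separated :: "nat \<Rightarrow> site set \<Rightarrow> bool" where
  "separated R X \<longleftrightarrow> (\<forall>u\<in>X. \<forall>v\<in>X. u \<noteq> v \<longrightarrow> int R < site_dist u v)"

section \<open>Star-paths and the contour count\<close>

fun star_paths :: "site \<Rightarrow> nat \<Rightarrow> site list set" where
  "star_paths u 0 = {[u]}"
| "star_paths u (Suc n) =
    (\<Union>w\<in>{- 1, 0, 1} \<times> {- 1, 0, 1}. (#) u ` star_paths (fst u + fst w, snd u + snd w) n)"

lemma finite_star_paths: "finite (star_paths u n)"
  by (induction n arbitrary: u) auto

lemma length_star_paths: "xs \<in> star_paths u n \<Longrightarrow> length xs = Suc n"
  by (induction n arbitrary: u xs) auto

lemma card_star_paths: "card (star_paths u n) \<le> 9 ^ n"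
proof (induction n arbitrary: u)
  case (Suc n)
  let ?W = "{- 1, 0, 1 :: int} \<times> {- 1, 0, 1 :: int}"
  have "card (star_paths u (Suc n)) \<le> (\<Sum>w\<in>?W. card ((#) u ` star_paths (fst u + fst w, snd u + snd w) n))"
    unfolding star_paths.simps by (rule card_UN_le) simp
  also have "\<dots> \<le> (\<Sum>w\<in>?W. 9 ^ n)"
    by (intro sum_mono order_trans[OF card_image_le[OF finite_star_paths] Suc.IH])
  also have "\<dots> = 9 ^ Suc n" by (simp add: card_cartesian_product)
  finally show ?case .
qed simp

lemmas star_paths_props = finite_star_paths card_star_paths length_star_paths

lemma star_pathsI:
  "successively (\<lambda>u v. site_dist u v \<le> 1) (u # xs) \<Longrightarrow> length xs = n \<Longrightarrow> u # xs \<in> star_paths u n"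
proof (induction n arbitrary: u xs)
  case (Suc n)
  then obtain v ys where xs: "xs = v # ys" by (cases xs) auto
  have "v # ys \<in> star_paths v n" using Suc by (intro Suc.IH) (auto simp: xs)
  moreover define w where "w = (fst v - fst u, snd v - snd u)"
  moreover have "(fst u + fst w, snd u + snd w) = v" by (simp add: w_def)
  ultimately have "u # v # ys \<in> (#) u ` star_paths (fst u + fst w, snd u + snd w) n" by simp
  moreover have "w \<in> {- 1, 0, 1} \<times> {- 1, 0, 1}"
  proof -
    have "\<bar>fst u - fst v\<bar> \<le> 1" "\<bar>snd u - snd v\<bar> \<le> 1" using Suc.prems(1) by (auto simp: xs site_dist_def)
    then have "fst w = - 1 \<or> fst w = 0 \<or> fst w = 1" "snd w = - 1 \<or> snd w = 0 \<or> snd w = 1"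
      unfolding w_def fst_conv snd_conv by linarith+
    then show ?thesis unfolding mem_Times_iff by simp
  qed
  ultimately show ?case unfolding xs star_paths.simps by (intro UN_I[of w])
qed simp

text \<open>Contours are thinned to separated sites, because the joint probability of bad sites is
  controlled only at distances above \<open>R\<close>. The last condition says that thinning keeps
  at least one in \<open>(R + 1)^2\<close> of the \<open>n + 1\<close> sites.\<close>

definition contour_sets :: "nat \<Rightarrow> site \<Rightarrow> nat \<Rightarrow> site set set" where
  "contour_sets R u n =
    {X. \<exists>xs\<in>star_paths u n. X \<subseteq> set xs \<and> separated R X \<and> n + 1 \<le> (R + 1)\<^sup>2 * card X}"

lemma contour_sets_props:
  shows finite_contour_sets: "finite (contour_sets R u n)"
    and card_contour_sets: "card (contour_sets R u n) \<le> 9 ^ n * 2 ^ (n + 1)"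
    and finite_contour_set: "X \<in> contour_sets R u n \<Longrightarrow> finite X"
proof -
  have sub: "contour_sets R u n \<subseteq> (\<Union>xs\<in>star_paths u n. Pow (set xs))" by (auto simp: contour_sets_def)
  then show "finite (contour_sets R u n)" by (rule finite_subset) (auto simp: star_paths_props)
  have "card (contour_sets R u n) \<le> card (\<Union>xs\<in>star_paths u n. Pow (set xs))"
    using sub by (intro card_mono) (auto simp: star_paths_props)
  also have "\<dots> \<le> (\<Sum>xs\<in>star_paths u n. card (Pow (set xs)))"
    by (rule card_UN_le) (rule star_paths_props)
  also have "\<dots> \<le> (\<Sum>xs\<in>star_paths u n. 2 ^ (n + 1))"
  proof (intro sum_mono)
    fix xs assume "xs \<in> star_paths u n"
    then have "card (set xs) \<le> n + 1" using card_length[of xs] star_paths_props(3) by simp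
    then show "card (Pow (set xs)) \<le> 2 ^ (n + 1)" by (simp only: card_Pow finite_set) (rule power_increasing; simp)
  qed
  also have "\<dots> \<le> 9 ^ n * 2 ^ (n + 1)" using star_paths_props(2) by simp
  finally show "card (contour_sets R u n) \<le> 9 ^ n * 2 ^ (n + 1)" .
  show "X \<in> contour_sets R u n \<Longrightarrow> finite X" by (auto simp: contour_sets_def intro: finite_subset)
qed

text \<open>\<open>288 = 9 * 2 * 16\<close>: the factors 9 and 2 pay for the choice of the star-path
  and of its subset, and 16 gives the decay.\<close>

lemma contour_sets_sum_le:
  fixes \<epsilon> :: real
  assumes "0 \<le> \<epsilon>" "\<epsilon> \<le> (1 / 288) ^ ((R + 1)\<^sup>2)"
  shows "(\<Sum>X\<in>contour_sets R u n. \<epsilon> ^ card X) \<le> (1 / 16) ^ (n + 1)"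
proof -
  have "\<epsilon> ^ card X \<le> (1 / 288) ^ (n + 1)" if "X \<in> contour_sets R u n" for X
  proof -
    have "\<epsilon> ^ card X \<le> ((1 / 288) ^ ((R + 1)\<^sup>2)) ^ card X" by (intro power_mono assms)
    also have "\<dots> = (1 / 288) ^ ((R + 1)\<^sup>2 * card X)" by (simp only: power_mult)
    also have "\<dots> \<le> (1 / 288) ^ (n + 1)" using that by (intro power_decreasing) (auto simp: contour_sets_def)
    finally show ?thesis .
  qed
  then have "(\<Sum>X\<in>contour_sets R u n. \<epsilon> ^ card X) \<le> real (card (contour_sets R u n)) * (1 / 288) ^ (n + 1)"
    by (rule sum_bounded_above)
  also have "\<dots> \<le> real (9 ^ n * 2 ^ (n + 1)) * (1 / 288) ^ (n + 1)"
    using card_contour_sets by (intro mult_right_mono) (auto simp only: of_nat_le_iff, simp)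
  also have "\<dots> = 2 / 288 * (9 * (2 * (1 / 288))) ^ n" unfolding power_mult_distrib by simp
  also have "\<dots> \<le> (1 / 16) ^ (n + 1)" by simp
  finally show ?thesis .
qed

lemma rtrancl_distinct_path:
  assumes "(u, v) \<in> Rel\<^sup>*"
  shows "\<exists>xs. successively (\<lambda>a b. (a, b) \<in> Rel) (u # xs) \<and> last (u # xs) = v \<and> distinct (u # xs)"
  using assms
proof (induction rule: converse_rtrancl_induct)
  case base
  then show ?case by (intro exI[of _ "[]"]) auto
next
  case (step u w)
  then obtain xs where xs: "successively (\<lambda>a b. (a, b) \<in> Rel) (w # xs)" "last (w # xs) = v" "distinct (w # xs)"
    by blast
  show ?case
  proof (cases "u \<in> set (w # xs)")
    case True
    then obtain ys zs where "w # xs = ys @ u # zs" by (meson split_list)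
    then show ?thesis using xs by (intro exI[of _ zs]) (auto simp: successively_append_iff)
  next
    case False
    then show ?thesis using xs step.hyps by (intro exI[of _ "w # xs"]) auto
  qed
qed

lemma site_dist_triangle: "site_dist u w \<le> site_dist u v + site_dist v w"
  by (auto simp: site_dist_def max_def)

lemma star_path_dist:
  "successively (\<lambda>u v. site_dist u v \<le> 1) (u # xs) \<Longrightarrow> site_dist u (last (u # xs)) \<le> int (length xs)"
proof (induction xs arbitrary: u)
  case (Cons v xs)
  then have "site_dist v (last (v # xs)) \<le> int (length xs)" "site_dist u v \<le> 1" by auto
  then show ?case using site_dist_triangle[of u "last (v # xs)" v] by simp
qed (simp add: site_dist_def)

text \<open>Pigeonhole over the residues of both coordinates modulo \<open>R + 1\<close>: distinct
  sites in one class differ by at least \<open>R + 1\<close> in some coordinate.\<close>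

lemma separated_subset_ex:
  assumes "finite S"
  shows "\<exists>X\<subseteq>S. separated R X \<and> card S \<le> (R + 1)\<^sup>2 * card X"
proof (cases "S = {}")
  case False
  define c :: "site \<Rightarrow> site" where "c x = (fst x mod int (R + 1), snd x mod int (R + 1))" for x
  define C where "C = {0..int R} \<times> {0..int R}"
  have C: "finite C" "card C = (R + 1)\<^sup>2" by (simp_all add: C_def card_cartesian_product power2_eq_square nat_add_distrib)
  have "m mod int (R + 1) \<in> {0..int R}" for m
    using pos_mod_bound[of "int (R + 1)" m] pos_mod_sign[of "int (R + 1)" m]
    unfolding atLeastAtMost_iff by linarith
  then have cC: "c x \<in> C" for x by (simp add: c_def C_def)
  let ?X = "\<lambda>y. {x\<in>S. c x = y}"
  have "\<exists>y. card S \<le> card C * card (?X y)"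
  proof (rule ccontr)
    assume "\<not> ?thesis"
    then have less: "card C * card (?X y) < card S" for y by (meson not_le)
    have "S = (\<Union>y\<in>C. ?X y)" using cC by auto
    then have "card S \<le> (\<Sum>y\<in>C. card (?X y))" using card_UN_le[OF C(1), of ?X] by simp
    then have "card C * card S \<le> (\<Sum>y\<in>C. card C * card (?X y))" by (simp add: sum_distrib_left[symmetric])
    also have "\<dots> < (\<Sum>y\<in>C. card S)" using C by (intro sum_strict_mono less) auto
    finally show False by simp
  qed
  then obtain y where y: "card S \<le> (R + 1)\<^sup>2 * card (?X y)" using C by auto
  have "separated R (?X y)"
    unfolding separated_def
  proof (intro ballI impI)
    fix u v assume uv: "u \<in> ?X y" "v \<in> ?X y" "u \<noteq> v"
    have far: "int R < \<bar>m - n\<bar>" if "m mod int (R + 1) = n mod int (R + 1)" "m \<noteq> n" for m n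
    proof -
      have "int (R + 1) dvd m - n" using that(1) by (rule mod_eq_dvd_iff[THEN iffD1])
      then have "int (R + 1) \<le> \<bar>m - n\<bar>" using that(2) by (intro dvd_imp_le_int[of "m - n" "int (R + 1)", simplified abs_of_nat] ) auto
      then show ?thesis by simp
    qed
    have "fst u \<noteq> fst v \<or> snd u \<noteq> snd v" using uv by (auto simp: prod_eq_iff)
    then show "int R < site_dist u v"
      using uv far[of "fst u" "fst v"] far[of "snd u" "snd v"] by (auto simp: c_def site_dist_def)
  qed
  then show ?thesis using y by (intro exI[of _ "?X y"]) auto
qed (auto intro!: exI[of _ "{}"] simp: separated_def)

text \<open>Loop erasure makes the path self-avoiding, so its first \<open>n + 1\<close> sites are
  distinct and can be thinned to a separated set.\<close>

lemma contour_set_ex: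
  assumes "(u, v) \<in> {(x, y). P x \<and> P y \<and> site_dist x y \<le> 1}\<^sup>*" "P u" "int n \<le> site_dist u v"
  shows "\<exists>X\<in>contour_sets R u n. \<forall>x\<in>X. P x"
proof -
  let ?Rel = "{(x, y). P x \<and> P y \<and> site_dist x y \<le> 1}"
  obtain xs where xs: "successively (\<lambda>a b. (a, b) \<in> ?Rel) (u # xs)" "last (u # xs) = v" "distinct (u # xs)"
    using rtrancl_distinct_path[OF assms(1)] by blast
  have star: "successively (\<lambda>a b. site_dist a b \<le> 1) (u # xs)"
    using xs(1) by (rule successively_mono) auto
  have P: "\<forall>x\<in>set (u # xs). P x"
    using xs(1) assms(2)
  proof (induction xs arbitrary: u)
    case (Cons w xs)
    have "successively (\<lambda>a b. (a, b) \<in> ?Rel) (w # xs)" "P w" using Cons.prems(1) by auto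
    then have "\<forall>x\<in>set (w # xs). P x" by (rule Cons.IH)
    then show ?case using Cons.prems(2) by simp
  qed simp
  have len: "n \<le> length xs" using star_path_dist[OF star] xs(2) assms(3) by simp
  define ys where "ys = take n xs"
  define zs where "zs = drop n xs"
  have xs_eq: "xs = ys @ zs" by (simp add: ys_def zs_def)
  have "successively (\<lambda>a b. site_dist a b \<le> 1) ((u # ys) @ zs)" using star by (simp add: xs_eq)
  then have ys: "successively (\<lambda>a b. site_dist a b \<le> 1) (u # ys)" "distinct (u # ys)" "\<forall>x\<in>set (u # ys). P x"
    using xs(3) P unfolding successively_append_iff by (auto simp: xs_eq)
  have path: "u # ys \<in> star_paths u n" using len by (intro star_pathsI ys) (simp add: ys_def)
  have "card (set (u # ys)) = n + 1" using ys(2) len by (simp only: distinct_card) (simp add: ys_def)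
  then obtain X where "X \<subseteq> set (u # ys)" "separated R X" "n + 1 \<le> (R + 1)\<^sup>2 * card X"
    using separated_subset_ex[of "set (u # ys)" R] by auto
  then have "X \<in> contour_sets R u n" "\<forall>x\<in>X. P x" using path ys(3) unfolding contour_sets_def by blast+
  then show ?thesis by blast
qed

section \<open>Parity of boundary crossings in a rectangle\<close>

lemma even_telescope: "even ((\<Sum>j<b. f j + f (Suc j)) + f 0 + f b :: nat)"
  by (induction b) auto

text \<open>Summing over all unit squares counts every interior edge twice, so modulo 2 only the
  four sides of the rectangle remain.\<close>

lemma rectangle_parity:
  fixes h v :: "nat \<Rightarrow> nat \<Rightarrow> nat"
  assumes "\<And>i j. i < a \<Longrightarrow> j < b \<Longrightarrow> even (h i j + h i (Suc j) + v i j + v (Suc i) j)"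
  shows "even ((\<Sum>i<a. h i 0) + (\<Sum>i<a. h i b) + (\<Sum>j<b. v 0 j) + (\<Sum>j<b. v a j))"
proof -
  define hh where "hh i = (\<Sum>j<b. h i j + h i (Suc j))" for i
  define vv where "vv j = (\<Sum>i<a. v i j + v (Suc i) j)" for j
  have "(\<Sum>i<a. \<Sum>j<b. h i j + h i (Suc j) + v i j + v (Suc i) j)
      = (\<Sum>i<a. \<Sum>j<b. h i j + h i (Suc j)) + (\<Sum>i<a. \<Sum>j<b. v i j + v (Suc i) j)"
    by (simp add: sum.distrib)
  also have "\<dots> = sum hh {..<a} + sum vv {..<b}"
    unfolding hh_def vv_def by (subst (2) sum.swap) rule
  finally have "even (sum hh {..<a} + sum vv {..<b})"
    using assms by (metis (no_types, lifting) dvd_sum lessThan_iff)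
  moreover have "even (\<Sum>i<a. hh i + h i 0 + h i b)"
    unfolding hh_def by (intro dvd_sum even_telescope)
  moreover have "even (\<Sum>j<b. vv j + v 0 j + v a j)"
    unfolding vv_def by (intro dvd_sum even_telescope[of "\<lambda>i. v i _"])
  ultimately show ?thesis unfolding sum.distrib by presburger
qed

lemma odd_changes:
  fixes A :: "nat \<Rightarrow> bool"
  shows "odd (\<Sum>i<n. of_bool (A i \<noteq> A (Suc i)) :: nat) \<longleftrightarrow> A 0 \<noteq> A n"
proof (induction n)
  case (Suc n)
  then show ?case by (cases "A 0"; cases "A n"; cases "A (Suc n)") simp_all
qed simp

text \<open>The corners are numbered cyclically. If no corner lies in \<open>Y\<close>, no edge
  counts. Otherwise \<open>Y\<close> contains every corner outside \<open>A\<close> that has a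
  neighbour in \<open>A\<close>, so the counted edges are those where \<open>A\<close> changes along
  a 4-cycle, and their number is even.\<close>

lemma square_parity:
  assumes "(Y1 \<longrightarrow> \<not> A1) \<and> (Y2 \<longrightarrow> \<not> A2) \<and> (Y3 \<longrightarrow> \<not> A3) \<and> (Y4 \<longrightarrow> \<not> A4)"
    and "Y1 \<or> Y2 \<or> Y3 \<or> Y4 \<Longrightarrow> (\<not> A1 \<and> (A2 \<or> A4) \<longrightarrow> Y1) \<and> (\<not> A2 \<and> (A1 \<or> A3) \<longrightarrow> Y2) \<and>
      (\<not> A3 \<and> (A2 \<or> A4) \<longrightarrow> Y3) \<and> (\<not> A4 \<and> (A1 \<or> A3) \<longrightarrow> Y4)"
  shows "even (of_bool ((A1 \<and> Y2) \<or> (A2 \<and> Y1)) + of_bool ((A4 \<and> Y3) \<or> (A3 \<and> Y4))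
    + of_bool ((A1 \<and> Y4) \<or> (A4 \<and> Y1)) + of_bool ((A2 \<and> Y3) \<or> (A3 \<and> Y2)) :: nat)"
  using assms by (cases A1; cases A2; cases A3; cases A4; cases "Y1 \<or> Y2 \<or> Y3 \<or> Y4") auto

text \<open>\<open>Y\<close> is a union of star-components of the outer boundary of \<open>A\<close>. Each unit square is crossed
  an even number of times by the part of the boundary of \<open>A\<close> that belongs to \<open>Y\<close>, so this part
  leaves the rectangle an even number of times.\<close>

lemma boundary_parity:
  fixes A Y :: "nat \<Rightarrow> nat \<Rightarrow> bool" and a b :: nat
  assumes "\<And>i j. Y i j \<Longrightarrow> \<not> A i j"
    and closed: "\<And>i j i' j'. i \<le> a \<Longrightarrow> j \<le> b \<Longrightarrow> i' \<le> a \<Longrightarrow> j' \<le> b \<Longrightarrow> Y i j \<Longrightarrow>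
      \<bar>int i - int i'\<bar> \<le> 1 \<Longrightarrow> \<bar>int j - int j'\<bar> \<le> 1 \<Longrightarrow> \<not> A i' j' \<Longrightarrow>
      (\<exists>k l. k \<le> a \<and> l \<le> b \<and> A k l \<and> \<bar>int k - int i'\<bar> + \<bar>int l - int j'\<bar> = 1) \<Longrightarrow> Y i' j'"
  defines "S \<equiv> \<lambda>i j k l. (A i j \<and> Y k l) \<or> (A k l \<and> Y i j)"
  shows "even ((\<Sum>i<a. of_bool (S i 0 (Suc i) 0)) + (\<Sum>i<a. of_bool (S i b (Suc i) b))
    + (\<Sum>j<b. of_bool (S 0 j 0 (Suc j))) + (\<Sum>j<b. of_bool (S a j a (Suc j))) :: nat)"
proof (rule rectangle_parity[where h = "\<lambda>i j. of_bool (S i j (Suc i) j)" and v = "\<lambda>i j. of_bool (S i j i (Suc j))"])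
  fix i j assume ij: "i < a" "j < b"
  define C where "C = {(i, j), (Suc i, j), (Suc i, Suc j), (i, Suc j)}"
  have spread: "\<not> A k' l' \<and> A k'' l'' \<longrightarrow> Y k' l'"
    if "(k, l) \<in> C" "Y k l" "(k', l') \<in> C" "(k'', l'') \<in> C" "\<bar>int k'' - int k'\<bar> + \<bar>int l'' - int l'\<bar> = 1"
    for k l k' l' k'' l''
  proof
    assume A: "\<not> A k' l' \<and> A k'' l''"
    have C: "i \<le> m \<and> m \<le> Suc i \<and> j \<le> n \<and> n \<le> Suc j" if "(m, n) \<in> C" for m n
      using that by (auto simp: C_def)
    have le: "k \<le> a" "l \<le> b" "k' \<le> a" "l' \<le> b" "k'' \<le> a" "l'' \<le> b"
      and near: "\<bar>int k - int k'\<bar> \<le> 1" "\<bar>int l - int l'\<bar> \<le> 1"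
      using C[OF that(1)] C[OF that(3)] C[OF that(4)] ij by linarith+
    have "\<exists>k l. k \<le> a \<and> l \<le> b \<and> A k l \<and> \<bar>int k - int k'\<bar> + \<bar>int l - int l'\<bar> = 1"
      using A le that(5) by blast
    then show "Y k' l'" using closed[OF le(1-4) that(2) near] A by blast
  qed
  show "even (of_bool (S i j (Suc i) j) + of_bool (S i (Suc j) (Suc i) (Suc j))
      + of_bool (S i j i (Suc j)) + of_bool (S (Suc i) j (Suc i) (Suc j)) :: nat)"
    unfolding S_def
  proof (rule square_parity)
    assume "Y i j \<or> Y (Suc i) j \<or> Y (Suc i) (Suc j) \<or> Y i (Suc j)"
    then obtain k l where kl: "(k, l) \<in> C" "Y k l" by (auto simp: C_def)
    note sp = spread[OF kl]
    show "(\<not> A i j \<and> (A (Suc i) j \<or> A i (Suc j)) \<longrightarrow> Y i j) \<and>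
      (\<not> A (Suc i) j \<and> (A i j \<or> A (Suc i) (Suc j)) \<longrightarrow> Y (Suc i) j) \<and>
      (\<not> A (Suc i) (Suc j) \<and> (A (Suc i) j \<or> A i (Suc j)) \<longrightarrow> Y (Suc i) (Suc j)) \<and>
      (\<not> A i (Suc j) \<and> (A i j \<or> A (Suc i) (Suc j)) \<longrightarrow> Y i (Suc j))"
    proof -
      have "\<not> A i j \<and> A (Suc i) j \<longrightarrow> Y i j" "\<not> A i j \<and> A i (Suc j) \<longrightarrow> Y i j"
        "\<not> A (Suc i) j \<and> A i j \<longrightarrow> Y (Suc i) j" "\<not> A (Suc i) j \<and> A (Suc i) (Suc j) \<longrightarrow> Y (Suc i) j"
        "\<not> A (Suc i) (Suc j) \<and> A (Suc i) j \<longrightarrow> Y (Suc i) (Suc j)"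
        "\<not> A (Suc i) (Suc j) \<and> A i (Suc j) \<longrightarrow> Y (Suc i) (Suc j)"
        "\<not> A i (Suc j) \<and> A i j \<longrightarrow> Y i (Suc j)" "\<not> A i (Suc j) \<and> A (Suc i) (Suc j) \<longrightarrow> Y i (Suc j)"
        by (rule sp; simp add: C_def)+
      then show ?thesis by argo
    qed
  qed (use assms(1) in auto)
qed


section \<open>Either a connection or a blocking contour\<close>

text \<open>Both adjacencies are preserved, nearest-neighbour for good paths and star for contours,
  so that a rectangle in standard position can be laid along either axis of the plane.\<close>

definition isometry :: "(site \<Rightarrow> site) \<Rightarrow> bool" where
  "isometry \<tau> \<longleftrightarrow> (\<forall>u v. site_dist (\<tau> u) (\<tau> v) = site_dist u v \<and>
    \<bar>fst (\<tau> u) - fst (\<tau> v)\<bar> + \<bar>snd (\<tau> u) - snd (\<tau> v)\<bar> = \<bar>fst u - fst v\<bar> + \<bar>snd u - snd v\<bar>)"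

lemma isometryD:
  assumes "isometry \<tau>"
  shows "site_dist (\<tau> u) (\<tau> v) = site_dist u v"
    "\<bar>fst (\<tau> u) - fst (\<tau> v)\<bar> + \<bar>snd (\<tau> u) - snd (\<tau> v)\<bar> = \<bar>fst u - fst v\<bar> + \<bar>snd u - snd v\<bar>"
  using assms unfolding isometry_def by blast+

text \<open>Only the target of a step has to be good: in the application, goodness of
  \<open>v\<close> already ensures the link from \<open>v\<close> to each of its neighbours.\<close>

definition good_steps :: "(site \<Rightarrow> bool) \<Rightarrow> site set \<Rightarrow> (site \<times> site) set" where
  "good_steps bad I =
    {(u, v). u \<in> I \<and> v \<in> I \<and> \<bar>fst u - fst v\<bar> + \<bar>snd u - snd v\<bar> = 1 \<and> \<not> bad v}"

definition rect :: "nat \<Rightarrow> nat \<Rightarrow> site set" where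
  "rect a b = {0..int a} \<times> {0..int b}"

text \<open>\<open>A\<close> plays the part of the set reached by good steps, \<open>Start\<close> the part of the bad sites along
  one side of the rectangle. The conclusion produces the far end of a star-path of bad sites.\<close>

lemma boundary_escape:
  fixes A :: "site set" and a b :: nat and bad :: "site \<Rightarrow> bool"
  assumes bad: "\<forall>u\<in>A. \<forall>v\<in>rect a b - A. \<bar>fst u - fst v\<bar> + \<bar>snd u - snd v\<bar> = 1 \<longrightarrow> bad v"
    and A: "A \<subseteq> rect a b"
    and Start: "Start \<subseteq> {u \<in> rect a b - A. bad u}"
  defines "P \<equiv> \<lambda>u. bad u \<and> u \<in> rect a b - A"
  defines "Y \<equiv> \<lambda>y. \<exists>u\<in>Start. (u, y) \<in> {(x, y). P x \<and> P y \<and> site_dist x y \<le> 1}\<^sup>*"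
  defines "S \<equiv> \<lambda>u v. (u \<in> A \<and> Y v) \<or> (v \<in> A \<and> Y u)"
  shows "even ((\<Sum>i<a. of_bool (S (int i, 0) (int (Suc i), 0)))
    + (\<Sum>i<a. of_bool (S (int i, int b) (int (Suc i), int b)))
    + (\<Sum>j<b. of_bool (S (0, int j) (0, int (Suc j))))
    + (\<Sum>j<b. of_bool (S (int a, int j) (int a, int (Suc j)))) :: nat)"
    and "Y y \<Longrightarrow> P y"
proof -
  have YP: "P y" if Y: "Y y" for y
  proof -
    obtain u where u: "u \<in> Start" "(u, y) \<in> {(x, y). P x \<and> P y \<and> site_dist x y \<le> 1}\<^sup>*"
      using Y unfolding Y_def by blast
    have "P u" using u(1) Start by (auto simp: P_def)
    with u(2) show ?thesis by (induction rule: rtrancl_induct) auto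
  qed
  then show "Y y \<Longrightarrow> P y" .
  have step: "Y z" if "Y y" "P z" "site_dist y z \<le> 1" for y z
  proof -
    obtain u where u: "u \<in> Start" "(u, y) \<in> {(x, y). P x \<and> P y \<and> site_dist x y \<le> 1}\<^sup>*"
      using \<open>Y y\<close> unfolding Y_def by blast
    have "(u, z) \<in> {(x, y). P x \<and> P y \<and> site_dist x y \<le> 1}\<^sup>*"
      by (rule rtrancl_into_rtrancl[OF u(2)]) (use that YP in auto)
    then show ?thesis using u unfolding Y_def by blast
  qed
  have "even ((\<Sum>i<a. of_bool (S (int i, int 0) (int (Suc i), int 0)))
    + (\<Sum>i<a. of_bool (S (int i, int b) (int (Suc i), int b)))
    + (\<Sum>j<b. of_bool (S (int 0, int j) (int 0, int (Suc j))))
    + (\<Sum>j<b. of_bool (S (int a, int j) (int a, int (Suc j)))) :: nat)"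
    unfolding S_def
  proof (rule boundary_parity[where A = "\<lambda>i j. (int i, int j) \<in> A" and Y = "\<lambda>i j. Y (int i, int j)"])
    show "Y (int i, int j) \<Longrightarrow> (int i, int j) \<notin> A" for i j using YP by (auto simp: P_def)
    fix i j i' j'
    assume *: "i \<le> a" "j \<le> b" "i' \<le> a" "j' \<le> b" "Y (int i, int j)" "\<bar>int i - int i'\<bar> \<le> 1"
      "\<bar>int j - int j'\<bar> \<le> 1" "(int i', int j') \<notin> A"
      "\<exists>k l. k \<le> a \<and> l \<le> b \<and> (int k, int l) \<in> A \<and> \<bar>int k - int i'\<bar> + \<bar>int l - int j'\<bar> = 1"
    have "(int i', int j') \<in> rect a b - A" using * by (auto simp: rect_def)
    moreover from this obtain k l where "(int k, int l) \<in> A" "\<bar>int k - int i'\<bar> + \<bar>int l - int j'\<bar> = 1"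
      using * by auto
    ultimately have "P (int i', int j')"
      using bad[rule_format, of "(int k, int l)" "(int i', int j')"] by (simp add: P_def)
    then show "Y (int i', int j')" using * by (intro step[OF *(5)]) (auto simp: site_dist_def)
  qed
  then show "even ((\<Sum>i<a. of_bool (S (int i, 0) (int (Suc i), 0)))
    + (\<Sum>i<a. of_bool (S (int i, int b) (int (Suc i), int b)))
    + (\<Sum>j<b. of_bool (S (0, int j) (0, int (Suc j))))
    + (\<Sum>j<b. of_bool (S (int a, int j) (int a, int (Suc j)))) :: nat)" by simp
qed

lemma rtrancl_image:
  "(u, v) \<in> R\<^sup>* \<Longrightarrow> (\<And>x y. (x, y) \<in> R \<Longrightarrow> (f x, f y) \<in> R') \<Longrightarrow> (f u, f v) \<in> R'\<^sup>*"
  by (induction rule: rtrancl_induct) (auto intro: rtrancl_into_rtrancl)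

lemma contour_set_transport:
  assumes \<tau>: "isometry \<tau>" and "(u, v) \<in> {(x, y). P x \<and> P y \<and> site_dist x y \<le> 1}\<^sup>*" "P u"
    and "int n \<le> site_dist u v" and "\<And>x. P x \<Longrightarrow> bad (\<tau> x) \<and> x \<in> I"
  shows "\<exists>X\<in>contour_sets R (\<tau> u) n. X \<subseteq> \<tau> ` I \<and> (\<forall>x\<in>X. bad x)"
proof -
  have "(\<tau> u, \<tau> v) \<in> {(x, y). (bad x \<and> x \<in> \<tau> ` I) \<and> (bad y \<and> y \<in> \<tau> ` I) \<and> site_dist x y \<le> 1}\<^sup>*"
    by (rule rtrancl_image[OF assms(2)]) (use assms(5) in \<open>auto simp: isometryD[OF \<tau>]\<close>)
  then have "\<exists>X\<in>contour_sets R (\<tau> u) n. \<forall>x\<in>X. bad x \<and> x \<in> \<tau> ` I"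
    by (rule contour_set_ex) (use assms(3-5) in \<open>auto simp: isometryD[OF \<tau>]\<close>)
  then show ?thesis by blast
qed

lemma sum_of_bool_ex:
  assumes "(\<Sum>i<n. of_bool (Q i) :: nat) \<noteq> 0" shows "\<exists>i<n. Q i"
proof (rule ccontr)
  assume "\<not> ?thesis"
  then have "(\<Sum>i<n. of_bool (Q i) :: nat) = 0" by (intro sum.neutral) auto
  then show False using assms by simp
qed

text \<open>If \<open>(int a, 0)\<close> is not reached, the reached set contains just one of the
  two corners of the base, so its boundary crosses the base an odd number of times. By parity a
  star-path of bad sites leads from some \<open>(int k, 0)\<close> to another side, at distance at
  least \<open>min k (a - k)\<close>.\<close>

theorem peierls_point:
  assumes \<tau>: "isometry \<tau>"
  shows "(\<tau> (0, 0), \<tau> (int a, 0)) \<in> (good_steps bad (\<tau> ` rect a a))\<^sup>* \<or>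
    (\<exists>k\<le>a. \<exists>X\<in>contour_sets R (\<tau> (int k, 0)) (min k (a - k)). X \<subseteq> \<tau> ` rect a a \<and> (\<forall>x\<in>X. bad x))"
proof (rule disjCI)
  assume nocontour: "\<not> (\<exists>k\<le>a. \<exists>X\<in>contour_sets R (\<tau> (int k, 0)) (min k (a - k)).
    X \<subseteq> \<tau> ` rect a a \<and> (\<forall>x\<in>X. bad x))"
  let ?G = "good_steps bad (\<tau> ` rect a a)"
  define A where "A = {u \<in> rect a a. (\<tau> (0, 0), \<tau> u) \<in> ?G\<^sup>*}"
  define bad' where "bad' u = bad (\<tau> u)" for u
  define Start where "Start = {u \<in> rect a a - A. bad' u \<and> snd u = 0}"
  define P where "P u \<longleftrightarrow> bad' u \<and> u \<in> rect a a - A" for u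
  define Y where "Y y \<longleftrightarrow> (\<exists>u\<in>Start. (u, y) \<in> {(x, y). P x \<and> P y \<and> site_dist x y \<le> 1}\<^sup>*)" for y
  define S where "S u v \<longleftrightarrow> (u \<in> A \<and> Y v) \<or> (v \<in> A \<and> Y u)" for u v
  have bad: "bad' v" if "u \<in> A" "v \<in> rect a a - A" "\<bar>fst u - fst v\<bar> + \<bar>snd u - snd v\<bar> = 1" for u v
  proof (rule ccontr)
    assume "\<not> bad' v"
    then have "(\<tau> u, \<tau> v) \<in> ?G" using that by (auto simp: A_def good_steps_def bad'_def isometryD[OF \<tau>])
    then have "(\<tau> (0, 0), \<tau> v) \<in> ?G\<^sup>*" using that by (auto simp: A_def intro: rtrancl_into_rtrancl)
    then show False using that by (simp add: A_def)
  qed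
  have bad_all: "\<forall>u\<in>A. \<forall>v\<in>rect a a - A. \<bar>fst u - fst v\<bar> + \<bar>snd u - snd v\<bar> = 1 \<longrightarrow> bad' v"
    using bad by blast
  have parity: "even ((\<Sum>i<a. of_bool (S (int i, 0) (int (Suc i), 0)))
    + (\<Sum>i<a. of_bool (S (int i, int a) (int (Suc i), int a)))
    + (\<Sum>j<a. of_bool (S (0, int j) (0, int (Suc j))))
    + (\<Sum>j<a. of_bool (S (int a, int j) (int a, int (Suc j)))) :: nat)"
    unfolding S_def Y_def P_def by (rule boundary_escape(1)[OF bad_all]) (auto simp: Start_def A_def)
  have YP: "P y" if "Y y" for y
  proof -
    have "A \<subseteq> rect a a" "Start \<subseteq> {u \<in> rect a a - A. bad' u}" by (auto simp: A_def Start_def)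
    from boundary_escape(2)[OF bad_all this] that show ?thesis unfolding Y_def P_def by blast
  qed
  show "(\<tau> (0, 0), \<tau> (int a, 0)) \<in> ?G\<^sup>*"
  proof (rule ccontr)
    assume notconn: "(\<tau> (0, 0), \<tau> (int a, 0)) \<notin> ?G\<^sup>*"
    have escape: False if "u \<in> Start" "(u, y) \<in> {(x, y). P x \<and> P y \<and> site_dist x y \<le> 1}\<^sup>*"
      "fst y = 0 \<or> fst y = int a \<or> snd y = int a" for u y
    proof -
      have "u = (int (nat (fst u)), 0)" "nat (fst u) \<le> a"
        using that(1) by (auto simp: Start_def rect_def)
      then obtain k where k: "u = (int k, 0)" "k \<le> a" by blast
      have "int (min k (a - k)) \<le> site_dist u y" using that(3) k by (auto simp: site_dist_def)
      then have "\<exists>X\<in>contour_sets R (\<tau> u) (min k (a - k)). X \<subseteq> \<tau> ` rect a a \<and> (\<forall>x\<in>X. bad x)"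
        using that(1,2) by (intro contour_set_transport[OF \<tau> that(2)]) (auto simp: P_def bad'_def Start_def)
      then show False using nocontour k by auto
    qed
    have "of_bool (S (int i, 0) (int (Suc i), 0)) = (of_bool (((int i, 0) \<in> A) \<noteq> ((int (Suc i), 0) \<in> A)) :: nat)"
      if "i < a" for i
    proof -
      have Y: "Y v" if "u \<in> A" "v \<in> rect a a - A" "\<bar>fst u - fst v\<bar> + \<bar>snd u - snd v\<bar> = 1" "snd v = 0" for u v
      proof -
        have "v \<in> Start" using bad[OF that(1-3)] that by (simp add: Start_def)
        then show ?thesis unfolding Y_def by blast
      qed
      define u v where "u = ((int i, 0) :: site)" and "v = ((int (Suc i), 0) :: site)"
      have uv: "u \<in> rect a a" "v \<in> rect a a" using that by (auto simp: u_def v_def rect_def)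
      have "u \<in> A \<Longrightarrow> v \<notin> A \<Longrightarrow> Y v" "v \<in> A \<Longrightarrow> u \<notin> A \<Longrightarrow> Y u"
        using Y[of u v] Y[of v u] uv by (simp_all add: u_def v_def)
      moreover have "Y u \<Longrightarrow> u \<notin> A" "Y v \<Longrightarrow> v \<notin> A" using YP[of u] YP[of v] by (simp_all add: P_def)
      ultimately have "S u v \<longleftrightarrow> (u \<in> A) \<noteq> (v \<in> A)" unfolding S_def by blast
      then show ?thesis by (simp only: u_def v_def)
    qed
    then have "(\<Sum>i<a. of_bool (S (int i, 0) (int (Suc i), 0)) :: nat)
        = (\<Sum>i<a. of_bool (((int i, 0) \<in> A) \<noteq> ((int (Suc i), 0) \<in> A)))" by (intro sum.cong) auto
    moreover have "((int 0, 0) \<in> A) \<noteq> ((int a, 0) \<in> A)" using notconn by (auto simp: A_def rect_def)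
    ultimately have "odd (\<Sum>i<a. of_bool (S (int i, 0) (int (Suc i), 0)) :: nat)"
      using odd_changes[of "\<lambda>i. (int i, 0) \<in> A" a] by simp
    then have "(\<Sum>i<a. of_bool (S (int i, int a) (int (Suc i), int a)) :: nat) \<noteq> 0
      \<or> (\<Sum>j<a. of_bool (S (0, int j) (0, int (Suc j))) :: nat) \<noteq> 0
      \<or> (\<Sum>j<a. of_bool (S (int a, int j) (int a, int (Suc j))) :: nat) \<noteq> 0"
      using parity by (metis add.right_neutral)
    then have "\<exists>y. Y y \<and> (fst y = 0 \<or> fst y = int a \<or> snd y = int a)"
      by (auto dest!: sum_of_bool_ex simp: S_def)
    then show False using escape unfolding Y_def by blast
  qed
qed

text \<open>The reached set contains the whole bottom row. If it misses the top row, its boundary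
  crosses the left side an odd number of times and neither row at all, so a star-path of bad sites
  from the left side ends on the right one. It starts at height at least 1, since
  \<open>(0, 0)\<close> is reached.\<close>

theorem peierls_crossing:
  assumes \<tau>: "isometry \<tau>"
  shows "(\<exists>i\<le>a. \<exists>i'\<le>a. (\<tau> (int i, 0), \<tau> (int i', int b)) \<in> (good_steps bad (\<tau> ` rect a b))\<^sup>*) \<or>
    (\<exists>k\<in>{1..b}. \<exists>X\<in>contour_sets R (\<tau> (0, int k)) a. X \<subseteq> \<tau> ` rect a b \<and> (\<forall>x\<in>X. bad x))"
proof (rule disjCI)
  assume nocontour: "\<not> (\<exists>k\<in>{1..b}. \<exists>X\<in>contour_sets R (\<tau> (0, int k)) a.
    X \<subseteq> \<tau> ` rect a b \<and> (\<forall>x\<in>X. bad x))"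
  let ?G = "good_steps bad (\<tau> ` rect a b)"
  define A where "A = {u \<in> rect a b. \<exists>i\<le>a. (\<tau> (int i, 0), \<tau> u) \<in> ?G\<^sup>*}"
  define bad' where "bad' u = bad (\<tau> u)" for u
  define Start where "Start = {u \<in> rect a b - A. bad' u \<and> fst u = 0}"
  define P where "P u \<longleftrightarrow> bad' u \<and> u \<in> rect a b - A" for u
  define Y where "Y y \<longleftrightarrow> (\<exists>u\<in>Start. (u, y) \<in> {(x, y). P x \<and> P y \<and> site_dist x y \<le> 1}\<^sup>*)" for y
  define S where "S u v \<longleftrightarrow> (u \<in> A \<and> Y v) \<or> (v \<in> A \<and> Y u)" for u v
  have bad: "bad' v" if "u \<in> A" "v \<in> rect a b - A" "\<bar>fst u - fst v\<bar> + \<bar>snd u - snd v\<bar> = 1" for u v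
  proof (rule ccontr)
    assume "\<not> bad' v"
    then have "(\<tau> u, \<tau> v) \<in> ?G" using that by (auto simp: A_def good_steps_def bad'_def isometryD[OF \<tau>])
    then have "\<exists>i\<le>a. (\<tau> (int i, 0), \<tau> v) \<in> ?G\<^sup>*" using that by (auto simp: A_def intro: rtrancl_into_rtrancl)
    then show False using that by (simp add: A_def)
  qed
  have bad_all: "\<forall>u\<in>A. \<forall>v\<in>rect a b - A. \<bar>fst u - fst v\<bar> + \<bar>snd u - snd v\<bar> = 1 \<longrightarrow> bad' v"
    using bad by blast
  have parity: "even ((\<Sum>i<a. of_bool (S (int i, 0) (int (Suc i), 0)))
    + (\<Sum>i<a. of_bool (S (int i, int b) (int (Suc i), int b)))
    + (\<Sum>j<b. of_bool (S (0, int j) (0, int (Suc j))))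
    + (\<Sum>j<b. of_bool (S (int a, int j) (int a, int (Suc j)))) :: nat)"
    unfolding S_def Y_def P_def by (rule boundary_escape(1)[OF bad_all]) (auto simp: Start_def A_def)
  have YP: "P y" if "Y y" for y
  proof -
    have "A \<subseteq> rect a b" "Start \<subseteq> {u \<in> rect a b - A. bad' u}" by (auto simp: A_def Start_def)
    from boundary_escape(2)[OF bad_all this] that show ?thesis unfolding Y_def P_def by blast
  qed
  have row0: "(int i, 0) \<in> A" if "i \<le> a" for i using that by (auto simp: A_def rect_def)
  show "\<exists>i\<le>a. \<exists>i'\<le>a. (\<tau> (int i, 0), \<tau> (int i', int b)) \<in> ?G\<^sup>*"
  proof (rule ccontr)
    assume notconn: "\<not> ?thesis"
    have rowb: "(int i, int b) \<notin> A" if "i \<le> a" for i using notconn that by (auto simp: A_def)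
    have escape: False if "u \<in> Start" "(u, y) \<in> {(x, y). P x \<and> P y \<and> site_dist x y \<le> 1}\<^sup>*"
      "fst y = int a" for u y
    proof -
      have "u = (0, int (nat (snd u)))" "nat (snd u) \<le> b"
        using that(1) by (auto simp: Start_def rect_def)
      then obtain k where k: "u = (0, int k)" "k \<le> b" by blast
      have "k \<noteq> 0"
      proof
        assume "k = 0"
        then show False using row0[of 0] that(1) k by (simp add: Start_def)
      qed
      have "int a \<le> site_dist u y" using that(3) k by (auto simp: site_dist_def)
      then have "\<exists>X\<in>contour_sets R (\<tau> u) a. X \<subseteq> \<tau> ` rect a b \<and> (\<forall>x\<in>X. bad x)"
        using that(1,2) by (intro contour_set_transport[OF \<tau> that(2)]) (auto simp: P_def bad'_def Start_def)
      moreover have "k \<in> {1..b}" using k \<open>k \<noteq> 0\<close> by simp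
      ultimately show False using nocontour unfolding k(1) by blast
    qed
    have "of_bool (S (0, int j) (0, int (Suc j))) = (of_bool (((0, int j) \<in> A) \<noteq> ((0, int (Suc j)) \<in> A)) :: nat)"
      if "j < b" for j
    proof -
      have Y: "Y v" if "u \<in> A" "v \<in> rect a b - A" "\<bar>fst u - fst v\<bar> + \<bar>snd u - snd v\<bar> = 1" "fst v = 0" for u v
      proof -
        have "v \<in> Start" using bad[OF that(1-3)] that by (simp add: Start_def)
        then show ?thesis unfolding Y_def by blast
      qed
      define u v where "u = ((0, int j) :: site)" and "v = ((0, int (Suc j)) :: site)"
      have uv: "u \<in> rect a b" "v \<in> rect a b" using that by (auto simp: u_def v_def rect_def)
      have "u \<in> A \<Longrightarrow> v \<notin> A \<Longrightarrow> Y v" "v \<in> A \<Longrightarrow> u \<notin> A \<Longrightarrow> Y u"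
        using Y[of u v] Y[of v u] uv by (simp_all add: u_def v_def)
      moreover have "Y u \<Longrightarrow> u \<notin> A" "Y v \<Longrightarrow> v \<notin> A" using YP[of u] YP[of v] by (simp_all add: P_def)
      ultimately have "S u v \<longleftrightarrow> (u \<in> A) \<noteq> (v \<in> A)" unfolding S_def by blast
      then show ?thesis by (simp only: u_def v_def)
    qed
    then have "(\<Sum>j<b. of_bool (S (0, int j) (0, int (Suc j))) :: nat)
        = (\<Sum>j<b. of_bool (((0, int j) \<in> A) \<noteq> ((0, int (Suc j)) \<in> A)))" by (intro sum.cong) auto
    moreover have "((0, int 0) \<in> A) \<noteq> ((0, int b) \<in> A)" using row0[of 0] rowb[of 0] by auto
    ultimately have "odd (\<Sum>j<b. of_bool (S (0, int j) (0, int (Suc j))) :: nat)"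
      using odd_changes[of "\<lambda>j. (0, int j) \<in> A" b] by simp
    moreover have "(\<Sum>i<a. of_bool (S (int i, 0) (int (Suc i), 0)) :: nat) = 0"
    proof (rule sum.neutral, intro ballI)
      fix i assume "i \<in> {..<a}"
      then show "of_bool (S (int i, 0) (int (Suc i), 0)) = (0 :: nat)"
        using row0[of i] row0[of "Suc i"] YP by (auto simp: S_def P_def)
    qed
    moreover have "(\<Sum>i<a. of_bool (S (int i, int b) (int (Suc i), int b)) :: nat) = 0"
    proof (rule sum.neutral, intro ballI)
      fix i assume "i \<in> {..<a}"
      then show "of_bool (S (int i, int b) (int (Suc i), int b)) = (0 :: nat)"
        using rowb[of i] rowb[of "Suc i"] by (auto simp: S_def)
    qed
    ultimately have "(\<Sum>j<b. of_bool (S (int a, int j) (int a, int (Suc j))) :: nat) \<noteq> 0"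
      using parity by (metis add.right_neutral add_0)
    then have "\<exists>y. Y y \<and> fst y = int a" by (auto dest!: sum_of_bool_ex simp: S_def)
    then show False using escape unfolding Y_def by blast
  qed
qed

section \<open>Renormalization\<close>

lemma unit_step:
  fixes a b :: int
  assumes "\<bar>a\<bar> + \<bar>b\<bar> = 1"
  shows "(a, b) \<in> {(0, 0), (1, 0), (- 1, 0), (0, 1), (0, - 1)}"
proof (cases "a = 0")
  case True
  then have "b = 1 \<or> b = - 1" using assms by linarith
  then show ?thesis using True by auto
next
  case False
  then have "b = 0" "a = 1 \<or> a = - 1" using assms by linarith+
  then show ?thesis by auto
qed

text \<open>With \<open>\<eta>\<close> fixed and \<open>\<omega>\<close> averaged first, the seeds
  chosen by \<open>\<eta>\<close> are deterministic in the random-cluster estimates.\<close>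

definition joint :: "edge set \<Rightarrow> real \<Rightarrow> real \<Rightarrow> real \<Rightarrow> (edge set \<Rightarrow> edge set \<Rightarrow> real) \<Rightarrow> real" where
  "joint E s r q f = wavg E (bernoulli_weight s) (\<lambda>\<eta>. wavg E (rc_weight r q) (\<lambda>\<omega>. f \<omega> \<eta>))"

lemma joint_swap: "joint E s r q f = wavg E (rc_weight r q) (\<lambda>\<omega>. wavg E (bernoulli_weight s) (f \<omega>))"
  unfolding joint_def by (rule wavg_swap)

lemma joint_mono:
  assumes "pair_set E" "0 < s" "s < 1" "0 < r" "1 \<le> q"
    and "\<And>\<omega> \<eta>. \<omega> \<subseteq> E \<Longrightarrow> \<eta> \<subseteq> E \<Longrightarrow> f \<omega> \<eta> \<le> g \<omega> \<eta>"
  shows "joint E s r q f \<le> joint E s r q g"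
  unfolding joint_def using assms
  by (intro wavg_mono log_supermodular_bernoulli log_supermodular_rc pair_set_finite)

lemma joint_sum: "joint E s r q (\<lambda>\<omega> \<eta>. \<Sum>i\<in>I. f i \<omega> \<eta>) = (\<Sum>i\<in>I. joint E s r q (f i))"
  unfolding joint_def by (simp add: wavg_sum)

lemma joint_add: "joint E s r q (\<lambda>\<omega> \<eta>. f \<omega> \<eta> + g \<omega> \<eta>) = joint E s r q f + joint E s r q g"
  unfolding joint_def by (simp add: wavg_add)

lemma rc_disc_sprinkle:
  assumes V: "finite V" and q: "1 \<le> q" and s: "sprinkle_ok q r r' s"
  shows "rc_disc r' q V A B \<le> joint (inner V) s r q (\<lambda>\<omega> \<eta>. of_bool (\<not> meets (\<omega> \<union> \<eta>) A B))"
proof -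
  let ?E = "inner V"
  have ps: "pair_set ?E" using pair_set_inner[OF V] .
  have rs: "0 < r" "0 < r'" "0 < s" "s < 1" using s by (auto simp: sprinkle_ok_def)
  note l1 = log_supermodular_rc[OF ps rs(1) q] and l2 = log_supermodular_bernoulli[OF pair_set_finite[OF ps] rs(3,4)]
  have "joint ?E s r q (\<lambda>\<omega> \<eta>. of_bool (\<not> meets (\<omega> \<union> \<eta>) A B))
      = wavg ?E (rc_weight r q) (\<lambda>\<omega>. 1 - wavg ?E (bernoulli_weight s) (\<lambda>\<eta>. of_bool (meets (\<omega> \<union> \<eta>) A B)))"
    unfolding joint_swap by (subst wavg_compl[OF l2]) rule
  also have "\<dots> = 1 - wavg ?E (rc_weight r q) (\<lambda>\<omega>. wavg ?E (bernoulli_weight s) (\<lambda>\<eta>. of_bool (meets (\<omega> \<union> \<eta>) A B)))"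
    by (simp add: wavg_diff wavg_const[OF l1])
  also have "\<dots> \<ge> 1 - wavg ?E (rc_weight r' q) (\<lambda>\<omega>. of_bool (meets \<omega> A B))"
    by (intro diff_left_mono rc_sprinkle[OF ps q s] monotone_onI) (auto dest: meets_mono)
  also have "1 - wavg ?E (rc_weight r' q) (\<lambda>\<omega>. of_bool (meets \<omega> A B)) = rc_disc r' q V A B"
    using rc_conn_eq[OF V rs(2) q] by simp
  finally show ?thesis .
qed

section \<open>Slab boxes and their translates in the plane\<close>

text \<open>A vector in the plane of the last two coordinates, the directions in which a slab is
  wide. Conditions such as \<open>i + 2 = d\<close> avoid truncated subtraction.\<close>

definition lat :: "nat \<Rightarrow> int \<Rightarrow> int \<Rightarrow> vertex" where
  "lat d a b = (\<lambda>i. if i + 2 = d then a else if i + 1 = d then b else 0)"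

definition slab_corner :: "nat \<Rightarrow> nat \<Rightarrow> nat \<Rightarrow> vertex" where
  "slab_corner d L N = (\<lambda>i. if i + 2 < d then int L else if i < d then int N else 0)"

lemma slab_box_ibox:
  assumes "2 \<le> d"
  shows "slab_box d L N = ibox (\<lambda>i. - slab_corner d L N i) (slab_corner d L N)"
proof (intro set_eqI iffI)
  fix x assume x: "x \<in> slab_box d L N"
  show "x \<in> ibox (\<lambda>i. - slab_corner d L N i) (slab_corner d L N)"
    unfolding ibox_def
  proof (intro CollectI allI)
    fix i show "- slab_corner d L N i \<le> x i \<and> x i \<le> slab_corner d L N i"
      using x by (auto simp: slab_box_def lattice_points_iff slab_corner_def)
  qed
next
  fix x assume "x \<in> ibox (\<lambda>i. - slab_corner d L N i) (slab_corner d L N)"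
  then have x: "- slab_corner d L N i \<le> x i \<and> x i \<le> slab_corner d L N i" for i by (auto simp: ibox_def)
  have "x i = 0" if "i \<ge> d" for i using x[of i] that by (simp add: slab_corner_def)
  moreover have "x i \<in> {- int L..int L}" if "i < d - 2" for i
  proof -
    have "i + 2 < d" using that by simp
    then show ?thesis using x[of i] by (simp add: slab_corner_def)
  qed
  moreover have "x i \<in> {- int N..int N}" if "i \<in> {d - 2..<d}" for i
  proof -
    have "\<not> i + 2 < d" "i < d" using that by auto
    then show ?thesis using x[of i] by (simp add: slab_corner_def)
  qed
  ultimately show "x \<in> slab_box d L N" by (auto simp: slab_box_def lattice_points_iff)
qed

lemma slab_corner_lattice: "slab_corner d L N \<in> lattice_points d" "(\<lambda>i. - slab_corner d L N i) \<in> lattice_points d"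
  by (auto simp: slab_corner_def lattice_points_iff)

lemma finite_slab_box: "2 \<le> d \<Longrightarrow> finite (slab_box d L N)"
  using slab_box_ibox finite_ibox slab_corner_lattice by metis

lemma slab_box_iff:
  assumes "2 \<le> d"
  shows "x \<in> slab_box d L N \<longleftrightarrow> (\<forall>i. \<bar>x i\<bar> \<le> slab_corner d L N i)"
  unfolding slab_box_ibox[OF assms] ibox_def by (auto simp: abs_le_iff) (smt (verit))+

lemma shift_lat: "shift (lat d a b) (shift (lat d a' b') x) = shift (lat d (a + a') (b + b')) x"
  by (auto simp: shift_def lat_def)

lemma lat_0: "shift (lat d 0 0) x = x"
  by (simp add: shift_def lat_def fun_eq_iff)

lemma shift_slab_subset:
  assumes "2 \<le> d" "int N + \<bar>a\<bar> \<le> int N'" "int N + \<bar>b\<bar> \<le> int N'"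
  shows "shift (lat d a b) ` slab_box d T N \<subseteq> slab_box d T N'"
proof
  fix x assume "x \<in> shift (lat d a b) ` slab_box d T N"
  then obtain y where y: "x = shift (lat d a b) y" "\<And>i. \<bar>y i\<bar> \<le> slab_corner d T N i"
    using assms(1) by (auto simp: slab_box_iff)
  have "\<bar>x i\<bar> \<le> slab_corner d T N' i" for i
    using y(2)[of i] assms(2,3) unfolding y(1)
    by (cases "i + 2 = d"; cases "i + 1 = d") (auto simp: shift_def lat_def slab_corner_def split: if_splits)
  then show "x \<in> slab_box d T N'" using assms(1) by (simp add: slab_box_iff)
qed

lemma shift_lat_image: "shift (lat d a b) ` shift (lat d a' b') ` V = shift (lat d (a + a') (b + b')) ` V"
  by (simp add: image_image shift_lat)

text \<open>Two translates of a fixed connected shape are linked with probability close to \<open>1\<close>, at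
  distances at which some of the \<open>k\<close> disjoint candidates for the translate is entirely open in a
  sprinkling of density \<open>s\<close>.\<close>

definition linked_seeds :: "nat \<Rightarrow> real \<Rightarrow> real \<Rightarrow> real \<Rightarrow> real \<Rightarrow> nat \<Rightarrow> vertex set \<Rightarrow> nat \<Rightarrow> nat \<Rightarrow> nat \<Rightarrow> bool" where
  "linked_seeds d q r \<epsilon> s \<rho> J g k T \<longleftrightarrow>
    J \<noteq> {} \<and> J \<subseteq> slab_box d T (g * k) \<and> (\<forall>x\<in>J. \<forall>y\<in>J. linked (inner J) x y) \<and> 0 < g \<and> 0 < k \<and>
    (\<forall>i<k. \<forall>j<k. i \<noteq> j \<longrightarrow> shift (lat d (int (i * g)) 0) ` J \<inter> shift (lat d (int (j * g)) 0) ` J = {}) \<and>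
    (1 - s ^ card (inner J)) ^ k \<le> \<epsilon> \<and>
    (\<forall>a b. \<bar>a\<bar> \<le> 2 * int (g * k) \<and> \<bar>b\<bar> \<le> 2 * int (g * k) \<longrightarrow>
      rc_disc r q (slab_box d T (\<rho> * (g * k))) J (shift (lat d a b) ` J) \<le> \<epsilon>)"

text \<open>The order of quantifiers matters: the smallness that the Peierls argument requires of
  \<open>\<epsilon>\<close> depends on the range of dependence of the renormalized process, which is
  governed by \<open>\<rho>\<close>, and the density \<open>s\<close> is dictated by the shift of
  the odds.\<close>

definition link_property :: "nat \<Rightarrow> real \<Rightarrow> real \<Rightarrow> bool" where
  "link_property d q r \<longleftrightarrow>
    (\<exists>\<rho>. \<forall>\<epsilon> s. 0 < \<epsilon> \<and> 0 < s \<and> s < 1 \<longrightarrow> (\<exists>J g k T. linked_seeds d q r \<epsilon> s \<rho> J g k T))"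

section \<open>The renormalized process of seeds\<close>

locale seeds =
  fixes d :: nat and q r \<epsilon> s :: real and \<rho> :: nat and J :: "vertex set" and g k T :: nat
  assumes d: "3 \<le> d" and q: "1 \<le> q" and r: "0 < r" and \<epsilon>: "0 < \<epsilon>" and s: "0 < s" "s < 1"
    and seeds: "linked_seeds d q r \<epsilon> s \<rho> J g k T"
begin

definition n :: nat where "n = g * k"

text \<open>The margin \<open>5 * n\<close> covers the offset of a candidate at its site, the step
  to a neighbouring site and the extent of the seed, each at most \<open>n\<close>; the remaining
  \<open>\<rho> * n\<close> is for the box in which the link is sought.\<close>

definition cell :: "site \<Rightarrow> vertex set" where
  "cell x = shift (lat d (int n * fst x) (int n * snd x)) ` slab_box d T ((\<rho> + 5) * n)"

definition cand :: "site \<Rightarrow> nat \<Rightarrow> vertex set" where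
  "cand x i = shift (lat d (int n * fst x + int (i * g)) (int n * snd x)) ` J"

definition open_cands :: "edge set \<Rightarrow> site \<Rightarrow> nat set" where
  "open_cands \<eta> x = {i. i < k \<and> inner (cand x i) \<subseteq> \<eta>}"

text \<open>A choice that depends on \<open>\<eta>\<close> alone. It is meaningful only when some
  candidate is open; \<open>bad\<close> records the other case separately.\<close>

definition seed :: "edge set \<Rightarrow> site \<Rightarrow> vertex set" where
  "seed \<eta> x = cand x (LEAST i. i \<in> open_cands \<eta> x)"

definition nbhd :: "site \<Rightarrow> site set" where
  "nbhd x = (\<lambda>w. (fst x + fst w, snd x + snd w)) ` {(0, 0), (1, 0), (- 1, 0), (0, 1), (0, - 1)}"

text \<open>Everything inspected lies in \<open>cell x\<close>: the candidates of \<open>x\<close>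
  and its neighbours, and the links between their seeds. Sites with disjoint cells are therefore
  open to product bounds.\<close>

definition bad :: "edge set \<Rightarrow> edge set \<Rightarrow> site \<Rightarrow> bool" where
  "bad \<omega> \<eta> x \<longleftrightarrow> (\<exists>y\<in>nbhd x. open_cands \<eta> y = {} \<or> \<not> meets (\<omega> \<inter> inner (cell x)) (seed \<eta> x) (seed \<eta> y))"

text \<open>A fixed set that stands in for the random seed at the two ends of a path.\<close>

definition all_cands :: "site \<Rightarrow> vertex set" where
  "all_cands x = (\<Union>i<k. cand x i)"

lemma d2: "2 \<le> d" using d by simp

lemma n_pos: "0 < n" and J: "J \<noteq> {}" "J \<subseteq> slab_box d T n" "\<And>x y. x \<in> J \<Longrightarrow> y \<in> J \<Longrightarrow> linked (inner J) x y"
  and seed_prob: "(1 - s ^ card (inner J)) ^ k \<le> \<epsilon>"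
  and link_prob: "\<And>a b. \<bar>a\<bar> \<le> 2 * int n \<Longrightarrow> \<bar>b\<bar> \<le> 2 * int n \<Longrightarrow>
      rc_disc r q (slab_box d T (\<rho> * n)) J (shift (lat d a b) ` J) \<le> \<epsilon>"
  and k_pos: "0 < k"
  using seeds by (auto simp: linked_seeds_def n_def)

lemma cand_disjoint: "i < k \<Longrightarrow> j < k \<Longrightarrow> i \<noteq> j \<Longrightarrow> cand x i \<inter> cand x j = {}"
proof -
  assume ij: "i < k" "j < k" "i \<noteq> j"
  have "cand x i = shift (lat d (int n * fst x) (int n * snd x)) ` shift (lat d (int (i * g)) 0) ` J" for i
    by (simp add: cand_def shift_lat_image)
  moreover have "shift (lat d (int (i * g)) 0) ` J \<inter> shift (lat d (int (j * g)) 0) ` J = {}"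
    using seeds ij unfolding linked_seeds_def by blast
  ultimately show ?thesis by (simp add: image_Int[OF inj_shift, symmetric])
qed

lemma offset_less: "i < k \<Longrightarrow> i * g \<le> n"
  unfolding n_def by (simp add: mult.commute less_imp_le)

lemma finite_cell: "finite (cell x)"
  using finite_slab_box[OF d2] by (simp add: cell_def)

lemma nbhd_close: "y \<in> nbhd x \<Longrightarrow> \<bar>fst y - fst x\<bar> \<le> 1 \<and> \<bar>snd y - snd x\<bar> \<le> 1"
  by (auto simp: nbhd_def)

lemma shift_in_cell:
  assumes "V \<subseteq> slab_box d T m" "int m + \<bar>a - int n * fst x\<bar> \<le> int ((\<rho> + 5) * n)"
    "int m + \<bar>b - int n * snd x\<bar> \<le> int ((\<rho> + 5) * n)"
  shows "shift (lat d a b) ` V \<subseteq> cell x"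
proof -
  have "shift (lat d a b) ` V = shift (lat d (int n * fst x) (int n * snd x)) `
      shift (lat d (a - int n * fst x) (b - int n * snd x)) ` V" by (simp add: shift_lat_image)
  also have "\<dots> \<subseteq> cell x"
    unfolding cell_def using shift_slab_subset[OF d2 assms(2,3), of T] assms(1) by (intro image_mono) blast
  finally show ?thesis .
qed

lemma scale_close: "\<bar>u - v\<bar> \<le> 1 \<Longrightarrow> \<bar>int n * u - int n * v\<bar> \<le> int n"
proof -
  assume "\<bar>u - v\<bar> \<le> 1"
  then have "int n * \<bar>u - v\<bar> \<le> int n * 1" by (intro mult_left_mono) auto
  then show ?thesis by (simp add: abs_mult right_diff_distrib[symmetric])
qed

lemma cand_in_cell: "y \<in> nbhd x \<Longrightarrow> i < k \<Longrightarrow> cand y i \<subseteq> cell x"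
  unfolding cand_def
proof (rule shift_in_cell[OF J(2)])
  assume y: "y \<in> nbhd x" and i: "i < k"
  have "\<bar>int n * fst y - int n * fst x\<bar> \<le> int n" "\<bar>int n * snd y - int n * snd x\<bar> \<le> int n"
    using scale_close nbhd_close[OF y] by auto
  moreover have "int (i * g) \<le> int n" "3 * int n \<le> int ((\<rho> + 5) * n)"
    using offset_less[OF i] by (simp_all only: of_nat_le_iff) (simp add: algebra_simps)
  ultimately show "int n + \<bar>int n * fst y + int (i * g) - int n * fst x\<bar> \<le> int ((\<rho> + 5) * n)"
    "int n + \<bar>int n * snd y - int n * snd x\<bar> \<le> int ((\<rho> + 5) * n)" by linarith+
qed

lemma nbhd_self: "x \<in> nbhd x" by (force simp: nbhd_def)

lemma finite_nbhd: "finite (nbhd x)" and card_nbhd: "card (nbhd x) \<le> 5" "card (nbhd x - {x}) \<le> 4"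
proof -
  show "finite (nbhd x)" by (simp add: nbhd_def)
  then show "card (nbhd x) \<le> 5" unfolding nbhd_def by (intro order_trans[OF card_image_le]) auto
  then show "card (nbhd x - {x}) \<le> 4" using nbhd_self \<open>finite (nbhd x)\<close> by simp
qed

lemma all_cands_in_cell: "all_cands x \<subseteq> cell x"
  unfolding all_cands_def using cand_in_cell[OF nbhd_self] by blast

lemma seed_open:
  assumes "open_cands \<eta> x \<noteq> {}"
  obtains i where "i < k" "seed \<eta> x = cand x i" "inner (cand x i) \<subseteq> \<eta>"
proof -
  obtain i where "i \<in> open_cands \<eta> x" using assms by blast
  then have "(LEAST i. i \<in> open_cands \<eta> x) \<in> open_cands \<eta> x" by (rule LeastI)
  then show thesis by (intro that[of "LEAST i. i \<in> open_cands \<eta> x"]) (auto simp: open_cands_def seed_def)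
qed

lemma seed_subset: "open_cands \<eta> x \<noteq> {} \<Longrightarrow> seed \<eta> x \<subseteq> all_cands x"
  by (erule seed_open) (auto simp: all_cands_def)

lemma seed_linked:
  assumes "open_cands \<eta> x \<noteq> {}" "a \<in> seed \<eta> x" "b \<in> seed \<eta> x"
  shows "linked \<eta> a b"
proof -
  obtain i where i: "seed \<eta> x = cand x i" "inner (cand x i) \<subseteq> \<eta>" using seed_open[OF assms(1)] by metis
  have "linked (inner (cand x i)) a b"
    using assms(2,3) J(3) unfolding i(1) by (auto simp: cand_def inner_shift linked_image_iff[OF inj_shift])
  then show ?thesis using i(2) by (rule linked_mono)
qed

text \<open>A good target supplies a link between the seeds at the two ends of the step, and the
  seeds are connected within \<open>\<eta>\<close>, which glues consecutive links. The case
  \<open>x = y\<close> is separate because the starting site may be bad.\<close>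

lemma good_steps_linked:
  assumes "(x, y) \<in> (good_steps (bad \<omega> \<eta>) I)\<^sup>*"
  shows "x = y \<or> (open_cands \<eta> x \<noteq> {} \<and> open_cands \<eta> y \<noteq> {} \<and>
    (\<forall>a\<in>seed \<eta> x. \<forall>b\<in>seed \<eta> y. linked (\<omega> \<union> \<eta>) a b))"
  using assms
proof (induction rule: rtrancl_induct)
  case (step y z)
  have step': "open_cands \<eta> y \<noteq> {} \<and> open_cands \<eta> z \<noteq> {} \<and> (\<forall>a\<in>seed \<eta> y. \<forall>b\<in>seed \<eta> z. linked (\<omega> \<union> \<eta>) a b)"
  proof -
    have "\<bar>fst y - fst z\<bar> + \<bar>snd y - snd z\<bar> = 1" and good: "\<not> bad \<omega> \<eta> z"
      using step.hyps by (auto simp: good_steps_def)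
    then have "(fst y - fst z, snd y - snd z) \<in> {(0, 0), (1, 0), (- 1, 0), (0, 1), (0, - 1)}"
      by (intro unit_step)
    then have "y \<in> nbhd z" unfolding nbhd_def by (rule rev_image_eqI) simp
    then have o: "open_cands \<eta> y \<noteq> {}" "open_cands \<eta> z \<noteq> {}" "meets (\<omega> \<inter> inner (cell z)) (seed \<eta> z) (seed \<eta> y)"
      using good nbhd_self[of z] unfolding bad_def by blast+
    then obtain a' b' where ab': "b' \<in> seed \<eta> z" "a' \<in> seed \<eta> y" "linked (\<omega> \<union> \<eta>) b' a'"
      unfolding meets_def using linked_mono[of _ _ _ "\<omega> \<union> \<eta>"] by blast
    have "linked (\<omega> \<union> \<eta>) a b" if "a \<in> seed \<eta> y" "b \<in> seed \<eta> z" for a b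
    proof -
      have "linked (\<omega> \<union> \<eta>) a a'" "linked (\<omega> \<union> \<eta>) b' b"
        using seed_linked[OF o(1) that(1) ab'(2)] seed_linked[OF o(2) ab'(1) that(2)]
        by (auto intro: linked_mono)
      then show ?thesis using linked_sym[OF ab'(3)] linked_trans by metis
    qed
    then show ?thesis using o by blast
  qed
  show ?case
  proof (cases "x = y")
    case False
    then have IH: "open_cands \<eta> x \<noteq> {}" "\<forall>a\<in>seed \<eta> x. \<forall>b\<in>seed \<eta> y. linked (\<omega> \<union> \<eta>) a b"
      using step.IH by auto
    obtain c where "c \<in> seed \<eta> y"
      using seed_open[of \<eta> y] step' J(1) unfolding cand_def by (metis equals0I image_is_empty)
    then show ?thesis using IH step' linked_trans by metis
  qed (use step' in simp)
qed simp

lemma good_steps_meets: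
  assumes "(x, y) \<in> (good_steps (bad \<omega> \<eta>) I)\<^sup>*"
  shows "meets (\<omega> \<union> \<eta>) (all_cands x) (all_cands y)"
proof (cases "x = y")
  case True
  obtain c where "c \<in> J" using J(1) by blast
  then have "shift (lat d (int n * fst x + int (0 * g)) (int n * snd x)) c \<in> all_cands x"
    unfolding all_cands_def cand_def using k_pos by blast
  then show ?thesis using True by (auto simp: meets_def)
next
  case False
  then have l: "open_cands \<eta> x \<noteq> {}" "open_cands \<eta> y \<noteq> {}" "\<forall>a\<in>seed \<eta> x. \<forall>b\<in>seed \<eta> y. linked (\<omega> \<union> \<eta>) a b"
    using good_steps_linked[OF assms] by auto
  obtain a b where "a \<in> seed \<eta> x" "b \<in> seed \<eta> y"
    using seed_open[OF l(1)] seed_open[OF l(2)] J(1) unfolding cand_def by (metis equals0I image_is_empty)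
  then show ?thesis using l seed_subset[OF l(1)] seed_subset[OF l(2)] unfolding meets_def by blast
qed

lemma seed_link_prob:
  assumes "y \<in> nbhd x" "open_cands \<eta> x \<noteq> {}" "open_cands \<eta> y \<noteq> {}"
  shows "rc_disc r q (cell x) (seed \<eta> x) (seed \<eta> y) \<le> \<epsilon>"
proof -
  obtain i where i: "i < k" "seed \<eta> x = cand x i" using seed_open[OF assms(2)] by metis
  obtain j where j: "j < k" "seed \<eta> y = cand y j" using seed_open[OF assms(3)] by metis
  define a b where "a = int n * fst x + int (i * g)" and "b = int n * snd x"
  define a' b' where "a' = int n * fst y + int (j * g) - a" and "b' = int n * snd y - b"
  have ig: "int (i * g) \<le> int n" "int (j * g) \<le> int n" using offset_less i j by (simp_all only: of_nat_le_iff)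
  have close: "\<bar>int n * fst y - int n * fst x\<bar> \<le> int n" "\<bar>int n * snd y - int n * snd x\<bar> \<le> int n"
    using scale_close nbhd_close[OF assms(1)] by auto
  have sub: "shift (lat d a b) ` slab_box d T (\<rho> * n) \<subseteq> cell x"
    by (rule shift_in_cell) (use ig in \<open>auto simp: a_def b_def algebra_simps\<close>)
  have "cand y j = shift (lat d a b) ` shift (lat d a' b') ` J"
    by (simp add: shift_lat_image cand_def a'_def b'_def)
  then have "rc_disc r q (cell x) (cand x i) (cand y j)
      \<le> rc_disc r q (shift (lat d a b) ` slab_box d T (\<rho> * n)) (shift (lat d a b) ` J) (shift (lat d a b) ` shift (lat d a' b') ` J)"
    using rc_disc_mono[OF finite_cell sub _ _ r q] by (simp add: cand_def a_def b_def)
  also have "\<dots> = rc_disc r q (slab_box d T (\<rho> * n)) J (shift (lat d a' b') ` J)" by (rule rc_disc_shift)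
  \<comment> \<open>The displacement is at most \<open>n\<close> from the two sites plus
    \<open>n\<close> from the offsets; this is the range \<open>2 * n\<close> allowed in
    \<open>linked_seeds\<close>.\<close>
  also have "\<dots> \<le> \<epsilon>"
    by (rule link_prob) (use close ig in \<open>unfold a'_def b'_def a_def b_def, linarith+\<close>)
  finally show ?thesis by (simp add: i j)
qed

lemma no_cands_prob:
  assumes "y \<in> nbhd x"
  shows "wavg (inner (cell x)) (bernoulli_weight s) (\<lambda>\<eta>. of_bool (open_cands \<eta> y = {})) \<le> \<epsilon>"
proof -
  let ?E = "inner (cell x)" and ?F = "\<lambda>i. inner (cand y i)"
  have lsm: "log_supermodular ?E (bernoulli_weight s)"
    using finite_cell finite_inner s by (intro log_supermodular_bernoulli) auto
  have sub: "?F i \<subseteq> ?E" if "i < k" for i using cand_in_cell[OF assms that] by (rule inner_mono)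
  have "(\<lambda>\<eta>. of_bool (open_cands \<eta> y = {})) = (\<lambda>\<eta>. \<Prod>i<k. of_bool (\<not> ?F i \<subseteq> \<eta> \<inter> ?F i) :: real)"
  proof
    fix \<eta>
    show "of_bool (open_cands \<eta> y = {}) = (\<Prod>i<k. of_bool (\<not> ?F i \<subseteq> \<eta> \<inter> ?F i) :: real)"
    proof (cases "open_cands \<eta> y = {}")
      case False
      then obtain i where "i < k" "?F i \<subseteq> \<eta> \<inter> ?F i" by (auto simp: open_cands_def)
      then have "(\<Prod>i<k. of_bool (\<not> ?F i \<subseteq> \<eta> \<inter> ?F i) :: real) = 0" by (intro prod_zero) auto
      then show ?thesis using False by simp
    next
      case True
      then have "(\<Prod>i<k. of_bool (\<not> ?F i \<subseteq> \<eta> \<inter> ?F i) :: real) = 1"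
        by (intro prod.neutral) (auto simp: open_cands_def)
      then show ?thesis using True by simp
    qed
  qed
  then have "wavg ?E (bernoulli_weight s) (\<lambda>\<eta>. of_bool (open_cands \<eta> y = {}))
      = wavg ?E (bernoulli_weight s) (\<lambda>\<eta>. \<Prod>i<k. of_bool (\<not> ?F i \<subseteq> \<eta> \<inter> ?F i))" by simp
  also have "\<dots> \<le> (\<Prod>i<k. 1 - s ^ card (inner J))"
  proof (rule wavg_prod_le[OF lsm, where g = "\<lambda>i A. of_bool (\<not> ?F i \<subseteq> A)"])
    show "disjoint_family_on ?F {..<k}"
      using cand_disjoint inner_disjoint by (auto simp: disjoint_family_on_def)
    fix i assume i: "i \<in> {..<k}"
    have fin: "finite (?F i)" using sub[of i] i finite_subset[OF _ finite_inner[OF finite_cell]] by blast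
    have "card (?F i) = card (inner J)"
      unfolding cand_def inner_shift by (rule card_image) (auto intro!: inj_onI simp: inj_image_eq_iff[OF inj_shift])
    then show "wavg (?F i) (bernoulli_weight s) (\<lambda>A. of_bool (\<not> ?F i \<subseteq> A)) \<le> 1 - s ^ card (inner J)"
      using wavg_bernoulli_all[OF fin s] wavg_compl[OF log_supermodular_bernoulli[OF fin s]] by simp
  qed (use sub in \<open>auto intro!: monotone_onI\<close>)
  also have "\<dots> \<le> \<epsilon>" using seed_prob by simp
  finally show ?thesis .
qed

lemma cells_disjoint:
  assumes "int (2 * (\<rho> + 5)) < site_dist x y"
  shows "cell x \<inter> cell y = {}"
proof -
  have False if z: "z \<in> cell x" "z \<in> cell y" for z
  proof -
    have close: "\<bar>z (d - 2) - int n * fst u\<bar> \<le> int ((\<rho> + 5) * n) \<and> \<bar>z (d - 1) - int n * snd u\<bar> \<le> int ((\<rho> + 5) * n)"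
      if zu: "z \<in> cell u" for u
    proof -
      obtain w where w: "z = shift (lat d (int n * fst u) (int n * snd u)) w" "\<And>i. \<bar>w i\<bar> \<le> slab_corner d T ((\<rho> + 5) * n) i"
        using zu unfolding cell_def by (auto simp: slab_box_iff[OF d2])
      show ?thesis using w(2)[of "d - 2"] w(2)[of "d - 1"] d
        by (auto simp: w(1) shift_def lat_def slab_corner_def)
    qed
    have "\<bar>int n * u - int n * v\<bar> \<le> int n * int (2 * (\<rho> + 5)) \<Longrightarrow> \<bar>u - v\<bar> \<le> int (2 * (\<rho> + 5))" for u v
      using n_pos by (simp add: abs_mult flip: right_diff_distrib)
    moreover have "\<bar>int n * fst x - int n * fst y\<bar> \<le> int n * int (2 * (\<rho> + 5))"
      "\<bar>int n * snd x - int n * snd y\<bar> \<le> int n * int (2 * (\<rho> + 5))"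
    proof -
      have "int n * int (2 * (\<rho> + 5)) = 2 * int ((\<rho> + 5) * n)" by (simp add: algebra_simps)
      then show "\<bar>int n * fst x - int n * fst y\<bar> \<le> int n * int (2 * (\<rho> + 5))"
        "\<bar>int n * snd x - int n * snd y\<bar> \<le> int n * int (2 * (\<rho> + 5))"
        using close[OF z(1)] close[OF z(2)] by linarith+
    qed
    ultimately have "site_dist x y \<le> int (2 * (\<rho> + 5))" by (simp add: site_dist_def)
    then show False using assms by simp
  qed
  then show ?thesis by blast
qed

text \<open>\<open>9 = 5 + 4\<close>: five sites may lack an open candidate and four links may fail,
  the link of a seed to itself being trivial. For fixed \<open>\<eta>\<close> the failing links are
  bounded by a product over the cells, and a second product under the sprinkling handles the missing
  candidates.\<close>

theorem all_bad_prob: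
  assumes V: "finite V" and X: "finite X" "separated (2 * (\<rho> + 5)) X" "\<And>x. x \<in> X \<Longrightarrow> cell x \<subseteq> V"
  shows "joint (inner V) s r q (\<lambda>\<omega> \<eta>. \<Prod>x\<in>X. of_bool (bad \<omega> \<eta> x)) \<le> (9 * \<epsilon>) ^ card X"
proof -
  let ?E = "inner V" and ?F = "\<lambda>x. inner (cell x)"
  have sub: "?F x \<subseteq> ?E" if "x \<in> X" for x using X(3)[OF that] by (rule inner_mono)
  have disj: "disjoint_family_on ?F X"
    unfolding disjoint_family_on_def
  proof (intro ballI impI inner_disjoint cells_disjoint)
    fix x y assume "x \<in> X" "y \<in> X" "x \<noteq> y"
    then show "int (2 * (\<rho> + 5)) < site_dist x y" using X(2) unfolding separated_def by blast
  qed
  define miss where "miss \<eta> x \<longleftrightarrow> (\<exists>y\<in>nbhd x. open_cands \<eta> y = {})" for \<eta> x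
  have lsm: "log_supermodular ?E (rc_weight r q)" using log_supermodular_inner[OF V r q] .
  have lsmb: "log_supermodular ?E (bernoulli_weight s)"
    using finite_inner[OF V] s by (intro log_supermodular_bernoulli) auto
  have local_bad: "bad \<omega> \<eta> x \<longleftrightarrow> bad (\<omega> \<inter> ?F x) \<eta> x" for \<omega> \<eta> x by (simp add: bad_def Int_assoc)
  have inside: "wavg ?E (rc_weight r q) (\<lambda>\<omega>. \<Prod>x\<in>X. of_bool (bad \<omega> \<eta> x)) \<le> (\<Prod>x\<in>X. of_bool (miss \<eta> x) + 4 * \<epsilon>)" for \<eta>
  proof -
    have "wavg ?E (rc_weight r q) (\<lambda>\<omega>. \<Prod>x\<in>X. of_bool (bad \<omega> \<eta> x))
        = wavg ?E (rc_weight r q) (\<lambda>\<omega>. \<Prod>x\<in>X. of_bool (bad (\<omega> \<inter> ?F x) \<eta> x))"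
      by (subst local_bad) rule
    also have "\<dots> \<le> (\<Prod>x\<in>X. of_bool (miss \<eta> x) + 4 * \<epsilon>)"
    proof (rule wavg_prod_le[OF lsm X(1), where g = "\<lambda>x \<omega>. of_bool (bad \<omega> \<eta> x)"])
      fix x assume x: "x \<in> X"
      note lsmx = log_supermodular_inner[OF finite_cell r q]
      show "antimono_on (Pow (?F x)) (\<lambda>\<omega>. of_bool (bad \<omega> \<eta> x) :: real)"
      proof (intro monotone_onI)
        fix A B assume "A \<le> B" "A \<in> Pow (?F x)" "B \<in> Pow (?F x)"
        then have "bad B \<eta> x \<Longrightarrow> bad A \<eta> x" unfolding bad_def
          by (meson Int_mono meets_mono order_refl)
        then show "of_bool (bad A \<eta> x) \<ge> (of_bool (bad B \<eta> x) :: real)" by auto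
      qed
      show "wavg (?F x) (rc_weight r q) (\<lambda>\<omega>. of_bool (bad \<omega> \<eta> x)) \<le> of_bool (miss \<eta> x) + 4 * \<epsilon>"
      proof (cases "miss \<eta> x")
        case True
        then show ?thesis using wavg_le[OF lsmx, of x "\<lambda>\<omega>. of_bool (bad \<omega> \<eta> x)" 1] \<epsilon> by simp
      next
        case False
        then have o: "open_cands \<eta> y \<noteq> {}" if "y \<in> nbhd x" for y using that by (auto simp: miss_def)
        obtain c where c: "c \<in> seed \<eta> x"
          using seed_open[OF o[OF nbhd_self]] J(1) unfolding cand_def by (metis equals0I image_is_empty)
        have "of_bool (bad \<omega> \<eta> x) \<le> (\<Sum>y\<in>nbhd x - {x}. of_bool (\<not> meets \<omega> (seed \<eta> x) (seed \<eta> y)) :: real)"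
          if \<omega>: "\<omega> \<subseteq> ?F x" for \<omega>
        proof (cases "bad \<omega> \<eta> x")
          case True
          have "\<omega> \<inter> ?F x = \<omega>" using \<omega> by blast
          then obtain y where y: "y \<in> nbhd x" "\<not> meets \<omega> (seed \<eta> x) (seed \<eta> y)"
            using True o unfolding bad_def by metis
          then have "y \<noteq> x" using c by (auto simp: meets_def)
          then have "(of_bool (\<not> meets \<omega> (seed \<eta> x) (seed \<eta> y)) :: real)
              \<le> (\<Sum>y\<in>nbhd x - {x}. of_bool (\<not> meets \<omega> (seed \<eta> x) (seed \<eta> y)))"
            using y finite_nbhd by (intro member_le_sum) auto
          then show ?thesis using y True by simp
        qed (simp add: sum_nonneg)
        then have "wavg (?F x) (rc_weight r q) (\<lambda>\<omega>. of_bool (bad \<omega> \<eta> x))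
            \<le> (\<Sum>y\<in>nbhd x - {x}. rc_disc r q (cell x) (seed \<eta> x) (seed \<eta> y))"
          unfolding rc_disc_def wavg_sum[symmetric] by (rule wavg_mono[OF lsmx])
        also have "\<dots> \<le> (\<Sum>y\<in>nbhd x - {x}. \<epsilon>)" using o nbhd_self by (intro sum_mono seed_link_prob) auto
        also have "\<dots> \<le> 4 * \<epsilon>" using card_nbhd(2)[of x] \<epsilon> by (simp add: mult_right_mono)
        finally show ?thesis using False by simp
      qed
    qed (use sub disj in auto)
    finally show ?thesis .
  qed
  have local_miss: "miss \<eta> x \<longleftrightarrow> miss (\<eta> \<inter> ?F x) x" for \<eta> x
  proof -
    have "open_cands \<eta> y = open_cands (\<eta> \<inter> ?F x) y" if "y \<in> nbhd x" for y
      using inner_mono[OF cand_in_cell[OF that]] by (auto simp: open_cands_def)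
    then show ?thesis by (auto simp: miss_def)
  qed
  have "joint ?E s r q (\<lambda>\<omega> \<eta>. \<Prod>x\<in>X. of_bool (bad \<omega> \<eta> x))
      \<le> wavg ?E (bernoulli_weight s) (\<lambda>\<eta>. \<Prod>x\<in>X. of_bool (miss \<eta> x) + 4 * \<epsilon>)"
    unfolding joint_def by (rule wavg_mono[OF lsmb inside])
  also have "\<dots> = wavg ?E (bernoulli_weight s) (\<lambda>\<eta>. \<Prod>x\<in>X. of_bool (miss (\<eta> \<inter> ?F x) x) + 4 * \<epsilon>)"
    by (subst local_miss) rule
  also have "\<dots> \<le> (\<Prod>x\<in>X. 9 * \<epsilon>)"
  proof (rule wavg_prod_le[OF lsmb X(1), where g = "\<lambda>x \<eta>. of_bool (miss \<eta> x) + 4 * \<epsilon>"])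
    fix x assume x: "x \<in> X"
    have lsmx: "log_supermodular (?F x) (bernoulli_weight s)"
      using finite_inner[OF finite_cell] s by (intro log_supermodular_bernoulli) auto
    show "antimono_on (Pow (?F x)) (\<lambda>\<eta>. of_bool (miss \<eta> x) + 4 * \<epsilon>)"
    proof (intro monotone_onI)
      fix A B :: "edge set" assume "A \<le> B"
      then have "miss B x \<Longrightarrow> miss A x" unfolding miss_def open_cands_def by blast
      then show "of_bool (miss A x) + 4 * \<epsilon> \<ge> of_bool (miss B x) + 4 * \<epsilon>" by auto
    qed
    have "of_bool (miss \<eta> x) \<le> (\<Sum>y\<in>nbhd x. of_bool (open_cands \<eta> y = {}) :: real)" for \<eta>
    proof (cases "miss \<eta> x")
      case True
      then obtain y where y: "y \<in> nbhd x" "open_cands \<eta> y = {}" by (auto simp: miss_def)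
      then have "(of_bool (open_cands \<eta> y = {}) :: real) \<le> (\<Sum>y\<in>nbhd x. of_bool (open_cands \<eta> y = {}))"
        using finite_nbhd by (intro member_le_sum) auto
      then show ?thesis using y by simp
    qed (simp add: sum_nonneg)
    then have "wavg (?F x) (bernoulli_weight s) (\<lambda>\<eta>. of_bool (miss \<eta> x))
        \<le> (\<Sum>y\<in>nbhd x. wavg (?F x) (bernoulli_weight s) (\<lambda>\<eta>. of_bool (open_cands \<eta> y = {})))"
      unfolding wavg_sum[symmetric] by (intro wavg_mono[OF lsmx])
    also have "\<dots> \<le> (\<Sum>y\<in>nbhd x. \<epsilon>)" by (intro sum_mono no_cands_prob)
    also have "\<dots> \<le> 5 * \<epsilon>" using card_nbhd(1)[of x] \<epsilon> by (simp add: mult_right_mono)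
    finally show "wavg (?F x) (bernoulli_weight s) (\<lambda>\<eta>. of_bool (miss \<eta> x) + 4 * \<epsilon>) \<le> 9 * \<epsilon>"
      by (simp add: wavg_add wavg_const[OF lsmx])
  qed (use sub disj \<epsilon> in \<open>auto intro!: add_nonneg_nonneg\<close>)
  also have "\<dots> = (9 * \<epsilon>) ^ card X" by simp
  finally show ?thesis .
qed

end

section \<open>Connection of two distant sites\<close>

lemma geometric_sum: "(\<Sum>i<n. (1 / 16) ^ (i + 1)) \<le> (1 / 15 :: real)"
proof -
  have "15 * (\<Sum>i<n. (1 / 16) ^ (i + 1)) = (1 - (1 / 16) ^ n :: real)"
    by (induction n) (simp_all add: algebra_simps)
  moreover have "0 \<le> (1 / 16 :: real) ^ n" by simp
  ultimately show ?thesis by linarith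
qed

context seeds
begin

definition few_bad :: bool where
  "few_bad \<longleftrightarrow> 9 * \<epsilon> \<le> (1 / 288) ^ ((2 * (\<rho> + 5) + 1)\<^sup>2)"

lemma contour_prob:
  assumes few_bad and V: "finite V" and I: "\<And>x. x \<in> I \<Longrightarrow> cell x \<subseteq> V"
  shows "joint (inner V) s r q (\<lambda>\<omega> \<eta>.
      of_bool (\<exists>X\<in>contour_sets (2 * (\<rho> + 5)) u m. X \<subseteq> I \<and> (\<forall>x\<in>X. bad \<omega> \<eta> x))) \<le> (1 / 16) ^ (m + 1)"
proof -
  let ?C = "contour_sets (2 * (\<rho> + 5)) u m"
  define C where "C = {X \<in> ?C. X \<subseteq> I}"
  have C: "finite C" "C \<subseteq> ?C" using finite_contour_sets by (auto simp: C_def)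
  have fin: "finite X" if "X \<in> C" for X using that C(2) finite_contour_set by blast
  have "joint (inner V) s r q (\<lambda>\<omega> \<eta>. of_bool (\<exists>X\<in>?C. X \<subseteq> I \<and> (\<forall>x\<in>X. bad \<omega> \<eta> x)))
      \<le> joint (inner V) s r q (\<lambda>\<omega> \<eta>. \<Sum>X\<in>C. \<Prod>x\<in>X. of_bool (bad \<omega> \<eta> x))"
  proof (rule joint_mono[OF pair_set_inner[OF V] s r q])
    fix \<omega> \<eta>
    show "of_bool (\<exists>X\<in>?C. X \<subseteq> I \<and> (\<forall>x\<in>X. bad \<omega> \<eta> x)) \<le> (\<Sum>X\<in>C. \<Prod>x\<in>X. of_bool (bad \<omega> \<eta> x) :: real)"
    proof (cases "\<exists>X\<in>?C. X \<subseteq> I \<and> (\<forall>x\<in>X. bad \<omega> \<eta> x)")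
      case True
      then obtain X where X: "X \<in> C" "\<forall>x\<in>X. bad \<omega> \<eta> x" by (auto simp: C_def)
      then have "1 = (\<Prod>x\<in>X. of_bool (bad \<omega> \<eta> x) :: real)" by (intro prod.neutral[symmetric]) auto
      also have "\<dots> \<le> (\<Sum>X\<in>C. \<Prod>x\<in>X. of_bool (bad \<omega> \<eta> x))"
        using X C by (intro member_le_sum) (auto intro!: prod_nonneg)
      finally show ?thesis by simp
    qed (auto intro!: sum_nonneg prod_nonneg)
  qed
  also have "\<dots> \<le> (\<Sum>X\<in>C. (9 * \<epsilon>) ^ card X)"
    unfolding joint_sum
  proof (intro sum_mono all_bad_prob V)
    fix X assume X: "X \<in> C"
    then show "finite X" by (rule fin)
    show "separated (2 * (\<rho> + 5)) X" using X unfolding C_def contour_sets_def by blast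
    show "cell x \<subseteq> V" if "x \<in> X" for x using X I that unfolding C_def by blast
  qed
  also have "\<dots> \<le> (\<Sum>X\<in>?C. (9 * \<epsilon>) ^ card X)"
    using C \<epsilon> finite_contour_sets by (intro sum_mono2) auto
  also have "\<dots> \<le> (1 / 16) ^ (m + 1)"
    using assms(1) \<epsilon> by (intro contour_sets_sum_le) (auto simp: few_bad_def)
  finally show ?thesis .
qed

lemma point_prob:
  assumes few_bad and V: "finite V" and \<tau>: "isometry \<tau>"
    and I: "\<And>x. x \<in> \<tau> ` rect a a \<Longrightarrow> cell x \<subseteq> V"
  shows "joint (inner V) s r q (\<lambda>\<omega> \<eta>.
      of_bool ((\<tau> (0, 0), \<tau> (int a, 0)) \<notin> (good_steps (bad \<omega> \<eta>) (\<tau> ` rect a a))\<^sup>*)) \<le> 2 / 15"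
proof -
  let ?Q = "\<lambda>k \<omega> \<eta>. \<exists>X\<in>contour_sets (2 * (\<rho> + 5)) (\<tau> (int k, 0)) (min k (a - k)).
      X \<subseteq> \<tau> ` rect a a \<and> (\<forall>x\<in>X. bad \<omega> \<eta> x)"
  have "joint (inner V) s r q (\<lambda>\<omega> \<eta>.
      of_bool ((\<tau> (0, 0), \<tau> (int a, 0)) \<notin> (good_steps (bad \<omega> \<eta>) (\<tau> ` rect a a))\<^sup>*))
    \<le> joint (inner V) s r q (\<lambda>\<omega> \<eta>. \<Sum>k<Suc a. of_bool (?Q k \<omega> \<eta>))"
  proof (rule joint_mono[OF pair_set_inner[OF V] s r q])
    fix \<omega> \<eta>
    show "of_bool ((\<tau> (0, 0), \<tau> (int a, 0)) \<notin> (good_steps (bad \<omega> \<eta>) (\<tau> ` rect a a))\<^sup>*)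
        \<le> (\<Sum>k<Suc a. of_bool (?Q k \<omega> \<eta>) :: real)"
    proof (cases "(\<tau> (0, 0), \<tau> (int a, 0)) \<in> (good_steps (bad \<omega> \<eta>) (\<tau> ` rect a a))\<^sup>*")
      case False
      then obtain k where k: "k \<le> a" "?Q k \<omega> \<eta>"
        using peierls_point[OF \<tau>, of a "bad \<omega> \<eta>" "2 * (\<rho> + 5)"] by blast
      then have "1 = (of_bool (?Q k \<omega> \<eta>) :: real)" by simp
      also have "\<dots> \<le> (\<Sum>k<Suc a. of_bool (?Q k \<omega> \<eta>))" by (rule member_le_sum) (use k in auto)
      finally show ?thesis by simp
    qed (simp add: sum_nonneg)
  qed
  also have "\<dots> \<le> (\<Sum>k<Suc a. (1 / 16) ^ (min k (a - k) + 1))"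
    unfolding joint_sum by (intro sum_mono contour_prob assms)
  \<comment> \<open>Replacing the minimum by a sum gives one geometric series from each corner of
    the base.\<close>
  also have "\<dots> \<le> (\<Sum>k<Suc a. (1 / 16) ^ (k + 1) + (1 / 16) ^ (Suc a - Suc k + 1))"
    by (intro sum_mono) (auto simp: min_def)
  also have "\<dots> = (\<Sum>k<Suc a. (1 / 16) ^ (k + 1)) + (\<Sum>k<Suc a. (1 / 16) ^ (k + 1))"
    unfolding sum.distrib sum.nat_diff_reindex[of "\<lambda>k. (1 / 16) ^ (k + 1)" "Suc a"] ..
  also have "\<dots> \<le> 1 / 15 + 1 / 15" by (intro add_mono geometric_sum)
  finally show ?thesis by simp
qed

lemma good_steps_mono: "I \<subseteq> I' \<Longrightarrow> (good_steps B I)\<^sup>* \<subseteq> (good_steps B I')\<^sup>*"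
  by (rule rtrancl_mono) (auto simp: good_steps_def)

lemma two_point_prob:
  assumes few_bad and V: "finite V" and x: "\<bar>fst x\<bar> \<le> m" "\<bar>snd x\<bar> \<le> m"
    and cells: "\<And>y. \<bar>fst y\<bar> \<le> m \<Longrightarrow> \<bar>snd y\<bar> \<le> m \<Longrightarrow> cell y \<subseteq> V"
  shows "joint (inner V) s r q (\<lambda>\<omega> \<eta>. of_bool (\<not> meets (\<omega> \<union> \<eta>) (all_cands (0, 0)) (all_cands x))) \<le> 4 / 15"
proof -
  \<comment> \<open>An L-shaped route through the corner \<open>(fst x, 0)\<close>. The signs place
    both squares within sup-distance \<open>m\<close> of the origin: the second one stands on the
    vertical leg and extends back in the direction of the origin.\<close>
  define \<sigma>1 \<sigma>2 :: int where "\<sigma>1 = (if 0 \<le> fst x then 1 else - 1)" and "\<sigma>2 = (if 0 \<le> snd x then 1 else - 1)"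
  define \<tau>1 \<tau>2 :: "site \<Rightarrow> site"
    where "\<tau>1 u = (\<sigma>1 * fst u, \<sigma>2 * snd u)" and "\<tau>2 u = (fst x - \<sigma>1 * snd u, \<sigma>2 * fst u)" for u
  define a b where "a = nat \<bar>fst x\<bar>" and "b = nat \<bar>snd x\<bar>"
  have iso: "isometry \<tau>1" "isometry \<tau>2"
    by (auto simp: isometry_def \<tau>1_def \<tau>2_def site_dist_def \<sigma>1_def \<sigma>2_def)
  have corners: "\<tau>1 (0, 0) = (0, 0)" "\<tau>1 (int a, 0) = \<tau>2 (0, 0)" "\<tau>2 (int b, 0) = x"
    by (auto simp: \<tau>1_def \<tau>2_def a_def b_def \<sigma>1_def \<sigma>2_def prod_eq_iff)
  let ?S = "{y :: site. \<bar>fst y\<bar> \<le> m \<and> \<bar>snd y\<bar> \<le> m}"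
  have sub1: "\<tau>1 ` rect a a \<subseteq> ?S"
  proof
    fix y assume "y \<in> \<tau>1 ` rect a a"
    then obtain u where u: "y = \<tau>1 u" "0 \<le> fst u" "fst u \<le> int a" "0 \<le> snd u" "snd u \<le> int a" by (auto simp: rect_def)
    then show "y \<in> ?S" using x by (auto simp: \<tau>1_def a_def \<sigma>1_def \<sigma>2_def)
  qed
  have sub2: "\<tau>2 ` rect b b \<subseteq> ?S"
  proof
    fix y assume "y \<in> \<tau>2 ` rect b b"
    then obtain u where u: "y = \<tau>2 u" "0 \<le> fst u" "fst u \<le> int b" "0 \<le> snd u" "snd u \<le> int b" by (auto simp: rect_def)
    then show "y \<in> ?S" using x by (auto simp: \<tau>2_def b_def \<sigma>1_def \<sigma>2_def)
  qed
  let ?N1 = "\<lambda>\<omega> \<eta>. (\<tau>1 (0, 0), \<tau>1 (int a, 0)) \<notin> (good_steps (bad \<omega> \<eta>) (\<tau>1 ` rect a a))\<^sup>*"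
  let ?N2 = "\<lambda>\<omega> \<eta>. (\<tau>2 (0, 0), \<tau>2 (int b, 0)) \<notin> (good_steps (bad \<omega> \<eta>) (\<tau>2 ` rect b b))\<^sup>*"
  have "joint (inner V) s r q (\<lambda>\<omega> \<eta>. of_bool (\<not> meets (\<omega> \<union> \<eta>) (all_cands (0, 0)) (all_cands x)))
      \<le> joint (inner V) s r q (\<lambda>\<omega> \<eta>. of_bool (?N1 \<omega> \<eta>) + of_bool (?N2 \<omega> \<eta>))"
  proof (rule joint_mono[OF pair_set_inner[OF V] s r q])
    fix \<omega> \<eta>
    have "meets (\<omega> \<union> \<eta>) (all_cands (0, 0)) (all_cands x)" if N: "\<not> ?N1 \<omega> \<eta>" "\<not> ?N2 \<omega> \<eta>"
    proof (rule good_steps_meets)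
      have "((0, 0), \<tau>2 (0, 0)) \<in> (good_steps (bad \<omega> \<eta>) ?S)\<^sup>*"
        using N(1) good_steps_mono[OF sub1] unfolding corners by blast
      moreover have "(\<tau>2 (0, 0), x) \<in> (good_steps (bad \<omega> \<eta>) ?S)\<^sup>*"
        using N(2) good_steps_mono[OF sub2] unfolding corners by blast
      ultimately show "((0, 0), x) \<in> (good_steps (bad \<omega> \<eta>) ?S)\<^sup>*" by (rule rtrancl_trans)
    qed
    then show "of_bool (\<not> meets (\<omega> \<union> \<eta>) (all_cands (0, 0)) (all_cands x))
        \<le> (of_bool (?N1 \<omega> \<eta>) + of_bool (?N2 \<omega> \<eta>) :: real)"
      by (cases "?N1 \<omega> \<eta>"; cases "?N2 \<omega> \<eta>") simp_all
  qed
  also have "\<dots> \<le> 2 / 15 + 2 / 15"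
    unfolding joint_add
  proof (intro add_mono point_prob assms(1) V iso)
    show "cell y \<subseteq> V" if "y \<in> \<tau>1 ` rect a a" for y using that sub1 cells by blast
    show "cell y \<subseteq> V" if "y \<in> \<tau>2 ` rect b b" for y using that sub2 cells by blast
  qed
  finally show ?thesis by simp
qed

end

section \<open>Slab percolation from the link property\<close>

lemma mono_on_all_open: "mono_on X (\<lambda>\<omega>. of_bool (F \<subseteq> \<omega>) :: real)"
  by (intro monotone_onI) (simp add: of_bool_def, blast)

lemma mono_on_meets: "mono_on X (\<lambda>\<omega>. of_bool (meets \<omega> A B) :: real)"
  by (intro monotone_onI) (auto dest: meets_mono[OF _ _ order_refl order_refl])

lemma rc_all_open_ge:
  assumes "finite V" "F \<subseteq> inner V" "0 < r" "1 \<le> q"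
  shows "(r / (q * (1 + r))) ^ card F \<le> wavg (inner V) (rc_weight r q) (\<lambda>\<omega>. of_bool (F \<subseteq> \<omega>))"
proof -
  have ps: "pair_set (inner V)" "pair_set F"
    using pair_set_inner[OF assms(1)] pair_set_subset[OF _ assms(2)] by auto
  note lsm = log_supermodular_rc[OF ps(1) assms(3,4)] and lsmF = log_supermodular_rc[OF ps(2) assms(3,4)]
  have anti: "antimono_on (Pow F) (\<lambda>\<omega>. of_bool (\<not> F \<subseteq> \<omega>) :: real)"
    by (intro monotone_onI) (auto simp: of_bool_def)
  have "wavg (inner V) (rc_weight r q) (\<lambda>\<omega>. of_bool (\<not> F \<subseteq> \<omega> \<inter> F))
      \<le> wavg F (rc_weight r q) (\<lambda>\<omega>. of_bool (\<not> F \<subseteq> \<omega>))"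
    by (rule wavg_restrict_antimono[OF lsm assms(2) anti]) simp
  then have "wavg (inner V) (rc_weight r q) (\<lambda>\<omega>. of_bool (\<not> F \<subseteq> \<omega>))
      \<le> wavg F (rc_weight r q) (\<lambda>\<omega>. of_bool (\<not> F \<subseteq> \<omega>))" by simp
  then have "wavg F (rc_weight r q) (\<lambda>\<omega>. of_bool (F \<subseteq> \<omega>))
      \<le> wavg (inner V) (rc_weight r q) (\<lambda>\<omega>. of_bool (F \<subseteq> \<omega>))"
    by (simp add: wavg_compl[OF lsm] wavg_compl[OF lsmF])
  then show ?thesis using rc_all_open[OF ps(2) assms(3,4)] by linarith
qed

lemma lattice_origin: "origin \<in> lattice_points d"
  by (simp add: origin_def lattice_points_iff)

lemma origin_in_slab: "2 \<le> d \<Longrightarrow> origin \<in> slab_box d L N"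
  by (auto simp: slab_box_iff origin_def slab_corner_def)

lemma slab_box_lattice: "2 \<le> d \<Longrightarrow> slab_box d L N \<subseteq> lattice_points d"
  by (auto simp: slab_box_def)

lemma ibox_Int: "ibox lo hi \<inter> ibox lo' hi' = ibox (\<lambda>i. max (lo i) (lo' i)) (\<lambda>i. min (hi i) (hi' i))"
  by (auto simp: ibox_def)

lemma slab_box_mono: "2 \<le> d \<Longrightarrow> N \<le> N' \<Longrightarrow> slab_box d T N \<subseteq> slab_box d T N'"
  using shift_slab_subset[of d N 0 N' 0 T] by (simp add: lat_0)

lemma linked_slab_shift:
  assumes d: "2 \<le> d" and xy: "x \<in> slab_box d T N \<inter> shift (lat d a b) ` slab_box d T H"
      "y \<in> slab_box d T N \<inter> shift (lat d a b) ` slab_box d T H"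
  shows "linked (inner (slab_box d T N \<inter> shift (lat d a b) ` slab_box d T H)) x y"
proof -
  have eq: "slab_box d T N \<inter> shift (lat d a b) ` slab_box d T H
      = ibox (\<lambda>i. max (- slab_corner d T N i) (shift (lat d a b) (\<lambda>i. - slab_corner d T H i) i))
        (\<lambda>i. min (slab_corner d T N i) (shift (lat d a b) (slab_corner d T H) i))"
    unfolding slab_box_ibox[OF d] shift_ibox ibox_Int ..
  have "x \<in> lattice_points d" "y \<in> lattice_points d" using xy slab_box_lattice[OF d] by auto
  with xy show ?thesis unfolding eq by (rule linked_ibox)
qed

text \<open>The Peierls estimate links the candidates of a site at the origin and of a site near
  \<open>y\<close> with probability at least 1/2. Bounded boxes around both points are then opened
  entirely, at a cost that does not depend on \<open>N\<close>, and FKG multiplies the three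
  probabilities. For small \<open>N\<close> the whole slab box is opened.\<close>

theorem slab_percolation_of_link:
  assumes d: "3 \<le> d" and q: "1 \<le> q" and rr: "0 < r" "r < r'" and link: "link_property d q r"
  shows "\<exists>T. \<exists>c>0. \<forall>N. \<forall>x\<in>slab_box d T N. c \<le> 1 - rc_disc r' q (slab_box d T N) {origin} {x}"
proof -
  obtain \<rho> where \<rho>: "\<And>\<epsilon> s. 0 < \<epsilon> \<Longrightarrow> 0 < s \<Longrightarrow> s < 1 \<Longrightarrow> \<exists>J g k T. linked_seeds d q r \<epsilon> s \<rho> J g k T"
    using link unfolding link_property_def by blast
  obtain s where sp: "sprinkle_ok q r r' s" using sprinkle_ok_ex[OF rr q] .
  then have s01: "0 < s" "s < 1" by (auto simp: sprinkle_ok_def)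
  define \<epsilon> :: real where "\<epsilon> = (1 / 288) ^ ((2 * (\<rho> + 5) + 1)\<^sup>2) / 9"
  have \<epsilon>: "0 < \<epsilon>" by (simp add: \<epsilon>_def)
  obtain J g k T where "linked_seeds d q r \<epsilon> s \<rho> J g k T" using \<rho>[OF \<epsilon> s01] by blast
  then interpret seeds d q r \<epsilon> s \<rho> J g k T using d q rr \<epsilon> s01 by unfold_locales auto
  have few: few_bad unfolding few_bad_def by (simp add: \<epsilon>_def)
  \<comment> \<open>Sites whose cells fit into the slab box stop short of its boundary by up to
    \<open>(\<rho> + 6) * n\<close>, and a box of this radius around such a site still reaches
    \<open>y\<close>.\<close>
  define H where "H = (\<rho> + 6) * n"
  define W where "W = slab_box d T H"
  define \<kappa> where "\<kappa> = r' / (q * (1 + r'))"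
  define M where "M = card (inner W)"
  have r': "0 < r'" using rr by simp
  have \<kappa>: "0 < \<kappa>" "\<kappa> \<le> 1"
  proof -
    have "r' \<le> q * (1 + r')" using q r' mult_mono[of 1 q r' "1 + r'"] by simp
    then show "0 < \<kappa>" "\<kappa> \<le> 1" using q r' by (auto simp: \<kappa>_def)
  qed
  have finW: "finite W" unfolding W_def by (rule finite_slab_box[OF d2])
  have "\<kappa> ^ M * \<kappa> ^ M * (1 / 2) \<le> 1 - rc_disc r' q (slab_box d T N) {origin} {y}"
    if y: "y \<in> slab_box d T N" for N y
  proof -
    define V where "V = slab_box d T N"
    have finV: "finite V" unfolding V_def by (rule finite_slab_box[OF d2])
    note lsm = log_supermodular_inner[OF finV r' q]
    note conn = rc_conn_eq[OF finV r' q, of "{origin}" "{y}"]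
    have y_lat: "y \<in> lattice_points d" using y slab_box_lattice[OF d2] by auto
    have oV: "origin \<in> V" unfolding V_def by (rule origin_in_slab[OF d2])
    have pow: "\<kappa> ^ M \<le> wavg (inner V) (rc_weight r' q) (\<lambda>\<omega>. of_bool (F \<subseteq> \<omega>))"
      if "F \<subseteq> inner V" "card F \<le> M" for F
    proof -
      have "\<kappa> ^ M \<le> \<kappa> ^ card F" using \<kappa> that by (intro power_decreasing) auto
      also have "\<dots> \<le> wavg (inner V) (rc_weight r' q) (\<lambda>\<omega>. of_bool (F \<subseteq> \<omega>))"
        unfolding \<kappa>_def by (rule rc_all_open_ge[OF finV that(1) r' q])
      finally show ?thesis .
    qed
    show ?thesis
    proof (cases "N \<le> H")
      case True
      have "V \<subseteq> W" unfolding V_def W_def by (rule slab_box_mono[OF d2 True])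
      then have card: "card (inner V) \<le> M" unfolding M_def
        by (intro card_mono finite_inner finW inner_mono)
      have "linked (inner V) origin y"
        using oV y y_lat lattice_origin linked_ibox unfolding V_def slab_box_ibox[OF d2] by blast
      then have "meets \<omega> {origin} {y}" if "inner V \<subseteq> \<omega>" for \<omega>
        using linked_mono[OF _ that] by (auto simp: meets_def)
      then have "wavg (inner V) (rc_weight r' q) (\<lambda>\<omega>. of_bool (inner V \<subseteq> \<omega>))
          \<le> wavg (inner V) (rc_weight r' q) (\<lambda>\<omega>. of_bool (meets \<omega> {origin} {y}))"
        by (intro wavg_mono[OF lsm]) auto
      then have "\<kappa> ^ M \<le> 1 - rc_disc r' q V {origin} {y}" using pow[OF order_refl card] conn by linarith
      moreover have "\<kappa> ^ M * \<kappa> ^ M * (1 / 2) \<le> \<kappa> ^ M"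
      proof -
        have "\<kappa> ^ M \<le> 1" "0 \<le> \<kappa> ^ M" using \<kappa> by (simp_all add: power_le_one)
        then have "\<kappa> ^ M * \<kappa> ^ M * (1 / 2) \<le> \<kappa> ^ M * 1 * 1" by (intro mult_mono) simp_all
        then show ?thesis by simp
      qed
      ultimately show ?thesis by (simp add: V_def)
    next
      case False
      \<comment> \<open>Sites within sup-distance \<open>m\<close> have their cells in the slab box;
        \<open>f\<close> rounds a coordinate towards zero in units of \<open>n\<close> and truncates
        the result at \<open>m\<close>.\<close>
      define m where "m = int (N div n) - int (\<rho> + 5)"
      define f where "f t = sgn t * min (\<bar>t\<bar> div int n) m" for t
      have n1: "0 < int n" using n_pos by simp
      have Nn: "int n * int (N div n) \<le> int N" "int N < int n * int (N div n) + int n"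
      proof -
        have "n * (N div n) \<le> N" "N < n * (N div n) + n"
          using dividend_less_times_div[OF n_pos, of N] by simp_all
        then have "int (n * (N div n)) \<le> int N" "int N < int (n * (N div n) + n)"
          by (simp_all only: of_nat_le_iff of_nat_less_iff)
        then show "int n * int (N div n) \<le> int N" "int N < int n * int (N div n) + int n" by simp_all
      qed
      have m0: "0 \<le> m"
      proof -
        have "n * (\<rho> + 6) < N" using False by (simp add: H_def mult.commute not_le)
        then have "int (n * (\<rho> + 6)) < int N" by (simp only: of_nat_less_iff)
        then have "int n * int (\<rho> + 6) < int N" by (simp only: of_nat_mult)
        then have "int n * int (\<rho> + 6) < int n * (int (N div n) + 1)" using Nn by (simp add: algebra_simps)
        then have "int (\<rho> + 6) < int (N div n) + 1" using n1 by (simp only: mult_less_cancel_left_pos)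
        then show ?thesis by (simp add: m_def)
      qed
      have mN: "int n * m + int ((\<rho> + 5) * n) \<le> int N" using Nn by (simp add: m_def algebra_simps)
      have f: "\<bar>f t\<bar> \<le> m" "\<bar>t - int n * f t\<bar> \<le> int H" if t: "\<bar>t\<bar> \<le> int N" for t
      proof -
        have fa: "0 \<le> min (\<bar>t\<bar> div int n) m" using m0 n1 by (simp add: pos_imp_zdiv_nonneg_iff)
        then show "\<bar>f t\<bar> \<le> m" by (auto simp: f_def abs_mult sgn_if m0)
        define D where "D = \<bar>t\<bar> div int n"
        have eq: "\<bar>t - int n * f t\<bar> = \<bar>\<bar>t\<bar> - int n * min D m\<bar>"
          using m0 by (auto simp: f_def sgn_if D_def)
        have D: "int n * D \<le> \<bar>t\<bar>" "\<bar>t\<bar> < int n * D + int n"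
          unfolding D_def
          using mult_div_mod_eq[of "int n" "\<bar>t\<bar>"] pos_mod_sign[OF n1, of "\<bar>t\<bar>"] pos_mod_bound[OF n1, of "\<bar>t\<bar>"]
          by linarith+
        show "\<bar>t - int n * f t\<bar> \<le> int H"
        proof (cases "D \<le> m")
          case True
          have "int n \<le> int H" unfolding of_nat_le_iff by (simp add: H_def)
          then show ?thesis using D unfolding eq min_absorb1[OF True] by linarith
        next
          case False
          then have h1: "int n * m \<le> int n * D" by (intro mult_left_mono) auto
          have h2: "\<bar>t\<bar> - int n * m \<le> int H" using t Nn by (simp add: m_def H_def algebra_simps)
          have "min D m = m" using False by simp
          then show ?thesis using D(1) h1 h2 unfolding eq by presburger
        qed
      qed
      have cells: "cell z \<subseteq> V" if "\<bar>fst z\<bar> \<le> m" "\<bar>snd z\<bar> \<le> m" for z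
      proof -
        have "\<bar>int n * fst z\<bar> \<le> int n * m" "\<bar>int n * snd z\<bar> \<le> int n * m"
          using that by (simp_all add: abs_mult mult_left_mono)
        then show ?thesis unfolding cell_def V_def using mN by (intro shift_slab_subset d2) linarith+
      qed
      have ybound: "\<bar>y (d - 2)\<bar> \<le> int N" "\<bar>y (d - 1)\<bar> \<le> int N"
      proof -
        have "\<bar>y i\<bar> \<le> slab_corner d T N i" for i using y unfolding slab_box_iff[OF d2] by blast
        moreover have "Suc (Suc (d - 2)) = d" "Suc (d - 1) = d" using d by simp_all
        then have "slab_corner d T N (d - 2) = int N" "slab_corner d T N (d - 1) = int N"
          using d by (simp_all add: slab_corner_def)
        ultimately show "\<bar>y (d - 2)\<bar> \<le> int N" "\<bar>y (d - 1)\<bar> \<le> int N" by metis+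
      qed
      define x where "x = (f (y (d - 2)), f (y (d - 1)))"
      have xm: "\<bar>fst x\<bar> \<le> m" "\<bar>snd x\<bar> \<le> m" using f(1) ybound by (auto simp: x_def)
      \<comment> \<open>The translate of \<open>W\<close> may stick out of the slab box. The
        intersection of two boxes is again a box, so it stays connected.\<close>
      define V1 where "V1 = V \<inter> shift (lat d (int n * fst x) (int n * snd x)) ` W"
      have cellW: "cell z \<subseteq> shift (lat d (int n * fst z) (int n * snd z)) ` W" for z
        unfolding cell_def W_def H_def by (intro image_mono slab_box_mono d2) simp
      have c1: "all_cands x \<subseteq> V1" unfolding V1_def
        using all_cands_in_cell[of x] cells[OF xm] cellW[of x] by blast
      have yV1: "y \<in> V1"
      proof -
        have "shift (\<lambda>i. - lat d (int n * fst x) (int n * snd x) i) y \<in> W"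
          unfolding W_def slab_box_iff[OF d2]
        proof
          fix i
          have "\<bar>y i\<bar> \<le> slab_corner d T N i" using y by (simp add: slab_box_iff[OF d2])
          moreover have "i + 2 = d \<Longrightarrow> i = d - 2" "i + 1 = d \<Longrightarrow> i = d - 1" by auto
          ultimately show "\<bar>shift (\<lambda>i. - lat d (int n * fst x) (int n * snd x) i) y i\<bar> \<le> slab_corner d T H i"
            using f(2)[OF ybound(1)] f(2)[OF ybound(2)] d
            by (cases "i + 2 = d"; cases "i + 1 = d") (auto simp: shift_def lat_def slab_corner_def x_def split: if_splits)
        qed
        then show ?thesis using y by (simp add: V1_def V_def shift_image_iff)
      qed
      have V0: "W \<subseteq> V" unfolding V_def W_def using False by (intro slab_box_mono d2) simp
      have c0: "all_cands (0, 0) \<subseteq> W"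
        using all_cands_in_cell[of "(0, 0)"] cellW[of "(0, 0)"] by (auto simp: lat_0)
      let ?o0 = "\<lambda>\<omega>. of_bool (inner W \<subseteq> \<omega>) :: real" and ?o1 = "\<lambda>\<omega>. of_bool (inner V1 \<subseteq> \<omega>) :: real"
      let ?mt = "\<lambda>\<omega>. of_bool (meets \<omega> (all_cands (0, 0)) (all_cands x)) :: real"
      have "card (inner V1) \<le> card (inner (shift (lat d (int n * fst x) (int n * snd x)) ` W))"
        unfolding V1_def using finW by (intro card_mono finite_inner inner_mono) auto
      also have "\<dots> = M" unfolding M_def inner_shift
        by (rule card_image) (auto intro!: inj_onI simp: inj_image_eq_iff[OF inj_shift])
      finally have p1: "\<kappa> ^ M \<le> wavg (inner V) (rc_weight r' q) ?o1"
        by (intro pow inner_mono) (auto simp: V1_def)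
      have p0: "\<kappa> ^ M \<le> wavg (inner V) (rc_weight r' q) ?o0" using V0 by (intro pow inner_mono) (auto simp: M_def)
      have "rc_disc r' q V (all_cands (0, 0)) (all_cands x) \<le> 4 / 15"
        using rc_disc_sprinkle[OF finV q sp] two_point_prob[OF few finV xm cells] by (rule order_trans)
      then have pm: "1 / 2 \<le> wavg (inner V) (rc_weight r' q) ?mt" using rc_conn_eq[OF finV r' q] by simp
      have mono: "mono_on (Pow (inner V)) ?o0" "mono_on (Pow (inner V)) ?o1" "mono_on (Pow (inner V)) ?mt"
        by (rule mono_on_all_open mono_on_meets)+
      have mono01: "mono_on (Pow (inner V)) (\<lambda>\<omega>. ?o0 \<omega> * ?o1 \<omega>)"
        by (intro monotone_onI) (simp add: of_bool_def, blast)
      have "\<kappa> ^ M * \<kappa> ^ M * (1 / 2)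
          \<le> wavg (inner V) (rc_weight r' q) ?o0 * wavg (inner V) (rc_weight r' q) ?o1 * wavg (inner V) (rc_weight r' q) ?mt"
        using p0 p1 pm \<kappa> by (intro mult_mono mult_nonneg_nonneg wavg_nonneg[OF lsm]) auto
      also have "\<dots> \<le> wavg (inner V) (rc_weight r' q) (\<lambda>\<omega>. ?o0 \<omega> * ?o1 \<omega>) * wavg (inner V) (rc_weight r' q) ?mt"
        using pm by (intro mult_right_mono fkg_mono[OF lsm mono(1) _ mono(2)]) auto
      also have "\<dots> \<le> wavg (inner V) (rc_weight r' q) (\<lambda>\<omega>. ?o0 \<omega> * ?o1 \<omega> * ?mt \<omega>)"
        by (intro fkg_mono[OF lsm mono01 _ mono(3)]) auto
      also have "\<dots> \<le> wavg (inner V) (rc_weight r' q) (\<lambda>\<omega>. of_bool (meets \<omega> {origin} {y}))"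
      proof (rule wavg_mono[OF lsm])
        fix \<omega>
        have "meets \<omega> {origin} {y}" if op: "inner W \<subseteq> \<omega>" "inner V1 \<subseteq> \<omega>"
          and mt: "meets \<omega> (all_cands (0, 0)) (all_cands x)"
        proof -
          obtain a b where ab: "a \<in> all_cands (0, 0)" "b \<in> all_cands x" "linked \<omega> a b" using mt by (auto simp: meets_def)
          have "a \<in> W" using ab(1) c0 by blast
          moreover have "a \<in> lattice_points d" using \<open>a \<in> W\<close> slab_box_lattice[OF d2] unfolding W_def by blast
          ultimately have "linked (inner W) origin a"
            using origin_in_slab[OF d2, of T H] lattice_origin
            unfolding W_def slab_box_ibox[OF d2] by (intro linked_ibox[where d = d]) auto
          then have "linked \<omega> origin a" using op(1) by (rule linked_mono)
          moreover have "linked (inner V1) b y"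
            using ab(2) c1 yV1 unfolding V1_def V_def W_def by (intro linked_slab_shift[OF d2]) auto
          then have "linked \<omega> b y" using op(2) by (rule linked_mono)
          ultimately have "linked \<omega> origin y" using linked_trans[OF linked_trans[OF _ ab(3)]] by blast
          then show ?thesis by (simp add: meets_def)
        qed
        then show "?o0 \<omega> * ?o1 \<omega> * ?mt \<omega> \<le> (of_bool (meets \<omega> {origin} {y}) :: real)"
          by (auto simp: of_bool_def)
      qed
      finally show ?thesis using conn by (simp add: V_def)
    qed
  qed
  moreover have "0 < \<kappa> ^ M * \<kappa> ^ M * (1 / 2)" using \<kappa> by simp
  ultimately show ?thesis by blast
qed

section \<open>Exponentially unlikely disconnection from the link property\<close>

text \<open>A vertical strip, thickened by \<open>T\<close> in the first \<open>d - 2\<close>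
  coordinates. Its half-height \<open>2 * L\<close> leaves room for paths that start below
  \<open>- L\<close> and end above \<open>L\<close>.\<close>

definition slice_corner :: "nat \<Rightarrow> nat \<Rightarrow> nat \<Rightarrow> vertex" where
  "slice_corner d T L = (\<lambda>i. if i + 2 < d then int T else if i + 2 = d then int L
    else if i + 1 = d then 2 * int L else 0)"

definition slice :: "nat \<Rightarrow> nat \<Rightarrow> nat \<Rightarrow> vertex set" where
  "slice d T L = {x. \<forall>i. \<bar>x i\<bar> \<le> slice_corner d T L i}"

lemma slice_ibox: "slice d T L = ibox (\<lambda>i. - slice_corner d T L i) (slice_corner d T L)"
  by (auto simp: slice_def ibox_def abs_le_iff) (smt (verit))+

lemma finite_slice: "finite (slice d T L)"
  unfolding slice_ibox by (rule finite_ibox[of _ d]) (auto simp: lattice_points_iff slice_corner_def)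

definition slice_low :: "nat \<Rightarrow> nat \<Rightarrow> nat \<Rightarrow> vertex set" where
  "slice_low d T L = {x \<in> slice d T L. x (d - 1) \<le> - int L}"

definition slice_high :: "nat \<Rightarrow> nat \<Rightarrow> nat \<Rightarrow> vertex set" where
  "slice_high d T L = {x \<in> slice d T L. int L \<le> x (d - 1)}"

context seeds
begin

text \<open>A crossing of \<open>2 * a + 1\<close> by \<open>2 * b + 1\<close> sites is blocked only
  by a star-path of bad sites from the left to the right side, with \<open>2 * b\<close> possible
  starting points. The conditions on \<open>a\<close> and \<open>b\<close> keep the cells in the
  slice and put the candidates of the two extreme rows beyond the heights \<open>- L\<close> and
  \<open>L\<close>.\<close>

lemma crossing_prob:
  fixes a b L :: nat
  assumes few_bad and a: "int n * int a + int ((\<rho> + 5) * n) \<le> int L"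
    and b: "int n * int b + int ((\<rho> + 5) * n) \<le> 2 * int L" "int L + int n \<le> int n * int b"
    and sp: "sprinkle_ok q r r' s"
  shows "rc_disc r' q (slice d T L) (slice_low d T L) (slice_high d T L) \<le> 2 * real b * (1 / 16) ^ (2 * a + 1)"
proof -
  define V where "V = slice d T L"
  have V: "finite V" unfolding V_def by (rule finite_slice)
  define \<tau> :: "site \<Rightarrow> site" where "\<tau> u = (fst u - int a, snd u - int b)" for u
  have iso: "isometry \<tau>" by (auto simp: isometry_def \<tau>_def site_dist_def)
  let ?I = "\<tau> ` rect (2 * a) (2 * b)"
  have I: "\<bar>fst y\<bar> \<le> int a \<and> \<bar>snd y\<bar> \<le> int b" if "y \<in> ?I" for y
    using that by (auto simp: \<tau>_def rect_def)
  have in_cell: "\<bar>z i\<bar> \<le> slice_corner d T L i" if z: "z \<in> cell y" and y: "\<bar>fst y\<bar> \<le> int a" "\<bar>snd y\<bar> \<le> int b" for z y i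
  proof -
    have ny: "\<bar>int n * fst y\<bar> \<le> int n * int a" "\<bar>int n * snd y\<bar> \<le> int n * int b"
      using y by (simp_all add: abs_mult mult_left_mono)
    obtain w where w: "z = shift (lat d (int n * fst y) (int n * snd y)) w" "\<And>i. \<bar>w i\<bar> \<le> slab_corner d T ((\<rho> + 5) * n) i"
      using z unfolding cell_def by (auto simp: slab_box_iff[OF d2])
    show ?thesis using w(2)[of i] ny a b(1) unfolding w(1) shift_def lat_def slice_corner_def slab_corner_def
      by (auto split: if_splits)
  qed
  have cells: "cell y \<subseteq> V" if "y \<in> ?I" for y
    using in_cell I[OF that] unfolding V_def slice_def by blast
  have height: "\<bar>z (d - 1) - int n * snd y\<bar> \<le> int n" if z: "z \<in> all_cands y" for z y
  proof -
    obtain i w where w: "z = shift (lat d (int n * fst y + int (i * g)) (int n * snd y)) w" "w \<in> J"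
      using z unfolding all_cands_def cand_def by blast
    have "\<bar>w (d - 1)\<bar> \<le> slab_corner d T n (d - 1)" using J(2) w(2) by (auto simp: slab_box_iff[OF d2])
    then show ?thesis using d by (simp add: w(1) shift_def lat_def slab_corner_def)
  qed
  let ?C = "\<lambda>k \<omega> \<eta>. \<exists>X\<in>contour_sets (2 * (\<rho> + 5)) (\<tau> (0, int k)) (2 * a). X \<subseteq> ?I \<and> (\<forall>x\<in>X. bad \<omega> \<eta> x)"
  have "rc_disc r' q V (slice_low d T L) (slice_high d T L)
      \<le> joint (inner V) s r q (\<lambda>\<omega> \<eta>. of_bool (\<not> meets (\<omega> \<union> \<eta>) (slice_low d T L) (slice_high d T L)))"
    by (rule rc_disc_sprinkle[OF V q sp])
  also have "\<dots> \<le> joint (inner V) s r q (\<lambda>\<omega> \<eta>. \<Sum>k\<in>{1..2 * b}. of_bool (?C k \<omega> \<eta>))"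
  proof (rule joint_mono[OF pair_set_inner[OF V] s r q])
    fix \<omega> \<eta>
    show "of_bool (\<not> meets (\<omega> \<union> \<eta>) (slice_low d T L) (slice_high d T L))
        \<le> (\<Sum>k\<in>{1..2 * b}. of_bool (?C k \<omega> \<eta>) :: real)"
    proof (cases "\<exists>k\<in>{1..2 * b}. ?C k \<omega> \<eta>")
      case True
      then obtain k where k: "k \<in> {1..2 * b}" "?C k \<omega> \<eta>" by blast
      have "of_bool (\<not> meets (\<omega> \<union> \<eta>) (slice_low d T L) (slice_high d T L)) \<le> (1 :: real)" by simp
      also have "1 = (of_bool (?C k \<omega> \<eta>) :: real)" using k by simp
      also have "\<dots> \<le> (\<Sum>k\<in>{1..2 * b}. of_bool (?C k \<omega> \<eta>))" by (rule member_le_sum) (use k in auto)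
      finally show ?thesis .
    next
      case False
      then obtain i i' where ii: "i \<le> 2 * a" "i' \<le> 2 * a"
        "(\<tau> (int i, 0), \<tau> (int i', int (2 * b))) \<in> (good_steps (bad \<omega> \<eta>) ?I)\<^sup>*"
        using peierls_crossing[OF iso, of "2 * a" "2 * b" "bad \<omega> \<eta>" "2 * (\<rho> + 5)"] by blast
      have t: "\<tau> (int i, 0) \<in> ?I" "\<tau> (int i', int (2 * b)) \<in> ?I" using ii by (auto simp: rect_def)
      have "all_cands (\<tau> (int i, 0)) \<subseteq> slice_low d T L"
      proof
        fix z assume z: "z \<in> all_cands (\<tau> (int i, 0))"
        then have "z \<in> V" using all_cands_in_cell cells[OF t(1)] by blast
        moreover have "\<bar>z (d - 1) + int n * int b\<bar> \<le> int n" using height[OF z] by (simp add: \<tau>_def)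
        ultimately show "z \<in> slice_low d T L" using b(2) by (simp add: slice_low_def V_def)
      qed
      moreover have "all_cands (\<tau> (int i', int (2 * b))) \<subseteq> slice_high d T L"
      proof
        fix z assume z: "z \<in> all_cands (\<tau> (int i', int (2 * b)))"
        then have "z \<in> V" using all_cands_in_cell cells[OF t(2)] by blast
        moreover have "\<bar>z (d - 1) - int n * int b\<bar> \<le> int n" using height[OF z] by (simp add: \<tau>_def)
        ultimately show "z \<in> slice_high d T L" using b(2) by (simp add: slice_high_def V_def)
      qed
      ultimately have "meets (\<omega> \<union> \<eta>) (slice_low d T L) (slice_high d T L)"
        by (rule meets_mono[OF good_steps_meets[OF ii(3)] order_refl])
      then show ?thesis by (simp add: sum_nonneg)
    qed
  qed
  also have "\<dots> \<le> (\<Sum>k\<in>{1..2 * b}. (1 / 16) ^ (2 * a + 1))"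
    unfolding joint_sum by (intro sum_mono contour_prob assms(1) V cells)
  finally show ?thesis by (simp add: V_def)
qed

end

text \<open>A discrete intermediate value theorem: one edge changes a coordinate by at most
  1.\<close>

lemma linked_intermediate:
  assumes "linked \<omega> x y" "\<omega> \<subseteq> inner V" "x i \<le> c" "c \<le> y i"
  shows "\<exists>z. z i = c \<and> linked \<omega> x z \<and> linked \<omega> z y"
proof -
  have "c \<le> y i \<longrightarrow> (\<exists>z. z i = c \<and> linked \<omega> x z)"
    using assms(1)
  proof (induction rule: linked_induct)
    case refl
    then show ?case using assms(3) by (auto intro!: exI[of _ x])
  next
    case (step y z)
    show ?case
    proof
      assume c: "c \<le> z i"
      show "\<exists>z. z i = c \<and> linked \<omega> x z"
      proof (cases "c \<le> y i")
        case False
        have "neighbours y z" using step.hyps(2) assms(2) inner_edge_iff by blast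
        then obtain j where "\<bar>y j - z j\<bar> = 1" "\<forall>k. k \<noteq> j \<longrightarrow> y k = z k" by (auto simp: neighbours_def)
        then have "z i \<le> y i + 1" by (cases "i = j") auto
        then have "z i = c" using c False by simp
        then show ?thesis using linked_trans[OF step.hyps(1) linked_edge[OF step.hyps(2)]] by blast
      qed (use step.IH in blast)
    qed
  qed
  then obtain z where z: "z i = c" "linked \<omega> x z" using assms(4) by blast
  then show ?thesis using linked_trans[OF linked_sym[OF z(2)] assms(1)] by blast
qed

lemma cube_ibox:
  "cube d N = ibox (\<lambda>i. if i < d then - N else 0) (\<lambda>i. if i < d then N else 0)"
proof (intro set_eqI iffI)
  fix x assume "x \<in> ibox (\<lambda>i. if i < d then - N else 0) (\<lambda>i. if i < d then N else 0)"
  then have x: "(if i < d then - N else 0) \<le> x i \<and> x i \<le> (if i < d then N else 0)" for i by (auto simp: ibox_def)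
  have "x i = 0" if "i \<ge> d" for i using x[of i] that by simp
  moreover have "x i \<in> {- N..N}" if "i < d" for i using x[of i] that by simp
  ultimately show "x \<in> cube d N" by (simp add: cube_def lattice_points_iff)
qed (auto simp: ibox_def cube_def lattice_points_iff)

lemma cube_corners: "(\<lambda>i. if i < d then - N else 0) \<in> lattice_points d" "(\<lambda>i. if i < d then N else 0) \<in> lattice_points d"
  by (auto simp: lattice_points_iff)

lemma finite_cube: "finite (cube d N)"
  unfolding cube_ibox by (rule finite_ibox[OF cube_corners])

text \<open>Slices at different positions in the first \<open>d - 2\<close> coordinates are disjoint, and each of them
  offers the bottom and the top an independent chance to be linked.\<close>

lemma stacked_slices:
  assumes d: "3 \<le> d" and q: "1 \<le> q" and r: "0 < r" and h: "h * (2 * T + 1) \<le> 2 * L + 1"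
  shows "rc_disc r q (cube d (2 * int L)) (bottom_side d (int L) (int L)) (top_side d (int L) (int L))
    \<le> rc_disc r q (slice d T L) (slice_low d T L) (slice_high d T L) ^ (h ^ (d - 2))"
proof -
  define \<Lambda> where "\<Lambda> = cube d (2 * int L)"
  have fin: "finite \<Lambda>" unfolding \<Lambda>_def by (rule finite_cube)
  \<comment> \<open>In the first \<open>d - 2\<close> coordinates the centres start at
    \<open>- L + T\<close> and have spacing \<open>2 * T + 1\<close>, so that slices of half-width
    \<open>T\<close> are disjoint and stay within \<open>L\<close> in absolute value.\<close>
  define c :: "(nat \<Rightarrow> nat) \<Rightarrow> vertex"
    where "c t = (\<lambda>i. if i + 2 < d then - int L + int T + int (2 * T + 1) * int (t i) else 0)" for t
  define Ix where "Ix = PiE {..<d - 2} (\<lambda>_. {..<h})"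
  define S where "S t = shift (c t) ` slice d T L" for t
  define lo hi where "lo t = shift (c t) ` slice_low d T L" and "hi t = shift (c t) ` slice_high d T L" for t
  have finIx: "finite Ix" "card Ix = h ^ (d - 2)" unfolding Ix_def by (auto intro: finite_PiE simp: card_PiE)
  have S_iff: "x \<in> S t \<longleftrightarrow> (\<forall>i. \<bar>x i - c t i\<bar> \<le> slice_corner d T L i)" for x t
    unfolding S_def shift_image_iff slice_def mem_Collect_eq by (simp add: shift_def)
  have SD: "\<bar>x i - c t i\<bar> \<le> slice_corner d T L i" if "x \<in> S t" for x t i using that S_iff by blast
  have coords: "\<bar>x i\<bar> \<le> int L" if x: "x \<in> S t" and t: "t \<in> Ix" and i: "i + 1 < d" for x t i
  proof (cases "i + 2 < d")
    case True
    then have "t i < h" using PiE_mem[OF t[unfolded Ix_def], of i] by simp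
    then have "(t i + 1) * (2 * T + 1) \<le> h * (2 * T + 1)" by (intro mult_right_mono) auto
    then have "(t i + 1) * (2 * T + 1) \<le> 2 * L + 1" using h by linarith
    then have "int ((t i + 1) * (2 * T + 1)) \<le> int (2 * L + 1)" by (simp only: of_nat_le_iff)
    then have "int (2 * T + 1) * int (t i) \<le> 2 * int L - 2 * int T" by (simp add: algebra_simps)
    moreover have "0 \<le> int (2 * T + 1) * int (t i)" by simp
    moreover have "\<bar>x i - (- int L + int T + int (2 * T + 1) * int (t i))\<bar> \<le> int T"
      using SD[OF x, of i] True by (simp add: c_def slice_corner_def)
    ultimately show ?thesis by linarith
  next
    case False
    then have "i + 2 = d" using i by simp
    then show ?thesis using SD[OF x, of i] by (simp add: c_def slice_corner_def)
  qed
  have top_coord: "x (d - 1) = y (d - 1)" if "x = shift (c t) y" for x y t using that d by (simp add: shift_def c_def)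
  have zero: "x i = 0" if "x \<in> S t" "i \<ge> d" for x t i
    using SD[OF that(1), of i] that(2) by (simp add: c_def slice_corner_def)
  have sub: "S t \<subseteq> \<Lambda>" if t: "t \<in> Ix" for t
  proof
    fix x assume x: "x \<in> S t"
    have "\<bar>x i\<bar> \<le> 2 * int L" if "i < d" for i
    proof (cases "i + 1 < d")
      case False
      then have "i + 1 = d" using that by simp
      then show ?thesis using SD[OF x, of i] by (simp add: c_def slice_corner_def)
    qed (use coords[OF x t, of i] in simp)
    then have "x i \<in> {- (2 * int L)..2 * int L}" if "i < d" for i using that unfolding atLeastAtMost_iff abs_le_iff by fastforce
    then show "x \<in> \<Lambda>" using zero[OF x] by (simp add: \<Lambda>_def cube_def lattice_points_iff)
  qed
  have disj: "S t \<inter> S t' = {}" if t: "t \<in> Ix" "t' \<in> Ix" "t \<noteq> t'" for t t'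
  proof -
    obtain i where i: "i < d - 2" "t i \<noteq> t' i" using t unfolding Ix_def by (metis PiE_ext lessThan_iff)
    have False if x: "x \<in> S t" "x \<in> S t'" for x
    proof -
      have "\<bar>x i - c t i\<bar> \<le> int T" "\<bar>x i - c t' i\<bar> \<le> int T"
        using SD[OF x(1), of i] SD[OF x(2), of i] i(1) by (auto simp: slice_corner_def less_diff_conv)
      then have "\<bar>c t i - c t' i\<bar> \<le> 2 * int T" by linarith
      then have "\<bar>int (2 * T + 1) * (int (t i) - int (t' i))\<bar> \<le> 2 * int T"
      proof -
        have "i + 2 < d" using i(1) by simp
        then show ?thesis using \<open>\<bar>c t i - c t' i\<bar> \<le> 2 * int T\<close> by (simp add: c_def algebra_simps)
      qed
      then have "int (2 * T + 1) * \<bar>int (t i) - int (t' i)\<bar> \<le> 2 * int T" by (simp only: abs_mult abs_of_nat)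
      moreover have "1 \<le> \<bar>int (t i) - int (t' i)\<bar>" using i(2) by linarith
      then have "int (2 * T + 1) * 1 \<le> int (2 * T + 1) * \<bar>int (t i) - int (t' i)\<bar>" by (intro mult_left_mono) auto
      ultimately have "int (2 * T + 1) * 1 \<le> 2 * int T" by (rule order_trans[rotated])
      then show False by simp
    qed
    then show ?thesis by blast
  qed
  have cross: "meets \<omega> (bottom_side d (int L) (int L)) (top_side d (int L) (int L))"
    if t: "t \<in> Ix" and m: "meets (\<omega> \<inter> inner (S t)) (lo t) (hi t)" for \<omega> t
  proof -
    let ?\<omega> = "\<omega> \<inter> inner (S t)"
    obtain a b where ab: "a \<in> lo t" "b \<in> hi t" "linked ?\<omega> a b" using m by (auto simp: meets_def)
    have aS: "a \<in> S t" "a (d - 1) \<le> - int L" using ab(1) top_coord by (auto simp: lo_def slice_low_def S_def)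
    have bS: "int L \<le> b (d - 1)" using ab(2) top_coord by (auto simp: hi_def slice_high_def)
    \<comment> \<open>The crossing may overshoot; cutting it at the heights \<open>- L\<close> and
      \<open>L\<close> gives vertices on the two sides themselves.\<close>
    obtain z where z: "z (d - 1) = - int L" "linked ?\<omega> a z" "linked ?\<omega> z b"
      using linked_intermediate[OF ab(3), of "S t" "d - 1" "- int L"] aS bS by auto
    obtain z' where z': "z' (d - 1) = int L" "linked ?\<omega> z z'"
      using linked_intermediate[OF z(3), of "S t" "d - 1" "int L"] z(1) bS by auto
    have zS: "z \<in> S t" by (rule linked_inner_mem[OF z(2) _ aS(1)]) simp
    have zS': "z' \<in> S t" by (rule linked_inner_mem[OF z'(2) _ zS]) simp
    have side: "(\<forall>i<d - 1. w i \<in> {- int L..int L}) \<and> w \<in> lattice_points d" if w: "w \<in> S t" for w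
    proof -
      have "w i \<in> {- int L..int L}" if i: "i < d - 1" for i
      proof -
        have "i + 1 < d" using i by simp
        from coords[OF w t this] show ?thesis by auto
      qed
      then show ?thesis using zero[OF w] by (simp add: lattice_points_iff)
    qed
    have "z \<in> bottom_side d (int L) (int L)" "z' \<in> top_side d (int L) (int L)"
      using side[OF zS] side[OF zS'] z(1) z'(1) by (auto simp: bottom_side_def top_side_def)
    moreover have "linked \<omega> z z'" using z'(2) by (rule linked_mono) simp
    ultimately show ?thesis by (auto simp: meets_def)
  qed
  note lsm = log_supermodular_inner[OF fin r q]
  let ?b = "rc_disc r q (slice d T L) (slice_low d T L) (slice_high d T L)"
  have "rc_disc r q \<Lambda> (bottom_side d (int L) (int L)) (top_side d (int L) (int L))
      \<le> wavg (inner \<Lambda>) (rc_weight r q) (\<lambda>\<omega>. \<Prod>t\<in>Ix. of_bool (\<not> meets (\<omega> \<inter> inner (S t)) (lo t) (hi t)))"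
    unfolding rc_disc_def
  proof (rule wavg_mono[OF lsm])
    fix \<omega>
    show "of_bool (\<not> meets \<omega> (bottom_side d (int L) (int L)) (top_side d (int L) (int L)))
        \<le> (\<Prod>t\<in>Ix. of_bool (\<not> meets (\<omega> \<inter> inner (S t)) (lo t) (hi t)) :: real)"
    proof (cases "meets \<omega> (bottom_side d (int L) (int L)) (top_side d (int L) (int L))")
      case False
      then have "(\<Prod>t\<in>Ix. of_bool (\<not> meets (\<omega> \<inter> inner (S t)) (lo t) (hi t)) :: real) = 1"
        using cross by (intro prod.neutral) auto
      then show ?thesis by simp
    qed (simp add: prod_nonneg)
  qed
  also have "\<dots> \<le> (\<Prod>t\<in>Ix. ?b)"
  proof (rule wavg_prod_le[OF lsm finIx(1), where g = "\<lambda>t \<omega>. of_bool (\<not> meets \<omega> (lo t) (hi t))"])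
    show "inner (S t) \<subseteq> inner \<Lambda>" if "t \<in> Ix" for t using sub[OF that] by (rule inner_mono)
    show "disjoint_family_on (\<lambda>t. inner (S t)) Ix"
      unfolding disjoint_family_on_def using disj inner_disjoint by blast
    show "wavg (inner (S t)) (rc_weight r q) (\<lambda>\<omega>. of_bool (\<not> meets \<omega> (lo t) (hi t))) \<le> ?b" for t
      using rc_disc_shift[of r q "c t" "slice d T L" "slice_low d T L" "slice_high d T L"]
      by (simp add: rc_disc_def S_def lo_def hi_def)
  qed (auto intro: antimono_not_meets)
  also have "\<dots> = ?b ^ (h ^ (d - 2))" using finIx by simp
  finally show ?thesis by (simp add: \<Lambda>_def)
qed

text \<open>The exponent is \<open>a * h ^ (d - 2)\<close>: a slice fails with probability
  exponentially small in its width \<open>a\<close> in units of \<open>n\<close>, and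
  \<open>h ^ (d - 2)\<close> slices fit. Both \<open>a\<close> and \<open>h\<close> are of order
  \<open>L\<close>.\<close>

theorem disconnection_of_link:
  assumes d: "3 \<le> d" and q: "1 \<le> q" and rr: "0 < r" "r < r'" and link: "link_property d q r"
  shows "\<exists>c>0. \<exists>L0. \<forall>L\<ge>L0. rc_disc r' q (cube d (2 * int L)) (bottom_side d (int L) (int L)) (top_side d (int L) (int L))
    \<le> exp (- c * real L ^ (d - 1))"
proof -
  obtain \<rho> where \<rho>: "\<And>\<epsilon> s. 0 < \<epsilon> \<Longrightarrow> 0 < s \<Longrightarrow> s < 1 \<Longrightarrow> \<exists>J g k T. linked_seeds d q r \<epsilon> s \<rho> J g k T"
    using link unfolding link_property_def by blast
  obtain s where sp: "sprinkle_ok q r r' s" using sprinkle_ok_ex[OF rr q] .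
  then have s01: "0 < s" "s < 1" by (auto simp: sprinkle_ok_def)
  define \<epsilon> :: real where "\<epsilon> = (1 / 288) ^ ((2 * (\<rho> + 5) + 1)\<^sup>2) / 9"
  have \<epsilon>: "0 < \<epsilon>" by (simp add: \<epsilon>_def)
  obtain J g k T where "linked_seeds d q r \<epsilon> s \<rho> J g k T" using \<rho>[OF \<epsilon> s01] by blast
  then interpret seeds d q r \<epsilon> s \<rho> J g k T using d q rr \<epsilon> s01 by unfold_locales auto
  have few: few_bad unfolding few_bad_def by (simp add: \<epsilon>_def)
  have r': "0 < r'" using rr by simp
  define L0 where "L0 = 2 * n * (\<rho> + 7) + 2 * T + 1"
  define c where "c = 1 / (2 * real n * (2 * real T + 1) ^ (d - 2))"
  have "rc_disc r' q (cube d (2 * int L)) (bottom_side d (int L) (int L)) (top_side d (int L) (int L))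
      \<le> exp (- c * real L ^ (d - 1))" if L: "L0 \<le> L" for L
  proof -
    \<comment> \<open>The largest half-width for which the cells stay in the slice. The
      \<open>+ 2\<close> in \<open>b\<close> below places the extreme rows beyond height
      \<open>L\<close> together with candidates of extent \<open>n\<close>.\<close>
    define a where "a = L div n - (\<rho> + 5)"
    define b where "b = L div n + 2"
    define h where "h = (2 * L + 1) div (2 * T + 1)"
    have Ln: "n * (L div n) \<le> L" "L < n * (L div n) + n"
      using dividend_less_times_div[OF n_pos, of L] by simp_all
    have big: "2 * (\<rho> + 7) \<le> L div n"
    proof -
      have "n * (2 * (\<rho> + 7)) \<le> L" using L by (simp add: L0_def algebra_simps)
      then show ?thesis using n_pos by (simp add: less_eq_div_iff_mult_less_eq mult.commute)
    qed
    have a: "a + (\<rho> + 5) = L div n" "\<rho> + 9 \<le> a" using big by (simp_all add: a_def)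
    have Ln': "n * (a + (\<rho> + 5)) \<le> L" "L < n * (a + (\<rho> + 5)) + n" using Ln unfolding a(1) by simp_all
    have bb: "b = a + (\<rho> + 7)" using a by (simp add: b_def)
    have "rc_disc r' q (slice d T L) (slice_low d T L) (slice_high d T L) \<le> 2 * real b * (1 / 16) ^ (2 * a + 1)"
    proof (rule crossing_prob[OF few _ _ _ sp])
      show "int n * int a + int ((\<rho> + 5) * n) \<le> int L"
        using Ln'(1) by (simp add: algebra_simps flip: of_nat_mult of_nat_add)
      have "n * (\<rho> + 7) \<le> n * a" using a(2) by (intro mult_left_mono) auto
      then have "n * b + (\<rho> + 5) * n \<le> 2 * L" using Ln'(1) by (simp add: bb algebra_simps)
      then show "int n * int b + int ((\<rho> + 5) * n) \<le> 2 * int L" by (simp flip: of_nat_mult of_nat_add)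
      have "L + n \<le> n * b" using Ln'(2) by (simp add: bb algebra_simps)
      then show "int L + int n \<le> int n * int b" by (simp flip: of_nat_mult of_nat_add)
    qed
    also have "\<dots> \<le> (1 / 16) ^ a"
    proof -
      \<comment> \<open>Half of the decay absorbs the number of starting points, since
        \<open>b <= 2 * a\<close> for large \<open>L\<close>.\<close>
      have "4 * real a \<le> 16 ^ a"
      proof (induction a)
        case (Suc m)
        have "4 * real (Suc m) = 4 * real m + 4 * 1" by simp
        also have "\<dots> \<le> 16 ^ m + 4 * 16 ^ m" using Suc by (intro add_mono mult_left_mono) simp_all
        also have "\<dots> \<le> 16 ^ Suc m" by simp
        finally show ?case .
      qed simp
      moreover have "2 * real b \<le> 4 * real a" using a(2) bb by simp
      ultimately have "2 * real b * (1 / 16) ^ (2 * a + 1) \<le> 16 ^ a * (1 / 16) ^ (2 * a + 1)"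
        by (intro mult_right_mono) auto
      also have "\<dots> = (16 * (1 / 16)) ^ a * (1 / 16) ^ a * (1 / 16)"
        unfolding power_mult_distrib by (simp add: power_add mult_2)
      also have "\<dots> \<le> (1 / 16) ^ a" by simp
      finally show ?thesis .
    qed
    also have "(1 / 16 :: real) ^ a \<le> exp (- 1) ^ a"
    proof (rule power_mono)
      have "exp 1 \<le> (16 :: real)" using exp_le by simp
      then show "1 / 16 \<le> exp (- 1 :: real)" by (simp add: exp_minus field_simps)
    qed simp
    also have "\<dots> = exp (- real a)" by (simp flip: exp_of_nat_mult)
    finally have slice_le: "rc_disc r' q (slice d T L) (slice_low d T L) (slice_high d T L) \<le> exp (- real a)" .
    have "rc_disc r' q (cube d (2 * int L)) (bottom_side d (int L) (int L)) (top_side d (int L) (int L))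
        \<le> rc_disc r' q (slice d T L) (slice_low d T L) (slice_high d T L) ^ (h ^ (d - 2))"
      by (rule stacked_slices[OF d q r']) (unfold h_def, rule div_times_less_eq_dividend)
    also have "\<dots> \<le> exp (- real a) ^ (h ^ (d - 2))"
      using slice_le rc_disc_nonneg[OF finite_slice r' q] by (rule power_mono)
    also have "\<dots> = exp (- (real a * real h ^ (d - 2)))" by (simp add: mult.commute flip: exp_of_nat_mult)
    also have "\<dots> \<le> exp (- c * real L ^ (d - 1))"
    proof -
      have "real L / (2 * real n) \<le> real a"
      proof -
        have "n * (\<rho> + 6) \<le> n * a" using a(2) by (intro mult_left_mono) auto
        then have "L \<le> 2 * (n * a)" using Ln'(2) by (simp add: algebra_simps)
        then have "real L \<le> 2 * (real n * real a)" by (simp flip: of_nat_mult)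
        then show ?thesis using n_pos by (simp add: field_simps)
      qed
      moreover have "real L / (2 * real T + 1) \<le> real h"
      proof -
        have "2 * L + 1 < (2 * T + 1) + h * (2 * T + 1)" unfolding h_def by (rule dividend_less_div_times) simp
        moreover have "2 * T + 1 \<le> L" using L by (simp add: L0_def)
        ultimately have "L \<le> h * (2 * T + 1)" by linarith
        then have "real L \<le> real (h * (2 * T + 1))" by (simp only: of_nat_le_iff)
        then have "real L \<le> real h * (2 * real T + 1)" by (simp add: algebra_simps)
        then show ?thesis by (simp add: field_simps)
      qed
      ultimately have "real L / (2 * real n) * (real L / (2 * real T + 1)) ^ (d - 2) \<le> real a * real h ^ (d - 2)"
        by (intro mult_mono power_mono) auto
      moreover have "real L / (2 * real n) * (real L / (2 * real T + 1)) ^ (d - 2) = c * real L ^ (d - 1)"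
      proof -
        have "d - 1 = Suc (d - 2)" using d by simp
        then show ?thesis by (simp add: c_def power_divide field_simps)
      qed
      ultimately show ?thesis by simp
    qed
    finally show ?thesis .
  qed
  moreover have "0 < c" using n_pos by (simp add: c_def)
  ultimately show ?thesis by blast
qed

section \<open>Slab percolation links seeds\<close>

definition axis :: "int \<Rightarrow> vertex" where
  "axis w = (\<lambda>i. if i = 0 then w else 0)"

text \<open>The seed is a segment transversal to \<open>K\<close> stacked slabs. In each slab a
  point of the segment is joined to its translate with probability at least \<open>c\<close>, so
  disconnection in all of them has probability at most \<open>(1 - c) ^ K\<close>: a small error is
  bought by thickness alone.\<close>

theorem link_of_slab:
  assumes d: "3 \<le> d" and q: "1 \<le> q" and r: "0 < r" and c: "0 < c"
    and slab: "\<And>N x. x \<in> slab_box d L N \<Longrightarrow> c \<le> 1 - rc_disc r q (slab_box d L N) {origin} {x}"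
  shows "link_property d q r"
  unfolding link_property_def
\<comment> \<open>Displacements in \<open>linked_seeds\<close> go up to \<open>2 * (g * k)\<close>,
  and a slab box of that width contains the displaced point; hence \<open>\<rho> = 2\<close>,
  whatever the error.\<close>
proof (rule exI[of _ 2], intro allI impI)
  fix \<epsilon> s :: real assume \<epsilon>s: "0 < \<epsilon> \<and> 0 < s \<and> s < 1"
  have d2: "2 \<le> d" using d by simp
  have "0 \<le> rc_disc r q (slab_box d L 0) {origin} {origin}" using rc_disc_nonneg[OF finite_slab_box[OF d2] r q] .
  then have c1: "0 \<le> 1 - c" using slab[OF origin_in_slab[OF d2], of 0] by linarith
  obtain K where K: "(1 - c) ^ K < \<epsilon>" using real_arch_pow_inv[of \<epsilon> "1 - c"] \<epsilon>s c by auto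
  define w where "w = 2 * int L + 1"
  define T where "T = (2 * L + 1) * K + L"
  define J where "J = ibox (\<lambda>_. 0) (axis (w * int K))"
  have w: "0 < w" by (simp add: w_def)
  have axis_lat: "axis v \<in> lattice_points d" "(\<lambda>_. 0) \<in> lattice_points d" for v
    using d by (auto simp: lattice_points_iff axis_def)
  have finJ: "finite J" unfolding J_def by (rule finite_ibox[OF axis_lat(2,1)])
  obtain k where k: "(1 - s ^ card (inner J)) ^ k < \<epsilon>"
    using real_arch_pow_inv[of \<epsilon> "1 - s ^ card (inner J)"] \<epsilon>s by auto
  define k' where "k' = Suc k"
  have J_iff: "x \<in> J \<longleftrightarrow> 0 \<le> x 0 \<and> x 0 \<le> w * int K \<and> (\<forall>i>0. x i = 0)" for x
    using w by (auto simp: J_def ibox_def axis_def split: if_splits) (metis antisym neq0_conv)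
  have Jconn: "\<forall>x\<in>J. \<forall>y\<in>J. linked (inner J) x y"
    using linked_ibox[of _ "\<lambda>_. 0" "axis (w * int K)" _ d] d
    unfolding J_def[symmetric] by (auto simp: lattice_points_iff J_iff)
  have Jslab: "J \<subseteq> slab_box d T (1 * k')"
  proof
    fix x assume x: "x \<in> J"
    have "w * int K \<le> int T" by (simp add: w_def T_def algebra_simps)
    then have "\<bar>x i\<bar> \<le> slab_corner d T (1 * k') i" for i
      using x d unfolding J_iff slab_corner_def by (cases "i = 0") auto
    then show "x \<in> slab_box d T (1 * k')" by (simp add: slab_box_iff[OF d2])
  qed
  have disj: "shift (lat d (int (i * 1)) 0) ` J \<inter> shift (lat d (int (j * 1)) 0) ` J = {}" if "i \<noteq> j" for i j
  proof -
    have "x (d - 2) = int m" if "x \<in> shift (lat d (int (m * 1)) 0) ` J" for x m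
      using that d by (auto simp: shift_def lat_def J_iff)
    then show ?thesis using \<open>i \<noteq> j\<close> by (metis disjoint_iff of_nat_eq_iff)
  qed
  have pw: "(1 - s ^ card (inner J)) ^ k' \<le> \<epsilon>"
  proof -
    have "0 \<le> 1 - s ^ card (inner J)" "1 - s ^ card (inner J) \<le> 1" using \<epsilon>s by (simp_all add: power_le_one)
    then have "(1 - s ^ card (inner J)) ^ k' \<le> (1 - s ^ card (inner J)) ^ k"
      unfolding k'_def by (intro power_decreasing) auto
    then show ?thesis using k by linarith
  qed
  have link: "rc_disc r q (slab_box d T (2 * (1 * k'))) J (shift (lat d a b) ` J) \<le> \<epsilon>"
    if ab: "\<bar>a\<bar> \<le> 2 * int (1 * k')" "\<bar>b\<bar> \<le> 2 * int (1 * k')" for a b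
  proof -
    let ?N = "2 * (1 * k')"
    define V where "V = slab_box d T ?N"
    have V: "finite V" unfolding V_def by (rule finite_slab_box[OF d2])
    define p where "p j = axis (w * int j)" for j
    define S where "S j = shift (p j) ` slab_box d L ?N" for j
    note lsm = log_supermodular_inner[OF V r q]
    have S_iff: "x \<in> S j \<longleftrightarrow> (\<forall>i. \<bar>x i - p j i\<bar> \<le> slab_corner d L ?N i)" for x j
      unfolding S_def shift_image_iff slab_box_iff[OF d2] by (simp add: shift_def)
    have sub: "S j \<subseteq> V" if j: "j < K" for j
    proof
      fix x assume x: "x \<in> S j"
      have "w * int j \<le> w * int K" using j w by (intro mult_left_mono) auto
      then have wj: "0 \<le> w * int j" "w * int j + int L \<le> int T" using w by (simp_all add: w_def T_def algebra_simps)
      have "\<bar>x i\<bar> \<le> slab_corner d T ?N i" for i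
      proof -
        have xi: "\<bar>x i - p j i\<bar> \<le> slab_corner d L ?N i" using x by (simp add: S_iff)
        have LT: "int L \<le> int T" by (simp add: T_def)
        show ?thesis
        proof (cases "i = 0")
          case True
          then show ?thesis using xi wj d by (simp add: p_def axis_def slab_corner_def)
        next
          case False
          then show ?thesis using xi LT by (auto simp: p_def axis_def slab_corner_def split: if_splits)
        qed
      qed
      then show "x \<in> V" by (simp add: V_def slab_box_iff[OF d2])
    qed
    have Sdisj: "S j \<inter> S j' = {}" if "j \<noteq> j'" for j j'
    proof -
      have False if x: "x \<in> S j" "x \<in> S j'" for x
      proof -
        have "\<bar>x 0 - w * int j\<bar> \<le> int L" "\<bar>x 0 - w * int j'\<bar> \<le> int L"
          using x(1)[unfolded S_iff, rule_format, of 0] x(2)[unfolded S_iff, rule_format, of 0] d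
          by (simp_all add: p_def axis_def slab_corner_def)
        then have "\<bar>w * (int j - int j')\<bar> \<le> 2 * int L" by (simp add: algebra_simps)
        then have "w * \<bar>int j - int j'\<bar> \<le> 2 * int L" using w by (simp add: abs_mult)
        moreover have "w * 1 \<le> w * \<bar>int j - int j'\<bar>" using \<open>j \<noteq> j'\<close> w by (intro mult_left_mono) auto
        ultimately have "w * 1 \<le> 2 * int L" by (rule order_trans[rotated])
        then show False by (simp add: w_def)
      qed
      then show ?thesis by blast
    qed
    have pJ: "p j \<in> J" if "j < K" for j
    proof -
      have "w * int j \<le> w * int K" using that w by (intro mult_left_mono) auto
      then show ?thesis using w by (simp add: J_iff p_def axis_def)
    qed
    let ?y = "\<lambda>j. shift (lat d a b) (p j)"
    have "rc_disc r q V J (shift (lat d a b) ` J)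
        \<le> wavg (inner V) (rc_weight r q) (\<lambda>\<omega>. \<Prod>j<K. of_bool (\<not> meets (\<omega> \<inter> inner (S j)) {p j} {?y j}))"
      unfolding rc_disc_def
    proof (rule wavg_mono[OF lsm])
      fix \<omega>
      show "of_bool (\<not> meets \<omega> J (shift (lat d a b) ` J))
          \<le> (\<Prod>j<K. of_bool (\<not> meets (\<omega> \<inter> inner (S j)) {p j} {?y j}) :: real)"
      proof (cases "meets \<omega> J (shift (lat d a b) ` J)")
        case False
        have "\<not> meets (\<omega> \<inter> inner (S j)) {p j} {?y j}" if "j < K" for j
          using False pJ[OF that] meets_mono[of "\<omega> \<inter> inner (S j)" "{p j}" "{?y j}" \<omega> J "shift (lat d a b) ` J"] by auto
        then have "(\<Prod>j<K. of_bool (\<not> meets (\<omega> \<inter> inner (S j)) {p j} {?y j}) :: real) = 1"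
          by (intro prod.neutral) auto
        then show ?thesis by simp
      qed (simp add: prod_nonneg)
    qed
    also have "\<dots> \<le> (\<Prod>j<K. 1 - c)"
    proof (rule wavg_prod_le[OF lsm, where g = "\<lambda>j \<omega>. of_bool (\<not> meets \<omega> {p j} {?y j})"])
      show "inner (S j) \<subseteq> inner V" if "j \<in> {..<K}" for j using sub that by (intro inner_mono) auto
      show "disjoint_family_on (\<lambda>j. inner (S j)) {..<K}"
        unfolding disjoint_family_on_def using Sdisj inner_disjoint by blast
      fix j
      have "{p j} = shift (p j) ` {origin}" "{?y j} = shift (p j) ` {lat d a b}"
        by (auto simp: shift_def origin_def)
      then have "rc_disc r q (S j) {p j} {?y j} = rc_disc r q (slab_box d L ?N) {origin} {lat d a b}"
        unfolding S_def by (simp only: rc_disc_shift)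
      also have "\<dots> \<le> 1 - c"
      proof -
        have "lat d a b \<in> slab_box d L ?N" using ab d unfolding slab_box_iff[OF d2]
          by (auto simp: lat_def slab_corner_def)
        from slab[OF this] show ?thesis by linarith
      qed
      finally show "wavg (inner (S j)) (rc_weight r q) (\<lambda>\<omega>. of_bool (\<not> meets \<omega> {p j} {?y j})) \<le> 1 - c"
        by (simp add: rc_disc_def)
    qed (auto intro: antimono_not_meets)
    also have "\<dots> \<le> \<epsilon>" using K by simp
    finally show ?thesis by (simp add: V_def)
  qed
  have "(\<lambda>_. 0) \<in> J" unfolding J_iff using w by simp
  then have "J \<noteq> {}" by blast
  then have "linked_seeds d q r \<epsilon> s 2 J 1 k' T"
    unfolding linked_seeds_def using Jslab Jconn disj pw link by (auto simp: k'_def)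
  then show "\<exists>J g k T. linked_seeds d q r \<epsilon> s 2 J g k T" by blast
qed

section \<open>Surface tension links seeds\<close>

text \<open>Flat in the last coordinate: its translates cover the bottom side, and its size of order
  \<open>K ^ (d - 1)\<close> matches the surface order of the tension.\<close>

definition tile :: "nat \<Rightarrow> nat \<Rightarrow> vertex \<Rightarrow> vertex set" where
  "tile d K z = {x. \<forall>i. \<bar>x i - z i\<bar> \<le> (if i + 1 < d then int K else 0)}"

definition far :: "nat \<Rightarrow> vertex \<Rightarrow> int \<Rightarrow> vertex set" where
  "far d z m = {b. \<exists>i<d. m \<le> \<bar>b i - z i\<bar>}"

lemma tile_shift: "shift z ` tile d K z' = tile d K (shift z z')"
  by (auto simp: set_eq_iff shift_image_iff) (simp_all add: tile_def shift_def algebra_simps)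

lemma far_shift: "shift z ` far d z' m = far d (shift z z') m"
  by (auto simp: set_eq_iff shift_image_iff) (simp_all add: far_def shift_def algebra_simps)

lemma shift_cube_superset:
  assumes "\<And>i. i < d \<Longrightarrow> \<bar>z i\<bar> + N \<le> R" "z \<in> lattice_points d"
  shows "cube d N \<subseteq> shift z ` cube d R"
proof
  fix x assume x: "x \<in> cube d N"
  have "- R \<le> x i - z i \<and> x i - z i \<le> R" if "i < d" for i
    using x assms(1)[OF that] that by (force simp: cube_def)
  then show "x \<in> shift z ` cube d R"
    unfolding shift_image_iff using x assms(2) by (simp add: cube_def lattice_points_iff shift_def)
qed

text \<open>Translated tiles cover the bottom side. By the FKG inequality the probability that the bottom is
  not linked to the top is at least the product over the tiles of the same probability.\<close>

theorem tile_far_prob: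
  fixes L K :: nat and N M R :: int
  assumes d: "3 \<le> d" and q: "1 \<le> q" and r: "0 < r" and K: "1 \<le> K" "K \<le> L" and c: "0 < c"
    and NM: "0 \<le> M" "M \<le> N" and R: "N + 2 * int L + M \<le> R"
    and disc: "rc_disc r q (cube d N) (bottom_side d (int L) M) (top_side d (int L) M) \<le> exp (- c * real L ^ (d - 1))"
  shows "rc_disc r q (cube d R) (tile d K (\<lambda>_. 0)) (far d (\<lambda>_. 0) (2 * M)) \<le> exp (- (c / 2 ^ (d - 1)) * real K ^ (d - 1))"
proof -
  define \<Lambda> where "\<Lambda> = cube d N"
  define h where "h = 2 * L div (2 * K + 1) + 1"
  define Ix where "Ix = PiE {..<d - 1} (\<lambda>_. {..<h})"
  define z :: "(nat \<Rightarrow> nat) \<Rightarrow> vertex" where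
    "z t = (\<lambda>i. if i + 1 < d then - int L + int K + int (2 * K + 1) * int (t i) else if i + 1 = d then - M else 0)" for t
  have fin: "finite \<Lambda>" unfolding \<Lambda>_def by (rule finite_cube)
  have finIx: "finite Ix" "card Ix = h ^ (d - 1)" unfolding Ix_def by (auto intro: finite_PiE simp: card_PiE)
  note lsm = log_supermodular_inner[OF fin r q]
  let ?top = "top_side d (int L) M" and ?bot = "bottom_side d (int L) M"
  have cover: "\<exists>t\<in>Ix. x \<in> tile d K (z t)" if x: "x \<in> ?bot" for x
  proof -
    define t where "t = (\<lambda>i. if i < d - 1 then nat ((x i + int L) div int (2 * K + 1)) else undefined)"
    have w: "0 < int (2 * K + 1)" by simp
    have xL: "0 \<le> x i + int L" "x i + int L \<le> 2 * int L" if "i < d - 1" for i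
      using x that by (auto simp: bottom_side_def)
    have "t \<in> Ix"
      unfolding Ix_def
    proof (rule PiE_I)
      fix i assume i: "i \<in> {..<d - 1}"
      have "(x i + int L) div int (2 * K + 1) \<le> (2 * int L) div int (2 * K + 1)"
        using xL[of i] i by (intro zdiv_mono1) auto
      also have "\<dots> = int (2 * L div (2 * K + 1))" by (simp add: zdiv_int)
      finally show "t i \<in> {..<h}" using i by (simp add: t_def h_def)
    qed (simp add: t_def)
    moreover have "\<bar>x i - z t i\<bar> \<le> (if i + 1 < d then int K else 0)" for i
    proof (cases "i + 1 < d")
      case True
      then have i: "i < d - 1" by simp
      have "0 \<le> (x i + int L) div int (2 * K + 1)" using xL[OF i] by (simp add: pos_imp_zdiv_nonneg_iff)
      then have "z t i = - int L + int K + int (2 * K + 1) * ((x i + int L) div int (2 * K + 1))"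
        using True i by (simp add: z_def t_def)
      moreover have "int (2 * K + 1) * ((x i + int L) div int (2 * K + 1)) + (x i + int L) mod int (2 * K + 1) = x i + int L"
        by (rule mult_div_mod_eq)
      moreover have "0 \<le> (x i + int L) mod int (2 * K + 1)" "(x i + int L) mod int (2 * K + 1) < int (2 * K + 1)"
        using w by (auto intro: pos_mod_sign pos_mod_bound)
      ultimately have "\<bar>x i - z t i\<bar> \<le> int K" by linarith
      then show ?thesis using True by simp
    next
      case False
      have "i = d - 1 \<or> i \<ge> d" using False by auto
      then show ?thesis using x False d by (auto simp: z_def bottom_side_def lattice_points_iff)
    qed
    then have "x \<in> tile d K (z t)" by (simp add: tile_def)
    ultimately show ?thesis by blast
  qed
  define x where "x = exp (- (c / 2 ^ (d - 1)) * real K ^ (d - 1))"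
  \<comment> \<open>A multiplicative pigeonhole: if every tile exceeded \<open>x\<close>, the
    product over the tiles would exceed the bound for the whole bottom side. The position of the
    tile found does not matter, since it is translated to the origin.\<close>
  have "\<exists>t\<in>Ix. rc_disc r q \<Lambda> (tile d K (z t)) ?top \<le> x"
  proof (rule ccontr)
    assume no: "\<not> ?thesis"
    have less: "x < rc_disc r q \<Lambda> (tile d K (z t)) ?top" if "t \<in> Ix" for t using no that by force
    have x0: "0 < x" by (simp add: x_def)
    have "Ix \<noteq> {}" using finIx(2) by (auto simp: h_def)
    then obtain t0 where "t0 \<in> Ix" by blast
    then have "(\<Prod>t\<in>Ix. x) < (\<Prod>t\<in>Ix. rc_disc r q \<Lambda> (tile d K (z t)) ?top)"
    proof (rule prod_mono_strict)
      show "x < rc_disc r q \<Lambda> (tile d K (z t0)) ?top" by (rule less) fact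
      show "0 \<le> x \<and> x \<le> rc_disc r q \<Lambda> (tile d K (z t)) ?top" if "t \<in> Ix" for t
        using less[OF that] x0 by simp
      show "0 < rc_disc r q \<Lambda> (tile d K (z t)) ?top" if "t \<in> Ix" for t
        using less[OF that] x0 by linarith
    qed (rule finIx(1))
    also have "\<dots> \<le> wavg (inner \<Lambda>) (rc_weight r q) (\<lambda>\<omega>. \<Prod>t\<in>Ix. of_bool (\<not> meets \<omega> (tile d K (z t)) ?top))"
      unfolding rc_disc_def by (rule fkg_antimono_prod[OF lsm finIx(1)]) (auto intro: antimono_not_meets)
    also have "\<dots> \<le> rc_disc r q \<Lambda> ?bot ?top"
      unfolding rc_disc_def
    proof (rule wavg_mono[OF lsm])
      fix \<omega>
      show "(\<Prod>t\<in>Ix. of_bool (\<not> meets \<omega> (tile d K (z t)) ?top)) \<le> (of_bool (\<not> meets \<omega> ?bot ?top) :: real)"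
      proof (cases "meets \<omega> ?bot ?top")
        case True
        then obtain a where a: "a \<in> ?bot" "meets \<omega> {a} ?top" by (auto simp: meets_def)
        obtain t where t: "t \<in> Ix" "a \<in> tile d K (z t)" using cover[OF a(1)] by blast
        have "meets \<omega> (tile d K (z t)) ?top" by (rule meets_mono[OF a(2)]) (use t in auto)
        then have "(\<Prod>t\<in>Ix. of_bool (\<not> meets \<omega> (tile d K (z t)) ?top) :: real) = 0"
          using t finIx by (intro prod_zero) auto
        then show ?thesis by simp
      next
        case False
        have "(\<Prod>t\<in>Ix. of_bool (\<not> meets \<omega> (tile d K (z t)) ?top) :: real) \<le> 1" by (rule prod_le_1) simp
        then show ?thesis using False by simp
      qed
    qed
    also have "\<dots> \<le> exp (- c * real L ^ (d - 1))" using disc by (simp add: \<Lambda>_def)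
    also have "\<dots> \<le> (\<Prod>t\<in>Ix. x)"
    proof -
      \<comment> \<open>This leads to \<open>K * h <= 2 * L\<close>, the origin of the factor
        \<open>2 ^ (d - 1)\<close>.\<close>
      have "K * (2 * L div (2 * K + 1)) \<le> L"
      proof -
        have "2 * (K * (2 * L div (2 * K + 1))) \<le> (2 * K + 1) * (2 * L div (2 * K + 1))" by (simp add: algebra_simps)
        also have "\<dots> \<le> 2 * L" by (rule times_div_less_eq_dividend)
        finally show ?thesis by simp
      qed
      then have "K * h \<le> 2 * L" using K by (simp add: h_def algebra_simps)
      then have "real (K * h) \<le> real (2 * L)" by (simp only: of_nat_le_iff)
      then have "real K * real h \<le> 2 * real L" by simp
      then have "(real K * real h) ^ (d - 1) \<le> (2 * real L) ^ (d - 1)" by (intro power_mono) auto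
      then have "c / 2 ^ (d - 1) * (real K * real h) ^ (d - 1) \<le> c / 2 ^ (d - 1) * (2 * real L) ^ (d - 1)"
        using c by (intro mult_left_mono) auto
      also have "\<dots> = c * real L ^ (d - 1)" by (simp add: power_mult_distrib)
      finally have "exp (- c * real L ^ (d - 1)) \<le> exp (- (c / 2 ^ (d - 1) * (real K * real h) ^ (d - 1)))" by simp
      also have "\<dots> = (\<Prod>t\<in>Ix. x)"
        by (simp add: x_def finIx(2) power_mult_distrib mult_ac flip: exp_of_nat_mult)
      finally show ?thesis .
    qed
    finally show False by simp
  qed
  then obtain t where t: "t \<in> Ix" "rc_disc r q \<Lambda> (tile d K (z t)) ?top \<le> x" by blast
  have zb: "\<bar>z t i\<bar> + N \<le> R" if "i < d" for i
  proof (cases "i + 1 < d")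
    case True
    then have "t i < h" using PiE_mem[OF t(1)[unfolded Ix_def], of i] by simp
    then have "(2 * K + 1) * t i \<le> (2 * K + 1) * (2 * L div (2 * K + 1))" by (intro mult_left_mono) (auto simp: h_def)
    also have "\<dots> \<le> 2 * L" by (rule times_div_less_eq_dividend)
    finally have "int ((2 * K + 1) * t i) \<le> int (2 * L)" by (simp only: of_nat_le_iff)
    then have "int (2 * K + 1) * int (t i) \<le> 2 * int L" by (simp add: algebra_simps)
    moreover have "0 \<le> int (2 * K + 1) * int (t i)" by simp
    moreover have "z t i = - int L + int K + int (2 * K + 1) * int (t i)" using True by (simp add: z_def)
    ultimately show ?thesis using R K NM by linarith
  next
    case False
    then show ?thesis using that R NM by (simp add: z_def)
  qed
  have zlat: "z t \<in> lattice_points d" by (simp add: lattice_points_iff z_def)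
  have z0: "shift (z t) (\<lambda>_. 0) = z t" by (simp add: shift_def)
  have "?top \<subseteq> far d (z t) (2 * M)"
  proof
    fix y assume "y \<in> ?top"
    then have "y (d - 1) = M" by (simp add: top_side_def)
    moreover have "z t (d - 1) = - M" using d by (simp add: z_def)
    ultimately show "y \<in> far d (z t) (2 * M)" using d NM by (auto simp: far_def intro!: exI[of _ "d - 1"])
  qed
  then have "rc_disc r q (shift (z t) ` cube d R) (tile d K (z t)) (far d (z t) (2 * M)) \<le> rc_disc r q \<Lambda> (tile d K (z t)) ?top"
    unfolding \<Lambda>_def by (intro rc_disc_mono shift_cube_superset zb zlat finite_imageI finite_cube r q order_refl)
  then have "rc_disc r q (cube d R) (tile d K (\<lambda>_. 0)) (far d (\<lambda>_. 0) (2 * M)) \<le> x"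
    using t(2) rc_disc_shift[of r q "z t" "cube d R" "tile d K (\<lambda>_. 0)" "far d (\<lambda>_. 0) (2 * M)"]
    by (simp add: tile_shift far_shift z0)
  then show ?thesis by (simp add: x_def)
qed

section \<open>Merging clusters by sprinkling\<close>

definition sphere_box :: "nat \<Rightarrow> int \<Rightarrow> vertex set" where
  "sphere_box d r = {x \<in> cube d r. \<exists>i<d. \<bar>x i\<bar> = r}"

definition annulus :: "nat \<Rightarrow> int \<Rightarrow> int \<Rightarrow> vertex set" where
  "annulus d a b = {x \<in> cube d b. \<exists>i<d. a \<le> \<bar>x i\<bar>}"

lemma cube_iff: "x \<in> cube d N \<longleftrightarrow> x \<in> lattice_points d \<and> (\<forall>i<d. \<bar>x i\<bar> \<le> N)"
  by (auto simp: cube_def abs_le_iff)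

lemma cube_lattice: "cube d N \<subseteq> lattice_points d"
  by (auto simp: cube_def)

lemma cube_mono: "N \<le> N' \<Longrightarrow> cube d N \<subseteq> cube d N'"
  by (fastforce simp: cube_def)

text \<open>Each face is a box, hence connected, and faces orthogonal to different axes share a
  vertex. Two faces orthogonal to the same axis are joined through a face orthogonal to another one,
  which exists as \<open>d >= 2\<close>.\<close>

lemma linked_sphere_box:
  assumes d: "2 \<le> d" and r: "0 \<le> r" and x: "x \<in> sphere_box d r" and y: "y \<in> sphere_box d r"
  shows "linked (inner (sphere_box d r)) x y"
proof -
  define face where "face i \<sigma> = {x \<in> cube d r. x i = \<sigma>}" for i and \<sigma> :: int
  have face: "linked (inner (sphere_box d r)) u v" if i: "i < d" "\<bar>\<sigma>\<bar> = r" "u \<in> face i \<sigma>" "v \<in> face i \<sigma>" for i \<sigma> u v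
  proof -
    let ?lo = "\<lambda>j. if j = i then \<sigma> else if j < d then - r else 0" and ?hi = "\<lambda>j. if j = i then \<sigma> else if j < d then r else 0"
    have sub: "face i \<sigma> \<subseteq> sphere_box d r" using i by (auto simp: face_def sphere_box_def)
    have eq: "face i \<sigma> = ibox ?lo ?hi"
    proof (intro set_eqI iffI)
      fix w assume "w \<in> face i \<sigma>"
      then have w: "w i = \<sigma>" "w \<in> lattice_points d" "\<And>j. j < d \<Longrightarrow> \<bar>w j\<bar> \<le> r" by (auto simp: face_def cube_iff)
      show "w \<in> ibox ?lo ?hi"
        unfolding ibox_def
      proof (intro CollectI allI)
        fix j
        show "?lo j \<le> w j \<and> w j \<le> ?hi j" using w(1,2) w(3)[of j] by (auto simp: lattice_points_iff)
      qed
    next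
      fix w assume "w \<in> ibox ?lo ?hi"
      then have w: "?lo j \<le> w j \<and> w j \<le> ?hi j" for j by (auto simp: ibox_def)
      have "w i = \<sigma>" using w[of i] by simp
      moreover have "\<bar>w j\<bar> \<le> r" if "j < d" for j using w[of j] i that by (cases "j = i") auto
      moreover have "w j = 0" if "j \<ge> d" for j using w[of j] i that by (cases "j = i") auto
      ultimately show "w \<in> face i \<sigma>" by (auto simp: face_def cube_iff lattice_points_iff)
    qed
    have "u \<in> lattice_points d" "v \<in> lattice_points d" using i cube_lattice by (auto simp: face_def)
    then have "linked (inner (face i \<sigma>)) u v" using i(3,4) unfolding eq by (intro linked_ibox[where d = d])
    then show ?thesis using inner_mono[OF sub] by (rule linked_mono)
  qed
  have two: "linked (inner (sphere_box d r)) u v"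
    if ij: "i < d" "j < d" "i \<noteq> j" "\<bar>\<sigma>\<bar> = r" "\<bar>\<tau>\<bar> = r" "u \<in> face i \<sigma>" "v \<in> face j \<tau>" for i j \<sigma> \<tau> u v
  proof -
    define c :: vertex where "c = (\<lambda>k. if k = i then \<sigma> else if k = j then \<tau> else 0)"
    have c: "c \<in> face i \<sigma>" "c \<in> face j \<tau>" using ij r by (auto simp: c_def face_def cube_iff lattice_points_iff)
    show ?thesis by (rule linked_trans[OF face[OF ij(1,4,6) c(1)] face[OF ij(2,5) c(2) ij(7)]])
  qed
  obtain i where i: "i < d" "\<bar>x i\<bar> = r" using x by (auto simp: sphere_box_def)
  obtain j where j: "j < d" "\<bar>y j\<bar> = r" using y by (auto simp: sphere_box_def)
  have xf: "x \<in> face i (x i)" and yf: "y \<in> face j (y j)" using x y by (auto simp: face_def sphere_box_def)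
  show ?thesis
  proof (cases "i = j")
    case False
    then show ?thesis using two[OF i(1) j(1) _ i(2) j(2) xf yf] by blast
  next
    case True
    define k where "k = (if i = 0 then 1 else 0 :: nat)"
    have k: "k < d" "k \<noteq> i" using d by (auto simp: k_def)
    define c :: vertex where "c = (\<lambda>l. if l = k then r else 0)"
    have c: "c \<in> face k r" using k r by (auto simp: c_def face_def cube_iff lattice_points_iff)
    have rr: "\<bar>r\<bar> = r" using r by simp
    have kj: "k \<noteq> j" using k True by simp
    have "linked (inner (sphere_box d r)) x c" by (rule two[OF i(1) k(1) k(2)[symmetric] i(2) rr xf c])
    moreover have "linked (inner (sphere_box d r)) c y" by (rule two[OF k(1) j(1) kj rr j(2) c yf])
    ultimately show ?thesis by (rule linked_trans)
  qed
qed

lemma linked_hits_sphere: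
  assumes "linked \<omega> a b" "\<omega> \<subseteq> inner V" "V \<subseteq> lattice_points d" "a \<in> cube d r" "b \<notin> cube d r"
  shows "\<exists>v\<in>sphere_box d r. linked \<omega> a v"
proof -
  have "b \<notin> cube d r \<longrightarrow> (\<exists>v\<in>sphere_box d r. linked \<omega> a v)"
    using assms(1)
  proof (induction rule: linked_induct)
    case (step y z)
    show ?case
    proof
      assume z: "z \<notin> cube d r"
      show "\<exists>v\<in>sphere_box d r. linked \<omega> a v"
      proof (cases "y \<in> cube d r")
        case True
        have "neighbours y z" "z \<in> V" using step.hyps(2) assms(2) inner_edge_iff by blast+
        then obtain j where j: "\<bar>y j - z j\<bar> = 1" "\<And>k. k \<noteq> j \<Longrightarrow> y k = z k" by (auto simp: neighbours_def)
        have "z \<in> lattice_points d" using \<open>z \<in> V\<close> assms(3) by blast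
        then obtain i where i: "i < d" "\<not> \<bar>z i\<bar> \<le> r" using z by (auto simp: cube_iff)
        have yi: "\<bar>y i\<bar> \<le> r" using True i by (simp add: cube_iff)
        then have "i = j" using j(2)[of i] i by (cases "i = j") auto
        then have "\<bar>y i\<bar> = r" using j(1) i(2) yi unfolding \<open>i = j\<close> by linarith
        then have "y \<in> sphere_box d r" using True i by (auto simp: sphere_box_def)
        then show ?thesis using step.hyps(1) by blast
      qed (use step.IH in blast)
    qed
  qed (use assms(4) in simp)
  then show ?thesis using assms(5) by blast
qed

lemma short_path:
  assumes K: "\<And>i. i < d \<Longrightarrow> \<bar>t i - z i\<bar> \<le> int m" "\<And>i. i < d \<Longrightarrow> \<bar>t' i - z i\<bar> \<le> int m"
    and lat: "t \<in> lattice_points d" "t' \<in> lattice_points d" "z \<in> lattice_points d"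
    and sub: "\<And>x. x \<in> lattice_points d \<Longrightarrow> (\<And>i. i < d \<Longrightarrow> \<bar>x i - z i\<bar> \<le> int m) \<Longrightarrow> x \<in> A"
  shows "\<exists>\<pi>\<subseteq>inner A. finite \<pi> \<and> card \<pi> \<le> d * (2 * m) \<and> linked \<pi> t t'"
proof -
  define lo hi :: vertex where "lo = (\<lambda>i. if i < d then z i - int m else 0)" and "hi = (\<lambda>i. if i < d then z i + int m else 0)"
  have in_box: "x \<in> ibox lo hi" if "x \<in> lattice_points d" "\<And>i. i < d \<Longrightarrow> \<bar>x i - z i\<bar> \<le> int m" for x
    unfolding ibox_def
  proof (intro CollectI allI)
    fix i show "lo i \<le> x i \<and> x i \<le> hi i"
      using that(1) that(2)[of i] by (auto simp: lo_def hi_def lattice_points_iff abs_le_iff)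
  qed
  have box_sub: "ibox lo hi \<subseteq> A"
  proof
    fix x assume x: "x \<in> ibox lo hi"
    have "lo \<in> lattice_points d" "hi \<in> lattice_points d" by (auto simp: lo_def hi_def lattice_points_iff)
    then have "x \<in> lattice_points d" using ibox_subset_lattice x by blast
    moreover have "\<bar>x i - z i\<bar> \<le> int m" if "i < d" for i
    proof -
      have "lo i \<le> x i" "x i \<le> hi i" using x by (auto simp: ibox_def)
      then show ?thesis using that by (simp add: lo_def hi_def abs_le_iff)
    qed
    ultimately show "x \<in> A" by (rule sub)
  qed
  obtain \<pi> where \<pi>: "\<pi> \<subseteq> inner (ibox lo hi)" "finite \<pi>" "card \<pi> \<le> (\<Sum>i<d. nat \<bar>t i - t' i\<bar>)" "linked \<pi> t t'"
    using ibox_path[OF in_box[OF lat(1) K(1)] in_box[OF lat(2) K(2)], of d] lat by (auto simp: lattice_points_iff)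
  have "(\<Sum>i<d. nat \<bar>t i - t' i\<bar>) \<le> (\<Sum>i<d. 2 * m)"
  proof (rule sum_mono)
    fix i assume "i \<in> {..<d}"
    then show "nat \<bar>t i - t' i\<bar> \<le> 2 * m" using K(1)[of i] K(2)[of i] by simp
  qed
  then have "card \<pi> \<le> d * (2 * m)" using \<pi>(3) by simp
  then show ?thesis using \<pi> inner_mono[OF box_sub] by blast
qed

text \<open>A vertex is alive if its cluster in \<open>\<omega>\<close> leaves the cube of size \<open>n\<close>. The cube is explored inwards
  through \<open>T\<close> layers, each made of \<open>J\<close> disjoint annuli. In each annulus two distinct clusters that
  cross it come within distance \<open>2 * K + 2\<close> of each other, and the sprinkling may join them there.\<close>

locale layers =
  fixes d :: nat and V :: "vertex set" and \<omega> :: "edge set" and n K J T :: nat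
  assumes d: "2 \<le> d" and V: "finite V" "V \<subseteq> lattice_points d" "cube d (int n) \<subseteq> V" and \<omega>: "\<omega> \<subseteq> inner V"
    and dense: "\<And>z. z \<in> cube d (int n) \<Longrightarrow> \<exists>a\<in>tile d K z. \<exists>b. linked \<omega> a b \<and> b \<notin> cube d (int n)"
    and room: "T * J * (2 * K + 4) \<le> n"
begin

definition live :: "vertex \<Rightarrow> bool" where
  "live a \<longleftrightarrow> (\<exists>b. linked \<omega> a b \<and> b \<notin> cube d (int n))"

text \<open>The radius of the sphere in the middle of the annulus \<open>m\<close>. Connecting paths
  stay within \<open>K + 1\<close> of that sphere, and consecutive spheres are
  \<open>2 * K + 4\<close> apart, so the annuli are disjoint.\<close>

definition rad :: "nat \<Rightarrow> int" where
  "rad m = int n - int m * (2 * int K + 4) - (int K + 2)"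

definition layer_edges :: "nat \<Rightarrow> edge set" where
  "layer_edges m = inner (annulus d (rad m - int K - 1) (rad m + int K + 1))"

definition level :: "nat \<Rightarrow> int" where
  "level i = int n - int (i * J) * (2 * int K + 4)"

text \<open>Only the first \<open>i\<close> layers of the sprinkling are revealed, so its edges in
  the next layer are still independent of \<open>conf \<eta> i\<close>.\<close>

definition conf :: "edge set \<Rightarrow> nat \<Rightarrow> edge set" where
  "conf \<eta> i = \<omega> \<union> (\<eta> \<inter> (\<Union>m<i * J. layer_edges m))"

definition alive :: "nat \<Rightarrow> vertex set" where
  "alive i = {a. live a \<and> a \<in> cube d (level i)}"

text \<open>Not every pair has to merge in a layer: success means only that the cluster of
  \<open>a\<close>, unless it is already linked to all of \<open>alive (Suc i)\<close>, absorbs at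
  least one other alive cluster. This is what the halving needs.\<close>

definition failure :: "edge set \<Rightarrow> nat \<Rightarrow> vertex \<Rightarrow> bool" where
  "failure \<eta> i a \<longleftrightarrow> a \<in> alive (Suc i) \<and> (\<exists>b\<in>alive (Suc i). \<not> linked (conf \<eta> i) a b) \<and>
    \<not> (\<exists>c\<in>alive i. \<not> linked (conf \<eta> i) a c \<and> linked (conf \<eta> (Suc i)) a c)"

lemma level_le: "level i \<le> int n" "level (Suc i) \<le> level i"
  by (simp_all add: level_def algebra_simps)

lemma level_nonneg: "i \<le> T \<Longrightarrow> 0 \<le> level i"
proof -
  assume "i \<le> T"
  then have "i * J * (2 * K + 4) \<le> T * J * (2 * K + 4)" by (intro mult_right_mono) auto
  then have "i * J * (2 * K + 4) \<le> n" using room by linarith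
  then have "int (i * J * (2 * K + 4)) \<le> int n" by (simp only: of_nat_le_iff)
  then show ?thesis by (simp add: level_def algebra_simps)
qed

lemma rad_bounds:
  assumes "i * J \<le> m" "m < Suc i * J"
  shows "level (Suc i) < rad m - int K - 1" "rad m + int K + 1 < level i"
proof -
  have "(m + 1) * (2 * K + 4) \<le> Suc i * J * (2 * K + 4)" using assms by (intro mult_right_mono) auto
  then have "int ((m + 1) * (2 * K + 4)) \<le> int (Suc i * J * (2 * K + 4))" by (simp only: of_nat_le_iff)
  then show "level (Suc i) < rad m - int K - 1" by (simp add: rad_def level_def algebra_simps)
  have "i * J * (2 * K + 4) \<le> m * (2 * K + 4)" using assms by (intro mult_right_mono) auto
  then have "int (i * J * (2 * K + 4)) \<le> int (m * (2 * K + 4))" by (simp only: of_nat_le_iff)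
  then show "rad m + int K + 1 < level i" by (simp add: rad_def level_def algebra_simps)
qed

lemma layer_edges_disjoint: "m \<noteq> m' \<Longrightarrow> layer_edges m \<inter> layer_edges m' = {}"
proof -
  have *: "layer_edges m \<inter> layer_edges m' = {}" if "m < m'" for m m'
  proof -
    have "(int m + 1) * (2 * int K + 4) \<le> int m' * (2 * int K + 4)" using that by (intro mult_right_mono) auto
    then have "rad m' + int K + 1 < rad m - int K - 1" by (simp add: rad_def algebra_simps)
    then show ?thesis unfolding layer_edges_def
      by (intro inner_disjoint) (fastforce simp: annulus_def cube_iff)
  qed
  assume "m \<noteq> m'"
  then show ?thesis using *[of m m'] *[of m' m] by (cases "m < m'") auto
qed

lemma layer_edges_inner: "layer_edges m \<subseteq> inner V"
proof -
  have "0 \<le> int m * (2 * int K + 4)" by simp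
  then have "rad m + int K + 1 \<le> int n" unfolding rad_def by linarith
  then have "annulus d (rad m - int K - 1) (rad m + int K + 1) \<subseteq> cube d (int n)"
    using cube_mono by (auto simp: annulus_def)
  then show ?thesis unfolding layer_edges_def using V(3) by (intro inner_mono) blast
qed

lemma live_linked: "live a \<Longrightarrow> linked \<omega> a b \<Longrightarrow> live b"
  unfolding live_def using linked_trans linked_sym by metis

lemma live_hits:
  assumes "live a" "a \<in> cube d r" "r \<le> int n"
  shows "\<exists>v\<in>sphere_box d r. linked \<omega> a v \<and> live v"
proof -
  obtain b where b: "linked \<omega> a b" "b \<notin> cube d (int n)" using assms(1) by (auto simp: live_def)
  have "b \<notin> cube d r" using b(2) cube_mono[OF assms(3)] by blast
  then obtain v where "v \<in> sphere_box d r" "linked \<omega> a v"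
    using linked_hits_sphere[OF b(1) \<omega> V(2) assms(2)] by blast
  then show ?thesis using live_linked[OF assms(1)] by blast
qed

lemma tile_coords: "t \<in> tile d K z \<Longrightarrow> \<bar>t i - z i\<bar> \<le> int K"
proof -
  assume "t \<in> tile d K z"
  then have "\<bar>t i - z i\<bar> \<le> (if i + 1 < d then int K else 0)" unfolding tile_def by blast
  then show ?thesis by (simp split: if_splits)
qed

lemma tile_lattice: "t \<in> tile d K z \<Longrightarrow> z \<in> lattice_points d \<Longrightarrow> t \<in> lattice_points d"
proof -
  assume t: "t \<in> tile d K z" and z: "z \<in> lattice_points d"
  have "t i = 0" if "i \<ge> d" for i
  proof -
    have "\<bar>t i - z i\<bar> \<le> (if i + 1 < d then int K else 0)" using t unfolding tile_def by blast
    then show ?thesis using z that by (simp add: lattice_points_iff)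
  qed
  then show ?thesis by (simp add: lattice_points_iff)
qed

text \<open>Both live clusters cross the sphere of radius \<open>rad m\<close>. Along a path on this
  sphere from one to the other, each vertex \<open>z\<close> is represented by a live vertex
  \<open>t z\<close> of its tile. At some edge the representative ceases to be linked to
  \<open>a\<close>, and there two distinct clusters are within reach of a short path.\<close>

lemma bridge:
  assumes a: "a \<in> alive (Suc i)" and b: "b \<in> alive (Suc i)" and ab: "\<not> linked \<omega>' a b"
    and sub: "\<omega> \<subseteq> \<omega>'" and i: "i < T" and m: "i * J \<le> m" "m < Suc i * J"
  shows "\<exists>\<pi>\<subseteq>layer_edges m. finite \<pi> \<and> card \<pi> \<le> d * (2 * (K + 1)) \<and>
    (\<exists>u c. linked \<pi> u c \<and> linked \<omega>' a u \<and> c \<in> alive i \<and> \<not> linked \<omega>' a c)"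
proof -
  define r where "r = rad m"
  have r: "level (Suc i) \<le> r" "0 \<le> r" "r \<le> int n" "r + int K + 1 \<le> level i"
    using rad_bounds[OF m] level_nonneg[of "Suc i"] i level_le(1)[of i] by (auto simp: r_def)
  \<comment> \<open>A live vertex represents itself, so that the two ends of the path on the sphere
    keep their own clusters.\<close>
  define t where "t z = (if live z then z else SOME a. a \<in> tile d K z \<and> live a)" for z
  have t: "t z \<in> tile d K z \<and> live (t z)" if "z \<in> cube d (int n)" for z
  proof (cases "live z")
    case True
    then show ?thesis by (simp add: t_def tile_def)
  next
    case False
    have "\<exists>a. a \<in> tile d K z \<and> live a" using dense[OF that] by (auto simp: live_def)
    then show ?thesis using False someI_ex[of "\<lambda>a. a \<in> tile d K z \<and> live a"] by (simp add: t_def)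
  qed
  have ac: "a \<in> cube d r" "b \<in> cube d r" using a b cube_mono[OF r(1)] by (auto simp: alive_def)
  have la: "live a" "live b" using a b by (auto simp: alive_def)
  obtain va where va: "va \<in> sphere_box d r" "linked \<omega> a va" "live va" using live_hits[OF la(1) ac(1) r(3)] by blast
  obtain vb where vb: "vb \<in> sphere_box d r" "linked \<omega> b vb" "live vb" using live_hits[OF la(2) ac(2) r(3)] by blast
  have "linked \<omega>' a (t va)" using va sub by (simp add: t_def linked_mono)
  moreover have "\<not> linked \<omega>' a (t vb)"
  proof
    assume "linked \<omega>' a (t vb)"
    then have "linked \<omega>' a vb" using vb by (simp add: t_def)
    also have "linked \<omega>' vb b" using linked_mono[OF linked_sym[OF vb(2)] sub] .
    finally show False using ab by contradiction
  qed
  ultimately obtain z z' where z: "{z, z'} \<in> inner (sphere_box d r)" "linked \<omega>' a (t z)" "\<not> linked \<omega>' a (t z')"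
    using linked_switch[OF linked_sphere_box[OF d r(2) va(1) vb(1)], of "\<lambda>z. linked \<omega>' a (t z)"] by blast
  then have zs: "z \<in> sphere_box d r" "z' \<in> sphere_box d r" "neighbours z z'" by (auto simp: inner_edge_iff)
  have zn: "z \<in> cube d (int n)" "z' \<in> cube d (int n)" using zs cube_mono[OF r(3)] by (auto simp: sphere_box_def)
  have zlat: "z \<in> lattice_points d" "z' \<in> lattice_points d" using zn cube_lattice by auto
  have nb: "\<bar>z' i - z i\<bar> \<le> 1" for i
  proof -
    obtain j where "\<bar>z j - z' j\<bar> = 1" "\<And>k. k \<noteq> j \<Longrightarrow> z k = z' k" using zs(3) by (auto simp: neighbours_def)
    then show ?thesis by (cases "i = j") auto
  qed
  have tz: "\<bar>t z i - z i\<bar> \<le> int (K + 1)" "\<bar>t z' i - z i\<bar> \<le> int (K + 1)" for i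
    using tile_coords[OF conjunct1[OF t[OF zn(1)]], of i] tile_coords[OF conjunct1[OF t[OF zn(2)]], of i] nb[of i] by linarith+
  have tlat: "t z \<in> lattice_points d" "t z' \<in> lattice_points d"
    using tile_lattice t zn zlat by blast+
  have ann: "x \<in> annulus d (rad m - int K - 1) (rad m + int K + 1)"
    if "x \<in> lattice_points d" "\<And>i. i < d \<Longrightarrow> \<bar>x i - z i\<bar> \<le> int (K + 1)" for x
  proof -
    have "\<bar>x i\<bar> \<le> r + int K + 1" if "i < d" for i
    proof -
      have "\<bar>z i\<bar> \<le> r" using zs(1) that by (auto simp: sphere_box_def cube_iff)
      then show ?thesis using \<open>\<And>i. i < d \<Longrightarrow> \<bar>x i - z i\<bar> \<le> int (K + 1)\<close>[OF that] by linarith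
    qed
    moreover obtain i where i: "i < d" "\<bar>z i\<bar> = r" using zs(1) by (auto simp: sphere_box_def)
    then have "r - int K - 1 \<le> \<bar>x i\<bar>" using that(2)[OF i(1)] by linarith
    ultimately show ?thesis using that(1) i(1) by (auto simp: annulus_def cube_iff r_def)
  qed
  obtain \<pi> where \<pi>: "\<pi> \<subseteq> layer_edges m" "finite \<pi>" "card \<pi> \<le> d * (2 * (K + 1))" "linked \<pi> (t z) (t z')"
    using short_path[OF tz tlat zlat(1) ann] unfolding layer_edges_def by blast
  have "t z' \<in> cube d (level i)"
  proof -
    have "\<bar>t z' i\<bar> \<le> r + int K" if "i < d" for i
    proof -
      have "\<bar>z' i\<bar> \<le> r" using zs(2) that by (auto simp: sphere_box_def cube_iff)
      then show ?thesis using tile_coords[OF conjunct1[OF t[OF zn(2)]], of i] by linarith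
    qed
    then show ?thesis using tlat(2) r(4) by (fastforce simp: cube_iff)
  qed
  then have "t z' \<in> alive i" using t[OF zn(2)] by (simp add: alive_def)
  then show ?thesis using \<pi> z(2,3) by blast
qed

text \<open>Given the sprinkling outside layer \<open>i\<close>, the clusters of
  \<open>conf Z i\<close> are fixed, and each of the \<open>J\<close> annuli offers its own short
  path, open with probability at least \<open>s ^ (d * (2 * (K + 1)))\<close>. Failure requires all
  of them to stay closed.\<close>

lemma failure_prob:
  assumes s: "0 < s" "s < 1" and i: "i < T"
  shows "wavg (inner V) (bernoulli_weight s) (\<lambda>\<eta>. of_bool (failure \<eta> i a)) \<le> (1 - s ^ (d * (2 * (K + 1)))) ^ J"
proof -
  let ?E = "inner V" and ?S = "{i * J..<Suc i * J}" and ?l = "d * (2 * (K + 1))"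
  define F where "F = (\<Union>m\<in>?S. layer_edges m)"
  have finE: "finite ?E" using finite_inner[OF V(1)] .
  have FE: "F \<subseteq> ?E" using layer_edges_inner by (auto simp: F_def)
  have lsm: "log_supermodular ?E (bernoulli_weight s)" using finE s by (rule log_supermodular_bernoulli)
  have lsmF: "log_supermodular F (bernoulli_weight s)" using log_supermodular_subset[OF lsm FE] .
  have pw: "0 \<le> 1 - s ^ ?l" using s by (simp add: power_le_one)
  have conf_eq: "conf (A \<union> Z) i = conf Z i" if "A \<subseteq> F" for A Z
  proof -
    have "A \<inter> (\<Union>m<i * J. layer_edges m) = {}"
    proof -
      have False if e: "e \<in> A" "e \<in> layer_edges m" "m < i * J" for e m
      proof -
        obtain m' where "m' \<in> ?S" "e \<in> layer_edges m'" using e(1) \<open>A \<subseteq> F\<close> unfolding F_def by blast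
        then show False using layer_edges_disjoint[of m m'] e(2,3) by auto
      qed
      then show ?thesis by blast
    qed
    then show ?thesis unfolding conf_def by blast
  qed
  have "wavg ?E (bernoulli_weight s) (\<lambda>\<eta>. of_bool (failure \<eta> i a))
      \<le> (1 - s ^ ?l) ^ J * wavg ?E (bernoulli_weight s) (\<lambda>\<eta>. 1)"
  proof (rule wavg_section_le[OF lsm FE, where h = "\<lambda>_. 1"])
    fix Z assume Z: "Z \<subseteq> ?E - F"
    have mono: "failure (B \<union> Z) i a \<Longrightarrow> failure (A \<union> Z) i a" if "A \<subseteq> B" "A \<subseteq> F" "B \<subseteq> F" for A B
    proof -
      have sub: "conf (A \<union> Z) (Suc i) \<subseteq> conf (B \<union> Z) (Suc i)" using that by (auto simp: conf_def)
      show "failure (B \<union> Z) i a \<Longrightarrow> failure (A \<union> Z) i a"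
        unfolding failure_def conf_eq[OF that(2)] conf_eq[OF that(3)] using linked_mono[OF _ sub] by blast
    qed
    show "antimono_on (Pow F) (\<lambda>A. of_bool (failure (A \<union> Z) i a) :: real)"
    proof (intro monotone_onI)
      fix A B assume "A \<in> Pow F" "B \<in> Pow F" "A \<le> B"
      then show "of_bool (failure (A \<union> Z) i a) \<ge> (of_bool (failure (B \<union> Z) i a) :: real)"
        using mono[of A B] by auto
    qed
    show "wavg F (bernoulli_weight s) (\<lambda>A. of_bool (failure (A \<union> Z) i a)) \<le> (1 - s ^ ?l) ^ J * 1"
    proof (cases "a \<in> alive (Suc i) \<and> (\<exists>b\<in>alive (Suc i). \<not> linked (conf Z i) a b)")
      case False
      then have "\<not> failure (A \<union> Z) i a" if "A \<subseteq> F" for A unfolding failure_def conf_eq[OF that] by blast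
      then have "wavg F (bernoulli_weight s) (\<lambda>A. of_bool (failure (A \<union> Z) i a)) \<le> 0"
        by (intro wavg_le[OF lsmF]) auto
      then show ?thesis using pw zero_le_power[OF pw, of J] by linarith
    next
      case True
      then obtain b where b: "a \<in> alive (Suc i)" "b \<in> alive (Suc i)" "\<not> linked (conf Z i) a b" by blast
      have sub: "\<omega> \<subseteq> conf Z i" by (auto simp: conf_def)
      define good where "good m \<pi> \<longleftrightarrow> \<pi> \<subseteq> layer_edges m \<and> finite \<pi> \<and> card \<pi> \<le> ?l \<and>
        (\<exists>u c. linked \<pi> u c \<and> linked (conf Z i) a u \<and> c \<in> alive i \<and> \<not> linked (conf Z i) a c)" for m \<pi>
      have ex: "\<exists>\<pi>. good m \<pi>" if "m \<in> ?S" for m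
        using bridge[OF b sub i, of m] that unfolding good_def by auto
      \<comment> \<open>The paths are selected from \<open>conf Z i\<close>, before the annuli of
        this layer are revealed.\<close>
      define pth where "pth m = (SOME \<pi>. good m \<pi>)" for m
      have pth: "good m (pth m)" if "m \<in> ?S" for m unfolding pth_def using ex[OF that] by (rule someI_ex)
      have avoid: "\<not> pth m \<subseteq> A \<inter> layer_edges m" if A: "A \<subseteq> F" "failure (A \<union> Z) i a" and m: "m \<in> ?S" for A m
      proof
        assume open_path: "pth m \<subseteq> A \<inter> layer_edges m"
        obtain u c where uc: "linked (pth m) u c" "linked (conf Z i) a u" "c \<in> alive i" "\<not> linked (conf Z i) a c"
          using pth[OF m] unfolding good_def by blast
        have "pth m \<subseteq> conf (A \<union> Z) (Suc i)" using open_path m by (auto simp: conf_def)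
        moreover have "conf Z i \<subseteq> conf (A \<union> Z) (Suc i)" unfolding conf_def by fastforce
        ultimately have "linked (conf (A \<union> Z) (Suc i)) a c"
          using linked_trans[OF linked_mono[OF uc(2)] linked_mono[OF uc(1)]] by blast
        then show False using A uc(3,4) unfolding failure_def conf_eq[OF A(1)] by blast
      qed
      have "wavg F (bernoulli_weight s) (\<lambda>A. of_bool (failure (A \<union> Z) i a))
          \<le> wavg F (bernoulli_weight s) (\<lambda>A. \<Prod>m\<in>?S. of_bool (\<not> pth m \<subseteq> A \<inter> layer_edges m))"
      proof (rule wavg_mono[OF lsmF])
        fix A assume A: "A \<subseteq> F"
        show "of_bool (failure (A \<union> Z) i a) \<le> (\<Prod>m\<in>?S. of_bool (\<not> pth m \<subseteq> A \<inter> layer_edges m) :: real)"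
        proof (cases "failure (A \<union> Z) i a")
          case True
          then have "(\<Prod>m\<in>?S. of_bool (\<not> pth m \<subseteq> A \<inter> layer_edges m) :: real) = 1"
            using avoid[OF A True] by (intro prod.neutral) auto
          then show ?thesis by simp
        qed (simp add: prod_nonneg)
      qed
      also have "\<dots> \<le> (\<Prod>m\<in>?S. 1 - s ^ ?l)"
      proof (rule wavg_prod_le[OF lsmF, where g = "\<lambda>m A. of_bool (\<not> pth m \<subseteq> A)"])
        show "layer_edges m \<subseteq> F" if "m \<in> ?S" for m using that by (auto simp: F_def)
        show "disjoint_family_on layer_edges ?S"
          unfolding disjoint_family_on_def using layer_edges_disjoint by blast
        fix m assume m: "m \<in> ?S"
        have P: "pth m \<subseteq> layer_edges m" "finite (pth m)" "card (pth m) \<le> ?l" using pth[OF m] by (auto simp: good_def)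
        have finL: "finite (layer_edges m)" using finite_subset[OF layer_edges_inner finE] .
        note lsmL = log_supermodular_bernoulli[OF finL s] and lsmP = log_supermodular_bernoulli[OF P(2) s]
        show anti: "antimono_on (Pow (layer_edges m)) (\<lambda>A. of_bool (\<not> pth m \<subseteq> A) :: real)"
          by (intro monotone_onI) (auto simp: of_bool_def)
        have antiP: "antimono_on (Pow (pth m)) (\<lambda>A. of_bool (\<not> pth m \<subseteq> A) :: real)"
          by (intro monotone_onI) (auto simp: of_bool_def)
        have "wavg (layer_edges m) (bernoulli_weight s) (\<lambda>A. of_bool (\<not> pth m \<subseteq> A))
            = wavg (layer_edges m) (bernoulli_weight s) (\<lambda>A. of_bool (\<not> pth m \<subseteq> A \<inter> pth m))" by simp
        also have "\<dots> \<le> wavg (pth m) (bernoulli_weight s) (\<lambda>A. of_bool (\<not> pth m \<subseteq> A))"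
          by (rule wavg_restrict_antimono[OF lsmL P(1) antiP]) simp
        also have "\<dots> = 1 - s ^ card (pth m)" using wavg_bernoulli_all[OF P(2) s] wavg_compl[OF lsmP] by simp
        also have "\<dots> \<le> 1 - s ^ ?l" using s P(3) by (simp add: power_decreasing)
        finally show "wavg (layer_edges m) (bernoulli_weight s) (\<lambda>A. of_bool (\<not> pth m \<subseteq> A)) \<le> 1 - s ^ ?l" .
      qed auto
      also have "\<dots> = (1 - s ^ ?l) ^ J" by simp
      finally show ?thesis by simp
    qed
  qed simp
  then show ?thesis using wavg_const[OF lsm, of 1] by simp
qed

lemma conf_mono: "conf \<eta> i \<subseteq> conf \<eta> (Suc i)"
  by (fastforce simp: conf_def)

lemma finite_alive: "finite (alive i)"
  by (rule finite_subset[OF _ finite_cube[of d "level i"]]) (auto simp: alive_def)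

lemma alive_mono: "alive (Suc i) \<subseteq> alive i"
  using cube_mono[OF level_le(2)] by (auto simp: alive_def)

text \<open>While at least two clusters remain, each of them contains two old ones, that of
  \<open>a\<close> and that of the vertex \<open>c\<close> which \<open>a\<close> has newly reached.
  Different new clusters contain disjoint families of old ones.\<close>

lemma halving:
  assumes ok: "\<And>a. \<not> failure \<eta> i a" and two: "2 \<le> card (cluster (conf \<eta> (Suc i)) ` alive (Suc i))"
  shows "2 * card (cluster (conf \<eta> (Suc i)) ` alive (Suc i)) \<le> card (cluster (conf \<eta> i) ` alive i)"
proof -
  let ?N = "cluster (conf \<eta> (Suc i)) ` alive (Suc i)" and ?O = "cluster (conf \<eta> i) ` alive i"
  define P where "P Z = {Y \<in> ?O. Y \<subseteq> Z}" for Z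
  have fin: "finite ?N" "finite ?O" using finite_alive by auto
  have self: "x \<in> cluster \<zeta> x" for \<zeta> and x :: vertex by (simp add: cluster_def)
  have ge2: "2 \<le> card (P Z)" if Z: "Z \<in> ?N" for Z
  proof -
    obtain a where a: "a \<in> alive (Suc i)" "Z = cluster (conf \<eta> (Suc i)) a" using Z by blast
    obtain Z' where Z': "Z' \<in> ?N" "Z' \<noteq> Z"
    proof (rule ccontr)
      assume "\<not> thesis"
      then have "?N \<subseteq> {Z}" using that by blast
      then have "card ?N \<le> card {Z}" by (intro card_mono) auto
      then show False using two by simp
    qed
    then obtain b where b: "b \<in> alive (Suc i)" "Z' = cluster (conf \<eta> (Suc i)) b" by blast
    have "\<not> linked (conf \<eta> (Suc i)) a b" using Z'(2) by (simp add: a b cluster_eq_iff linked_commute)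
    then have "\<not> linked (conf \<eta> i) a b" using linked_mono[OF _ conf_mono] by blast
    then obtain c where c: "c \<in> alive i" "\<not> linked (conf \<eta> i) a c" "linked (conf \<eta> (Suc i)) a c"
      using ok[of a] a(1) b(1) unfolding failure_def by blast
    have sub: "cluster (conf \<eta> i) x \<subseteq> cluster (conf \<eta> (Suc i)) x" for x
      using linked_mono[OF _ conf_mono] by (auto simp: cluster_def)
    have "cluster (conf \<eta> (Suc i)) c = Z" using c(3) by (simp add: a cluster_eq_iff linked_commute)
    moreover have "a \<in> alive i" using a(1) alive_mono by blast
    ultimately have "{cluster (conf \<eta> i) a, cluster (conf \<eta> i) c} \<subseteq> P Z"
      using sub[of a] sub[of c] a(2) c(1) by (simp add: P_def)
    moreover have "finite (P Z)" using fin by (simp add: P_def)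
    moreover have "card {cluster (conf \<eta> i) a, cluster (conf \<eta> i) c} = 2" using c(2) by (simp add: cluster_eq_iff)
    ultimately show ?thesis by (metis card_mono)
  qed
  have disj: "P Z \<inter> P Z' = {}" if "Z \<in> ?N" "Z' \<in> ?N" "Z \<noteq> Z'" for Z Z'
  proof -
    have False if Y: "Y \<in> P Z" "Y \<in> P Z'" for Y
    proof -
      obtain x where x: "Y = cluster (conf \<eta> i) x" using Y(1) by (auto simp: P_def)
      obtain a b where ab: "Z = cluster (conf \<eta> (Suc i)) a" "Z' = cluster (conf \<eta> (Suc i)) b"
        using \<open>Z \<in> ?N\<close> \<open>Z' \<in> ?N\<close> by blast
      have "x \<in> Z" "x \<in> Z'" using Y self[of x "conf \<eta> i"] x by (auto simp: P_def)
      then have "Z = cluster (conf \<eta> (Suc i)) x" "Z' = cluster (conf \<eta> (Suc i)) x"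
        unfolding ab cluster_eq_iff by (simp_all add: cluster_def)
      then show False using \<open>Z \<noteq> Z'\<close> by simp
    qed
    then show ?thesis by blast
  qed
  have "2 * card ?N = (\<Sum>Z\<in>?N. 2)" by simp
  also have "\<dots> \<le> (\<Sum>Z\<in>?N. card (P Z))" by (rule sum_mono) (rule ge2)
  also have "\<dots> = card (\<Union>Z\<in>?N. P Z)"
    using disj fin by (intro card_UN_disjoint[symmetric]) (auto simp: P_def)
  also have "\<dots> \<le> card ?O" using fin by (intro card_mono) (auto simp: P_def)
  finally show ?thesis .
qed

text \<open>The number of clusters is initially at most the number of vertices of the cube, which is
  below \<open>2 ^ T\<close>; after \<open>T\<close> halvings at most one is left. The bound is a
  union over the layers and the vertices.\<close>

theorem merged_prob:
  assumes s: "0 < s" "s < 1" and T: "card (cube d (int n)) < 2 ^ T"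
  shows "wavg (inner V) (bernoulli_weight s) (\<lambda>\<eta>. of_bool (\<exists>a\<in>alive T. \<exists>b\<in>alive T. \<not> linked (\<omega> \<union> \<eta>) a b))
    \<le> real T * real (card (cube d (int n))) * (1 - s ^ (d * (2 * (K + 1)))) ^ J"
proof -
  let ?C = "cube d (int n)"
  have lsm: "log_supermodular (inner V) (bernoulli_weight s)"
    using finite_inner[OF V(1)] s by (rule log_supermodular_bernoulli)
  have alive_sub: "alive i \<subseteq> ?C" for i using cube_mono[OF level_le(1)] by (auto simp: alive_def)
  have merged: "linked (\<omega> \<union> \<eta>) a b"
    if ok: "\<forall>i<T. \<forall>a\<in>?C. \<not> failure \<eta> i a" and ab: "a \<in> alive T" "b \<in> alive T" for \<eta> a b
  proof -
    let ?N = "\<lambda>i. card (cluster (conf \<eta> i) ` alive i)"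
    have nofail: "\<not> failure \<eta> i a" if "i < T" for i a
      using ok that alive_sub unfolding failure_def by blast
    have "?N i \<le> 1 \<or> ?N i * 2 ^ i \<le> ?N 0" if "i \<le> T" for i
      using that
    proof (induction i)
      case (Suc i)
      show ?case
      proof (cases "2 \<le> ?N (Suc i)")
        case True
        then have h: "2 * ?N (Suc i) \<le> ?N i" using nofail Suc.prems by (intro halving) auto
        then have "\<not> ?N i \<le> 1" using True by linarith
        then have "?N i * 2 ^ i \<le> ?N 0" using Suc by simp
        moreover have "2 * ?N (Suc i) * 2 ^ i \<le> ?N i * 2 ^ i" using h by (rule mult_right_mono) simp
        ultimately have "2 * ?N (Suc i) * 2 ^ i \<le> ?N 0" by (rule order_trans[rotated])
        then show ?thesis by (simp add: mult_ac)
      qed linarith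
    qed simp
    moreover have "?N 0 < 2 ^ T"
      using T card_mono[OF finite_cube alive_sub[of 0]] card_image_le[OF finite_alive, of "cluster (conf \<eta> 0)" 0] by linarith
    ultimately have "?N T \<le> 1"
    proof -
      have "?N T \<le> 1 \<or> ?N T * 2 ^ T \<le> ?N 0" using \<open>\<And>i. i \<le> T \<Longrightarrow> ?N i \<le> 1 \<or> ?N i * 2 ^ i \<le> ?N 0\<close> by blast
      moreover have "?N T = 0" if "?N T * 2 ^ T \<le> ?N 0"
      proof (rule ccontr)
        assume "?N T \<noteq> 0"
        then have "1 * 2 ^ T \<le> ?N T * 2 ^ T" by (intro mult_right_mono) auto
        then show False using that \<open>?N 0 < 2 ^ T\<close> by linarith
      qed
      ultimately show ?thesis by linarith
    qed
    then have "\<forall>y\<in>cluster (conf \<eta> T) ` alive T. \<forall>z\<in>cluster (conf \<eta> T) ` alive T. y = z"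
      using card_le_Suc0_iff_eq[of "cluster (conf \<eta> T) ` alive T"] finite_imageI[OF finite_alive[of T]]
      unfolding One_nat_def by blast
    then have "cluster (conf \<eta> T) a = cluster (conf \<eta> T) b" using ab by blast
    then have "linked (conf \<eta> T) a b" by (simp add: cluster_eq_iff)
    then show ?thesis by (rule linked_mono) (auto simp: conf_def)
  qed
  have "wavg (inner V) (bernoulli_weight s) (\<lambda>\<eta>. of_bool (\<exists>a\<in>alive T. \<exists>b\<in>alive T. \<not> linked (\<omega> \<union> \<eta>) a b))
      \<le> wavg (inner V) (bernoulli_weight s) (\<lambda>\<eta>. \<Sum>i<T. \<Sum>a\<in>?C. of_bool (failure \<eta> i a))"
  proof (rule wavg_mono[OF lsm])
    fix \<eta>
    show "of_bool (\<exists>a\<in>alive T. \<exists>b\<in>alive T. \<not> linked (\<omega> \<union> \<eta>) a b) \<le> (\<Sum>i<T. \<Sum>a\<in>?C. of_bool (failure \<eta> i a) :: real)"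
    proof (cases "\<forall>i<T. \<forall>a\<in>?C. \<not> failure \<eta> i a")
      case True
      then show ?thesis using merged by (simp add: sum_nonneg)
    next
      case False
      then obtain i a where ia: "i < T" "a \<in> ?C" "failure \<eta> i a" by blast
      have "1 = (of_bool (failure \<eta> i a) :: real)" using ia by simp
      also have "\<dots> \<le> (\<Sum>a\<in>?C. of_bool (failure \<eta> i a))" using ia finite_cube by (intro member_le_sum) auto
      also have "\<dots> \<le> (\<Sum>i<T. \<Sum>a\<in>?C. of_bool (failure \<eta> i a))"
        by (rule member_le_sum) (use ia in \<open>auto intro: sum_nonneg\<close>)
      finally show ?thesis by (rule order_trans[rotated]) simp
    qed
  qed
  also have "\<dots> \<le> (\<Sum>i<T. \<Sum>a\<in>?C. (1 - s ^ (d * (2 * (K + 1)))) ^ J)"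
    unfolding wavg_sum by (intro sum_mono failure_prob s) auto
  also have "\<dots> = real T * real (card ?C) * (1 - s ^ (d * (2 * (K + 1)))) ^ J" by simp
  finally show ?thesis .
qed

end

section \<open>The scales of the merging argument\<close>

lemma card_cube_le: "card (cube d (int n)) \<le> (2 * n + 1) ^ d"
proof -
  have "card (cube d (int n)) \<le> card (PiE {..<d} (\<lambda>_. {- int n..int n}))"
  proof (rule card_inj_on_le)
    show "inj_on (\<lambda>x. restrict x {..<d}) (cube d (int n))"
    proof (rule inj_onI, rule ext)
      fix x y :: vertex and i
      assume "x \<in> cube d (int n)" "y \<in> cube d (int n)" and eq: "restrict x {..<d} = restrict y {..<d}"
      moreover have "x i = y i" if "i < d" using eq that by (metis lessThan_iff restrict_apply')
      ultimately show "x i = y i" by (cases "i < d") (simp_all add: cube_iff lattice_points_iff)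
    qed
    show "(\<lambda>x. restrict x {..<d}) ` cube d (int n) \<subseteq> PiE {..<d} (\<lambda>_. {- int n..int n})"
      by (intro image_subsetI) (simp add: cube_def restrict_PiE_iff)
  qed (simp add: finite_PiE)
  also have "\<dots> = (2 * n + 1) ^ d" by (simp add: card_PiE nat_add_distrib nat_mult_distrib)
  finally show ?thesis .
qed

text \<open>Three sources of error: some tile in the cube does not reach the outside,
  \<open>A\<close> or \<open>B\<close> does not reach it, or all of this happens and the sprinkling
  fails to merge the clusters.\<close>

lemma disc_by_merging:
  fixes n K J T :: nat
  assumes d: "2 \<le> d" and q: "1 \<le> q" and r: "0 < r" and s: "sprinkle_ok q r r' s"
    and V: "finite V" "V \<subseteq> lattice_points d" "cube d (int n) \<subseteq> V"
    and room: "T * J * (2 * K + 4) \<le> n" and T: "(2 * n + 1) ^ d < 2 ^ T"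
    and A: "A \<subseteq> cube d (int n - int (T * J) * (2 * int K + 4))"
    and B: "B \<subseteq> cube d (int n - int (T * J) * (2 * int K + 4))"
    and \<alpha>: "\<And>z. z \<in> cube d (int n) \<Longrightarrow> rc_disc r q V (tile d K z) (- cube d (int n)) \<le> \<alpha>"
    and \<beta>: "rc_disc r q V A (- cube d (int n)) \<le> \<beta>" "rc_disc r q V B (- cube d (int n)) \<le> \<beta>"
  shows "rc_disc r' q V A B \<le> (2 * real n + 1) ^ d * \<alpha> + 2 * \<beta> +
    real T * (2 * real n + 1) ^ d * (1 - s ^ (d * (2 * (K + 1)))) ^ J"
proof -
  let ?E = "inner V" and ?C = "cube d (int n)" and ?p = "(1 - s ^ (d * (2 * (K + 1)))) ^ J"
  define \<gamma> where "\<gamma> = real T * real (card ?C) * ?p"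
  have s01: "0 < s" "s < 1" using s by (auto simp: sprinkle_ok_def)
  have p0: "0 \<le> ?p" using s01 by (simp add: power_le_one)
  have lsb: "log_supermodular ?E (bernoulli_weight s)" using finite_inner[OF V(1)] s01 by (rule log_supermodular_bernoulli)
  have lsr: "log_supermodular ?E (rc_weight r q)" using V(1) r q by (rule log_supermodular_inner)
  have finC: "finite ?C" by (rule finite_cube)
  have cardC: "real (card ?C) \<le> (2 * real n + 1) ^ d"
    using card_cube_le[of d n] by (metis (mono_tags, lifting) of_nat_1 of_nat_add of_nat_le_iff of_nat_mult of_nat_numeral of_nat_power)
  let ?out = "\<lambda>A \<omega>. of_bool (\<not> meets \<omega> A (- ?C)) :: real"
  have "rc_disc r' q V A B \<le> joint ?E s r q (\<lambda>\<omega> \<eta>. of_bool (\<not> meets (\<omega> \<union> \<eta>) A B))"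
    using V(1) q s by (rule rc_disc_sprinkle)
  also have "\<dots> = wavg ?E (rc_weight r q) (\<lambda>\<omega>. wavg ?E (bernoulli_weight s) (\<lambda>\<eta>. of_bool (\<not> meets (\<omega> \<union> \<eta>) A B)))"
    by (rule joint_swap)
  also have "\<dots> \<le> wavg ?E (rc_weight r q) (\<lambda>\<omega>. (\<Sum>z\<in>?C. ?out (tile d K z) \<omega>) + ?out A \<omega> + ?out B \<omega> + \<gamma>)"
  proof (rule wavg_mono[OF lsr])
    fix \<omega> assume \<omega>: "\<omega> \<subseteq> ?E"
    let ?w = "wavg ?E (bernoulli_weight s) (\<lambda>\<eta>. of_bool (\<not> meets (\<omega> \<union> \<eta>) A B))"
    have \<gamma>0: "0 \<le> \<gamma>" using p0 by (simp add: \<gamma>_def)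
    have w1: "?w \<le> 1" by (rule wavg_le[OF lsb]) simp
    have sum0: "0 \<le> (\<Sum>z\<in>?C. ?out (tile d K z) \<omega>)" by (rule sum_nonneg) simp
    consider z where "z \<in> ?C" "\<not> meets \<omega> (tile d K z) (- ?C)" | "\<not> meets \<omega> A (- ?C)" | "\<not> meets \<omega> B (- ?C)"
      | (good) "\<And>z. z \<in> ?C \<Longrightarrow> meets \<omega> (tile d K z) (- ?C)" "meets \<omega> A (- ?C)" "meets \<omega> B (- ?C)"
      by blast
    then show "?w \<le> (\<Sum>z\<in>?C. ?out (tile d K z) \<omega>) + ?out A \<omega> + ?out B \<omega> + \<gamma>"
    proof cases
      case (1 z)
      have "?out (tile d K z) \<omega> \<le> (\<Sum>z\<in>?C. ?out (tile d K z) \<omega>)"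
        by (rule member_le_sum[OF 1(1)]) (use finC in auto)
      then have "1 \<le> (\<Sum>z\<in>?C. ?out (tile d K z) \<omega>)" using 1(2) by simp
      then have "1 + 0 + 0 + 0 \<le> (\<Sum>z\<in>?C. ?out (tile d K z) \<omega>) + ?out A \<omega> + ?out B \<omega> + \<gamma>"
        using \<gamma>0 by (intro add_mono) auto
      then show ?thesis using w1 by linarith
    next
      case good
      have "layers d V \<omega> n K J T"
      proof
        fix z assume z: "z \<in> ?C"
        show "\<exists>a\<in>tile d K z. \<exists>b. linked \<omega> a b \<and> b \<notin> ?C" using good(1)[OF z] unfolding meets_def by blast
      qed (use d V room \<omega> in auto)
      then interpret layers d V \<omega> n K J T .
      have "A \<noteq> {}" "B \<noteq> {}" using good(2,3) unfolding meets_def by blast+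
      obtain a where a: "a \<in> A" "live a" using good(2) unfolding meets_def live_def by blast
      obtain b where b: "b \<in> B" "live b" using good(3) unfolding meets_def live_def by blast
      have ab: "a \<in> alive T" "b \<in> alive T" using a b A B unfolding alive_def level_def by auto
      have "?w \<le> wavg ?E (bernoulli_weight s) (\<lambda>\<eta>. of_bool (\<exists>a\<in>alive T. \<exists>b\<in>alive T. \<not> linked (\<omega> \<union> \<eta>) a b))"
      proof (rule wavg_mono[OF lsb])
        fix \<eta>
        have "\<exists>a\<in>alive T. \<exists>b\<in>alive T. \<not> linked (\<omega> \<union> \<eta>) a b" if "\<not> meets (\<omega> \<union> \<eta>) A B"
          using that a(1) b(1) ab unfolding meets_def by blast
        then show "of_bool (\<not> meets (\<omega> \<union> \<eta>) A B) \<le> (of_bool (\<exists>a\<in>alive T. \<exists>b\<in>alive T. \<not> linked (\<omega> \<union> \<eta>) a b) :: real)"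
          by auto
      qed
      also have "\<dots> \<le> \<gamma>" unfolding \<gamma>_def using card_cube_le[of d n] T by (intro merged_prob s01) linarith
      finally show ?thesis using sum0 by (simp add: add_increasing)
    qed (use w1 sum0 \<gamma>0 in \<open>simp_all add: add_increasing add_increasing2\<close>)
  qed
  also have "\<dots> = (\<Sum>z\<in>?C. rc_disc r q V (tile d K z) (- ?C)) + rc_disc r q V A (- ?C) + rc_disc r q V B (- ?C) + \<gamma>"
    by (simp add: wavg_add wavg_sum wavg_const[OF lsr] rc_disc_def)
  also have "\<dots> \<le> (2 * real n + 1) ^ d * \<alpha> + \<beta> + \<beta> + real T * (2 * real n + 1) ^ d * ?p"
  proof (intro add_mono \<beta>)
    have "(\<lambda>_. 0) \<in> ?C" by (simp add: cube_iff lattice_points_iff)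
    then have \<alpha>0: "0 \<le> \<alpha>" using \<alpha> rc_disc_nonneg[OF V(1) r q] order_trans by blast
    have "(\<Sum>z\<in>?C. rc_disc r q V (tile d K z) (- ?C)) \<le> (\<Sum>z\<in>?C. \<alpha>)" by (intro sum_mono \<alpha>)
    also have "\<dots> \<le> (2 * real n + 1) ^ d * \<alpha>" using mult_right_mono[OF cardC \<alpha>0] by simp
    finally show "(\<Sum>z\<in>?C. rc_disc r q V (tile d K z) (- ?C)) \<le> (2 * real n + 1) ^ d * \<alpha>" .
    show "\<gamma> \<le> real T * (2 * real n + 1) ^ d * ?p"
      unfolding \<gamma>_def using cardC p0 by (intro mult_right_mono mult_left_mono) auto
  qed
  finally show ?thesis by simp
qed

lemma tile_disc_shift:
  assumes q: "1 \<le> q" and r: "0 < r"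
    and far: "rc_disc r q (cube d R) (tile d K (\<lambda>_. 0)) (far d (\<lambda>_. 0) m) \<le> \<alpha>"
    and z: "z \<in> cube d n" and R: "R + n \<le> R'" "2 * n < m"
  shows "rc_disc r q (cube d R') (tile d K z) (- cube d n) \<le> \<alpha>"
proof -
  have z0: "shift z (\<lambda>_. 0) = z" by (simp add: shift_def)
  have "rc_disc r q (cube d R') (tile d K z) (- cube d n)
      \<le> rc_disc r q (shift z ` cube d R) (shift z ` tile d K (\<lambda>_. 0)) (shift z ` far d (\<lambda>_. 0) m)"
  proof (rule rc_disc_mono[OF finite_cube _ _ _ r q])
    show "shift z ` cube d R \<subseteq> cube d R'"
    proof
      fix x assume "x \<in> shift z ` cube d R"
      then obtain y where y: "y \<in> cube d R" "x = shift z y" by blast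
      have "\<bar>x i\<bar> \<le> R'" if "i < d" for i
      proof -
        have "\<bar>y i\<bar> \<le> R" "\<bar>z i\<bar> \<le> n" using y(1) z that by (auto simp: cube_iff)
        then show ?thesis using R(1) unfolding y(2) shift_def by linarith
      qed
      then show "x \<in> cube d R'" using y z by (auto simp: cube_iff lattice_points_iff shift_def)
    qed
    show "shift z ` far d (\<lambda>_. 0) m \<subseteq> - cube d n"
      unfolding far_shift z0
    proof
      fix b assume "b \<in> far d z m"
      then obtain i where i: "i < d" "m \<le> \<bar>b i - z i\<bar>" by (auto simp: far_def)
      show "b \<in> - cube d n"
      proof
        assume "b \<in> cube d n"
        then have "\<bar>b i\<bar> \<le> n" "\<bar>z i\<bar> \<le> n" using i z by (auto simp: cube_iff)
        then show False using i R(2) by linarith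
      qed
    qed
  qed (simp add: tile_shift z0)
  also have "\<dots> \<le> \<alpha>" using far by (simp only: rc_disc_shift)
  finally show ?thesis .
qed

text \<open>\<open>T\<close> is about \<open>d * log2 n\<close>, to beat the number of vertices, and
  \<open>J\<close> is as large as the room allows. The factor 4 confines the layers to the outer
  quarter of the cube, so that a core remains for the seeds.\<close>

lemma merging_parameters:
  fixes d :: nat and c s \<epsilon> \<eta> :: real
  assumes d: "3 \<le> d" and c: "0 < c" and s: "0 < s" "s < 1" and \<epsilon>: "0 < \<epsilon>" "0 < \<eta>"
  shows "\<forall>\<^sub>F n in sequentially. \<exists>K T J. 1 \<le> K \<and> real K \<le> \<eta> * real n \<and> 4 * (T * J * (2 * K + 4)) \<le> n \<and>
    (2 * n + 1) ^ d < 2 ^ T \<and> (2 * real n + 1) ^ d * exp (- c * real K ^ (d - 1)) \<le> \<epsilon> \<and>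
    real T * (2 * real n + 1) ^ d * (1 - s ^ (d * (2 * (K + 1)))) ^ J \<le> \<epsilon>"
proof -
  define D where "D = real d"
  define \<kappa> where "\<kappa> = D * ln (1 / s)"
  have D: "0 < D" using d by (simp add: D_def)
  have \<kappa>: "0 < \<kappa>" using D s by (simp add: \<kappa>_def)
  \<comment> \<open>Both limits are stated for real-valued bounds: \<open>ln n\<close> to the power
    2/3 bounds \<open>K\<close> from below in the first, and in the second upper bounds for
    \<open>K\<close> and \<open>T\<close> and a lower bound for \<open>J\<close> absorb the
    rounding.\<close>
  have l1: "(\<lambda>n. (2 * real n + 1) powr D * exp (- c * (ln (real n) powr (2 / 3))\<^sup>2)) \<longlonglongrightarrow> 0"
    using D c by real_asymp
  have l2: "(\<lambda>n. D * (ln (2 * real n + 2) / ln 2 + 1) * (2 * real n + 1) powr D *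
      exp (- (real n / (4 * (D * (ln (2 * real n + 2) / ln 2 + 1)) * (2 * (ln (real n) powr (2 / 3) + 1) + 4)) - 1) *
        exp (- \<kappa> * (2 * (ln (real n) powr (2 / 3) + 1) + 2)))) \<longlonglongrightarrow> 0"
    using D \<kappa> by real_asymp
  have l3: "(\<lambda>n. (ln (real n) powr (2 / 3) + 1) / real n) \<longlonglongrightarrow> 0" by real_asymp
  show ?thesis
    using order_tendstoD(2)[OF l1 \<epsilon>(1)] order_tendstoD(2)[OF l2 \<epsilon>(1)] order_tendstoD(2)[OF l3 \<epsilon>(2)]
      eventually_ge_at_top[of "2 :: nat"]
  proof eventually_elim
    case (elim n)
    define a where "a = ln (real n) powr (2 / 3)"
    define t where "t = D * (ln (2 * real n + 2) / ln 2 + 1)"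
    define K where "K = nat \<lceil>a\<rceil>"
    define T where "T = nat \<lceil>D * (ln (2 * real n + 2) / ln 2)\<rceil>"
    define J where "J = n div (4 * (T * (2 * K + 4)))"
    define y where "y = s ^ (d * (2 * (K + 1)))"
    have n: "2 \<le> n" by (rule elim(4))
    then have a0: "0 < a" by (simp add: a_def)
    have K: "a \<le> real K" "real K \<le> a + 1" "1 \<le> K" using a0 unfolding K_def by linarith+
    have l0: "0 < ln (2 * real n + 2) / ln 2" using n by simp
    have T: "D * (ln (2 * real n + 2) / ln 2) \<le> real T" "real T \<le> t"
    proof -
      have "0 < D * (ln (2 * real n + 2) / ln 2)" using D l0 by simp
      then show "D * (ln (2 * real n + 2) / ln 2) \<le> real T" unfolding T_def by linarith
      have "1 \<le> D" using d by (simp add: D_def)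
      then show "real T \<le> t" using \<open>0 < D * (ln (2 * real n + 2) / ln 2)\<close> unfolding T_def t_def distrib_left by linarith
    qed
    have T0: "0 < T" using T(1) D l0 by (metis less_le_trans mult_pos_pos of_nat_0_less_iff)
    have Kn: "real K \<le> \<eta> * real n"
    proof -
      have "(a + 1) / real n \<le> \<eta>" using elim(3) by (simp add: a_def)
      then have "a + 1 \<le> \<eta> * real n" using n by (simp add: divide_le_eq)
      then show ?thesis using K(2) by linarith
    qed
    have room: "4 * (T * J * (2 * K + 4)) \<le> n"
    proof -
      have "J * (4 * (T * (2 * K + 4))) \<le> n" unfolding J_def by simp
      then show ?thesis by (simp add: mult_ac)
    qed
    have card: "(2 * n + 1) ^ d < 2 ^ T"
    proof -
      have "real ((2 * n + 1) ^ d) < (2 * real n + 2) ^ d"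
        using d by (simp add: power_strict_mono)
      also have "\<dots> = (2 * real n + 2) powr D" by (simp add: D_def powr_realpow)
      also have "\<dots> = 2 powr (D * (ln (2 * real n + 2) / ln 2))" by (simp add: powr_def)
      also have "\<dots> \<le> 2 powr real T" using T(1) by simp
      also have "\<dots> = real (2 ^ T)" by (simp add: powr_realpow)
      finally show ?thesis by (simp only: of_nat_less_iff)
    qed
    have pw: "(2 * real n + 1) ^ d = (2 * real n + 1) powr D" by (simp add: D_def powr_realpow)
    have first: "(2 * real n + 1) ^ d * exp (- c * real K ^ (d - 1)) \<le> \<epsilon>"
    proof -
      have "a\<^sup>2 \<le> real K ^ 2" using K a0 by (intro power_mono) auto
      also have "\<dots> \<le> real K ^ (d - 1)" using d K(3) by (intro power_increasing) auto
      finally have "exp (- c * real K ^ (d - 1)) \<le> exp (- c * a\<^sup>2)" using c by simp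
      then have "(2 * real n + 1) ^ d * exp (- c * real K ^ (d - 1)) \<le> (2 * real n + 1) powr D * exp (- c * a\<^sup>2)"
        unfolding pw by (intro mult_left_mono) auto
      then show ?thesis using elim(1) by (simp add: a_def)
    qed
    have "real T * (2 * real n + 1) ^ d * (1 - y) ^ J \<le> \<epsilon>"
    proof -
      define b where "b = real n / (4 * t * (2 * (a + 1) + 4)) - 1"
      define u where "u = exp (- \<kappa> * (2 * (a + 1) + 2))"
      have yeq: "y = exp (- \<kappa> * (2 * real K + 2))"
      proof -
        have "y = exp (ln s) ^ (d * (2 * (K + 1)))" using s by (simp add: y_def)
        also have "\<dots> = exp (real (d * (2 * (K + 1))) * ln s)" by (rule exp_of_nat_mult[symmetric])
        finally show ?thesis using s by (simp add: \<kappa>_def D_def ln_div algebra_simps)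
      qed
      have uy: "u \<le> y" using K(2) \<kappa> by (simp add: u_def yeq)
      have u0: "0 \<le> u" by (simp add: u_def)
      have y1: "0 \<le> y" "y \<le> 1" using s by (auto simp: y_def power_le_one)
      have bJ: "b \<le> real J"
      proof -
        have "real (n div (4 * (T * (2 * K + 4)))) > real n / real (4 * (T * (2 * K + 4))) - 1"
          using floor_divide_of_nat_eq[of n "4 * (T * (2 * K + 4))", where 'a = real] by linarith
        moreover have "real n / (4 * t * (2 * (a + 1) + 4)) \<le> real n / real (4 * (T * (2 * K + 4)))"
        proof (rule divide_left_mono)
          have "real T * (2 * real K + 4) \<le> t * (2 * (a + 1) + 4)" using T K a0 by (intro mult_mono) auto
          then show "real (4 * (T * (2 * K + 4))) \<le> 4 * t * (2 * (a + 1) + 4)" by simp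
          have "0 < real T" using T0 by simp
          then show "0 < 4 * t * (2 * (a + 1) + 4) * real (4 * (T * (2 * K + 4)))"
            using T(2) a0 T0 by (intro mult_pos_pos) auto
        qed simp
        ultimately show ?thesis by (simp add: b_def J_def)
      qed
      have "b * u \<le> real J * u" using bJ u0 by (rule mult_right_mono)
      also have "\<dots> \<le> real J * y" using uy by (simp add: mult_left_mono)
      finally have bu: "b * u \<le> real J * y" .
      have "(1 - y) ^ J \<le> exp (- y) ^ J" using exp_ge_add_one_self[of "- y"] y1 by (intro power_mono) auto
      also have "\<dots> = exp (- (real J * y))" by (simp flip: exp_of_nat_mult)
      also have "\<dots> \<le> exp (- (b * u))" using bu by simp
      finally have "(1 - y) ^ J \<le> exp (- (b * u))" .
      then have "real T * (2 * real n + 1) ^ d * (1 - y) ^ J \<le> t * (2 * real n + 1) powr D * exp (- (b * u))"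
        unfolding pw using T y1 by (intro mult_mono) auto
      also have "\<dots> \<le> \<epsilon>" using less_imp_le[OF elim(2)] by (simp only: b_def u_def t_def a_def mult_minus_left)
      finally show ?thesis .
    qed
    then show ?case using K(3) Kn room card first unfolding y_def by blast
  qed
qed

lemma disjoint_tiles:
  assumes "2 * K < g" "3 \<le> d" "i \<noteq> j"
  shows "shift (lat d (int (i * g)) 0) ` tile d K (\<lambda>_. 0) \<inter> shift (lat d (int (j * g)) 0) ` tile d K (\<lambda>_. 0) = {}"
proof (rule equals0I)
  fix x assume "x \<in> shift (lat d (int (i * g)) 0) ` tile d K (\<lambda>_. 0) \<inter> shift (lat d (int (j * g)) 0) ` tile d K (\<lambda>_. 0)"
  then have tiles: "x \<in> tile d K (shift (lat d (int (i * g)) 0) (\<lambda>_. 0))" "x \<in> tile d K (shift (lat d (int (j * g)) 0) (\<lambda>_. 0))"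
    unfolding tile_shift by auto
  have bound: "\<bar>x (d - 2) - int (l * g)\<bar> \<le> int K" if "x \<in> tile d K (shift (lat d (int (l * g)) 0) (\<lambda>_. 0))" for l
  proof -
    have "\<bar>x (d - 2) - shift (lat d (int (l * g)) 0) (\<lambda>_. 0) (d - 2)\<bar> \<le> (if d - 2 + 1 < d then int K else 0)"
      using that unfolding tile_def by blast
    moreover have "Suc (Suc (d - 2)) = d" "Suc (d - 2) < d" using assms(2) by auto
    ultimately show ?thesis by (simp add: shift_def lat_def)
  qed
  have "\<bar>int (i * g) - int (j * g)\<bar> \<le> 2 * int K" using bound[OF tiles(1)] bound[OF tiles(2)] by linarith
  moreover have "int g \<le> \<bar>int (i * g) - int (j * g)\<bar>"
  proof -
    have "1 * int g \<le> \<bar>int i - int j\<bar> * int g" using assms(3) by (intro mult_right_mono) auto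
    also have "\<dots> = \<bar>(int i - int j) * int g\<bar>" by (simp add: abs_mult)
    finally show ?thesis by (simp add: left_diff_distrib)
  qed
  ultimately show False using assms(1) by linarith
qed

lemma tile_connected:
  assumes "z \<in> lattice_points d" "x \<in> tile d K z" "y \<in> tile d K z"
  shows "linked (inner (tile d K z)) x y"
proof -
  let ?lo = "\<lambda>i. z i - (if i + 1 < d then int K else 0)" and ?hi = "\<lambda>i. z i + (if i + 1 < d then int K else 0)"
  have eq: "tile d K z = ibox ?lo ?hi"
    unfolding tile_def ibox_def by (intro Collect_cong all_cong1) (simp add: abs_le_iff, linarith)
  have lat: "v \<in> lattice_points d" if "v \<in> tile d K z" for v
    unfolding lattice_points_iff
  proof (intro allI impI)
    fix i assume "d \<le> i"
    moreover have "\<bar>v i - z i\<bar> \<le> (if i + 1 < d then int K else 0)" using that unfolding tile_def by blast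
    ultimately show "v i = 0" using assms(1) by (simp add: lattice_points_iff)
  qed
  show ?thesis using assms(2,3) lat[OF assms(2)] lat[OF assms(3)] unfolding eq by (intro linked_ibox[where d = d])
qed

lemma tile_subset_cube:
  assumes "z \<in> lattice_points d" "\<And>i. i < d \<Longrightarrow> \<bar>z i\<bar> + int K \<le> N"
  shows "tile d K z \<subseteq> cube d N"
proof
  fix v assume v: "v \<in> tile d K z"
  have v': "\<bar>v i - z i\<bar> \<le> (if i + 1 < d then int K else 0)" for i using v unfolding tile_def by blast
  have "v i = 0" if "d \<le> i" for i using v'[of i] assms(1) that by (simp add: lattice_points_iff)
  moreover have "\<bar>v i\<bar> \<le> N" if "i < d" for i using v'[of i] assms(2)[OF that] by (simp split: if_splits)
  ultimately show "v \<in> cube d N" by (simp add: cube_iff lattice_points_iff)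
qed

lemma cube_subset_slab:
  assumes "m \<le> Q"
  shows "cube d (int m) \<subseteq> slab_box d Q m"
proof
  fix x assume x: "x \<in> cube d (int m)"
  have "- int m \<le> x i \<and> x i \<le> int m" if "i < d" for i using x that by (simp add: cube_def)
  moreover have "- int Q \<le> x i \<and> x i \<le> int Q" if "i < d" for i using calculation[OF that] assms by linarith
  ultimately show "x \<in> slab_box d Q m" using x by (simp add: cube_def slab_box_def)
qed

lemma slab_box_cube: "slab_box d T T = cube d (int T)"
  by (auto simp: slab_box_def cube_def)

text \<open>Two sizes of tiles occur. A tile of fixed size \<open>K0\<close>, chosen from
  \<open>\<epsilon>\<close> alone, is the seed; tiles of size \<open>K\<close>, growing with
  \<open>n\<close>, show that every place in the cube is close to a cluster reaching the
  outside.\<close>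

theorem link_of_tension:
  fixes C \<delta> c :: real
  assumes d: "3 \<le> d" and q: "1 \<le> q" and rr: "0 < r" "r < r'" and \<delta>: "0 < \<delta>" "\<delta> \<le> C" and c: "0 < c"
    and tension: "\<And>L0. \<exists>L\<ge>L0. rc_disc r q (cube d \<lfloor>C * real L\<rfloor>) (bottom_side d (int L) \<lfloor>\<delta> * real L\<rfloor>)
      (top_side d (int L) \<lfloor>\<delta> * real L\<rfloor>) \<le> exp (- c * real L ^ (d - 1))"
  shows "link_property d q r'"
proof -
  \<comment> \<open>Below, \<open>R + n <= (C + 2 + 2 * \<delta>) * L\<close>,
    \<open>L <= 2 * n / \<delta>\<close> and \<open>n <= 16 * (g * k)\<close>, whence
    \<open>32 = 2 * 16\<close>. Only \<open>C\<close> and \<open>\<delta>\<close> enter, as the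
    order of quantifiers demands.\<close>
  define \<rho> where "\<rho> = nat \<lceil>32 * (C + 2 + 2 * \<delta>) / \<delta>\<rceil>"
  define c' where "c' = c / 2 ^ (d - 1)"
  have c': "0 < c'" using c by (simp add: c'_def)
  have \<rho>: "32 * (C + 2 + 2 * \<delta>) / \<delta> \<le> real \<rho>" unfolding \<rho>_def by linarith
  have "0 < 32 * (C + 2 + 2 * \<delta>) / \<delta>" using \<delta> by simp
  then have \<rho>1: "1 \<le> \<rho>" using \<rho> by linarith
  show ?thesis
    unfolding link_property_def
  proof (rule exI[of _ \<rho>], intro allI impI)
    fix \<epsilon> s :: real assume "0 < \<epsilon> \<and> 0 < s \<and> s < 1"
    then have \<epsilon>: "0 < \<epsilon>" and s: "0 < s" "s < 1" by auto
    obtain s' where sp: "sprinkle_ok q r r' s'" using sprinkle_ok_ex[OF rr q] .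
    then have s': "0 < s'" "s' < 1" by (auto simp: sprinkle_ok_def)
    have "(\<lambda>K. exp (- c' * real K)) \<longlonglongrightarrow> 0" using c' by real_asymp
    then have "\<forall>\<^sub>F K in sequentially. exp (- c' * real K) < \<epsilon> / 4" by (rule order_tendstoD) (use \<epsilon> in simp)
    then have "\<forall>\<^sub>F K in sequentially. exp (- c' * real K) < \<epsilon> / 4 \<and> 1 \<le> K" using eventually_ge_at_top by (rule eventually_conj)
    then obtain K0 where K0: "exp (- c' * real K0) < \<epsilon> / 4" "1 \<le> K0"
      unfolding eventually_sequentially by blast
    define S where "S = tile d K0 (\<lambda>_. 0)"
    define g where "g = 2 * K0 + 1"
    have K0': "exp (- c' * real K0 ^ (d - 1)) \<le> \<epsilon> / 4"
    proof -
      have "real K0 ^ 1 \<le> real K0 ^ (d - 1)" using d K0(2) by (intro power_increasing) auto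
      then have "exp (- c' * real K0 ^ (d - 1)) \<le> exp (- c' * real K0)" using c' by simp
      then show ?thesis using K0(1) by linarith
    qed
    have "0 < s ^ card (inner S)" "s ^ card (inner S) \<le> 1" using s by (auto simp: power_le_one)
    then obtain k0 where k0: "(1 - s ^ card (inner S)) ^ k0 < \<epsilon>"
      using real_arch_pow_inv[OF \<epsilon>, of "1 - s ^ card (inner S)"] by auto
    have "\<forall>\<^sub>F n in sequentially. \<exists>K T J. 1 \<le> K \<and> real K \<le> 1 / (2 * \<delta>) * real n \<and> 4 * (T * J * (2 * K + 4)) \<le> n \<and>
        (2 * n + 1) ^ d < 2 ^ T \<and> (2 * real n + 1) ^ d * exp (- c' * real K ^ (d - 1)) \<le> \<epsilon> / 4 \<and>
        real T * (2 * real n + 1) ^ d * (1 - s' ^ (d * (2 * (K + 1)))) ^ J \<le> \<epsilon> / 4"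
      by (rule merging_parameters[OF d c' s']) (use \<epsilon> \<delta> in auto)
    then obtain n0 where n0: "\<And>n. n0 \<le> n \<Longrightarrow> \<exists>K T J. 1 \<le> K \<and> real K \<le> 1 / (2 * \<delta>) * real n \<and>
        4 * (T * J * (2 * K + 4)) \<le> n \<and>
        (2 * n + 1) ^ d < 2 ^ T \<and> (2 * real n + 1) ^ d * exp (- c' * real K ^ (d - 1)) \<le> \<epsilon> / 4 \<and>
        real T * (2 * real n + 1) ^ d * (1 - s' ^ (d * (2 * (K + 1)))) ^ J \<le> \<epsilon> / 4"
      unfolding eventually_sequentially by blast
    \<comment> \<open>Large enough for \<open>merging_parameters\<close> and for at least
      \<open>k0\<close> candidates.\<close>
    define n1 where "n1 = n0 + 16 * g * (k0 + 1) + 2"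
    define L0 where "L0 = nat \<lceil>(real n1 + 2) / \<delta>\<rceil> + K0 + 1"
    obtain L where L: "L0 \<le> L" and disc: "rc_disc r q (cube d \<lfloor>C * real L\<rfloor>) (bottom_side d (int L) \<lfloor>\<delta> * real L\<rfloor>)
      (top_side d (int L) \<lfloor>\<delta> * real L\<rfloor>) \<le> exp (- c * real L ^ (d - 1))" using tension by blast
    define M N where "M = \<lfloor>\<delta> * real L\<rfloor>" and "N = \<lfloor>C * real L\<rfloor>"
    \<comment> \<open>A point at distance \<open>2 * M\<close> from a vertex of the cube of size
      \<open>n\<close> lies outside this cube, because \<open>2 * n < 2 * M\<close>.\<close>
    define n where "n = nat (M - 1)"
    define R where "R = N + 2 * int L + M"
    \<comment> \<open>Displacements up to \<open>2 * (g * k) <= n / 4\<close>, together with the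
      extent of the seed, then keep both seeds in the core that the layers leave.\<close>
    define k where "k = n div (8 * g)"
    have "(real n1 + 2) / \<delta> \<le> real L" using L unfolding L0_def by linarith
    then have \<delta>L: "real n1 + 2 \<le> \<delta> * real L" using \<delta> by (simp add: divide_le_eq mult.commute)
    then have M: "int n1 + 2 \<le> M" unfolding M_def by linarith
    have n: "int n = M - 1" "n1 \<le> n" using M unfolding n_def by auto
    have nL: "real n \<le> \<delta> * real L" "\<delta> * real L \<le> 2 * real n"
    proof -
      have "real_of_int M = real n + 1" using n(1) by linarith
      then show "real n \<le> \<delta> * real L" unfolding M_def by linarith
      have "\<delta> * real L < real n + 2" using \<open>real_of_int M = real n + 1\<close> unfolding M_def by linarith
      moreover have "2 \<le> real n" using n(2) by (simp add: n1_def)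
      ultimately show "\<delta> * real L \<le> 2 * real n" by linarith
    qed
    have g: "0 < g" by (simp add: g_def)
    have k: "k0 \<le> k" "0 < k" "8 * (g * k) \<le> n" "n \<le> 16 * (g * k)"
    proof -
      have big: "8 * g * (k0 + 1) \<le> n" using n(2) by (simp add: n1_def)
      then have "k0 + 1 \<le> k" using g unfolding k_def by (simp add: less_eq_div_iff_mult_less_eq mult_ac)
      then show "k0 \<le> k" "0 < k" by auto
      show "8 * (g * k) \<le> n" unfolding k_def using div_times_less_eq_dividend[of n "8 * g"] by (simp add: mult_ac)
      have "n < 8 * g * (k + 1)" unfolding k_def using g dividend_less_times_div[of "8 * g" n] by simp
      also have "\<dots> \<le> 8 * g * (2 * k)" using \<open>0 < k\<close> by (intro mult_left_mono) auto
      finally show "n \<le> 16 * (g * k)" by (simp add: mult_ac)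
    qed
    have K0gk: "K0 \<le> g * k" using k(2) mult_le_mono[of K0 g 1 k] by (simp add: g_def)
    obtain K T J where P: "1 \<le> K" "real K \<le> 1 / (2 * \<delta>) * real n" "4 * (T * J * (2 * K + 4)) \<le> n"
        "(2 * n + 1) ^ d < 2 ^ T" "(2 * real n + 1) ^ d * exp (- c' * real K ^ (d - 1)) \<le> \<epsilon> / 4"
        "real T * (2 * real n + 1) ^ d * (1 - s' ^ (d * (2 * (K + 1)))) ^ J \<le> \<epsilon> / 4"
      using n0[of n] n(2) unfolding n1_def by auto
    have KL: "K \<le> L"
    proof -
      have "real K \<le> 1 / (2 * \<delta>) * (\<delta> * real L)" 
        using nL(1) \<delta> by (intro order_trans[OF P(2)] mult_left_mono) auto
      also have "\<dots> \<le> real L" using \<delta> by simp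
      finally show ?thesis by simp
    qed
    have MN: "0 \<le> M" "M \<le> N" using M \<delta> by (auto simp: M_def N_def intro!: floor_mono mult_right_mono)
    \<comment> \<open>The slab is taken as thick as it is wide, which makes it a cube.\<close>
    define Q where "Q = \<rho> * (g * k)"
    have RQ: "R + int n \<le> int Q"
    proof -
      have "real_of_int (R + int n) = real_of_int N + 2 * real L + real_of_int M + real n" by (simp add: R_def)
      also have "\<dots> \<le> C * real L + 2 * real L + \<delta> * real L + \<delta> * real L"
        using nL(1) unfolding M_def N_def by (intro add_mono) auto
      also have "\<dots> = (C + 2 + 2 * \<delta>) * real L" by (simp add: algebra_simps)
      also have "\<dots> \<le> (C + 2 + 2 * \<delta>) * (2 * real n / \<delta>)"
      proof (rule mult_left_mono)
        show "real L \<le> 2 * real n / \<delta>" using nL(2) \<delta> by (simp add: field_simps)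
      qed (use \<delta> in simp)
      also have "\<dots> \<le> (C + 2 + 2 * \<delta>) * (2 * (16 * real (g * k)) / \<delta>)"
      proof -
        have "real n \<le> 16 * real (g * k)" using k(4) by linarith
        then show ?thesis using \<delta> by (intro mult_left_mono divide_right_mono) auto
      qed
      also have "\<dots> = 32 * (C + 2 + 2 * \<delta>) / \<delta> * real (g * k)" by simp
      also have "\<dots> \<le> real \<rho> * real (g * k)" using \<rho> by (rule mult_right_mono) simp
      also have "\<dots> = real_of_int (int Q)" by (simp add: Q_def)
      finally show ?thesis by (simp only: of_int_le_iff)
    qed
    have far: "rc_disc r q (cube d (int Q)) (tile d K' z) (- cube d (int n)) \<le> exp (- c' * real K' ^ (d - 1))"
      if "1 \<le> K'" "K' \<le> L" "z \<in> cube d (int n)" for K' z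
    proof (rule tile_disc_shift[OF q rr(1) _ that(3) RQ])
      show "rc_disc r q (cube d R) (tile d K' (\<lambda>_. 0)) (far d (\<lambda>_. 0) (2 * M)) \<le> exp (- c' * real K' ^ (d - 1))"
        unfolding c'_def
        by (rule tile_far_prob[OF d q rr(1) that(1,2) c MN]) (use disc in \<open>simp_all add: R_def M_def N_def\<close>)
    qed (use n in simp)
    have K0L: "K0 \<le> L" using L by (simp add: L0_def)
    have zero: "(\<lambda>_. 0) \<in> cube d (int n)" by (simp add: cube_iff lattice_points_iff)
    have Qlat: "cube d (int Q) \<subseteq> lattice_points d" by (rule cube_lattice)
    have nQ: "cube d (int n) \<subseteq> cube d (int Q)"
      by (rule cube_mono) (use RQ MN in \<open>simp add: R_def\<close>)
    have room: "T * J * (2 * K + 4) \<le> n" using P(3) by linarith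
    have inside: "shift (lat d a b) ` S \<subseteq> cube d (int n - int (T * J) * (2 * int K + 4))"
      and latn: "lat d a b \<in> cube d (int n)"
      if ab: "\<bar>a\<bar> \<le> 2 * int (g * k)" "\<bar>b\<bar> \<le> 2 * int (g * k)" for a b
    proof -
      have l: "lat d a b \<in> lattice_points d" using d by (auto simp: lat_def lattice_points_iff)
      have lb: "\<bar>lat d a b i\<bar> \<le> 2 * int (g * k)" for i using ab by (simp add: lat_def)
      have k8: "8 * int (g * k) \<le> int n" using k(3) by linarith
      have lm: "4 * (int (T * J) * (2 * int K + 4)) \<le> int n"
      proof -
        have "int (4 * (T * J * (2 * K + 4))) \<le> int n" using P(3) by (simp only: of_nat_le_iff)
        then show ?thesis by simp
      qed
      have z: "shift (lat d a b) (\<lambda>_. 0) = lat d a b" by (simp add: shift_def)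
      show "shift (lat d a b) ` S \<subseteq> cube d (int n - int (T * J) * (2 * int K + 4))"
        unfolding S_def tile_shift z
      proof (rule tile_subset_cube[OF l])
        fix i
        show "\<bar>lat d a b i\<bar> + int K0 \<le> int n - int (T * J) * (2 * int K + 4)"
          using lb[of i] k8 lm K0gk by linarith
      qed
      have "\<bar>lat d a b i\<bar> \<le> int n" for i using lb[of i] k8 by linarith
      then show "lat d a b \<in> cube d (int n)" using l by (simp add: cube_iff)
    qed
    have "linked_seeds d q r' \<epsilon> s \<rho> S g k Q"
      unfolding linked_seeds_def
    proof (intro conjI ballI allI impI)
      show "S \<noteq> {}" unfolding S_def tile_def by (auto intro!: exI[of _ "\<lambda>_. 0"])
      show "S \<subseteq> slab_box d Q (g * k)"
      proof -
        have "int K0 \<le> int (g * k)" using K0gk by (simp only: of_nat_le_iff)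
        then have "S \<subseteq> cube d (int (g * k))" unfolding S_def
          by (intro tile_subset_cube) (simp_all add: lattice_points_iff)
        moreover have "g * k \<le> Q" using \<rho>1 unfolding Q_def by simp
        ultimately show ?thesis using cube_subset_slab by blast
      qed
      show "linked (inner S) x y" if "x \<in> S" "y \<in> S" for x y
        using that unfolding S_def by (intro tile_connected) (simp add: lattice_points_iff)
      show "0 < g" "0 < k" by (fact g k)+
      show "shift (lat d (int (i * g)) 0) ` S \<inter> shift (lat d (int (j * g)) 0) ` S = {}" if "i \<noteq> j" for i j
        unfolding S_def by (rule disjoint_tiles) (use d that in \<open>simp_all add: g_def\<close>)
      show "(1 - s ^ card (inner S)) ^ k \<le> \<epsilon>"
      proof -
        have "(1 - s ^ card (inner S)) ^ k \<le> (1 - s ^ card (inner S)) ^ k0"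
          using k(1) s by (intro power_decreasing) (auto simp: power_le_one)
        then show ?thesis using k0 by linarith
      qed
      fix a b assume ab: "\<bar>a\<bar> \<le> 2 * int (g * k) \<and> \<bar>b\<bar> \<le> 2 * int (g * k)"
      have z: "shift (lat d a b) (\<lambda>_. 0) = lat d a b" by (simp add: shift_def)
      have "shift (lat d 0 0) x = x" for x by (rule ext) (simp add: shift_def lat_def)
      then have origin_lat: "shift (lat d 0 0) ` S = S" by simp
      have S: "S \<subseteq> cube d (int n - int (T * J) * (2 * int K + 4))" using inside[of 0 0] unfolding origin_lat by simp
      have "rc_disc r' q (cube d (int Q)) S (shift (lat d a b) ` S)
        \<le> (2 * real n + 1) ^ d * exp (- c' * real K ^ (d - 1)) + 2 * exp (- c' * real K0 ^ (d - 1)) +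
          real T * (2 * real n + 1) ^ d * (1 - s' ^ (d * (2 * (K + 1)))) ^ J"
      proof (rule disc_by_merging[OF _ q rr(1) sp finite_cube Qlat nQ room P(4) S])
        show "shift (lat d a b) ` S \<subseteq> cube d (int n - int (T * J) * (2 * int K + 4))" using inside ab by blast
        show "rc_disc r q (cube d (int Q)) S (- cube d (int n)) \<le> exp (- c' * real K0 ^ (d - 1))"
          unfolding S_def by (rule far[OF K0(2) K0L zero])
        show "rc_disc r q (cube d (int Q)) (shift (lat d a b) ` S) (- cube d (int n)) \<le> exp (- c' * real K0 ^ (d - 1))"
          unfolding S_def tile_shift z by (rule far[OF K0(2) K0L]) (use latn ab in blast)
        show "2 \<le> d" using d by simp
      qed (rule far[OF P(1) KL])
      also have "\<dots> \<le> \<epsilon>" using P(5,6) K0' by linarith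
      finally show "rc_disc r' q (slab_box d Q (\<rho> * (g * k))) S (shift (lat d a b) ` S) \<le> \<epsilon>"
        unfolding Q_def[symmetric] slab_box_cube .
    qed
    then show "\<exists>J g k T. linked_seeds d q r' \<epsilon> s \<rho> J g k T" by blast
  qed
qed

section \<open>Comparison of the thresholds\<close>

lemma fk_partition_pos:
  assumes "finite \<Lambda>" "\<Lambda> \<subseteq> lattice_points d" "0 \<le> p" "p \<le> 1" "1 \<le> q"
  shows "0 < fk_partition d \<Lambda> p q {}"
proof -
  let ?E = "edges_meeting d \<Lambda>"
  have fin: "finite ?E" using assms finite_edges_meeting by blast
  have nn: "0 \<le> fk_weight d \<Lambda> p q {} \<omega>" for \<omega> using assms by (simp add: fk_weight_def)
  obtain \<omega> where \<omega>: "\<omega> \<subseteq> ?E" "0 < fk_weight d \<Lambda> p q {} \<omega>"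
  proof (cases "p = 0")
    case True
    then show ?thesis using that[of "{}"] assms by (simp add: fk_weight_def)
  next
    case False
    then have "0 < fk_weight d \<Lambda> p q {} ?E" using assms by (simp add: fk_weight_def)
    then show ?thesis using that[of ?E] by blast
  qed
  have "fk_weight d \<Lambda> p q {} \<omega> \<le> fk_partition d \<Lambda> p q {}"
    unfolding fk_partition_def using fin \<omega>(1) nn by (intro member_le_sum) auto
  then show ?thesis using \<omega>(2) by linarith
qed

text \<open>For the endpoints \<open>p = 0\<close> and \<open>p = 1\<close>, which the
  representation by odds excludes: there a single configuration has positive weight. It also covers
  events that are constant for geometric reasons.\<close>

lemma free_prob_const:
  assumes "finite \<Lambda>" "\<Lambda> \<subseteq> lattice_points d" "0 \<le> p" "p \<le> 1" "1 \<le> q"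
    and Q: "\<And>\<omega>. \<omega> \<subseteq> edges_meeting d \<Lambda> \<Longrightarrow> fk_weight d \<Lambda> p q {} \<omega> \<noteq> 0 \<Longrightarrow> Q \<omega> \<longleftrightarrow> b"
  shows "measure (fk_free d \<Lambda> p q) {\<omega> \<in> space (fk_free d \<Lambda> p q). Q \<omega>} = of_bool b"
proof -
  have "(\<Sum>\<omega>\<in>Pow (edges_meeting d \<Lambda>). fk_weight d \<Lambda> p q {} \<omega> * of_bool (Q \<omega>))
      = (\<Sum>\<omega>\<in>Pow (edges_meeting d \<Lambda>). fk_weight d \<Lambda> p q {} \<omega> * of_bool b)"
    using Q by (intro sum.cong) auto
  also have "\<dots> = fk_partition d \<Lambda> p q {} * of_bool b" by (simp add: fk_partition_def sum_distrib_right)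
  finally show ?thesis using fk_partition_pos[OF assms(1-5)] free_prob_eq[OF assms(1-5), of Q] by simp
qed

lemma fk_weight_0: "finite \<omega> \<Longrightarrow> fk_weight d \<Lambda> 0 q \<xi> \<omega> \<noteq> 0 \<Longrightarrow> \<omega> = {}"
  by (auto simp: fk_weight_def)

lemma fk_weight_1:
  "finite (edges_meeting d \<Lambda>) \<Longrightarrow> \<omega> \<subseteq> edges_meeting d \<Lambda> \<Longrightarrow> fk_weight d \<Lambda> 1 q \<xi> \<omega> \<noteq> 0 \<Longrightarrow> \<omega> = edges_meeting d \<Lambda>"
  by (auto simp: fk_weight_def power_0_left split: if_splits)

lemma linked_empty: "linked {} x y \<longleftrightarrow> x = y"
  using linked_Union[of "{}" x y] by auto

text \<open>\<open>Inf\<close> on the reals is meaningful only for nonempty sets that are bounded below, hence the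
  nonnegativity.\<close>

lemma slab_inf_pos_iff:
  assumes d: "2 \<le> d" and nonneg: "\<And>N x. 0 \<le> f N x"
  shows "0 < (INF N::nat. INF x\<in>slab_box d L N. f N x) \<longleftrightarrow> (\<exists>c>0::real. \<forall>N. \<forall>x\<in>slab_box d L N. c \<le> f N x)"
proof
  have ne: "slab_box d L N \<noteq> {}" for N using origin_in_slab[OF d] by blast
  have bdd: "bdd_below (f N ` X)" for N X using nonneg by (auto simp: bdd_below_def)
  have "0 \<le> (INF x\<in>slab_box d L N. f N x)" for N using ne nonneg by (intro cINF_greatest)
  then have bdd': "bdd_below (range (\<lambda>N. INF x\<in>slab_box d L N. f N x))" by (auto simp: bdd_below_def)
  {
    assume "0 < (INF N. INF x\<in>slab_box d L N. f N x)"
    moreover have "(INF N. INF x\<in>slab_box d L N. f N x) \<le> f N x" if "x \<in> slab_box d L N" for N x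
      using cINF_lower[OF bdd' UNIV_I[of N]] cINF_lower[OF bdd that, of N] by linarith
    ultimately show "\<exists>c>0. \<forall>N. \<forall>x\<in>slab_box d L N. c \<le> f N x" by blast
  }
  assume "\<exists>c>0. \<forall>N. \<forall>x\<in>slab_box d L N. c \<le> f N x"
  then obtain c where c: "0 < c" "\<And>N x. x \<in> slab_box d L N \<Longrightarrow> c \<le> f N x" by blast
  have "c \<le> (INF N. INF x\<in>slab_box d L N. f N x)" using ne c(2) by (intro cINF_greatest) auto
  then show "0 < (INF N. INF x\<in>slab_box d L N. f N x)" using c(1) by linarith
qed

definition slab_percolates :: "nat \<Rightarrow> real \<Rightarrow> real \<Rightarrow> bool" where
  "slab_percolates d q p \<longleftrightarrow> (\<exists>L. \<exists>c>0. \<forall>N. \<forall>x\<in>slab_box d L N.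
    c \<le> free_connect_prob d (slab_box d L N) p q {origin} {x})"

lemma p_hat_eq: "2 \<le> d \<Longrightarrow> p_hat q d = Inf {p \<in> {0..1}. slab_percolates d q p}"
  unfolding p_hat_def slab_percolates_def
  by (subst slab_inf_pos_iff) (auto simp: free_connect_prob_def)

context
  fixes d :: nat and q :: real
  assumes d: "3 \<le> d" and q: "1 \<le> q"
begin

lemma d2: "2 \<le> d" using d by simp

lemma slab_prob_eq:
  assumes "0 < p" "p < 1" "x \<in> slab_box d L N"
  shows "free_connect_prob d (slab_box d L N) p q {origin} {x}
    = 1 - rc_disc (p / (1 - p)) q (slab_box d L N) {origin} {x}"
  using assms origin_in_slab[OF d2]
  by (intro free_connect_prob_eq[OF slab_corner_lattice(2,1) slab_box_ibox[OF d2] _ _ q]) auto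

lemma slab_percolates_0: "\<not> slab_percolates d q 0"
proof
  assume "slab_percolates d q 0"
  then obtain L c where c: "0 < c" "\<And>N x. x \<in> slab_box d L N \<Longrightarrow> c \<le> free_connect_prob d (slab_box d L N) 0 q {origin} {x}"
    unfolding slab_percolates_def by blast
  define x where "x = lat d 1 0"
  have x: "x \<in> slab_box d L 1" using d by (auto simp: x_def slab_box_iff lat_def slab_corner_def)
  have "x (d - 2) = 1" using d by (simp add: x_def lat_def)
  then have ne: "x \<noteq> origin" by (auto simp: origin_def)
  have lat: "{origin} \<subseteq> lattice_points d" "{x} \<subseteq> lattice_points d" using x slab_box_lattice[OF d2] lattice_origin by auto
  have fin: "finite (slab_box d L 1)" "slab_box d L 1 \<subseteq> lattice_points d"
    using finite_slab_box[OF d2] slab_box_lattice[OF d2] by auto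
  have "free_connect_prob d (slab_box d L 1) 0 q {origin} {x} = of_bool False"
    unfolding free_connect_prob_def connected_to_iff[OF lat]
  proof (rule free_prob_const[OF fin _ _ q])
    fix \<omega> assume "\<omega> \<subseteq> edges_meeting d (slab_box d L 1)" "fk_weight d (slab_box d L 1) 0 q {} \<omega> \<noteq> 0"
    then have "\<omega> = {}" using fk_weight_0 finite_subset finite_edges_meeting[OF fin] by blast
    then show "meets \<omega> {origin} {x} \<longleftrightarrow> False" using ne by (simp add: meets_def linked_empty)
  qed auto
  then show False using c(1) c(2)[OF x] by simp
qed

lemma box_linked_at_1:
  assumes "lo \<in> lattice_points d" "hi \<in> lattice_points d" "\<Lambda> = ibox lo hi" "a \<in> \<Lambda>" "b \<in> \<Lambda>"
    and \<omega>: "\<omega> \<subseteq> edges_meeting d \<Lambda>" "fk_weight d \<Lambda> 1 q {} \<omega> \<noteq> 0"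
  shows "linked \<omega> a b"
proof -
  have fin: "finite \<Lambda>" "\<Lambda> \<subseteq> lattice_points d" using finite_box box_lattice assms(1-3) by auto
  have "\<omega> = edges_meeting d \<Lambda>" using fk_weight_1[OF finite_edges_meeting[OF fin] \<omega>] .
  then have "inner \<Lambda> \<subseteq> \<omega>" using inner_subset_meeting[OF assms(1-3)] by simp
  moreover have "linked (inner \<Lambda>) a b"
    using assms(4,5) fin(2) unfolding assms(3) by (intro linked_ibox[where d = d]) auto
  ultimately show ?thesis by (rule linked_mono[rotated])
qed

lemma slab_percolates_1: "slab_percolates d q 1"
  unfolding slab_percolates_def
proof (rule exI[of _ 0], rule exI[of _ 1], intro conjI allI ballI)
  fix N x assume x: "x \<in> slab_box d 0 N"
  have lat: "{origin} \<subseteq> lattice_points d" "{x} \<subseteq> lattice_points d" using x slab_box_lattice[OF d2] lattice_origin by auto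
  have "free_connect_prob d (slab_box d 0 N) 1 q {origin} {x} = of_bool True"
    unfolding free_connect_prob_def connected_to_iff[OF lat]
  proof (rule free_prob_const[OF finite_slab_box[OF d2] slab_box_lattice[OF d2] _ _ q])
    fix \<omega> assume "\<omega> \<subseteq> edges_meeting d (slab_box d 0 N)" "fk_weight d (slab_box d 0 N) 1 q {} \<omega> \<noteq> 0"
    then have "linked \<omega> origin x"
      using box_linked_at_1[OF slab_corner_lattice(2,1) slab_box_ibox[OF d2] origin_in_slab[OF d2] x] by blast
    then show "meets \<omega> {origin} {x} \<longleftrightarrow> True" by (simp add: meets_def)
  qed auto
  then show "1 \<le> free_connect_prob d (slab_box d 0 N) 1 q {origin} {x}" by simp
qed simp

section \<open>Surface tension as an exponential bound\<close>

abbreviation disc_prob :: "real \<Rightarrow> real \<Rightarrow> real \<Rightarrow> nat \<Rightarrow> real" where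
  "disc_prob p C \<delta> L \<equiv> free_disconnect_prob d (cube d \<lfloor>C * real L\<rfloor>) p q
    (bottom_side d (int L) \<lfloor>\<delta> * real L\<rfloor>) (top_side d (int L) \<lfloor>\<delta> * real L\<rfloor>)"

lemma disc_prob_nonneg: "0 \<le> disc_prob p C \<delta> L"
  by (simp add: free_disconnect_prob_def)

lemma side_lattice: "bottom_side d L M \<subseteq> lattice_points d" "top_side d L M \<subseteq> lattice_points d"
  by (auto simp: bottom_side_def top_side_def)

lemma side_subset_cube:
  assumes "L \<le> N" "0 \<le> M" "M \<le> N"
  shows "bottom_side d L M \<subseteq> cube d N" "top_side d L M \<subseteq> cube d N"
proof -
  have split: "i < d - 1 \<or> i = d - 1" if "i < d" for i using that by linarith
  have "\<bar>x i\<bar> \<le> N" if "i < d" "x \<in> bottom_side d L M \<union> top_side d L M" for x i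
    using split[OF that(1)] that(2) assms by (auto simp: bottom_side_def top_side_def abs_le_iff)
  then show "bottom_side d L M \<subseteq> cube d N" "top_side d L M \<subseteq> cube d N"
    using side_lattice[of L M] by (fastforce simp: cube_iff)+
qed

text \<open>An edge meeting the cube reaches height at most \<open>N + 1\<close>, so the vertices of
  a side at height \<open>N + 2\<close> or more are isolated.\<close>

lemma sides_disconnected:
  assumes \<omega>: "\<omega> \<subseteq> edges_meeting d (cube d N)" and M: "0 < M" "\<omega> = {} \<or> N + 2 \<le> M"
  shows "\<not> meets \<omega> (bottom_side d L M) (top_side d L M)"
proof
  assume "meets \<omega> (bottom_side d L M) (top_side d L M)"
  then obtain a b where ab: "a (d - 1) = - M" "b (d - 1) = M" "linked \<omega> a b"
    by (auto simp: meets_def bottom_side_def top_side_def)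
  have "a \<noteq> b" using ab(1,2) M(1) by auto
  then have "b \<in> \<Union>\<omega>" using linked_Union[OF ab(3)] by blast
  then obtain e where e: "e \<in> \<omega>" "b \<in> e" by blast
  then have e': "e \<in> lattice_edges d" "e \<inter> cube d N \<noteq> {}" using \<omega> by (auto simp: edges_meeting_def)
  then obtain x y where xy: "e = {x, y}" "neighbours x y" unfolding lattice_edges_iff by blast
  then obtain j where j: "\<bar>x j - y j\<bar> = 1" "\<And>k. k \<noteq> j \<Longrightarrow> x k = y k" by (auto simp: neighbours_def)
  have near: "\<bar>x (d - 1) - y (d - 1)\<bar> \<le> 1" using j(1) j(2)[of "d - 1"] by (cases "d - 1 = j") auto
  obtain v where v: "v \<in> e" "v \<in> cube d N" using e'(2) by blast
  have "\<bar>v (d - 1)\<bar> \<le> N" using v(2) d by (simp add: cube_iff)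
  moreover have "\<bar>v (d - 1) - b (d - 1)\<bar> \<le> 1" using v(1) e(2) near unfolding xy(1) by auto
  ultimately have "M \<le> N + 1" using ab(2) by linarith
  then show False using M(2) e(1) by auto
qed

lemma disc_prob_eq_1:
  assumes p: "0 \<le> p" "p \<le> 1" and M: "0 < \<lfloor>\<delta> * real L\<rfloor>" "p = 0 \<or> \<lfloor>C * real L\<rfloor> + 2 \<le> \<lfloor>\<delta> * real L\<rfloor>"
  shows "disc_prob p C \<delta> L = 1"
proof -
  let ?\<Lambda> = "cube d \<lfloor>C * real L\<rfloor>" and ?A = "bottom_side d (int L) \<lfloor>\<delta> * real L\<rfloor>" and ?B = "top_side d (int L) \<lfloor>\<delta> * real L\<rfloor>"
  have "disc_prob p C \<delta> L = of_bool True"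
    unfolding free_disconnect_prob_def connected_to_iff[OF side_lattice]
  proof (rule free_prob_const[OF finite_cube cube_lattice p q])
    fix \<omega> assume \<omega>: "\<omega> \<subseteq> edges_meeting d ?\<Lambda>" "fk_weight d ?\<Lambda> p q {} \<omega> \<noteq> 0"
    have "finite \<omega>" using \<omega>(1) finite_edges_meeting[OF finite_cube cube_lattice] finite_subset by blast
    then have "\<omega> = {} \<or> \<lfloor>C * real L\<rfloor> + 2 \<le> \<lfloor>\<delta> * real L\<rfloor>" using M(2) \<omega>(2) fk_weight_0 by blast
    then show "\<not> meets \<omega> ?A ?B \<longleftrightarrow> True" using sides_disconnected[OF \<omega>(1) M(1)] by blast
  qed
  then show ?thesis by simp
qed

lemma log_recip_ge:
  assumes "0 \<le> a" "0 < u"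
  shows "ereal c \<le> log_recip a / ereal u \<longleftrightarrow> a \<le> exp (- c * u)"
proof (cases "a = 0")
  case True
  then show ?thesis using assms(2) by (simp add: log_recip_def)
next
  case False
  then have a: "0 < a" using assms(1) by simp
  have "log_recip a / ereal u = ereal (- ln a / u)" using False assms by (simp add: log_recip_def ln_div)
  then have "ereal c \<le> log_recip a / ereal u \<longleftrightarrow> c \<le> - ln a / u" by simp
  also have "\<dots> \<longleftrightarrow> c * u \<le> - ln a" using assms(2) by (rule pos_le_divide_eq)
  also have "\<dots> \<longleftrightarrow> ln a \<le> - c * u" by auto
  also have "\<dots> \<longleftrightarrow> a \<le> exp (- c * u)" using a by (metis exp_ln ln_exp ln_le_cancel_iff exp_gt_zero)
  finally show ?thesis .
qed

text \<open>A positive limit superior yields the exponential bound only at arbitrarily large scales,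
  which is the form that \<open>link_of_tension\<close> takes as its hypothesis.\<close>

lemma tension_posD:
  assumes "0 < surface_tension p q d"
  shows "\<exists>C \<delta> c. 1 \<le> C \<and> 0 < \<delta> \<and> 0 < c \<and>
    (\<forall>L0. \<exists>L\<ge>L0. disc_prob p C \<delta> L \<le> exp (- c * real L ^ (d - 1)))"
proof -
  let ?f = "\<lambda>C \<delta> L. log_recip (disc_prob p C \<delta> L) / ereal (real L ^ (d - 1))"
  obtain C \<delta> where C: "1 \<le> C" "0 < \<delta>" "0 < limsup (?f C \<delta>)"
    using assms unfolding surface_tension_def by (auto simp: less_SUP_iff)
  obtain c where c: "0 < ereal c" "ereal c < limsup (?f C \<delta>)" using ereal_dense2[OF C(3)] by blast
  have "\<exists>L\<ge>L0. disc_prob p C \<delta> L \<le> exp (- c * real L ^ (d - 1))" for L0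
  proof (rule ccontr)
    assume no: "\<not> (\<exists>L\<ge>L0. disc_prob p C \<delta> L \<le> exp (- c * real L ^ (d - 1)))"
    have "?f C \<delta> L \<le> ereal c" if L: "max L0 1 \<le> L" for L
    proof -
      have "\<not> disc_prob p C \<delta> L \<le> exp (- c * real L ^ (d - 1))" using no L by auto
      then have "\<not> ereal c \<le> ?f C \<delta> L" using log_recip_ge[OF disc_prob_nonneg, of "real L ^ (d - 1)"] L by simp
      then show ?thesis by simp
    qed
    then have "\<forall>\<^sub>F L in sequentially. ?f C \<delta> L \<le> ereal c" unfolding eventually_sequentially by blast
    then have "limsup (?f C \<delta>) \<le> ereal c" by (rule Limsup_bounded)
    then show False using c(2) by simp
  qed
  then show ?thesis using C(1,2) c(1) by (intro exI[of _ C] exI[of _ \<delta>] exI[of _ c]) simp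
qed

lemma tension_posI:
  assumes C: "1 \<le> C" "0 < \<delta>" and c: "0 < c"
    and bound: "\<And>L. L0 \<le> L \<Longrightarrow> disc_prob p C \<delta> L \<le> exp (- c * real L ^ (d - 1))"
  shows "0 < surface_tension p q d"
proof -
  let ?f = "\<lambda>C \<delta> L. log_recip (disc_prob p C \<delta> L) / ereal (real L ^ (d - 1))"
  have "ereal c \<le> ?f C \<delta> L" if "max L0 1 \<le> L" for L
    using log_recip_ge[OF disc_prob_nonneg, of "real L ^ (d - 1)"] bound[of L] that by simp
  then have "\<forall>\<^sub>F L in sequentially. ereal c \<le> ?f C \<delta> L" unfolding eventually_sequentially by blast
  then have "ereal c \<le> limsup (?f C \<delta>)"
    by (intro order_trans[OF Liminf_bounded Liminf_le_Limsup]) auto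
  moreover have "0 < ereal c" using c by simp
  ultimately have "0 < limsup (?f C \<delta>)" by (rule less_le_trans[rotated])
  then show ?thesis unfolding surface_tension_def using C by (auto simp: less_SUP_iff)
qed

text \<open>The supremum also runs over \<open>\<delta> > C\<close>, where the two sides eventually
  lie outside the cube. They are then disconnected with probability 1, as they are for
  \<open>p = 0\<close>, which contradicts the exponential bound.\<close>

lemma tension_posD':
  assumes p: "0 \<le> p" "p < 1" and tension: "0 < surface_tension p q d"
  shows "0 < p \<and> (\<exists>C \<delta> c. 0 < \<delta> \<and> \<delta> \<le> C \<and> 0 < c \<and>
    (\<forall>L0. \<exists>L\<ge>L0. rc_disc (p / (1 - p)) q (cube d \<lfloor>C * real L\<rfloor>) (bottom_side d (int L) \<lfloor>\<delta> * real L\<rfloor>)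
      (top_side d (int L) \<lfloor>\<delta> * real L\<rfloor>) \<le> exp (- c * real L ^ (d - 1))))"
proof -
  obtain C \<delta> c where C: "1 \<le> C" "0 < \<delta>" and c: "0 < c"
    and often: "\<And>L0. \<exists>L\<ge>L0. disc_prob p C \<delta> L \<le> exp (- c * real L ^ (d - 1))"
    using tension_posD[OF tension] by blast
  have no: False if ev: "\<And>L. L0 \<le> L \<Longrightarrow> disc_prob p C \<delta> L = 1" for L0
  proof -
    obtain L where L: "L0 + 1 \<le> L" "disc_prob p C \<delta> L \<le> exp (- c * real L ^ (d - 1))" using often by blast
    have "0 < c * real L ^ (d - 1)" using c L(1) by simp
    then have "exp (- c * real L ^ (d - 1)) < 1" by simp
    then show False using L ev[of L] by simp
  qed
  have "0 < p"
  proof (rule ccontr)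
    assume "\<not> 0 < p"
    then have "p = 0" using p by simp
    have "disc_prob p C \<delta> L = 1" if "nat \<lceil>1 / \<delta>\<rceil> \<le> L" for L
    proof (rule disc_prob_eq_1)
      have "1 / \<delta> \<le> real L" using that by linarith
      then have "1 \<le> \<delta> * real L" using C(2) by (simp add: divide_le_eq mult.commute)
      then show "0 < \<lfloor>\<delta> * real L\<rfloor>" by linarith
    qed (use \<open>p = 0\<close> in auto)
    then show False by (rule no)
  qed
  have "\<delta> \<le> C"
  proof (rule ccontr)
    assume "\<not> \<delta> \<le> C"
    then have pos: "0 < \<delta> - C" by simp
    have "disc_prob p C \<delta> L = 1" if "nat \<lceil>3 / (\<delta> - C)\<rceil> \<le> L" for L
    proof (rule disc_prob_eq_1)
      have "3 / (\<delta> - C) \<le> real L" using that by linarith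
      then have "3 \<le> (\<delta> - C) * real L" using pos by (simp add: divide_le_eq mult.commute)
      then have gap: "C * real L + 3 \<le> \<delta> * real L" by (simp add: left_diff_distrib)
      then show "p = 0 \<or> \<lfloor>C * real L\<rfloor> + 2 \<le> \<lfloor>\<delta> * real L\<rfloor>" by linarith
      have "0 \<le> C * real L" using C by simp
      then show "0 < \<lfloor>\<delta> * real L\<rfloor>" using gap by linarith
    qed (use p in auto)
    then show False by (rule no)
  qed
  have "disc_prob p C \<delta> L = rc_disc (p / (1 - p)) q (cube d \<lfloor>C * real L\<rfloor>)
      (bottom_side d (int L) \<lfloor>\<delta> * real L\<rfloor>) (top_side d (int L) \<lfloor>\<delta> * real L\<rfloor>)" for L
  proof -
    have "1 * real L \<le> C * real L" using C by (intro mult_right_mono) auto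
    then have L: "int L \<le> \<lfloor>C * real L\<rfloor>" by linarith
    have "\<delta> * real L \<le> C * real L" using \<open>\<delta> \<le> C\<close> by (intro mult_right_mono) auto
    then have M: "\<lfloor>\<delta> * real L\<rfloor> \<le> \<lfloor>C * real L\<rfloor>" by (rule floor_mono)
    have M0: "0 \<le> \<lfloor>\<delta> * real L\<rfloor>" using C by simp
    show ?thesis
      by (rule free_disconnect_prob_eq[OF cube_corners cube_ibox \<open>0 < p\<close> p(2) q side_subset_cube[OF L M0 M]])
  qed
  then show ?thesis
    using C(2) c often \<open>0 < p\<close> \<open>\<delta> \<le> C\<close>
    by (intro conjI exI[of _ C] exI[of _ \<delta>] exI[of _ c]) simp_all
qed

lemma surface_tension_1: "0 < surface_tension 1 q d"
proof (rule tension_posI[of 1 1 1 1])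
  fix L :: nat assume L: "1 \<le> L"
  let ?\<Lambda> = "cube d (int L)" and ?A = "bottom_side d (int L) (int L)" and ?B = "top_side d (int L) (int L)"
  have sub: "?A \<subseteq> ?\<Lambda>" "?B \<subseteq> ?\<Lambda>" by (rule side_subset_cube; simp)+
  define a b :: vertex where "a = (\<lambda>i. if i = d - 1 then - int L else 0)" and "b = (\<lambda>i. if i = d - 1 then int L else 0)"
  have ab: "a \<in> ?A" "b \<in> ?B" using d by (auto simp: a_def b_def bottom_side_def top_side_def lattice_points_iff)
  have "free_disconnect_prob d ?\<Lambda> 1 q ?A ?B = of_bool False"
    unfolding free_disconnect_prob_def connected_to_iff[OF side_lattice]
  proof (rule free_prob_const[OF finite_cube cube_lattice _ _ q])
    fix \<omega> assume \<omega>: "\<omega> \<subseteq> edges_meeting d ?\<Lambda>" "fk_weight d ?\<Lambda> 1 q {} \<omega> \<noteq> 0"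
    have "a \<in> ?\<Lambda>" "b \<in> ?\<Lambda>" using ab sub by blast+
    then have "linked \<omega> a b" by (rule box_linked_at_1[OF cube_corners cube_ibox _ _ \<omega>])
    then show "\<not> meets \<omega> ?A ?B \<longleftrightarrow> False" using ab unfolding meets_def by blast
  qed auto
  then show "disc_prob 1 1 1 L \<le> exp (- 1 * real L ^ (d - 1))" by simp
qed auto

lemma odds_mono: "0 < p \<Longrightarrow> p < p' \<Longrightarrow> p' < 1 \<Longrightarrow> 0 < p / (1 - p) \<and> p / (1 - p) < p' / (1 - p')" for p p' :: real
  by (simp add: field_simps)

lemma tension_of_slab:
  assumes p: "0 \<le> p" "p < p'" "p' < 1" and slab: "slab_percolates d q p"
  shows "0 < surface_tension p' q d"
proof -
  have "p \<noteq> 0" using slab slab_percolates_0 by auto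
  then have p0: "0 < p" "p < 1" "0 < p'" using p by auto
  let ?r = "p / (1 - p)" and ?r' = "p' / (1 - p')"
  have r: "0 < ?r" "?r < ?r'" using odds_mono[OF p0(1) p(2,3)] by auto
  obtain T c where c: "0 < c" "\<And>N x. x \<in> slab_box d T N \<Longrightarrow> c \<le> free_connect_prob d (slab_box d T N) p q {origin} {x}"
    using slab unfolding slab_percolates_def by blast
  have "link_property d q ?r"
    using c(2) by (intro link_of_slab[OF d q r(1) c(1), of T]) (simp add: slab_prob_eq[OF p0(1,2)])
  then obtain b L0 where b: "0 < b" and L0: "\<And>L. L0 \<le> L \<Longrightarrow>
      rc_disc ?r' q (cube d (2 * int L)) (bottom_side d (int L) (int L)) (top_side d (int L) (int L)) \<le> exp (- b * real L ^ (d - 1))"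
    using disconnection_of_link[OF d q r] by blast
  show ?thesis
  proof (rule tension_posI[of 2 1 b L0])
    fix L assume "L0 \<le> L"
    moreover have "\<lfloor>2 * real L\<rfloor> = 2 * int L" "\<lfloor>1 * real L\<rfloor> = int L" by linarith+
    moreover have "free_disconnect_prob d (cube d (2 * int L)) p' q (bottom_side d (int L) (int L)) (top_side d (int L) (int L))
        = rc_disc ?r' q (cube d (2 * int L)) (bottom_side d (int L) (int L)) (top_side d (int L) (int L))"
      by (rule free_disconnect_prob_eq[OF cube_corners cube_ibox p0(3) p(3) q side_subset_cube]) auto
    ultimately show "disc_prob p' 2 1 L \<le> exp (- b * real L ^ (d - 1))" using L0 by simp
  qed (use b in auto)
qed

lemma slab_of_tension:
  assumes p: "0 \<le> p" "p < p'" "p' < 1" and tension: "0 < surface_tension p q d"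
  shows "slab_percolates d q p'"
proof -
  have p1: "p < 1" using p by simp
  obtain C \<delta> c where C: "0 < \<delta>" "\<delta> \<le> C" "0 < c" and p0: "0 < p"
    and often: "\<And>L0. \<exists>L\<ge>L0. rc_disc (p / (1 - p)) q (cube d \<lfloor>C * real L\<rfloor>) (bottom_side d (int L) \<lfloor>\<delta> * real L\<rfloor>)
      (top_side d (int L) \<lfloor>\<delta> * real L\<rfloor>) \<le> exp (- c * real L ^ (d - 1))"
    using tension_posD'[OF p(1) p1 tension] by blast
  have p0': "0 < p'" using p by simp
  \<comment> \<open>An intermediate value, since two shifts of the odds are needed: one for merging
    the clusters and one for the Peierls argument.\<close>
  obtain r where r: "p / (1 - p) < r" "r < p' / (1 - p')" using odds_mono[OF p0 p(2,3)] dense by blast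
  have r0: "0 < p / (1 - p)" "0 < r" using odds_mono[OF p0 p(2,3)] r by linarith+
  have "link_property d q r" by (rule link_of_tension[OF d q r0(1) r(1) C often])
  then obtain T b where "0 < b" "\<And>N x. x \<in> slab_box d T N \<Longrightarrow> b \<le> 1 - rc_disc (p' / (1 - p')) q (slab_box d T N) {origin} {x}"
    using slab_percolation_of_link[OF d q r0(2) r(2)] by blast
  then have "b \<le> free_connect_prob d (slab_box d T N) p' q {origin} {x}" if "x \<in> slab_box d T N" for N x
    using slab_prob_eq[OF p0' p(3) that] that by metis
  then show ?thesis unfolding slab_percolates_def using \<open>0 < b\<close> by blast
qed

end

text \<open>The shift from \<open>p\<close> to \<open>p'\<close> vanishes in the infimum. Only
  \<open>p = 1\<close> leaves no room for a shift, and there membership of 1 in \<open>Y\<close>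
  suffices.\<close>

lemma threshold_le:
  assumes "X \<subseteq> {0..1}" "Y \<subseteq> {0..1}" "1 \<in> X" "1 \<in> Y"
    and "\<And>p p'. p \<in> X \<Longrightarrow> p < p' \<Longrightarrow> p' < 1 \<Longrightarrow> p' \<in> Y"
  shows "Inf Y \<le> (Inf X :: real)"
proof (rule cInf_greatest)
  fix p assume p: "p \<in> X"
  have bdd: "bdd_below Y" using assms(2) by (intro bdd_belowI[of _ 0]) auto
  show "Inf Y \<le> p"
  proof (cases "p < 1")
    case True
    then show ?thesis
      by (rule dense_ge_bounded) (use assms(5)[OF p] bdd in \<open>auto intro: cInf_lower\<close>)
  next
    case False
    then have "p = 1" using p assms(1) by auto
    then show ?thesis using cInf_lower[OF assms(4) bdd] by simp
  qed
qed (use assms(3) in blast)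

theorem theorem1p3:
  fixes q :: real and d :: nat
  assumes "q \<ge> 1" and "d \<ge> 3"
  shows "p_hat q d = p_tilde q d"
proof -
  note dq = assms(2,1)
  have d2: "2 \<le> d" using assms by simp
  let ?X = "{p \<in> {0..1}. slab_percolates d q p}" and ?Y = "{p \<in> {0..1}. 0 < surface_tension p q d}"
  have one: "1 \<in> ?X" "1 \<in> ?Y" using slab_percolates_1[OF dq] surface_tension_1[OF dq] by simp_all
  have "Inf ?Y \<le> Inf ?X"
  proof (rule threshold_le[OF _ _ one])
    fix p p' assume "p \<in> ?X" "p < p'" "p' < 1"
    then show "p' \<in> ?Y" using tension_of_slab[OF dq, of p p'] by simp
  qed blast+
  moreover have "Inf ?X \<le> Inf ?Y"
  proof (rule threshold_le[OF _ _ one(2,1)])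
    fix p p' assume "p \<in> ?Y" "p < p'" "p' < 1"
    then show "p' \<in> ?X" using slab_of_tension[OF dq, of p p'] by simp
  qed blast+
  ultimately show ?thesis unfolding p_hat_eq[OF d2] p_tilde_def by simp
qed

end
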